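(* Let $p$ be a prime, let $F$ be an algebraic field extension of $\mathbb{F}_p$, let $S=\{s_1,\dots,s_\nu\}$ be a finite set of irreducible elements of $\mathbb{F}_p[z]$ which remain irreducible in $F[z]$, and let $R=F[z,s_1^{-1},\dots,s_\nu^{-1}]\subseteq F(z)$. Assume that the $\mathcal{L}_p$-theory of the field $F$ is decidable. Then the $\mathcal{L}_p(z)^e$-theory of $R$ is decidable.
   Context: $\mathcal{L}_p=\{+,\ x\mapsto x^p,\ =,\ 0,\ 1\}$, with $+$ interpreted as addition, $x\mapsto x^p$ as the Frobenius map, and constants $0,1$; the field $F$ is regarded as an $\mathcal{L}_p$-structure in the obvious way. $\mathcal{L}_p(z)=\mathcal{L}_p\cup\{\,\in F,\ x\mapsto zx\}$, where $x\mapsto zx$ is a unary function symbol interpreted as multiplication by $z$ and $\in F$ is a unary predicate interpreted as membership in $F$. $\mathcal{L}_p(z)^e$ is the extension of $\mathcal{L}_p(z)$ by predicate symbols $P_\sigma$, one for each $\mathcal{L}_p$-formula $\sigma(a_1,\dots,a_n)$ (all free variables of $\sigma$ being among $a_1,\dots,a_n$); $P_\sigma$ is interpreted in $R$ as the $n$-ary relation "$a_1,\dots,a_n\in F$ and $\sigma(a_1,\dots,a_n)$ is true in the $\mathcal{L}_p$-structure $F$". The ring $R$ is regarded as an $\mathcal{L}_p(z)^e$-structure with these interpretations. *)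

theory Defs
  imports
    "HOL-Computational_Algebra.Computational_Algebra"
    "HOL-Library.Nat_Bijection"
begin

section \<open>Decidable sets of natural numbers\<close>

text \<open>The total recursive functions of a given arity.  Functions of arity \<open>n\<close> act on lists; only
  their values on lists of length \<open>n\<close> are meaningful, and every clause respects this.\<close>

inductive recursive_fn :: "nat \<Rightarrow> (nat list \<Rightarrow> nat) \<Rightarrow> bool" where
  zero: "recursive_fn n (\<lambda>xs. 0)"
| suc: "recursive_fn 1 (\<lambda>xs. Suc (xs ! 0))"
| proj: "i < n \<Longrightarrow> recursive_fn n (\<lambda>xs. xs ! i)"
| comp: "\<lbrakk>recursive_fn m f; length gs = m; \<forall>g\<in>set gs. recursive_fn n g\<rbrakk>
    \<Longrightarrow> recursive_fn n (\<lambda>xs. f (map (\<lambda>g. g xs) gs))"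
| prim_rec: "\<lbrakk>recursive_fn n f; recursive_fn (n + 2) g\<rbrakk>
    \<Longrightarrow> recursive_fn (n + 1)
          (\<lambda>xs. rec_nat (f (tl xs)) (\<lambda>k r. g (k # r # tl xs)) (hd xs))"
| minimization: "\<lbrakk>recursive_fn (n + 1) f; \<forall>xs. length xs = n \<longrightarrow> (\<exists>k. f (k # xs) = 0)\<rbrakk>
    \<Longrightarrow> recursive_fn n (\<lambda>xs. LEAST k. f (k # xs) = 0)"

definition decidable :: "nat set \<Rightarrow> bool" where
  "decidable A \<longleftrightarrow> (\<exists>f. recursive_fn 1 f \<and> (\<forall>x. f [x] = (if x \<in> A then 1 else 0)))"


section \<open>The language \<open>\<L>\<^sub>p\<close>\<close>

datatype lp_term =
    LVar nat
  | LZero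
  | LOne
  | LAdd lp_term lp_term
  | LFrob lp_term

datatype lp_form =
    LEq lp_term lp_term
  | LNeg lp_form
  | LAnd lp_form lp_form
  | LEx nat lp_form

primrec lp_term_vars :: "lp_term \<Rightarrow> nat set" where
  "lp_term_vars (LVar i) = {i}"
| "lp_term_vars LZero = {}"
| "lp_term_vars LOne = {}"
| "lp_term_vars (LAdd s t) = lp_term_vars s \<union> lp_term_vars t"
| "lp_term_vars (LFrob t) = lp_term_vars t"

primrec lp_free :: "lp_form \<Rightarrow> nat set" where
  "lp_free (LEq s t) = lp_term_vars s \<union> lp_term_vars t"
| "lp_free (LNeg \<phi>) = lp_free \<phi>"
| "lp_free (LAnd \<phi> \<psi>) = lp_free \<phi> \<union> lp_free \<psi>"
| "lp_free (LEx i \<phi>) = lp_free \<phi> - {i}"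

primrec lp_val :: "nat \<Rightarrow> (nat \<Rightarrow> 'a::field) \<Rightarrow> lp_term \<Rightarrow> 'a" where
  "lp_val p e (LVar i) = e i"
| "lp_val p e LZero = 0"
| "lp_val p e LOne = 1"
| "lp_val p e (LAdd s t) = lp_val p e s + lp_val p e t"
| "lp_val p e (LFrob t) = lp_val p e t ^ p"

text \<open>Satisfaction in the field \<open>F\<close>, which is the whole type \<open>'a\<close>.\<close>

primrec lp_sat :: "nat \<Rightarrow> (nat \<Rightarrow> 'a::field) \<Rightarrow> lp_form \<Rightarrow> bool" where
  "lp_sat p e (LEq s t) \<longleftrightarrow> lp_val p e s = lp_val p e t"
| "lp_sat p e (LNeg \<phi>) \<longleftrightarrow> \<not> lp_sat p e \<phi>"
| "lp_sat p e (LAnd \<phi> \<psi>) \<longleftrightarrow> lp_sat p e \<phi> \<and> lp_sat p e \<psi>"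
| "lp_sat p e (LEx i \<phi>) \<longleftrightarrow> (\<exists>a. lp_sat p (e(i := a)) \<phi>)"

primrec lp_term_code :: "lp_term \<Rightarrow> nat" where
  "lp_term_code (LVar i) = prod_encode (0, i)"
| "lp_term_code LZero = prod_encode (1, 0)"
| "lp_term_code LOne = prod_encode (2, 0)"
| "lp_term_code (LAdd s t) = prod_encode (3, prod_encode (lp_term_code s, lp_term_code t))"
| "lp_term_code (LFrob t) = prod_encode (4, lp_term_code t)"

primrec lp_code :: "lp_form \<Rightarrow> nat" where
  "lp_code (LEq s t) = prod_encode (0, prod_encode (lp_term_code s, lp_term_code t))"
| "lp_code (LNeg \<phi>) = prod_encode (1, lp_code \<phi>)"
| "lp_code (LAnd \<phi> \<psi>) = prod_encode (2, prod_encode (lp_code \<phi>, lp_code \<psi>))"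
| "lp_code (LEx i \<phi>) = prod_encode (3, prod_encode (i, lp_code \<phi>))"

definition lp_theory :: "'a::field itself \<Rightarrow> nat \<Rightarrow> lp_form set" where
  "lp_theory _ p = {\<phi>. lp_free \<phi> = {} \<and> (\<forall>e :: nat \<Rightarrow> 'a. lp_sat p e \<phi>)}"


section \<open>The ring \<open>R\<close>\<close>

text \<open>In a field of characteristic \<open>p > 0\<close>, the set \<open>\<int>\<close> (the image of the integers) is the prime
  field \<open>\<bbbF>\<^sub>p\<close>, so this is \<open>\<bbbF>\<^sub>p[z]\<close> as a subring of \<open>F[z]\<close>.\<close>

definition prime_field_polys :: "'a::field poly set" where
  "prime_field_polys = {f. \<forall>i. coeff f i \<in> \<int>}"

definition algebraic_over_prime_field :: "'a::field itself \<Rightarrow> bool" where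
  "algebraic_over_prime_field _ \<longleftrightarrow>
     (\<forall>x::'a. \<exists>f\<in>prime_field_polys. f \<noteq> 0 \<and> poly f x = 0)"

definition unit_in :: "'b::idom set \<Rightarrow> 'b \<Rightarrow> bool" where
  "unit_in A a \<longleftrightarrow> a \<in> A \<and> (\<exists>b\<in>A. a * b = 1)"

definition irreducible_in :: "'b::idom set \<Rightarrow> 'b \<Rightarrow> bool" where
  "irreducible_in A s \<longleftrightarrow> s \<in> A \<and> s \<noteq> 0 \<and> \<not> unit_in A s \<and>
     (\<forall>a\<in>A. \<forall>b\<in>A. s = a * b \<longrightarrow> unit_in A a \<or> unit_in A b)"

definition const_fract :: "'a::field \<Rightarrow> 'a poly fract" where
  "const_fract c = to_fract [:c:]"

definition z_fract :: "'a::field poly fract" where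
  "z_fract = to_fract [:0, 1:]"

text \<open>The subring \<open>F[z, s\<^sup>-\<^sup>1 : s \<in> S]\<close> of \<open>F(z)\<close> generated by \<open>F\<close>, \<open>z\<close> and the
  inverses; closure under negation follows from \<open>-1 \<in> F\<close>.\<close>

inductive_set adjoin_ring :: "'a::field poly set \<Rightarrow> 'a poly fract set"
  for S :: "'a poly set" where
  const: "const_fract c \<in> adjoin_ring S"
| z: "z_fract \<in> adjoin_ring S"
| inv: "s \<in> S \<Longrightarrow> inverse (to_fract s) \<in> adjoin_ring S"
| add: "x \<in> adjoin_ring S \<Longrightarrow> y \<in> adjoin_ring S \<Longrightarrow> x + y \<in> adjoin_ring S"
| mult: "x \<in> adjoin_ring S \<Longrightarrow> y \<in> adjoin_ring S \<Longrightarrow> x * y \<in> adjoin_ring S"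


section \<open>The language \<open>\<L>\<^sub>p(z)\<^sup>e\<close>\<close>

datatype lpz_term =
    ZVar nat
  | ZZero
  | ZOne
  | ZAdd lpz_term lpz_term
  | ZFrob lpz_term
  | ZMulz lpz_term

text \<open>\<open>ZPred n \<sigma> ts\<close> is the \<open>n\<close>-ary symbol \<open>P\<^sub>\<sigma>\<close> applied to \<open>ts\<close>, where \<open>\<sigma>(a\<^sub>1,\<dots>,a\<^sub>n)\<close> is written
  with the variables \<open>a\<^sub>1,\<dots>,a\<^sub>n\<close> being \<open>0,\<dots>,n-1\<close>.  The side conditions on \<open>n\<close>, \<open>\<sigma>\<close>, \<open>ts\<close> are
  imposed by \<open>lpz_wf\<close>.\<close>

datatype lpz_form =
    ZEq lpz_term lpz_term
  | ZInF lpz_term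
  | ZPred nat lp_form "lpz_term list"
  | ZNeg lpz_form
  | ZAnd lpz_form lpz_form
  | ZEx nat lpz_form

primrec lpz_wf :: "lpz_form \<Rightarrow> bool" where
  "lpz_wf (ZEq s t) \<longleftrightarrow> True"
| "lpz_wf (ZInF t) \<longleftrightarrow> True"
| "lpz_wf (ZPred n \<sigma> ts) \<longleftrightarrow> lp_free \<sigma> \<subseteq> {..<n} \<and> length ts = n"
| "lpz_wf (ZNeg \<phi>) \<longleftrightarrow> lpz_wf \<phi>"
| "lpz_wf (ZAnd \<phi> \<psi>) \<longleftrightarrow> lpz_wf \<phi> \<and> lpz_wf \<psi>"
| "lpz_wf (ZEx i \<phi>) \<longleftrightarrow> lpz_wf \<phi>"

primrec lpz_term_vars :: "lpz_term \<Rightarrow> nat set" where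
  "lpz_term_vars (ZVar i) = {i}"
| "lpz_term_vars ZZero = {}"
| "lpz_term_vars ZOne = {}"
| "lpz_term_vars (ZAdd s t) = lpz_term_vars s \<union> lpz_term_vars t"
| "lpz_term_vars (ZFrob t) = lpz_term_vars t"
| "lpz_term_vars (ZMulz t) = lpz_term_vars t"

primrec lpz_free :: "lpz_form \<Rightarrow> nat set" where
  "lpz_free (ZEq s t) = lpz_term_vars s \<union> lpz_term_vars t"
| "lpz_free (ZInF t) = lpz_term_vars t"
| "lpz_free (ZPred n \<sigma> ts) = (\<Union>t\<in>set ts. lpz_term_vars t)"
| "lpz_free (ZNeg \<phi>) = lpz_free \<phi>"
| "lpz_free (ZAnd \<phi> \<psi>) = lpz_free \<phi> \<union> lpz_free \<psi>"
| "lpz_free (ZEx i \<phi>) = lpz_free \<phi> - {i}"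

primrec lpz_val :: "nat \<Rightarrow> (nat \<Rightarrow> 'a::field poly fract) \<Rightarrow> lpz_term \<Rightarrow> 'a poly fract" where
  "lpz_val p e (ZVar i) = e i"
| "lpz_val p e ZZero = 0"
| "lpz_val p e ZOne = 1"
| "lpz_val p e (ZAdd s t) = lpz_val p e s + lpz_val p e t"
| "lpz_val p e (ZFrob t) = lpz_val p e t ^ p"
| "lpz_val p e (ZMulz t) = z_fract * lpz_val p e t"

text \<open>Satisfaction in the structure with universe \<open>R\<close>.  In the clause for \<open>ZPred\<close>, the value \<open>0\<close>
  assigned to variables from \<open>length cs\<close> on is irrelevant for well-formed formulas.\<close>

primrec lpz_sat :: "nat \<Rightarrow> 'a::field poly fract set \<Rightarrow> (nat \<Rightarrow> 'a poly fract) \<Rightarrow> lpz_form \<Rightarrow> bool" where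
  "lpz_sat p R e (ZEq s t) \<longleftrightarrow> lpz_val p e s = lpz_val p e t"
| "lpz_sat p R e (ZInF t) \<longleftrightarrow> lpz_val p e t \<in> range const_fract"
| "lpz_sat p R e (ZPred n \<sigma> ts) \<longleftrightarrow>
     (\<exists>cs :: 'a list. map (lpz_val p e) ts = map const_fract cs \<and>
        lp_sat p (\<lambda>i. if i < length cs then cs ! i else 0) \<sigma>)"
| "lpz_sat p R e (ZNeg \<phi>) \<longleftrightarrow> \<not> lpz_sat p R e \<phi>"
| "lpz_sat p R e (ZAnd \<phi> \<psi>) \<longleftrightarrow> lpz_sat p R e \<phi> \<and> lpz_sat p R e \<psi>"
| "lpz_sat p R e (ZEx i \<phi>) \<longleftrightarrow> (\<exists>a\<in>R. lpz_sat p R (e(i := a)) \<phi>)"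

primrec lpz_term_code :: "lpz_term \<Rightarrow> nat" where
  "lpz_term_code (ZVar i) = prod_encode (0, i)"
| "lpz_term_code ZZero = prod_encode (1, 0)"
| "lpz_term_code ZOne = prod_encode (2, 0)"
| "lpz_term_code (ZAdd s t) = prod_encode (3, prod_encode (lpz_term_code s, lpz_term_code t))"
| "lpz_term_code (ZFrob t) = prod_encode (4, lpz_term_code t)"
| "lpz_term_code (ZMulz t) = prod_encode (5, lpz_term_code t)"

primrec lpz_code :: "lpz_form \<Rightarrow> nat" where
  "lpz_code (ZEq s t) = prod_encode (0, prod_encode (lpz_term_code s, lpz_term_code t))"
| "lpz_code (ZInF t) = prod_encode (1, lpz_term_code t)"
| "lpz_code (ZPred n \<sigma> ts) =
     prod_encode (2, prod_encode (n, prod_encode (lp_code \<sigma>, list_encode (map lpz_term_code ts))))"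
| "lpz_code (ZNeg \<phi>) = prod_encode (3, lpz_code \<phi>)"
| "lpz_code (ZAnd \<phi> \<psi>) = prod_encode (4, prod_encode (lpz_code \<phi>, lpz_code \<psi>))"
| "lpz_code (ZEx i \<phi>) = prod_encode (5, prod_encode (i, lpz_code \<phi>))"

definition lpz_theory :: "nat \<Rightarrow> 'a::field poly fract set \<Rightarrow> lpz_form set" where
  "lpz_theory p R = {\<phi>. lpz_wf \<phi> \<and> lpz_free \<phi> = {} \<and>
     (\<forall>e. (\<forall>i. e i \<in> R) \<longrightarrow> lpz_sat p R e \<phi>)}"


section \<open>The codings are injective\<close>

lemma lp_term_code_inject: "lp_term_code s = lp_term_code t \<longleftrightarrow> s = t"
proof (induction s arbitrary: t)
  case (LVar i) then show ?case by (cases t) auto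
next
  case LZero then show ?case by (cases t) auto
next
  case LOne then show ?case by (cases t) auto
next
  case (LAdd s1 s2) then show ?case by (cases t) auto
next
  case (LFrob s) then show ?case by (cases t) auto
qed

lemma lp_code_inject: "lp_code \<phi> = lp_code \<psi> \<longleftrightarrow> \<phi> = \<psi>"
proof (induction \<phi> arbitrary: \<psi>)
  case (LEq s t) then show ?case by (cases \<psi>) (auto simp: lp_term_code_inject)
next
  case (LNeg \<phi>) then show ?case by (cases \<psi>) auto
next
  case (LAnd \<phi>1 \<phi>2) then show ?case by (cases \<psi>) auto
next
  case (LEx i \<phi>) then show ?case by (cases \<psi>) auto
qed

lemma lpz_term_code_inject: "lpz_term_code s = lpz_term_code t \<longleftrightarrow> s = t"
proof (induction s arbitrary: t)
  case (ZVar i) then show ?case by (cases t) auto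
next
  case ZZero then show ?case by (cases t) auto
next
  case ZOne then show ?case by (cases t) auto
next
  case (ZAdd s1 s2) then show ?case by (cases t) auto
next
  case (ZFrob s) then show ?case by (cases t) auto
next
  case (ZMulz s) then show ?case by (cases t) auto
qed

lemma lpz_code_inject: "lpz_code \<phi> = lpz_code \<psi> \<longleftrightarrow> \<phi> = \<psi>"
proof (induction \<phi> arbitrary: \<psi>)
  case (ZEq s t) then show ?case by (cases \<psi>) (auto simp: lpz_term_code_inject)
next
  case (ZInF t) then show ?case by (cases \<psi>) (auto simp: lpz_term_code_inject)
next
  case (ZPred n \<sigma> ts)
  have "inj lpz_term_code" by (simp add: inj_def lpz_term_code_inject)
  then show ?case by (cases \<psi>) (auto simp: lp_code_inject inj_map_eq_map list_encode_eq)
next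
  case (ZNeg \<phi>) then show ?case by (cases \<psi>) auto
next
  case (ZAnd \<phi>1 \<phi>2) then show ?case by (cases \<psi>) auto
next
  case (ZEx i \<phi>) then show ?case by (cases \<psi>) auto
qed

end

(*
  Let s be the product of the elements of S. The ring R is the union of the finite-dimensional
  F-spaces R_d = {f / s^d : deg f <= (deg s + 1) d}. Consider the subgroups of R^t defined by
  additive equations (in the Frobenius map and multiplication by z) with auxiliary unknowns from R
  and from F. There are only finitely many of bounded complexity, and tuples that lie in the same
  ones satisfy a back-and-forth property in which the answer is found in an R_d with d computable.
  Hence every quantifier over R can be bounded by some computable R_d, and a quantifier over R_d is
  a block of quantifiers over coefficients in F. This turns a sentence about R into an equivalent
  sentence about F.
*)
theory Submission
  imports Defs "HOL-Library.FuncSet"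
begin

section \<open>Computable functions on encoded types\<close>

subsection \<open>Recursive functions up to their values on lists of the right length\<close>

text \<open>Every estimate must depend only on the size of the equations, never on a particular
  solution, so that it can be a function in \<open>CB\<close>. The estimates come from one
  dichotomy: either the leading forms of an additive system do not cancel, and then solutions are
  bounded by values, or a syzygy lowers the order of a column. Leading forms are only linear over
  p-powers; as F is perfect, 1, z, ..., z^(q-1) is a basis of R over its q-th powers (q a power of
  p), and this turns leading forms into matrices over F_p[z]. Coefficients never leave F_p, which
  keeps the number of subgroups of a given size finite. F itself may be infinite, hence so may the
  R_d: bounded coset representatives do not mean finite index, and the two notions are kept apart.
  The back-and-forth step is the Baur-Monk argument from the model theory of modules, made
  effective: conditions of finite index are handled by counting cosets, those of infinite index by
  avoiding them. The predicates P_sigma lead to no further subgroups, since a formula over F is read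
  as a formula over R with quantifiers relativized to F.\<close>

definition rf :: "nat \<Rightarrow> (nat list \<Rightarrow> nat) \<Rightarrow> bool" where
  "rf n g \<longleftrightarrow> (\<exists>f. recursive_fn n f \<and> (\<forall>xs. length xs = n \<longrightarrow> f xs = g xs))"

text \<open>\<open>recursive_fn\<close> fixes values on all lists, also on those of the wrong
  length. Ignoring these values allows recursive functions to be written as natural expressions in
  \<open>xs ! 0\<close>, \<open>xs ! 1\<close> and so on.\<close>

lemma rf_cong: "rf n f \<Longrightarrow> (\<And>xs. length xs = n \<Longrightarrow> f xs = g xs) \<Longrightarrow> rf n g"
  unfolding rf_def by metis

lemma rf_zero: "rf n (\<lambda>xs. 0)"
  unfolding rf_def using recursive_fn.zero by blast

lemma rf_proj: "i < n \<Longrightarrow> rf n (\<lambda>xs. xs ! i)"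
  unfolding rf_def using recursive_fn.proj by blast

lemma rf_comp:
  assumes "rf m f" "length gs = m" "\<forall>g\<in>set gs. rf n g"
  shows "rf n (\<lambda>xs. f (map (\<lambda>g. g xs) gs))"
proof -
  obtain f' where f': "recursive_fn m f'" "\<And>xs. length xs = m \<Longrightarrow> f' xs = f xs"
    using assms(1) unfolding rf_def by blast
  obtain r where r: "\<And>g. g \<in> set gs \<Longrightarrow> recursive_fn n (r g) \<and> (\<forall>xs. length xs = n \<longrightarrow> r g xs = g xs)"
    using assms(3) unfolding rf_def by metis
  have "recursive_fn n (\<lambda>xs. f' (map (\<lambda>g. g xs) (map r gs)))"
    using f'(1) assms(2) r by (intro recursive_fn.comp[of m]) auto
  moreover have "f' (map (\<lambda>g. g xs) (map r gs)) = f (map (\<lambda>g. g xs) gs)" if "length xs = n" for xs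
  proof -
    have "map (\<lambda>g. g xs) (map r gs) = map (\<lambda>g. g xs) gs" using r that by simp
    then show ?thesis using f'(2)[of "map (\<lambda>g. g xs) gs"] assms(2) by (simp del: map_map)
  qed
  ultimately show ?thesis unfolding rf_def by blast
qed

lemma rf_comp1: "rf 1 (\<lambda>xs. h (xs ! 0)) \<Longrightarrow> rf n f \<Longrightarrow> rf n (\<lambda>xs. h (f xs))"
  using rf_comp[of 1 "\<lambda>xs. h (xs ! 0)" "[f]" n] by simp

lemma rf_comp2: "rf 2 (\<lambda>xs. h (xs ! 0) (xs ! 1)) \<Longrightarrow> rf n f \<Longrightarrow> rf n g \<Longrightarrow> rf n (\<lambda>xs. h (f xs) (g xs))"
  using rf_comp[of 2 "\<lambda>xs. h (xs ! 0) (xs ! 1)" "[f, g]" n] by simp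

lemma rf_Suc: "rf n f \<Longrightarrow> rf n (\<lambda>xs. Suc (f xs))"
  by (rule rf_comp1[of Suc]) (auto simp: rf_def intro: recursive_fn.suc[simplified])

lemma rf_const: "rf n (\<lambda>xs. c)"
  by (induction c) (auto intro: rf_zero rf_Suc)

lemma rf_rec:
  assumes "rf n f" "rf (n + 2) g"
  shows "rf (n + 1) (\<lambda>xs. rec_nat (f (tl xs)) (\<lambda>k r. g (k # r # tl xs)) (hd xs))"
proof -
  obtain f' where f': "recursive_fn n f'" "\<And>xs. length xs = n \<Longrightarrow> f' xs = f xs"
    using assms(1) unfolding rf_def by blast
  obtain g' where g': "recursive_fn (n + 2) g'" "\<And>xs. length xs = n + 2 \<Longrightarrow> g' xs = g xs"
    using assms(2) unfolding rf_def by blast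
  have "rec_nat (f' (tl xs)) (\<lambda>k r. g' (k # r # tl xs)) m = rec_nat (f (tl xs)) (\<lambda>k r. g (k # r # tl xs)) m"
    if "length xs = n + 1" for xs m
    using that f'(2) g'(2) by (induction m) auto
  then show ?thesis
    unfolding rf_def using recursive_fn.prim_rec[OF f'(1) g'(1)] by blast
qed

lemma length_2: "length xs = 2 \<Longrightarrow> \<exists>a b. xs = [a, b]"
  by (metis (no_types, opaque_lifting) Suc_1 length_0_conv length_Suc_conv One_nat_def)

lemma length_1: "length xs = Suc 0 \<Longrightarrow> \<exists>a. xs = [a]"
  by (simp add: length_Suc_conv)

lemma rf_rec2:
  assumes "rf 1 (\<lambda>xs. f (xs ! 0))" "rf 3 (\<lambda>xs. g (xs ! 0) (xs ! 1) (xs ! 2))"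
  shows "rf 2 (\<lambda>xs. rec_nat (f (xs ! 1)) (\<lambda>k r. g k r (xs ! 1)) (xs ! 0))"
proof -
  have "rf (1 + 1) (\<lambda>xs. rec_nat (f (tl xs ! 0)) (\<lambda>k r. g ((k # r # tl xs) ! 0) ((k # r # tl xs) ! 1)
      ((k # r # tl xs) ! 2)) (hd xs))"
    by (rule rf_rec) (use assms in \<open>simp_all add: numeral_3_eq_3\<close>)
  then have "rf 2 (\<lambda>xs. rec_nat (f (tl xs ! 0)) (\<lambda>k r. g ((k # r # tl xs) ! 0) ((k # r # tl xs) ! 1)
      ((k # r # tl xs) ! 2)) (hd xs))" by (simp only: one_add_one)
  then show ?thesis by (rule rf_cong) (auto dest!: length_2)
qed

lemma rf_rec1:
  assumes "rf 2 (\<lambda>xs. g (xs ! 0) (xs ! 1))"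
  shows "rf 1 (\<lambda>xs. rec_nat c g (xs ! 0))"
proof -
  have "rf (0 + 1) (\<lambda>xs. rec_nat c (\<lambda>k r. g ((k # r # tl xs) ! 0) ((k # r # tl xs) ! 1)) (hd xs))"
    by (rule rf_rec[of 0 "\<lambda>_. c" "\<lambda>xs. g (xs ! 0) (xs ! 1)"])
       (use assms rf_const in \<open>simp_all add: numeral_2_eq_2\<close>)
  then have "rf 1 (\<lambda>xs. rec_nat c (\<lambda>k r. g ((k # r # tl xs) ! 0) ((k # r # tl xs) ! 1)) (hd xs))"
    by (simp only: add_0)
  then show ?thesis by (rule rf_cong) (auto dest!: length_1)
qed

lemma rf_add: "rf n f \<Longrightarrow> rf n g \<Longrightarrow> rf n (\<lambda>xs. f xs + g xs)"
proof (rule rf_comp2[of "(+)"])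
  have "rf 2 (\<lambda>xs. rec_nat (xs ! 1) (\<lambda>k r. Suc r) (xs ! 0))"
    using rf_rec2[of "\<lambda>x. x" "\<lambda>k r x. Suc r"] by (simp add: rf_proj rf_Suc)
  moreover have "rec_nat b (\<lambda>k r. Suc r) a = a + b" for a b :: nat by (induction a) auto
  ultimately show "rf 2 (\<lambda>xs. xs ! 0 + xs ! 1)" by simp
qed

lemma rf_mult: "rf n f \<Longrightarrow> rf n g \<Longrightarrow> rf n (\<lambda>xs. f xs * g xs)"
proof (rule rf_comp2[of "(*)"])
  have "rf 2 (\<lambda>xs. rec_nat 0 (\<lambda>k r. r + xs ! 1) (xs ! 0))"
    using rf_rec2[of "\<lambda>x. 0" "\<lambda>k r x. r + x"] by (simp add: rf_proj rf_add rf_zero)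
  moreover have "rec_nat 0 (\<lambda>k r. r + b) a = a * b" for a b :: nat by (induction a) auto
  ultimately show "rf 2 (\<lambda>xs. xs ! 0 * xs ! 1)" by simp
qed

lemma rf_pred: "rf n f \<Longrightarrow> rf n (\<lambda>xs. f xs - 1)"
proof (rule rf_comp1[of "\<lambda>x. x - 1"])
  have "rf 1 (\<lambda>xs. rec_nat 0 (\<lambda>k r. k) (xs ! 0))"
    by (rule rf_rec1) (simp add: rf_proj)
  moreover have "rec_nat 0 (\<lambda>k r. k) a = a - 1" for a :: nat by (cases a) auto
  ultimately show "rf 1 (\<lambda>xs. xs ! 0 - 1)" by simp
qed

lemma rf_diff: "rf n f \<Longrightarrow> rf n g \<Longrightarrow> rf n (\<lambda>xs. f xs - g xs)"
\<comment> \<open>The recursion runs on the first argument, which for subtraction has to be the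
  subtrahend; hence the swapped arguments.\<close>
proof (rule rf_comp2[of "\<lambda>x y. y - x", of n g f])
  have "rf 2 (\<lambda>xs. rec_nat (xs ! 1) (\<lambda>k r. r - 1) (xs ! 0))"
    using rf_rec2[of "\<lambda>x. x" "\<lambda>k r x. r - 1"] rf_pred[OF rf_proj[of 1 3]] by (simp add: rf_proj)
  moreover have "rec_nat b (\<lambda>k r. r - 1) a = b - a" for a b :: nat by (induction a) auto
  ultimately show "rf 2 (\<lambda>xs. xs ! 1 - xs ! 0)" by simp
qed

lemma rf_if:
  assumes "rf n a" "rf n b" "rf n f" "rf n g"
  shows "rf n (\<lambda>xs. if a xs = b xs then f xs else g xs)"
proof -
  \<comment> \<open>With truncated subtraction, 1 - ((a - b) + (b - a)) is the indicator of a =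
    b.\<close>
  have "rf n (\<lambda>xs. (1 - ((a xs - b xs) + (b xs - a xs))) * f xs
      + (1 - (1 - ((a xs - b xs) + (b xs - a xs)))) * g xs)"
    by (intro rf_add rf_mult rf_diff rf_const assms)
  then show ?thesis by (rule rf_cong) auto
qed

lemma rf_triangle: "rf n f \<Longrightarrow> rf n (\<lambda>xs. triangle (f xs))"
proof (rule rf_comp1[of triangle])
  have "rf 1 (\<lambda>xs. rec_nat 0 (\<lambda>k r. r + Suc k) (xs ! 0))"
    by (rule rf_rec1) (intro rf_add rf_Suc rf_proj; simp)
  moreover have "rec_nat 0 (\<lambda>k r. r + Suc k) a = triangle a" for a :: nat by (induction a) auto
  ultimately show "rf 1 (\<lambda>xs. triangle (xs ! 0))" by simp
qed

lemma rf_prod_encode: "rf n f \<Longrightarrow> rf n g \<Longrightarrow> rf n (\<lambda>xs. prod_encode (f xs, g xs))"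
  unfolding prod_encode_def by (simp add: rf_add rf_triangle)

text \<open>The largest r with \<open>triangle r \<le> n\<close>, that is, the antidiagonal on which
  n lies under the pairing function. Raising r whenever a triangular number is reached makes it
  primitive recursive and so gives access to \<open>prod_decode\<close>.\<close>

definition tri_root :: "nat \<Rightarrow> nat" where
  "tri_root = rec_nat 0 (\<lambda>k r. if Suc k = triangle (Suc r) then Suc r else r)"

lemma tri_root: "triangle (tri_root n) \<le> n \<and> n < triangle (Suc (tri_root n))"
  by (induction n) (auto simp: tri_root_def)

lemma prod_decode_tri_root:
  "prod_decode n = (n - triangle (tri_root n), tri_root n - (n - triangle (tri_root n)))"
proof -
  let ?a = "n - triangle (tri_root n)"
  have "?a \<le> tri_root n" using tri_root[of n] by auto
  then have "prod_encode (?a, tri_root n - ?a) = n"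
    using tri_root[of n] by (simp add: prod_encode_def)
  then show ?thesis by (metis prod_encode_inverse)
qed

lemma rf_tri_root: "rf n f \<Longrightarrow> rf n (\<lambda>xs. tri_root (f xs))"
proof (rule rf_comp1[of tri_root])
  show "rf 1 (\<lambda>xs. tri_root (xs ! 0))"
    unfolding tri_root_def by (rule rf_rec1) (intro rf_if rf_triangle rf_Suc rf_proj; simp)
qed

lemma rf_fst: "rf n f \<Longrightarrow> rf n (\<lambda>xs. fst (prod_decode (f xs)))"
  and rf_snd: "rf n f \<Longrightarrow> rf n (\<lambda>xs. snd (prod_decode (f xs)))"
  unfolding prod_decode_tri_root fst_conv snd_conv
  by (auto intro!: rf_diff rf_triangle rf_tri_root)

subsection \<open>Encoded types\<close>

text \<open>The instances for terms and formulas are the codings of the definitions, so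
  computability of a map between formulas is literally a statement about the numbers that occur in
  the decidability hypothesis.\<close>

class enc =
  fixes enc :: "'a \<Rightarrow> nat"
  assumes enc_eq_iff [simp]: "enc x = enc y \<longleftrightarrow> x = y"

instantiation nat :: enc
begin
definition enc_nat :: "nat \<Rightarrow> nat" where [simp]: "enc_nat n = n"
instance by standard simp
end

instantiation bool :: enc
begin
definition enc_bool :: "bool \<Rightarrow> nat" where [simp]: "enc_bool b = (if b then 1 else 0)"
instance by standard simp
end

instantiation prod :: (enc, enc) enc
begin
definition enc_prod :: "'a \<times> 'b \<Rightarrow> nat" where "enc_prod x = prod_encode (enc (fst x), enc (snd x))"
instance by standard (auto simp: enc_prod_def prod_eq_iff)
end

instantiation list :: (enc) enc
begin
definition enc_list :: "'a list \<Rightarrow> nat" where "enc_list xs = list_encode (map enc xs)"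
instance by standard (auto simp: enc_list_def list_encode_eq inj_map_eq_map inj_def)
end

instantiation lp_term :: enc
begin
definition enc_lp_term :: "lp_term \<Rightarrow> nat" where "enc_lp_term = lp_term_code"
instance by standard (simp add: enc_lp_term_def lp_term_code_inject)
end

instantiation lp_form :: enc
begin
definition enc_lp_form :: "lp_form \<Rightarrow> nat" where "enc_lp_form = lp_code"
instance by standard (simp add: enc_lp_form_def lp_code_inject)
end

instantiation lpz_term :: enc
begin
definition enc_lpz_term :: "lpz_term \<Rightarrow> nat" where "enc_lpz_term = lpz_term_code"
instance by standard (simp add: enc_lpz_term_def lpz_term_code_inject)
end

instantiation lpz_form :: enc
begin
definition enc_lpz_form :: "lpz_form \<Rightarrow> nat" where "enc_lpz_form = lpz_code"
instance by standard (simp add: enc_lpz_form_def lpz_code_inject)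
end

lemma enc_Pair: "enc (x, y) = prod_encode (enc x, enc y)"
  by (simp add: enc_prod_def)

lemma enc_Nil: "enc [] = 0" and enc_Cons: "enc (x # xs) = Suc (prod_encode (enc x, enc xs))"
  by (simp_all add: enc_list_def)

text \<open>Only values on codes are constrained; a number that codes nothing may be sent
  anywhere.\<close>

definition computable :: "('a::enc \<Rightarrow> 'b::enc) \<Rightarrow> bool" where
  "computable f \<longleftrightarrow> (\<exists>g. rf 1 g \<and> (\<forall>x. g [enc x] = enc (f x)))"

named_theorems computable_intros

lemma computableI: "rf 1 g \<Longrightarrow> (\<And>x. g [enc x] = enc (f x)) \<Longrightarrow> computable f"
  unfolding computable_def by blast

text \<open>Reduces an operation \<open>k\<close> to one recursive function \<open>h\<close> on
  codes, which has to agree with \<open>k\<close> only on the values that \<open>f\<close>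
  takes.\<close>

lemma computable_lift:
  assumes "rf 1 (\<lambda>xs. h (xs ! 0))" "computable f" "\<And>x. h (enc (f x)) = enc (k (f x))"
  shows "computable (\<lambda>x. k (f x))"
proof -
  obtain g where g: "rf 1 g" "\<And>x. g [enc x] = enc (f x)" using assms(2) by (auto simp: computable_def)
  show ?thesis by (rule computableI[OF rf_comp1[OF assms(1) g(1)]]) (simp add: g(2) assms(3))
qed

lemma computable_lift2:
  assumes "rf 2 (\<lambda>xs. h (xs ! 0) (xs ! 1))" "computable f" "computable g"
    "\<And>x. h (enc (f x)) (enc (g x)) = enc (k (f x) (g x))"
  shows "computable (\<lambda>x. k (f x) (g x))"
proof -
  obtain f' where f: "rf 1 f'" "\<And>x. f' [enc x] = enc (f x)" using assms(2) by (auto simp: computable_def)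
  obtain g' where g: "rf 1 g'" "\<And>x. g' [enc x] = enc (g x)" using assms(3) by (auto simp: computable_def)
  show ?thesis by (rule computableI[OF rf_comp2[OF assms(1) f(1) g(1)]]) (simp add: f(2) g(2) assms(4))
qed

lemma computable_id [computable_intros]: "computable (\<lambda>x. x)"
  by (rule computableI[of "\<lambda>xs. xs ! 0"]) (simp_all add: rf_proj)

lemma computable_const [computable_intros]: "computable (\<lambda>x. c)"
  by (rule computableI[OF rf_const[of _ "enc c"]]) simp

lemma computable_comp: "computable f \<Longrightarrow> computable g \<Longrightarrow> computable (\<lambda>x. f (g x))"
proof -
  assume "computable f" "computable g"
  then obtain f' where f: "rf 1 f'" "\<And>x. f' [enc x] = enc (f x)" by (auto simp: computable_def)
  have "rf 1 (\<lambda>xs. f' [xs ! 0])" using f(1) by (rule rf_cong) (auto dest!: length_1)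
  then show ?thesis by (rule computable_lift) (simp_all add: f(2) \<open>computable g\<close>)
qed

lemma computable_Pair [computable_intros]:
  "computable f \<Longrightarrow> computable g \<Longrightarrow> computable (\<lambda>x. (f x, g x))"
  by (rule computable_lift2[of "\<lambda>a b. prod_encode (a, b)"])
     (simp_all add: enc_Pair rf_prod_encode rf_proj)

lemma computable_fst [computable_intros]: "computable f \<Longrightarrow> computable (\<lambda>x. fst (f x))"
  by (rule computable_lift[of "\<lambda>a. fst (prod_decode a)" _ fst])
     (simp_all add: enc_prod_def rf_fst rf_proj)

lemma computable_snd [computable_intros]: "computable f \<Longrightarrow> computable (\<lambda>x. snd (f x))"
  by (rule computable_lift[of "\<lambda>a. snd (prod_decode a)" _ snd])
     (simp_all add: enc_prod_def rf_snd rf_proj)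

lemma computable_Suc [computable_intros]: "computable f \<Longrightarrow> computable (\<lambda>x. Suc (f x))"
  by (rule computable_lift[of Suc]) (simp_all add: rf_Suc rf_proj)

lemma computable_add [computable_intros]:
  "computable f \<Longrightarrow> computable g \<Longrightarrow> computable (\<lambda>x. f x + g x :: nat)"
  by (rule computable_lift2[of "(+)"]) (simp_all add: rf_add rf_proj)

lemma computable_mult [computable_intros]:
  "computable f \<Longrightarrow> computable g \<Longrightarrow> computable (\<lambda>x. f x * g x :: nat)"
  by (rule computable_lift2[of "(*)"]) (simp_all add: rf_mult rf_proj)

lemma computable_diff [computable_intros]:
  "computable f \<Longrightarrow> computable g \<Longrightarrow> computable (\<lambda>x. f x - g x :: nat)"
  by (rule computable_lift2[of "(-)"]) (simp_all add: rf_diff rf_proj)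

lemma computable_prod_encode [computable_intros]:
  "computable f \<Longrightarrow> computable g \<Longrightarrow> computable (\<lambda>x. prod_encode (f x, g x))"
  by (rule computable_lift2[of "\<lambda>a b. prod_encode (a, b)"]) (simp_all add: rf_prod_encode rf_proj)

lemma computable_eq [computable_intros]:
  "computable f \<Longrightarrow> computable g \<Longrightarrow> computable (\<lambda>x. f x = g x)"
  by (rule computable_lift2[of "\<lambda>a b. if a = b then 1 else 0"])
     (simp_all add: rf_if rf_proj rf_const rf_zero)

lemma computable_enc [computable_intros]: "computable f \<Longrightarrow> computable (\<lambda>x. enc (f x))"
  by (rule computable_lift[of "\<lambda>x. x"]) (simp_all add: rf_proj)

lemma computable_If [computable_intros]:
  assumes "computable b" "computable f" "computable g"
  shows "computable (\<lambda>x. if b x then f x else g x)"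
proof -
  obtain f' where f: "rf 1 f'" "\<And>x. f' [enc x] = enc (f x)" using assms(2) by (auto simp: computable_def)
  obtain g' where g: "rf 1 g'" "\<And>x. g' [enc x] = enc (g x)" using assms(3) by (auto simp: computable_def)
  obtain b' where b: "rf 1 b'" "\<And>x. b' [enc x] = enc (b x)" using assms(1) by (auto simp: computable_def)
  show ?thesis
    by (rule computableI[OF rf_if[OF b(1) rf_const[of _ 1] f(1) g(1)]]) (simp add: b(2) f(2) g(2))
qed

lemma computable_not [computable_intros]: "computable f \<Longrightarrow> computable (\<lambda>x. \<not> f x)"
proof -
  assume "computable f"
  then have "computable (\<lambda>x. if f x then False else True)" by (intro computable_intros)
  then show ?thesis by (rule back_subst[of computable]) auto
qed

lemma computable_conj [computable_intros]:
  "computable f \<Longrightarrow> computable g \<Longrightarrow> computable (\<lambda>x. f x \<and> g x)"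
proof -
  assume "computable f" "computable g"
  then have "computable (\<lambda>x. if f x then g x else False)" by (intro computable_intros)
  then show ?thesis by (rule back_subst[of computable]) auto
qed

lemma computable_disj [computable_intros]:
  "computable f \<Longrightarrow> computable g \<Longrightarrow> computable (\<lambda>x. f x \<or> g x)"
proof -
  assume "computable f" "computable g"
  then have "computable (\<lambda>x. if f x then True else g x)" by (intro computable_intros)
  then show ?thesis by (rule back_subst[of computable]) auto
qed

lemma computable_le [computable_intros]:
  "computable f \<Longrightarrow> computable g \<Longrightarrow> computable (\<lambda>x. f x \<le> (g x :: nat))"
proof -
  assume "computable f" "computable g"
  then have "computable (\<lambda>x. f x - g x = 0)" by (intro computable_intros)
  then show ?thesis by simp
qed

lemma computable_less [computable_intros]:
  "computable f \<Longrightarrow> computable g \<Longrightarrow> computable (\<lambda>x. f x < (g x :: nat))"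
proof -
  assume "computable f" "computable g"
  then have "computable (\<lambda>x. \<not> g x \<le> f x)" by (intro computable_intros)
  then show ?thesis by (simp add: not_le)
qed

text \<open>The parameter x is carried along as a code, so the step may depend on it. Iteration,
  folds over lists and recursion over syntax are all derived from this case.\<close>

lemma computable_rec_nat [computable_intros]:
  fixes g :: "'a::enc \<Rightarrow> nat \<Rightarrow> 'b::enc \<Rightarrow> 'b"
  assumes "computable f" "computable n"
    and "computable (\<lambda>t. g (fst t) (fst (snd t)) (snd (snd t)))"
  shows "computable (\<lambda>x. rec_nat (f x) (g x) (n x))"
proof -
  obtain f' where f: "rf 1 f'" "\<And>x. f' [enc x] = enc (f x)" using assms(1) by (auto simp: computable_def)
  obtain n' where n: "rf 1 n'" "\<And>x. n' [enc x] = enc (n x)" using assms(2) by (auto simp: computable_def)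
  obtain g' where g: "rf 1 g'" "\<And>x k r. g' [prod_encode (enc x, prod_encode (k, enc r))] = enc (g x k r)"
    using assms(3) by (force simp: computable_def enc_prod_def)
  have f1: "rf 1 (\<lambda>xs. f' [xs ! 0])"
    using f(1) by (rule rf_cong) (auto dest!: length_1)
  have g1: "rf 1 (\<lambda>xs. g' [xs ! 0])"
    using g(1) by (rule rf_cong) (auto dest!: length_1)
  have "rf 3 (\<lambda>xs. g' [prod_encode (xs ! 2, prod_encode (xs ! 0, xs ! 1))])"
    by (rule rf_comp1[OF g1]) (intro rf_prod_encode rf_proj; simp)
  then have "rf 2 (\<lambda>xs. rec_nat (f' [xs ! 1]) (\<lambda>k r. g' [prod_encode (xs ! 1, prod_encode (k, r))]) (xs ! 0))"
    using rf_rec2[of "\<lambda>a. f' [a]" "\<lambda>k r x. g' [prod_encode (x, prod_encode (k, r))]", OF f1] by simp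
  then have "rf 1 (\<lambda>xs. rec_nat (f' [xs ! 0]) (\<lambda>k r. g' [prod_encode (xs ! 0, prod_encode (k, r))]) (n' xs))"
    by (rule rf_comp2[where h = "\<lambda>m x. rec_nat (f' [x]) (\<lambda>k r. g' [prod_encode (x, prod_encode (k, r))]) m"])
       (use n in \<open>simp_all add: rf_proj\<close>)
  then show ?thesis
  proof (rule computableI)
    fix x
    have "rec_nat (enc (f x)) (\<lambda>k r. g' [prod_encode (enc x, prod_encode (k, r))]) m = enc (rec_nat (f x) (g x) m)" for m
      by (induction m) (simp_all add: g(2))
    then show "rec_nat (f' [[enc x] ! 0]) (\<lambda>k r. g' [prod_encode ([enc x] ! 0, prod_encode (k, r))]) (n' [enc x])
        = enc (rec_nat (f x) (g x) (n x))"
      by (simp add: f(2) n(2))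
  qed
qed

lemma computable_funpow [computable_intros]:
  fixes g :: "'a::enc \<Rightarrow> 'b::enc \<Rightarrow> 'b"
  assumes "computable n" "computable f" "computable (\<lambda>t. g (fst t) (snd t))"
  shows "computable (\<lambda>x. (g x ^^ n x) (f x))"
proof -
  have "computable (\<lambda>x. rec_nat (f x) (\<lambda>k r. g x r) (n x))"
    using assms(1,2)
  proof (intro computable_intros)
    show "computable (\<lambda>t::'a \<times> nat \<times> 'b. g (fst t) (snd (snd t)))"
    proof -
      have "computable (\<lambda>t::'a \<times> nat \<times> 'b. (fst t, snd (snd t)))" by (intro computable_intros)
      from computable_comp[OF assms(3) this] show ?thesis by simp
    qed
  qed
  moreover have "rec_nat (f x) (\<lambda>k r. g x r) m = (g x ^^ m) (f x)" for x m
    by (induction m) auto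
  ultimately show ?thesis by simp
qed

lemma computable_power [computable_intros]:
  "computable f \<Longrightarrow> computable g \<Longrightarrow> computable (\<lambda>x. (f x :: nat) ^ g x)"
proof -
  assume f: "computable f" and g: "computable g"
  have "computable (\<lambda>x. (((*) (f x)) ^^ g x) 1)"
  proof (intro computable_intros g)
    show "computable (\<lambda>t. f (fst t))" by (intro computable_comp[OF f] computable_intros)
  qed
  moreover have "(((*) a) ^^ n) 1 = a ^ n" for a n :: nat by (induction n) auto
  ultimately show ?thesis by simp
qed

subsection \<open>Bound functions\<close>

text \<open>Monotone and above the identity: arguments may be enlarged freely and a composition
  dominates its parts, so several estimates merge into one. Computability is what finally makes the
  bounds on quantifiers effective.\<close>

definition CB :: "(nat \<Rightarrow> nat) set" where
  "CB = {h. computable h \<and> mono h \<and> (\<forall>n. n \<le> h n)}"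

lemma CB_ge: "h \<in> CB \<Longrightarrow> n \<le> h n"
  by (simp add: CB_def)

lemma CB_mono: "h \<in> CB \<Longrightarrow> m \<le> n \<Longrightarrow> h m \<le> h n"
  by (simp add: CB_def mono_def)

lemma CB_id: "(\<lambda>n. n) \<in> CB"
  by (simp add: CB_def mono_def computable_id)

lemma CB_comp: "f \<in> CB \<Longrightarrow> g \<in> CB \<Longrightarrow> (\<lambda>n. f (g n)) \<in> CB"
proof -
  assume f: "f \<in> CB" and g: "g \<in> CB"
  have "n \<le> f (g n)" for n using order_trans[OF CB_ge[OF g] CB_ge[OF f]] .
  moreover have "mono (\<lambda>n. f (g n))" by (intro monoI CB_mono[OF f] CB_mono[OF g])
  moreover have "computable (\<lambda>n. f (g n))" using f g by (auto simp: CB_def intro: computable_comp)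
  ultimately show ?thesis by (simp add: CB_def)
qed

lemma CB_add: "f \<in> CB \<Longrightarrow> g \<in> CB \<Longrightarrow> (\<lambda>n. f n + g n) \<in> CB"
proof -
  assume f: "f \<in> CB" and g: "g \<in> CB"
  then have "computable (\<lambda>n. f n + g n)" by (intro computable_intros) (auto simp: CB_def)
  moreover have "mono (\<lambda>n. f n + g n)" by (intro monoI add_mono CB_mono[OF f] CB_mono[OF g])
  ultimately show ?thesis using CB_ge[OF f] by (simp add: CB_def trans_le_add1)
qed

lemma CB_add_const: "f \<in> CB \<Longrightarrow> (\<lambda>n. f n + c) \<in> CB"
proof -
  assume f: "f \<in> CB"
  then have "computable (\<lambda>n. f n + c)" by (intro computable_intros) (auto simp: CB_def)
  moreover have "mono (\<lambda>n. f n + c)" by (intro monoI add_mono CB_mono[OF f] order_refl)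
  ultimately show ?thesis using CB_ge[OF f] by (simp add: CB_def trans_le_add1)
qed

lemma CB_Suc: "f \<in> CB \<Longrightarrow> (\<lambda>n. Suc (f n)) \<in> CB"
  using CB_add_const[of f 1] by simp

lemma CB_mult_const: "f \<in> CB \<Longrightarrow> c > 0 \<Longrightarrow> (\<lambda>n. c * f n) \<in> CB"
proof -
  assume f: "f \<in> CB" and c: "c > 0"
  from f have "computable (\<lambda>n. c * f n)" by (intro computable_intros) (auto simp: CB_def)
  moreover have "mono (\<lambda>n. c * f n)" by (intro monoI mult_le_mono CB_mono[OF f] order_refl)
  moreover have "n \<le> c * f n" for n
  proof -
    have "1 * n \<le> c * f n" using c CB_ge[OF f] by (intro mult_le_mono) auto
    then show ?thesis by simp
  qed
  ultimately show ?thesis by (simp add: CB_def)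
qed

lemma CB_mult: "f \<in> CB \<Longrightarrow> g \<in> CB \<Longrightarrow> (\<lambda>n. f n * g n) \<in> CB"
  unfolding CB_def mono_def
proof (auto intro!: computable_intros mult_mono)
  fix n assume "\<forall>n. n \<le> f n" "\<forall>n. n \<le> g n"
  then have "n * n \<le> f n * g n" by (simp add: mult_mono)
  with le_square[of n] show "n \<le> f n * g n" by (rule le_trans)
qed

lemma CB_power: "f \<in> CB \<Longrightarrow> c \<ge> 2 \<Longrightarrow> (\<lambda>n. c ^ f n) \<in> CB"
  unfolding CB_def mono_def
proof (auto intro!: computable_intros)
  fix n assume "\<forall>n. n \<le> f n" "2 \<le> c"
  then have "n \<le> f n" "f n < c ^ f n" using power_gt_expt by (auto simp: Suc_le_eq)
  then show "n \<le> c ^ f n" by linarith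
qed

lemma funpow_le:
  assumes "\<And>m n. m \<le> n \<Longrightarrow> f m \<le> f (n :: nat)" "\<And>n. n \<le> f n" "a \<le> b" "m \<le> n"
  shows "(f ^^ a) m \<le> (f ^^ b) n"
proof -
  have "(f ^^ a) m \<le> (f ^^ a) n" by (induction a) (auto simp: assms)
  also have "\<dots> \<le> (f ^^ (a + k)) n" for k
  proof (induction k)
    case (Suc k)
    then show ?case using assms(2)[of "(f ^^ (a + k)) n"] by (simp add: order_trans[OF Suc])
  qed simp
  finally show ?thesis using assms(3) by (metis le_add_diff_inverse)
qed

lemma CB_funpow_le: "f \<in> CB \<Longrightarrow> a \<le> b \<Longrightarrow> m \<le> n \<Longrightarrow> (f ^^ a) m \<le> (f ^^ b) n"
  by (rule funpow_le) (simp_all add: CB_mono CB_ge)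

text \<open>The number of iterations may grow with the argument. Bounds obtained by an induction
  whose length depends on the input, such as column reduction or descent through a formula, stay in
  \<open>CB\<close> for this reason.\<close>

lemma CB_funpow:
  assumes "f \<in> CB" "a \<in> CB" "b \<in> CB"
  shows "(\<lambda>n. (f ^^ a n) (b n)) \<in> CB"
proof -
  have "n \<le> (f ^^ a n) (b n)" for n
    using CB_funpow_le[OF assms(1), of 0 "a n" "b n" "b n"] CB_ge[OF assms(3), of n] by simp
  moreover have "computable (\<lambda>n. (f ^^ a n) (b n))"
  proof -
    have c: "computable f" "computable a" "computable b" using assms by (auto simp: CB_def)
    have "computable (\<lambda>t::nat \<times> nat. f (snd t))"
      by (rule computable_comp[OF c(1)]) (intro computable_intros)
    from computable_funpow[OF c(2,3) this] show ?thesis .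
  qed
  moreover have "mono (\<lambda>n. (f ^^ a n) (b n))"
    by (rule monoI, rule CB_funpow_le[OF assms(1)]) (rule CB_mono[OF assms(2)] CB_mono[OF assms(3)], assumption)+
  ultimately show ?thesis by (simp add: CB_def)
qed

lemmas CB_intros = CB_id CB_add CB_add_const CB_Suc CB_mult CB_power

section \<open>Frobenius identities in characteristic p and polynomials over the prime field\<close>

locale char_p_field =
  fixes p :: nat and s :: "'a::field poly"
  assumes prime_p: "prime p" and char_p: "CHAR('a) = p" and s_nz: "s \<noteq> 0"
begin

declare s_nz [simp]

lemma p_pos [simp]: "p > 0" and p_ge_2: "p \<ge> 2"
  using prime_p prime_gt_0_nat prime_ge_2_nat by auto

lemma p_nz [simp]: "p \<noteq> 0"
  using p_pos by (rule gr_implies_not0)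

lemma char_fract_p: "CHAR('a poly fract) = p"
proof (rule CHAR_eqI)
  have of_nat: "of_nat n = to_fract (of_nat n :: 'a poly)" for n
    by (induction n) auto
  show "of_nat p = (0 :: 'a poly fract)"
    using of_nat_CHAR[where ?'a = 'a] by (simp add: of_nat char_p of_nat_poly)
  show "p dvd n" if "of_nat n = (0 :: 'a poly fract)" for n
    using that by (simp add: of_nat of_nat_eq_0_iff_char_dvd char_p)
qed

lemma frob_add: "(x + y :: 'a poly fract) ^ (p ^ n) = x ^ (p ^ n) + y ^ (p ^ n)"
  using freshmans_dream'[where ?'a = "'a poly fract" and n = n] prime_p by (simp add: char_fract_p)

lemma frob_sum: "(sum f A :: 'a poly fract) ^ (p ^ n) = (\<Sum>i\<in>A. f i ^ (p ^ n))"
  using freshmans_dream_sum'[where ?'a = "'a poly fract" and n = n, OF _ refl] prime_p by (simp add: char_fract_p)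

lemma frob_sum_poly: "(sum f A :: 'a poly) ^ (p ^ n) = (\<Sum>i\<in>A. f i ^ (p ^ n))"
  using freshmans_dream_sum'[where ?'a = "'a poly" and n = n, OF _ refl] prime_p by (simp add: char_p)

lemma frob_add_poly: "(x + y :: 'a poly) ^ (p ^ n) = x ^ (p ^ n) + y ^ (p ^ n)"
  using freshmans_dream'[where ?'a = "'a poly" and n = n] prime_p by (simp add: char_p)

lemma frob_add_field: "(x + y :: 'a) ^ (p ^ n) = x ^ (p ^ n) + y ^ (p ^ n)"
  using freshmans_dream'[where ?'a = 'a and n = n] prime_p by (simp add: char_p)

lemma frob_diff_field: "(x - y :: 'a) ^ (p ^ n) = x ^ (p ^ n) - y ^ (p ^ n)"
  using frob_add_field[of "x - y" y n] by simp

lemma frob_inj: "(x :: 'a) ^ (p ^ n) = y ^ (p ^ n) \<longleftrightarrow> x = y"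
  using frob_diff_field[of x y n] by (auto simp: right_minus_eq)

text \<open>Fermat's little theorem: additivity of the Frobenius map carries the identity from 0 and
  1 to all integers.\<close>

lemma Ints_frob: "(x :: 'a) \<in> \<int> \<Longrightarrow> x ^ (p ^ n) = x"
proof -
  assume "x \<in> \<int>"
  then obtain k where k: "x = of_int k" by (auto elim: Ints_cases)
  have nat: "(of_nat m :: 'a) ^ (p ^ n) = of_nat m" for m
    by (induction m) (auto simp: frob_add_field zero_power)
  have "(of_int k :: 'a) ^ (p ^ n) = of_int k"
  proof (cases "k \<ge> 0")
    case True then show ?thesis using nat[of "nat k"] by simp
  next
    case False
    then have "(of_int k :: 'a) = 0 - of_nat (nat (- k))" by simp
    then show ?thesis using frob_diff_field[of 0 "of_nat (nat (- k))" n] nat by (simp add: zero_power)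
  qed
  then show ?thesis using k by simp
qed

subsection \<open>Prime-field polynomials\<close>

abbreviation PF :: "'a poly set" where "PF \<equiv> prime_field_polys"

lemma PF_0 [simp]: "0 \<in> PF" and PF_1 [simp]: "1 \<in> PF"
  by (auto simp: prime_field_polys_def coeff_1)

lemma PF_add: "f \<in> PF \<Longrightarrow> g \<in> PF \<Longrightarrow> f + g \<in> PF"
  by (auto simp: prime_field_polys_def)

lemma PF_uminus: "f \<in> PF \<Longrightarrow> - f \<in> PF"
  by (auto simp: prime_field_polys_def)

lemma PF_diff: "f \<in> PF \<Longrightarrow> g \<in> PF \<Longrightarrow> f - g \<in> PF"
  by (auto simp: prime_field_polys_def)

lemma PF_sum: "(\<And>i. i \<in> A \<Longrightarrow> f i \<in> PF) \<Longrightarrow> sum f A \<in> PF"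
  by (induction A rule: infinite_finite_induct) (auto simp: PF_add)

lemma PF_mult: "f \<in> PF \<Longrightarrow> g \<in> PF \<Longrightarrow> f * g \<in> PF"
  by (auto simp: prime_field_polys_def coeff_mult intro!: Ints_sum Ints_mult)

lemma PF_power: "f \<in> PF \<Longrightarrow> f ^ n \<in> PF"
  by (induction n) (auto simp: PF_mult)

lemma PF_monom: "c \<in> \<int> \<Longrightarrow> monom c n \<in> PF"
  by (auto simp: prime_field_polys_def)

lemma PF_coeff: "f \<in> PF \<Longrightarrow> coeff f i \<in> \<int>"
  by (auto simp: prime_field_polys_def)

end

locale frob_ring = char_p_field p s for p :: nat and s :: "'a::field poly" +
  assumes perfect: "\<exists>y::'a. y ^ p = x"
begin

lemma perfect_pow: "\<exists>y::'a. y ^ (p ^ n) = x"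
proof (induction n arbitrary: x)
  case (Suc n)
  obtain y where "y ^ (p ^ n) = x" using Suc by blast
  moreover obtain w where "w ^ p = y" using perfect by blast
  ultimately show ?case by (intro exI[of _ w]) (simp add: power_mult)
qed auto

subsection \<open>\<open>p ^ n\<close>-components of polynomials\<close>

text \<open>If \<rho> lists the q-th roots of the coefficients of f, this is the component f_k in f
  = sum of z^k f_k^q. The roots are a parameter because they come from perfectness for general f,
  but are the coefficients themselves over the prime field.\<close>

definition comp_poly :: "nat \<Rightarrow> nat \<Rightarrow> (nat \<Rightarrow> 'a) \<Rightarrow> nat \<Rightarrow> 'a poly" where
  "comp_poly q d \<rho> k = (\<Sum>i\<in>{i. i \<le> d \<and> i mod q = k}. monom (\<rho> i) (i div q))"

lemma comp_poly_sum:
  assumes "\<And>i. i \<le> d \<Longrightarrow> \<rho> i ^ (p ^ n) = coeff f i" "degree f \<le> d"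
  shows "f = (\<Sum>k<p ^ n. monom 1 k * comp_poly (p ^ n) d \<rho> k ^ (p ^ n))"
proof -
  let ?q = "p ^ n"
  have "(\<Sum>k<?q. monom 1 k * comp_poly ?q d \<rho> k ^ ?q)
      = (\<Sum>k<?q. \<Sum>i\<in>{i\<in>{..d}. i mod ?q = k}. monom (coeff f i) i)"
  proof (intro sum.cong refl)
    fix k
    have "monom 1 k * comp_poly ?q d \<rho> k ^ ?q
        = (\<Sum>i\<in>{i. i \<le> d \<and> i mod ?q = k}. monom 1 k * monom (\<rho> i) (i div ?q) ^ ?q)"
      by (simp add: comp_poly_def frob_sum_poly sum_distrib_left)
    also have "\<dots> = (\<Sum>i\<in>{i\<in>{..d}. i mod ?q = k}. monom (coeff f i) i)"
      by (rule sum.cong) (auto simp: monom_power mult_monom assms(1) mult_ac)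
    finally show "monom 1 k * comp_poly ?q d \<rho> k ^ ?q
        = (\<Sum>i\<in>{i\<in>{..d}. i mod ?q = k}. monom (coeff f i) i)" .
  qed
  also have "\<dots> = (\<Sum>i\<le>d. monom (coeff f i) i)"
    by (rule sum.group) auto
  also have "\<dots> = f" by (rule poly_as_sum_of_monoms') (rule assms(2))
  finally show ?thesis ..
qed

lemma degree_comp_poly: "q * degree (comp_poly q d \<rho> k) \<le> d"
proof (cases "q = 0")
  case False
  have "degree (comp_poly q d \<rho> k) \<le> d div q"
    unfolding comp_poly_def
    by (rule degree_sum_le) (auto intro!: order_trans[OF degree_monom_le] div_le_mono)
  then have "q * degree (comp_poly q d \<rho> k) \<le> q * (d div q)" by simp
  also have "\<dots> \<le> d" by simp
  finally show ?thesis .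
qed auto

lemma coeff_frob_poly:
  "coeff (h ^ (p ^ n)) i = (if p ^ n dvd i then coeff h (i div p ^ n) ^ (p ^ n) else (0 :: 'a))"
proof -
  let ?q = "p ^ n"
  have "h ^ ?q = (\<Sum>j\<le>degree h. monom (coeff h j) j) ^ ?q"
    by (simp add: poly_as_sum_of_monoms)
  also have "\<dots> = (\<Sum>j\<le>degree h. monom (coeff h j ^ ?q) (j * ?q))"
    by (simp add: frob_sum_poly monom_power mult.commute)
  finally have eq: "coeff (h ^ ?q) i = (\<Sum>j\<le>degree h. if j * ?q = i then coeff h j ^ ?q else 0)"
    by (simp add: coeff_sum)
  show ?thesis
  proof (cases "?q dvd i")
    case True
    then obtain m where m: "i = ?q * m" by blast
    have "j * ?q = i \<longleftrightarrow> j = m" for j using p_pos by (simp add: m)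
    then have "coeff (h ^ ?q) i = (\<Sum>j\<le>degree h. if j = m then coeff h j ^ ?q else 0)"
      by (simp add: eq)
    also have "\<dots> = coeff h m ^ ?q"
      using p_pos by (auto simp: coeff_eq_0 zero_power)
    finally show ?thesis using m p_pos by simp
  next
    case False
    then have "j * ?q \<noteq> i" for j by auto
    with False show ?thesis by (simp add: eq)
  qed
qed

text \<open>The exponents in z^j a_j^q are congruent to j modulo q, so distinct summands never
  overlap.\<close>

lemma coeff_comp_sum:
  fixes a :: "nat \<Rightarrow> 'a poly"
  assumes "k < p ^ n"
  shows "coeff (\<Sum>k<p ^ n. monom 1 k * a k ^ (p ^ n)) (k + p ^ n * m) = coeff (a k) m ^ (p ^ n)"
proof -
  let ?q = "p ^ n"
  have "coeff (monom 1 j * a j ^ ?q) (k + ?q * m) = (if j = k then coeff (a k) m ^ ?q else 0)"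
    if "j < ?q" for j
  proof (cases "j = k")
    case True
    then show ?thesis using p_pos by (simp add: coeff_monom_mult coeff_frob_poly)
  next
    case False
    have "\<not> ?q dvd k + ?q * m - j" if "j \<le> k + ?q * m"
    proof
      assume "?q dvd k + ?q * m - j"
      then have "(k + ?q * m) mod ?q = j mod ?q"
        using that mod_eq_dvd_iff_nat by blast
      then show False using assms \<open>j < ?q\<close> False by simp
    qed
    then show ?thesis using False by (auto simp: coeff_monom_mult coeff_frob_poly)
  qed
  then have "coeff (\<Sum>k<?q. monom 1 k * a k ^ ?q) (k + ?q * m)
      = (\<Sum>j<?q. if j = k then coeff (a k) m ^ ?q else 0)"
    by (simp add: coeff_sum)
  then show ?thesis using assms by simp
qed

lemma comp_sum_inj:
  fixes a b :: "nat \<Rightarrow> 'a poly"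
  assumes "(\<Sum>k<p ^ n. monom 1 k * a k ^ (p ^ n)) = (\<Sum>k<p ^ n. monom 1 k * b k ^ (p ^ n))" "k < p ^ n"
  shows "a k = b k"
proof (rule poly_eqI)
  fix m
  have "coeff (a k) m ^ (p ^ n) = coeff (b k) m ^ (p ^ n)"
    using coeff_comp_sum[OF assms(2), of a m] coeff_comp_sum[OF assms(2), of b m] assms(1) by simp
  then show "coeff (a k) m = coeff (b k) m" by (simp add: frob_inj)
qed

subsection \<open>The filtration\<close>

text \<open>One more than the degree of s, so that the pole at infinity may grow with d as well as
  the poles at the roots of s. With \<open>degree s\<close> in its place, z would lie in no
  \<open>Rd d\<close>; as it stands, z^i lies in \<open>Rd d\<close> exactly for i \<le> d.\<close>

abbreviation D :: nat where "D \<equiv> Suc (degree s)"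

definition Rd :: "nat \<Rightarrow> 'a poly fract set" where
  "Rd d = {to_fract f / to_fract s ^ d | f. degree f \<le> D * d}"

definition RR :: "'a poly fract set" where "RR = (\<Union>d. Rd d)"

lemma tf_power: "to_fract (f ^ n) = to_fract (f :: 'a poly) ^ n"
  by (induction n) auto

lemma RdI: "degree f \<le> D * d \<Longrightarrow> x = to_fract f / to_fract s ^ d \<Longrightarrow> x \<in> Rd d"
  by (auto simp: Rd_def)

lemma RdE:
  assumes "x \<in> Rd d"
  obtains f where "degree f \<le> D * d" "x = to_fract f / to_fract s ^ d"
  using assms by (auto simp: Rd_def)

lemma Rd_mono: "d \<le> e \<Longrightarrow> Rd d \<subseteq> Rd e"
proof
  fix x assume "d \<le> e" "x \<in> Rd d"
  then obtain f where f: "degree f \<le> D * d" "x = to_fract f / to_fract s ^ d" by (auto elim: RdE)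
  obtain k where k: "e = d + k" using \<open>d \<le> e\<close> le_Suc_ex by blast
  show "x \<in> Rd e"
  proof (rule RdI)
    have "degree (f * s ^ k) \<le> degree f + k * degree s"
      using degree_mult_le[of f "s ^ k"] degree_power_le[of s k] by (simp add: mult.commute)
    also have "\<dots> \<le> D * e" using f(1) k by (simp add: algebra_simps)
    finally show "degree (f * s ^ k) \<le> D * e" .
    show "x = to_fract (f * s ^ k) / to_fract s ^ e"
      by (simp add: f(2) k tf_power power_add)
  qed
qed

lemma Rd_monoD: "x \<in> Rd d \<Longrightarrow> d \<le> e \<Longrightarrow> x \<in> Rd e"
  using Rd_mono by blast

lemma Rd_0 [simp]: "0 \<in> Rd d" by (rule RdI[of 0]) auto

lemma Rd_add: "x \<in> Rd d \<Longrightarrow> y \<in> Rd d \<Longrightarrow> x + y \<in> Rd d"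
proof (erule RdE, erule RdE)
  fix f g assume "degree f \<le> D * d" "x = to_fract f / to_fract s ^ d"
    "degree g \<le> D * d" "y = to_fract g / to_fract s ^ d"
  then show "x + y \<in> Rd d" by (intro RdI[of "f + g"] degree_add_le) (auto simp: add_divide_distrib)
qed

lemma Rd_uminus: "x \<in> Rd d \<Longrightarrow> - x \<in> Rd d"
proof (erule RdE)
  fix f assume "degree f \<le> D * d" "x = to_fract f / to_fract s ^ d"
  then show "- x \<in> Rd d" by (intro RdI[of "- f"]) auto
qed

lemma Rd_diff: "x \<in> Rd d \<Longrightarrow> y \<in> Rd d \<Longrightarrow> x - y \<in> Rd d"
  using Rd_add[of x d "- y"] Rd_uminus by simp

lemma Rd_sum: "(\<And>i. i \<in> A \<Longrightarrow> f i \<in> Rd d) \<Longrightarrow> sum f A \<in> Rd d"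
  by (induction A rule: infinite_finite_induct) (auto simp: Rd_add)

lemma Rd_mult: "x \<in> Rd d \<Longrightarrow> y \<in> Rd e \<Longrightarrow> x * y \<in> Rd (d + e)"
proof (erule RdE, erule RdE)
  fix f g assume "degree f \<le> D * d" "x = to_fract f / to_fract s ^ d"
    "degree g \<le> D * e" "y = to_fract g / to_fract s ^ e"
  then show "x * y \<in> Rd (d + e)"
    using degree_mult_le[of f g]
    by (intro RdI[of "f * g"]) (auto simp: power_add algebra_simps)
qed

lemma Rd_tf: "to_fract a \<in> Rd (degree a)"
proof (rule RdI)
  show "degree (a * s ^ degree a) \<le> D * degree a"
    using degree_mult_le[of a "s ^ degree a"] degree_power_le[of s "degree a"]
    by (simp add: mult.commute)
qed (simp add: tf_power)

lemma Rd_tf_le: "degree a \<le> d \<Longrightarrow> to_fract a \<in> Rd d"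
  using Rd_tf Rd_mono by blast

lemma Rd_tf_mult: "x \<in> Rd d \<Longrightarrow> degree a \<le> e \<Longrightarrow> to_fract a * x \<in> Rd (e + d)"
  using Rd_mult Rd_tf_le by blast

lemma Rd_1 [simp]: "1 \<in> Rd d"
  using Rd_tf_le[of 1 d] by simp

lemma Rd_power: "x \<in> Rd d \<Longrightarrow> x ^ n \<in> Rd (n * d)"
  by (induction n) (auto simp: Rd_mult)

lemma Rd_zero: "Rd 0 = range const_fract"
proof (intro equalityI subsetI)
  fix x assume "x \<in> Rd 0"
  then obtain f where "degree f = 0" "x = to_fract f" by (auto elim: RdE)
  then obtain c where "f = [:c:]" using degree_0_id by metis
  with \<open>x = to_fract f\<close> show "x \<in> range const_fract" by (simp add: const_fract_def)
next
  fix x :: "'a poly fract" assume "x \<in> range const_fract"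
  then obtain c where "x = to_fract [:c:]" by (auto simp: const_fract_def)
  then show "x \<in> Rd 0" using Rd_tf[of "[:c:]"] by simp
qed

lemma RRE: assumes "x \<in> RR" obtains d where "x \<in> Rd d"
  using assms by (auto simp: RR_def)

lemma Rd_RR: "x \<in> Rd d \<Longrightarrow> x \<in> RR" by (auto simp: RR_def)

lemma RR_0 [simp]: "0 \<in> RR" and RR_1 [simp]: "1 \<in> RR"
  using Rd_RR[OF Rd_0[of 0]] Rd_RR[OF Rd_1[of 0]] by auto

lemma RR_add: "x \<in> RR \<Longrightarrow> y \<in> RR \<Longrightarrow> x + y \<in> RR"
proof (erule RRE, erule RRE)
  fix d e assume "x \<in> Rd d" "y \<in> Rd e"
  then show "x + y \<in> RR" by (intro Rd_RR[of _ "d + e"] Rd_add) (auto elim: Rd_monoD)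
qed

lemma RR_uminus: "x \<in> RR \<Longrightarrow> - x \<in> RR" by (auto simp: RR_def dest: Rd_uminus)

lemma RR_diff: "x \<in> RR \<Longrightarrow> y \<in> RR \<Longrightarrow> x - y \<in> RR"
  using RR_add[of x "- y"] RR_uminus by simp

lemma RR_mult: "x \<in> RR \<Longrightarrow> y \<in> RR \<Longrightarrow> x * y \<in> RR"
  by (auto simp: RR_def dest: Rd_mult)

lemma RR_power: "x \<in> RR \<Longrightarrow> x ^ n \<in> RR"
  by (induction n) (auto simp: RR_mult)

lemma RR_sum: "(\<And>i. i \<in> A \<Longrightarrow> f i \<in> RR) \<Longrightarrow> sum f A \<in> RR"
  by (induction A rule: infinite_finite_induct) (auto simp: RR_add)

lemma RR_tf [simp]: "to_fract a \<in> RR" using Rd_tf Rd_RR by blast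

lemma RR_common:
  assumes "finite A" "\<And>i. i \<in> A \<Longrightarrow> x i \<in> RR"
  shows "\<exists>d. \<forall>i\<in>A. x i \<in> Rd d"
  using assms
proof (induction A rule: finite_induct)
  case (insert i A)
  then obtain d where d: "\<forall>i\<in>A. x i \<in> Rd d" by auto
  obtain e where "x i \<in> Rd e" using insert.prems by (blast elim: RRE)
  with d show ?case by (intro exI[of _ "d + e"]) (auto intro: Rd_monoD[of _ d] Rd_monoD[of _ e])
qed auto

lemma z_power_Rd: "to_fract (monom 1 i) \<in> Rd d \<longleftrightarrow> i \<le> d"
proof
  assume "to_fract (monom 1 i) \<in> Rd d"
  then obtain f where f: "degree f \<le> D * d" "to_fract (monom 1 i) = to_fract f / to_fract s ^ d"
    by (rule RdE)
  then have "to_fract (monom 1 i * s ^ d) = to_fract f"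
    by (simp add: tf_power field_simps)
  then have "f = monom 1 i * s ^ d" using to_fract_eq_iff by metis
  then have "degree f = i + d * degree s"
    using s_nz by (simp add: degree_mult_eq degree_monom_eq degree_power_eq)
  with f(1) show "i \<le> d" by simp
qed (auto intro!: Rd_tf_le simp: degree_monom_eq)

text \<open>Perfectness supplies the roots of the coefficients. The denominator s^(q e) is itself a
  q-th power, so the splitting of the numerator splits the fraction, and its degree bound divides by
  q.\<close>

lemma Rd_components:
  assumes "x \<in> Rd (p ^ n * e)"
  shows "\<exists>y. (\<forall>k<p ^ n. y k \<in> Rd e) \<and> x = (\<Sum>k<p ^ n. to_fract (monom 1 k) * y k ^ (p ^ n))"
proof -
  let ?q = "p ^ n"
  obtain f where f: "degree f \<le> D * (?q * e)" "x = to_fract f / to_fract s ^ (?q * e)"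
    using assms by (rule RdE)
  define \<rho> where "\<rho> i = (SOME r. r ^ ?q = coeff f i)" for i
  have \<rho>: "\<rho> i ^ ?q = coeff f i" for i
    unfolding \<rho>_def by (rule someI_ex) (rule perfect_pow)
  define g where "g = comp_poly ?q (degree f) \<rho>"
  have fg: "f = (\<Sum>k<?q. monom 1 k * g k ^ ?q)"
    unfolding g_def by (rule comp_poly_sum) (auto simp: \<rho>)
  have deg: "degree (g k) \<le> D * e" for k
  proof -
    have "?q * degree (g k) \<le> D * (?q * e)"
      using degree_comp_poly[of ?q "degree f" \<rho> k] f(1) by (simp add: g_def)
    then have "?q * degree (g k) \<le> ?q * (D * e)" by (simp only: mult.left_commute[of ?q D e])
    moreover have "?q > 0" using p_pos by simp
    ultimately show ?thesis using mult_le_cancel1[of ?q "degree (g k)" "D * e"] by blast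
  qed
  have "x = (\<Sum>k<?q. to_fract (monom 1 k) * (to_fract (g k) / to_fract s ^ e) ^ ?q)"
    unfolding f(2) by (subst fg) (simp add: tf_power sum_divide_distrib power_divide mult.commute power_mult)
  moreover have "to_fract (g k) / to_fract s ^ e \<in> Rd e" for k
    by (rule RdI[OF deg refl])
  ultimately show ?thesis by (intro exI[of _ "\<lambda>k. to_fract (g k) / to_fract s ^ e"]) simp
qed

lemma RR_components:
  assumes "x \<in> RR"
  shows "\<exists>y. (\<forall>k<p ^ n. y k \<in> RR) \<and> x = (\<Sum>k<p ^ n. to_fract (monom 1 k) * y k ^ (p ^ n))"
proof -
  obtain e where "x \<in> Rd e" using assms by (rule RRE)
  then have "x \<in> Rd (p ^ n * e)" by (rule Rd_monoD) (use p_pos in \<open>simp add: Suc_le_eq\<close>)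
  from Rd_components[OF this] show ?thesis using Rd_RR by blast
qed

text \<open>Components are unique: over a common denominator, two expansions of one element have the
  same numerators. Hence the given y_k are the bounded components found by
  \<open>Rd_components\<close>.\<close>

lemma components_Rd:
  assumes "\<And>k. k < p ^ n \<Longrightarrow> y k \<in> RR"
    and "(\<Sum>k<p ^ n. to_fract (monom 1 k) * y k ^ (p ^ n)) \<in> Rd (p ^ n * e)" "k < p ^ n"
  shows "y k \<in> Rd e"
proof -
  let ?q = "p ^ n"
  obtain w where w: "\<forall>k<?q. w k \<in> Rd e"
    "(\<Sum>k<?q. to_fract (monom 1 k) * y k ^ ?q) = (\<Sum>k<?q. to_fract (monom 1 k) * w k ^ ?q)"
    using Rd_components[OF assms(2)] by auto
  obtain E where E: "\<forall>k\<in>{..<?q}. y k \<in> Rd E" using RR_common[of "{..<?q}" y] assms(1) by auto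
  define m where "m = e + E"
  have "\<exists>f. w k = to_fract f / to_fract s ^ m" "\<exists>f. y k = to_fract f / to_fract s ^ m" if "k < ?q" for k
    using w(1) E that Rd_mono[of e m] Rd_mono[of E m] unfolding m_def
    by (metis RdE lessThan_iff in_mono le_add1 le_add2)+
  then obtain g h where gh: "\<And>k. k < ?q \<Longrightarrow> y k = to_fract (g k) / to_fract s ^ m"
    "\<And>k. k < ?q \<Longrightarrow> w k = to_fract (h k) / to_fract s ^ m" by metis
  have expand: "(\<Sum>k<?q. to_fract (monom 1 k) * u k ^ ?q)
      = to_fract (\<Sum>k<?q. monom 1 k * v k ^ ?q) / to_fract s ^ (m * ?q)"
    if "\<And>k. k < ?q \<Longrightarrow> u k = to_fract (v k) / to_fract s ^ m" for u v
    using that by (simp add: sum_divide_distrib power_divide tf_power power_mult)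
  have "to_fract (\<Sum>k<?q. monom 1 k * g k ^ ?q) = to_fract (\<Sum>k<?q. monom 1 k * h k ^ ?q)"
    using w(2) expand[of y g, OF gh(1)] expand[of w h, OF gh(2)] by simp
  then have "(\<Sum>k<?q. monom 1 k * g k ^ ?q) = (\<Sum>k<?q. monom 1 k * h k ^ ?q)"
    by (simp only: to_fract_eq_iff)
  then have "g k = h k" using comp_sum_inj assms(3) by blast
  then show ?thesis using gh w(1) assms(3) by simp
qed

lemma Rd_pth_root: "x \<in> RR \<Longrightarrow> x ^ (p ^ n) \<in> Rd (p ^ n * e) \<Longrightarrow> x \<in> Rd e"
proof -
  assume x: "x \<in> RR" "x ^ (p ^ n) \<in> Rd (p ^ n * e)"
  \<comment> \<open>A q-th power has a single component, at k = 0, so its bound is a case of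
    \<open>components_Rd\<close>.\<close>
  let ?y = "\<lambda>k. if k = 0 then x else 0"
  have "(\<Sum>k<p ^ n. to_fract (monom 1 k) * ?y k ^ (p ^ n)) = (\<Sum>k<p ^ n. if k = 0 then x ^ (p ^ n) else 0)"
    by (intro sum.cong) (auto simp: zero_power)
  also have "\<dots> = x ^ (p ^ n)" by simp
  finally show ?thesis using components_Rd[of n ?y e 0] x by auto
qed

subsection \<open>Division by a nonzero polynomial\<close>

text \<open>Coprimality is expressed by a Bezout identity, since \<open>gcd\<close> is not available for
  polynomials over an arbitrary field.\<close>

lemma bezout_or_factor:
  fixes c :: "'a poly"
  assumes "c \<noteq> 0"
  shows "(\<exists>u v. u * c + v * s = 1) \<or> (\<exists>g. g dvd c \<and> g dvd s \<and> degree g > 0)"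
proof -
  \<comment> \<open>A nonzero element of least degree in the ideal generated by c and s divides both
    generators.\<close>
  define I where "I = {u * c + v * s | u v. u * c + v * s \<noteq> 0}"
  have "1 * c + 0 * s \<in> I" unfolding I_def using assms by (intro CollectI exI[of _ 1] exI[of _ 0]) simp
  then obtain g where g: "g \<in> I" "\<And>h. h \<in> I \<Longrightarrow> degree g \<le> degree h"
    using arg_min_nat_lemma[of "\<lambda>x. x \<in> I" _ degree] by blast
  obtain u v where uv: "g = u * c + v * s" "g \<noteq> 0" using g(1) by (auto simp: I_def)
  have dvd: "g dvd x * c + y * s" for x y
  proof (rule ccontr)
    assume "\<not> g dvd x * c + y * s"
    then have r: "(x * c + y * s) mod g \<noteq> 0" by (simp add: dvd_eq_mod_eq_0)
    have "(x * c + y * s) mod g = x * c + y * s - ((x * c + y * s) div g) * g"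
      by (simp add: minus_div_mult_eq_mod)
    also have "\<dots> = (x - ((x * c + y * s) div g) * u) * c + (y - ((x * c + y * s) div g) * v) * s"
      by (subst (2) uv(1)) (simp add: algebra_simps)
    finally have "(x * c + y * s) mod g \<in> I" unfolding I_def using r by auto
    then show False using g(2) degree_mod_less'[OF uv(2) r] by fastforce
  qed
  show ?thesis
  proof (cases "degree g = 0")
    case True
    then obtain a where a: "g = [:a:]" using degree_0_id by metis
    then have "a \<noteq> 0" using uv(2) by auto
    have "([:inverse a:] * u) * c + ([:inverse a:] * v) * s = [:inverse a:] * g"
      by (subst uv(1)) (simp only: algebra_simps)
    also have "\<dots> = 1" using a \<open>a \<noteq> 0\<close> by (simp add: one_pCons)
    finally show ?thesis by blast
  next
    case False
    then show ?thesis using dvd[of 1 0] dvd[of 0 1] by auto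
  qed
qed

lemma bezout_power: "u * a + v * s = 1 \<Longrightarrow> \<exists>u v. u * a + v * s ^ n = 1"
proof (induction n)
  case 0
  then show ?case by (intro exI[of _ 0] exI[of _ 1]) simp
next
  case (Suc n)
  then obtain u' v' where *: "u' * a + v' * s ^ n = 1" by blast
  have "(u * a + v * s) * (u' * a + v' * s ^ n) = 1" using * Suc.prems by simp
  also have "(u * a + v * s) * (u' * a + v' * s ^ n)
      = (u * (u' * a + v' * s ^ n) + v * s * u') * a + v * v' * s ^ Suc n"
    by (simp add: algebra_simps)
  finally show ?case by blast
qed

text \<open>Factors shared with s are split off one at a time. Each has positive degree, so there
  are at most \<open>degree c\<close> of them, which bounds k. In R the factor b is a unit, while a
  is coprime to s.\<close>

lemma coprime_split:
  fixes c :: "'a poly"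
  assumes "c \<noteq> 0"
  obtains a b u v k where "c = a * b" "u * a + v * s = 1" "b dvd s ^ k" "k \<le> degree c"
proof -
  have "\<exists>a b u v k. c = a * b \<and> u * a + v * s = 1 \<and> b dvd s ^ k \<and> k \<le> degree c"
    using assms
  proof (induction "degree c" arbitrary: c rule: less_induct)
    case less
    show ?case
    proof (cases "\<exists>u v. u * c + v * s = 1")
      case True
      then obtain u v where "u * c + v * s = 1" by blast
      then have "c = c * 1 \<and> u * c + v * s = 1 \<and> 1 dvd s ^ 0 \<and> 0 \<le> degree c" by simp
      then show ?thesis by blast
    next
      case False
      then obtain g where g: "g dvd c" "g dvd s" "degree g > 0"
        using bezout_or_factor[OF less.prems] by blast
      then have gnz: "g \<noteq> 0" by auto
      obtain c' where c': "c = g * c'" using g(1) by blast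
      have nz: "c' \<noteq> 0" using less.prems c' by auto
      have deg: "degree c = degree g + degree c'" using c' nz gnz by (simp add: degree_mult_eq)
      then have "degree c' < degree c" using g(3) by simp
      from less.hyps[OF this nz] obtain a b u v k
        where abk: "c' = a * b" "u * a + v * s = 1" "b dvd s ^ k" "k \<le> degree c'"
        by blast
      have "g * b dvd s ^ Suc k" using g(2) abk(3) by (simp add: mult_dvd_mono)
      moreover have "c = a * (g * b)" using c' abk(1) by (simp add: mult_ac)
      moreover have "Suc k \<le> degree c" using abk(4) deg g(3) by simp
      ultimately show ?thesis using abk(2) by blast
    qed
  qed
  then show ?thesis using that by blast
qed

text \<open>The part of a that is coprime to s cannot cancel powers of s in a denominator; the other
  part divides s^k with k \<le> \<open>degree a\<close>, so division by it costs at most k further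
  powers of s.\<close>

lemma Rd_cancel:
  assumes "a \<noteq> 0" "x \<in> RR" "to_fract a * x \<in> Rd d"
  shows "x \<in> Rd (d + degree a)"
proof -
  obtain a0 a1 u v k where a: "a = a0 * a1" "u * a0 + v * s = 1" "a1 dvd s ^ k" "k \<le> degree a"
    using coprime_split[OF assms(1)] .
  obtain E where "x \<in> Rd E" using assms(2) by (rule RRE)
  then have "x \<in> Rd (d + E)" by (rule Rd_monoD) simp
  then obtain f where f: "x = to_fract f / to_fract s ^ (d + E)" by (auto elim: RdE)
  obtain g where g: "degree g \<le> D * d" "to_fract a * x = to_fract g / to_fract s ^ d"
    using assms(3) by (rule RdE)
  have "to_fract a * to_fract f = to_fract g * to_fract s ^ E"
    using g(2) unfolding f by (simp add: power_add divide_simps)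
  then have "to_fract (a * f) = to_fract (g * s ^ E)" by (simp add: tf_power)
  then have eq: "a * f = g * s ^ E" by (simp only: to_fract_eq_iff)
  have dvd: "s ^ E dvd a0 * (a1 * f)" using eq a(1) by (metis dvd_triv_right mult.assoc)
  obtain u' v' where uv: "u' * a0 + v' * s ^ E = 1" using bezout_power[OF a(2)] by blast
  have "a1 * f = (u' * a0 + v' * s ^ E) * (a1 * f)" by (simp add: uv)
  also have "\<dots> = u' * (a0 * (a1 * f)) + v' * (a1 * f) * s ^ E" by (simp add: algebra_simps)
  finally have "s ^ E dvd a1 * f" using dvd by (metis dvd_add dvd_mult dvd_triv_right)
  also have "a1 * f dvd s ^ k * f" using a(3) by (simp add: mult_dvd_mono)
  finally obtain h where h: "s ^ k * f = s ^ E * h" by blast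
  have x: "x = to_fract h / to_fract s ^ (d + k)"
  proof -
    have "to_fract s ^ k * to_fract f = to_fract s ^ E * to_fract h"
      using h by (metis tf_power to_fract_mult)
    then show ?thesis unfolding f by (simp add: power_add field_simps)
  qed
  have "degree h \<le> D * (d + k)"
  proof (cases "f = 0")
    case False
    then have hnz: "h \<noteq> 0" "g \<noteq> 0" using h eq s_nz assms(1) by auto
    have "k * degree s + degree f = E * degree s + degree h"
      using arg_cong[OF h, of degree] hnz False s_nz by (simp add: degree_mult_eq degree_power_eq)
    moreover have "degree a + degree f = degree g + E * degree s"
      using arg_cong[OF eq, of degree] hnz False s_nz assms(1) by (simp add: degree_mult_eq degree_power_eq)
    ultimately have "degree h \<le> k * degree s + degree g" by simp
    also have "\<dots> \<le> D * (d + k)" using g(1) by (simp add: algebra_simps)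
    finally show ?thesis .
  qed (use h s_nz in auto)
  then have "x \<in> Rd (d + k)" using x by (rule RdI)
  then show ?thesis by (rule Rd_monoD) (use a(4) in simp)
qed

lemma RR_inverse_dvd:
  assumes "b dvd s ^ k"
  shows "inverse (to_fract b) \<in> RR"
proof -
  obtain c where c: "s ^ k = b * c" using assms by blast
  have "b * c \<noteq> 0" using s_nz by (metis c power_not_zero)
  then have "b \<noteq> 0" "c \<noteq> 0" by auto
  have "to_fract s ^ k = to_fract b * to_fract c" using c by (metis tf_power to_fract_mult)
  then have "inverse (to_fract b) = to_fract c / to_fract s ^ k"
    using \<open>b \<noteq> 0\<close> \<open>c \<noteq> 0\<close> by (simp add: field_simps)
  also have "\<dots> = to_fract (c * s ^ degree c) / to_fract s ^ (k + degree c)"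
    by (simp add: tf_power power_add)
  also have "\<dots> \<in> Rd (k + degree c)"
  proof (rule RdI)
    show "degree (c * s ^ degree c) \<le> D * (k + degree c)"
      using degree_mult_le[of c "s ^ degree c"] degree_power_le[of s "degree c"] by (simp add: algebra_simps)
  qed simp
  finally show ?thesis by (rule Rd_RR)
qed

text \<open>Modulo the part a of c that is coprime to s, the Bezout coefficient v is an inverse of
  s^d. So x is congruent to the polynomial f v, which ordinary division reduces; the remaining
  factor b of c is a unit of R.\<close>

lemma RR_division:
  assumes "c \<noteq> 0" "x \<in> RR"
  shows "\<exists>y\<in>RR. \<exists>\<rho>\<in>Rd (degree c). x = to_fract c * y + \<rho>"
proof -
  obtain a b u0 v0 k where a: "c = a * b" "u0 * a + v0 * s = 1" "b dvd s ^ k"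
    using coprime_split[OF assms(1)] .
  obtain d where "x \<in> Rd d" using assms(2) by (rule RRE)
  then obtain f where f: "x = to_fract f / to_fract s ^ d" by (rule RdE)
  have anz: "a \<noteq> 0" "b \<noteq> 0" using a(1) assms(1) by auto
  obtain u v where uv: "u * a + v * s ^ d = 1" using bezout_power[OF a(2)] by blast
  define r where "r = (f * v) mod a"
  define g where "g = f * u + ((f * v) div a) * s ^ d"
  have "f = f * (u * a + v * s ^ d)" by (simp add: uv)
  also have "\<dots> = a * (f * u) + (f * v) * s ^ d" by (simp add: algebra_simps)
  also have "\<dots> = a * (f * u) + (a * ((f * v) div a) + r) * s ^ d" by (simp add: r_def)
  also have "\<dots> = a * g + r * s ^ d" by (simp add: g_def algebra_simps)
  finally have fe: "f = a * g + r * s ^ d" .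
  have "degree r \<le> degree a" unfolding r_def using anz(1) degree_mod_less'[of a "f * v"]
    by (cases "f * v mod a = 0") auto
  also have "\<dots> \<le> degree c" using a(1) anz by (simp add: degree_mult_eq)
  finally have "to_fract r \<in> Rd (degree c)" by (rule Rd_tf_le)
  moreover define y where "y = inverse (to_fract b) * to_fract g * inverse (to_fract (s ^ d))"
  have "y \<in> RR" unfolding y_def using a(3) by (intro RR_mult RR_inverse_dvd[of _ d] RR_inverse_dvd[of _ k]) auto
  moreover have "x = to_fract c * y + to_fract r"
    unfolding f y_def a(1) using anz by (subst fe) (simp add: tf_power field_simps)
  ultimately show ?thesis by blast
qed

section \<open>Additive operators\<close>

text \<open>A polynomial \<open>P = \<Sum> a\<^sub>i \<tau>\<^sup>i\<close> over \<open>F[z]\<close> stands for the additive operator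
  \<open>x \<mapsto> \<Sum> a\<^sub>i x\<^bsup>p^i\<^esup>\<close>; composition of operators is \<open>oc\<close>, not the product of polynomials.\<close>

definition ev :: "'a poly poly \<Rightarrow> 'a poly fract \<Rightarrow> 'a poly fract" where
  "ev P x = (\<Sum>i\<le>degree P. to_fract (coeff P i) * x ^ (p ^ i))"

lemma ev_le: "degree P \<le> n \<Longrightarrow> ev P x = (\<Sum>i\<le>n. to_fract (coeff P i) * x ^ (p ^ i))"
  unfolding ev_def by (rule sum.mono_neutral_left) (auto simp: coeff_eq_0)

lemma ev_0 [simp]: "ev 0 x = 0"
  by (simp add: ev_def)

lemma ev_add: "ev (P + Q) x = ev P x + ev Q x"
proof -
  define n where "n = max (degree P) (degree Q)"
  have "degree (P + Q) \<le> n" "degree P \<le> n" "degree Q \<le> n"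
    by (auto simp: n_def intro: degree_add_le)
  then show ?thesis by (simp add: ev_le[of _ n] sum.distrib algebra_simps)
qed

lemma ev_uminus: "ev (- P) x = - ev P x"
  using ev_add[of P "- P" x] by (simp add: eq_neg_iff_add_eq_0 add.commute)

lemma ev_diff: "ev (P - Q) x = ev P x - ev Q x"
  using ev_add[of P "- Q" x] by (simp add: ev_uminus)

lemma ev_sum: "ev (sum f A) x = (\<Sum>i\<in>A. ev (f i) x)"
  by (induction A rule: infinite_finite_induct) (auto simp: ev_add)

lemma ev_monom: "ev (monom a i) x = to_fract a * x ^ (p ^ i)"
proof -
  have "ev (monom a i) x = (\<Sum>k\<le>i. to_fract (coeff (monom a i) k) * x ^ (p ^ k))"
    by (rule ev_le) (rule degree_monom_le)
  also have "\<dots> = (\<Sum>k\<le>i. if k = i then to_fract a * x ^ (p ^ i) else 0)"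
    by (rule sum.cong) auto
  finally show ?thesis by simp
qed

lemma ev_one [simp]: "ev 1 x = x"
  using ev_monom[of 1 0 x] by simp

lemma ev_x_add: "ev P (x + y) = ev P x + ev P y"
  by (simp add: ev_def frob_add sum.distrib algebra_simps)

lemma ev_x_0 [simp]: "ev P 0 = 0"
  by (simp add: ev_def zero_power)

lemma ev_x_uminus: "ev P (- x) = - ev P x"
  using ev_x_add[of P x "- x"] by (simp add: eq_neg_iff_add_eq_0 add.commute)

lemma ev_x_diff: "ev P (x - y) = ev P x - ev P y"
  using ev_x_add[of P x "- y"] by (simp add: ev_x_uminus)

lemma ev_x_sum: "ev P (sum f A) = (\<Sum>i\<in>A. ev P (f i))"
  by (induction A rule: infinite_finite_induct) (auto simp: ev_x_add)

lemma ev_RR: "x \<in> RR \<Longrightarrow> ev P x \<in> RR"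
  unfolding ev_def by (intro RR_sum RR_mult RR_power) auto

text \<open>Multiplication in the twisted polynomial ring with the rule \<tau> a = a^p \<tau>; hence
  the exponent p^i on the coefficients of Q.\<close>

definition oc :: "'a poly poly \<Rightarrow> 'a poly poly \<Rightarrow> 'a poly poly" where
  "oc P Q = (\<Sum>i\<le>degree P. \<Sum>j\<le>degree Q. monom (coeff P i * coeff Q j ^ (p ^ i)) (i + j))"

lemma ev_oc: "ev (oc P Q) x = ev P (ev Q x)"
proof -
  have "ev P (ev Q x) = (\<Sum>i\<le>degree P. \<Sum>j\<le>degree Q.
      to_fract (coeff P i) * (to_fract (coeff Q j) ^ (p ^ i) * x ^ (p ^ (i + j))))"
    by (simp add: ev_def[of P] ev_def[of Q] frob_sum sum_distrib_left power_mult_distrib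
        power_add power_mult[symmetric] mult.commute[of "p ^ _" "p ^ _"])
  then show ?thesis by (simp add: oc_def ev_sum ev_monom tf_power mult.assoc)
qed

text \<open>Composing with a single monomial shifts orders without mixing coefficients, so
  cancellation of leading coefficients can be read off column by column.\<close>

lemma coeff_oc_monom:
  "coeff (oc P (monom a d)) k = (if d \<le> k then coeff P (k - d) * a ^ (p ^ (k - d)) else 0)"
proof (cases "a = 0")
  case True
  then show ?thesis by (simp add: oc_def zero_power)
next
  case False
  have "oc P (monom a d) = (\<Sum>i\<le>degree P. \<Sum>j\<le>d. if j = d then monom (coeff P i * a ^ (p ^ i)) (i + d) else 0)"
    unfolding oc_def using False by (intro sum.cong) (auto simp: degree_monom_eq zero_power)
  also have "\<dots> = (\<Sum>i\<le>degree P. monom (coeff P i * a ^ (p ^ i)) (i + d))" by simp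
  finally have "coeff (oc P (monom a d)) k
      = (\<Sum>i\<le>degree P. if i + d = k then coeff P i * a ^ (p ^ i) else 0)"
    by (simp add: coeff_sum)
  also have "\<dots> = (if d \<le> k then coeff P (k - d) * a ^ (p ^ (k - d)) else 0)"
  proof (cases "d \<le> k")
    case True
    then have "i + d = k \<longleftrightarrow> i = k - d" for i by auto
    then show ?thesis using True by (auto simp: coeff_eq_0)
  next
    case False
    then have "i + d \<noteq> k" for i by auto
    with False show ?thesis by simp
  qed
  finally show ?thesis .
qed

text \<open>One number bounds both the order in \<tau> and the degrees in z. The restriction to
  prime-field coefficients leaves only finitely many operators of each size.\<close>

definition osz :: "nat \<Rightarrow> 'a poly poly \<Rightarrow> bool" where
  "osz t P \<longleftrightarrow> degree P \<le> t \<and> (\<forall>i. degree (coeff P i) \<le> t \<and> coeff P i \<in> PF)"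

lemma osz_mono: "osz t P \<Longrightarrow> t \<le> u \<Longrightarrow> osz u P"
  by (auto simp: osz_def intro: order_trans)

lemma osz_0 [simp]: "osz t 0" by (simp add: osz_def)

lemma osz_add: "osz t P \<Longrightarrow> osz t Q \<Longrightarrow> osz t (P + Q)"
  by (auto simp: osz_def intro: degree_add_le PF_add)

lemma osz_uminus: "osz t P \<Longrightarrow> osz t (- P)"
  by (auto simp: osz_def PF_uminus)

lemma osz_diff: "osz t P \<Longrightarrow> osz t Q \<Longrightarrow> osz t (P - Q)"
  using osz_add[of t P "- Q"] by (simp add: osz_uminus)

lemma osz_sum: "(\<And>i. i \<in> A \<Longrightarrow> osz t (f i)) \<Longrightarrow> osz t (sum f A)"
  by (induction A rule: infinite_finite_induct) (auto simp: osz_add)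

lemma osz_monom: "a \<in> PF \<Longrightarrow> degree a \<le> t \<Longrightarrow> i \<le> t \<Longrightarrow> osz t (monom a i)"
  by (auto simp: osz_def intro: order_trans[OF degree_monom_le])

lemma osz_one [simp]: "osz t 1"
  using osz_monom[of 1 t 0] by simp

text \<open>In a composition the order is at most 2 t and a coefficient has degree at most t + t
  p^t. The sum covers both, and also t + p^t t, the growth of values in
  \<open>ev_Rd\<close>.\<close>

definition hoc :: "nat \<Rightarrow> nat" where "hoc t = t + t + t * p ^ t"

lemma CB_hoc: "hoc \<in> CB"
  unfolding hoc_def[abs_def] by (intro CB_intros p_ge_2)

lemma osz_oc:
  assumes "osz t P" "osz t Q"
  shows "osz (hoc t) (oc P Q)"
  unfolding oc_def
proof (intro osz_sum osz_monom)
  fix i j assume i: "i \<in> {..degree P}" and j: "j \<in> {..degree Q}"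
  then have le: "i \<le> t" "j \<le> t" using assms by (auto simp: osz_def)
  show "coeff P i * coeff Q j ^ (p ^ i) \<in> PF"
    using assms by (auto simp: osz_def intro: PF_mult PF_power)
  have "degree (coeff P i * coeff Q j ^ (p ^ i)) \<le> degree (coeff P i) + degree (coeff Q j) * p ^ i"
    by (intro order_trans[OF degree_mult_le] add_mono degree_power_le order_refl)
  also have "\<dots> \<le> t + t * p ^ t"
    using assms le by (intro add_mono mult_le_mono power_increasing) (auto simp: osz_def Suc_le_eq)
  finally show "degree (coeff P i * coeff Q j ^ (p ^ i)) \<le> hoc t" by (simp add: hoc_def)
  show "i + j \<le> hoc t" using le by (simp add: hoc_def)
qed

lemma p_power_le: "i \<le> j \<Longrightarrow> p ^ i \<le> p ^ j"
  by (rule power_increasing) (auto simp: Suc_le_eq)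

lemma one_le_p_power [simp]: "Suc 0 \<le> p ^ n"
  by (simp add: Suc_le_eq)

lemma ev_Rd: "osz t P \<Longrightarrow> x \<in> Rd d \<Longrightarrow> ev P x \<in> Rd (t + p ^ t * d)"
  unfolding ev_def
proof (intro Rd_sum)
  fix i assume *: "osz t P" "x \<in> Rd d" "i \<in> {..degree P}"
  then have "to_fract (coeff P i) * x ^ (p ^ i) \<in> Rd (t + p ^ i * d)"
    by (intro Rd_tf_mult Rd_power) (auto simp: osz_def)
  moreover have "p ^ i \<le> p ^ t" using * by (intro p_power_le) (auto simp: osz_def)
  ultimately show "to_fract (coeff P i) * x ^ (p ^ i) \<in> Rd (t + p ^ t * d)"
    by (elim Rd_monoD) simp
qed

lemma ev_Rd_hoc: "osz t P \<Longrightarrow> x \<in> Rd t \<Longrightarrow> ev P x \<in> Rd (hoc t)"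
  by (erule Rd_monoD[OF ev_Rd]) (auto simp: hoc_def mult.commute)

section \<open>Linear algebra over \<open>\<bbbF>\<^sub>p[z]\<close>\<close>

text \<open>Fraction-free elimination keeps all entries polynomial.\<close>

lemma kernel_or_injective:
  fixes A :: "'i \<Rightarrow> 'j \<Rightarrow> 'a poly"
  assumes "finite J" "\<And>i j. i \<in> I \<Longrightarrow> j \<in> J \<Longrightarrow> A i j \<in> PF \<and> degree (A i j) \<le> t"
  shows "(\<exists>c. (\<exists>j\<in>J. c j \<noteq> 0) \<and> (\<forall>j\<in>J. c j \<in> PF \<and> degree (c j) \<le> t * 4 ^ Suc (card J)) \<and>
        (\<forall>i\<in>I. (\<Sum>j\<in>J. A i j * c j) = 0))
    \<or> (\<forall>x e. (\<forall>j\<in>J. x j \<in> RR) \<longrightarrow> (\<forall>i\<in>I. (\<Sum>j\<in>J. to_fract (A i j) * x j) \<in> Rd e) \<longrightarrow>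
        (\<forall>j\<in>J. x j \<in> Rd (e + t * 4 ^ Suc (card J))))"
  using assms
proof (induction J arbitrary: A t rule: finite_induct)
  case (insert m J)
  \<comment> \<open>Elimination doubles the degree of the entries. The factor 4 per column pays for
    this doubling and for the extra 3 t lost when the pivot variable is recovered.\<close>
  let ?\<kappa>' = "2 * t * 4 ^ Suc (card J)" and ?\<kappa> = "t * 4 ^ Suc (card (insert m J))"
  have card: "card (insert m J) = Suc (card J)" using insert.hyps by simp
  have \<kappa>1: "t + ?\<kappa>' \<le> ?\<kappa>" and \<kappa>2: "3 * t + ?\<kappa>' \<le> ?\<kappa>"
  proof -
    have "(1::nat) \<le> 4 ^ card J" by simp
    then have "(3::nat) \<le> 8 * 4 ^ card J" by linarith
    then show "t + ?\<kappa>' \<le> ?\<kappa>" "3 * t + ?\<kappa>' \<le> ?\<kappa>" unfolding card by simp_all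
  qed
  show ?case
  proof (cases "\<forall>i\<in>I. A i m = 0")
    case True
    let ?c = "\<lambda>j. if j = m then 1 else 0 :: 'a poly"
    have "(\<Sum>j\<in>insert m J. A i j * ?c j) = 0" if "i \<in> I" for i
      using True that by (intro sum.neutral) auto
    then show ?thesis by (intro disjI1 exI[of _ ?c]) auto
  next
    case False
    then obtain i0 where i0: "i0 \<in> I" "A i0 m \<noteq> 0" by blast
    define a where "a = A i0 m"
    define A' where "A' i j = a * A i j - A i m * A i0 j" for i j
    have A: "A i j \<in> PF" "degree (A i j) \<le> t" if "i \<in> I" "j \<in> insert m J" for i j
      using insert.prems that by auto
    have a: "a \<in> PF" "degree a \<le> t" "a \<noteq> 0" using A i0 by (auto simp: a_def)
    have "A' i j \<in> PF \<and> degree (A' i j) \<le> 2 * t" if "i \<in> I" "j \<in> J" for i j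
    proof
      show "A' i j \<in> PF" unfolding A'_def using that a A i0 by (intro PF_diff PF_mult) auto
      have "degree (a * A i j) \<le> t + t" "degree (A i m * A i0 j) \<le> t + t"
        using that a A i0 by (auto intro!: order_trans[OF degree_mult_le] add_mono)
      then show "degree (A' i j) \<le> 2 * t" unfolding A'_def by (simp add: degree_diff_le)
    qed
    from insert.IH[of A' "2 * t", OF this] consider
      (ker) c where "\<exists>j\<in>J. c j \<noteq> 0" "\<forall>j\<in>J. c j \<in> PF \<and> degree (c j) \<le> ?\<kappa>'"
        "\<forall>i\<in>I. (\<Sum>j\<in>J. A' i j * c j) = 0"
      | (inj) "\<And>x e. \<forall>j\<in>J. x j \<in> RR \<Longrightarrow> \<forall>i\<in>I. (\<Sum>j\<in>J. to_fract (A' i j) * x j) \<in> Rd e \<Longrightarrow>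
        \<forall>j\<in>J. x j \<in> Rd (e + ?\<kappa>')"
      by blast
    then show ?thesis
    proof cases
      case ker
      \<comment> \<open>Back substitution: scaling the old kernel vector by the pivot a makes the
        pivot coordinate a polynomial instead of a fraction.\<close>
      define c' where "c' j = (if j = m then - (\<Sum>k\<in>J. A i0 k * c k) else a * c j)" for j
      have sumJ: "(\<Sum>j\<in>J. f j * c' j) = (\<Sum>j\<in>J. f j * (a * c j))" for f
        using insert.hyps by (intro sum.cong) (auto simp: c'_def)
      have "(\<Sum>j\<in>insert m J. A i j * c' j) = 0" if "i \<in> I" for i
      proof -
        have "(\<Sum>j\<in>insert m J. A i j * c' j) = - A i m * (\<Sum>k\<in>J. A i0 k * c k) + (\<Sum>j\<in>J. A i j * (a * c j))"
          using insert.hyps by (simp add: sumJ) (simp add: c'_def)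
        also have "\<dots> = (\<Sum>j\<in>J. A' i j * c j)"
          by (simp add: A'_def sum_distrib_left sum_negf[symmetric] sum.distrib[symmetric] algebra_simps)
        finally show ?thesis using ker(3) that by simp
      qed
      moreover have "\<exists>j\<in>insert m J. c' j \<noteq> 0"
        using ker(1) insert.hyps a(3) by (auto simp: c'_def)
      moreover have "c' j \<in> PF \<and> degree (c' j) \<le> ?\<kappa>" if j: "j \<in> insert m J" for j
      proof (cases "j = m")
        case True
        have "degree (A i0 k * c k) \<le> t + ?\<kappa>'" if "k \<in> J" for k
          using A i0 ker(2) that by (intro order_trans[OF degree_mult_le] add_mono) auto
        then have "degree (\<Sum>k\<in>J. A i0 k * c k) \<le> t + ?\<kappa>'"
          using insert.hyps by (intro degree_sum_le) auto
        moreover have "(\<Sum>k\<in>J. A i0 k * c k) \<in> PF" using A i0 ker(2) by (intro PF_sum PF_mult) auto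
        ultimately show ?thesis using True \<kappa>1 by (auto simp: c'_def PF_uminus)
      next
        case False
        then have "degree (a * c j) \<le> t + ?\<kappa>'" "a * c j \<in> PF"
          using a ker(2) j by (auto intro!: order_trans[OF degree_mult_le] add_mono PF_mult)
        then show ?thesis using False \<kappa>1 by (auto simp: c'_def)
      qed
      ultimately show ?thesis by (intro disjI1 exI[of _ c']) auto
    next
      case inj
      have "\<forall>j\<in>insert m J. x j \<in> Rd (e + ?\<kappa>)"
        if x: "\<forall>j\<in>insert m J. x j \<in> RR"
          "\<forall>i\<in>I. (\<Sum>j\<in>insert m J. to_fract (A i j) * x j) \<in> Rd e" for x e
      proof -
        let ?S = "\<lambda>i. \<Sum>j\<in>insert m J. to_fract (A i j) * x j"
        have S: "?S i = to_fract (A i m) * x m + (\<Sum>j\<in>J. to_fract (A i j) * x j)" for i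
          using insert.hyps by simp
        have "(\<Sum>j\<in>J. to_fract (A' i j) * x j) \<in> Rd (t + e)" if "i \<in> I" for i
        proof -
          have "to_fract a * ?S i - to_fract (A i m) * ?S i0
              = (\<Sum>j\<in>J. to_fract a * (to_fract (A i j) * x j)) - (\<Sum>j\<in>J. to_fract (A i m) * (to_fract (A i0 j) * x j))"
            unfolding S by (simp add: a_def[symmetric] sum_distrib_left algebra_simps)
          also have "\<dots> = (\<Sum>j\<in>J. to_fract (A' i j) * x j)"
            by (simp add: A'_def sum_subtractf[symmetric] algebra_simps)
          finally show ?thesis
            using that x(2) i0 a A by (metis (no_types, lifting) Rd_diff Rd_tf_mult insertI1)
        qed
        then have xJ: "\<forall>j\<in>J. x j \<in> Rd (t + e + ?\<kappa>')" using inj[of x "t + e"] x(1) by auto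
        have "to_fract a * x m = ?S i0 - (\<Sum>j\<in>J. to_fract (A i0 j) * x j)"
          unfolding S by (simp add: a_def)
        also have "\<dots> \<in> Rd (t + (t + e + ?\<kappa>'))"
        proof (rule Rd_diff)
          show "?S i0 \<in> Rd (t + (t + e + ?\<kappa>'))" by (rule Rd_monoD[of _ e]) (use x(2) i0 in auto)
          show "(\<Sum>j\<in>J. to_fract (A i0 j) * x j) \<in> Rd (t + (t + e + ?\<kappa>'))"
            by (intro Rd_sum Rd_tf_mult) (use xJ A i0 in auto)
        qed
        finally have "x m \<in> Rd (t + (t + e + ?\<kappa>') + degree a)"
          using Rd_cancel[OF a(3)] x(1) by auto
        then have "x m \<in> Rd (e + ?\<kappa>)" by (rule Rd_monoD) (use a(2) \<kappa>2 in simp)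
        moreover have "\<forall>j\<in>J. x j \<in> Rd (e + ?\<kappa>)"
        proof
          fix j assume "j \<in> J"
          then show "x j \<in> Rd (e + ?\<kappa>)"
            by (intro Rd_monoD[OF bspec[OF xJ]]) (use \<kappa>1 in \<open>simp_all add: ac_simps\<close>)
        qed
        ultimately show ?thesis by simp
      qed
      then show ?thesis by blast
    qed
  qed
qed simp

section \<open>Top forms\<close>

text \<open>Quantitative independence of leading forms: they cancel by at most \<kappa>. Bounding
  x_j^(p^\<nu> j) rather than x_j puts columns of different orders on one scale.\<close>

definition TI :: "nat \<Rightarrow> (nat \<Rightarrow> nat \<Rightarrow> 'a poly poly) \<Rightarrow> nat set \<Rightarrow> (nat \<Rightarrow> nat) \<Rightarrow> nat \<Rightarrow> bool" where
  "TI r M J \<nu> \<kappa> \<longleftrightarrow> (\<forall>x e. (\<forall>j\<in>J. x j \<in> RR) \<longrightarrow>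
     (\<forall>i<r. (\<Sum>j\<in>J. to_fract (coeff (M i j) (\<nu> j)) * x j ^ (p ^ \<nu> j)) \<in> Rd e) \<longrightarrow>
     (\<forall>j\<in>J. x j ^ (p ^ \<nu> j) \<in> Rd (e + \<kappa>)))"

lemma TI_mono: "TI r M J \<nu> \<kappa> \<Longrightarrow> \<kappa> \<le> \<kappa>' \<Longrightarrow> TI r M J \<nu> \<kappa>'"
  unfolding TI_def by (meson Rd_monoD add_le_mono order_refl)

text \<open>Over the prime field a coefficient is its own p^n-th root, so the components have
  prime-field coefficients again.\<close>

definition cp :: "nat \<Rightarrow> 'a poly \<Rightarrow> nat \<Rightarrow> 'a poly" where
  "cp n a k = comp_poly (p ^ n) (degree a) (coeff a) k"

lemma cp_sum: "a \<in> PF \<Longrightarrow> a = (\<Sum>k<p ^ n. monom 1 k * cp n a k ^ (p ^ n))"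
  unfolding cp_def by (rule comp_poly_sum) (auto simp: PF_coeff Ints_frob)

lemma cp_PF: "a \<in> PF \<Longrightarrow> cp n a k \<in> PF"
  unfolding cp_def comp_poly_def by (intro PF_sum PF_monom PF_coeff)

lemma degree_cp: "degree (cp n a k) \<le> degree a"
proof -
  have "1 * degree (cp n a k) \<le> p ^ n * degree (cp n a k)" by (rule mult_le_mono1) simp
  also have "\<dots> \<le> degree a" unfolding cp_def by (rule degree_comp_poly)
  finally show ?thesis by simp
qed

text \<open>Bringing all columns to the common level \<open>n\<close>: after splitting the unknowns into components,
  the top form becomes \<open>p\<^sup>n\<close>-linear, hence a matrix over \<open>\<bbbF>\<^sub>p[z]\<close>.\<close>

lemma level_identity:
  fixes y :: "nat \<times> nat \<Rightarrow> 'a poly fract"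
  assumes "finite J" "\<And>j. j \<in> J \<Longrightarrow> \<nu> j \<le> n" "\<And>j. j \<in> J \<Longrightarrow> b j \<in> PF"
  shows "(\<Sum>j\<in>J. to_fract (b j) * (\<Sum>l<p ^ (n - \<nu> j). to_fract (monom 1 l) * y (j, l) ^ (p ^ (n - \<nu> j))) ^ (p ^ \<nu> j))
    = (\<Sum>k<p ^ n. to_fract (monom 1 k) *
        (\<Sum>(j, l)\<in>Sigma J (\<lambda>j. {..<p ^ (n - \<nu> j)}).
          to_fract (cp n (b j * monom 1 (l * p ^ \<nu> j)) k) * y (j, l)) ^ (p ^ n))"
proof -
  let ?C = "Sigma J (\<lambda>j. {..<p ^ (n - \<nu> j)})"
  let ?b = "\<lambda>j l. b j * monom 1 (l * p ^ \<nu> j)"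
  have "to_fract (b j) * (\<Sum>l<p ^ (n - \<nu> j). to_fract (monom 1 l) * y (j, l) ^ (p ^ (n - \<nu> j))) ^ (p ^ \<nu> j)
      = (\<Sum>l<p ^ (n - \<nu> j). to_fract (?b j l) * y (j, l) ^ (p ^ n))" if "j \<in> J" for j
  proof -
    have "p ^ (n - \<nu> j) * p ^ \<nu> j = p ^ n" using assms(2)[OF that] by (simp flip: power_add)
    then have "(y (j, l) ^ (p ^ (n - \<nu> j))) ^ (p ^ \<nu> j) = y (j, l) ^ (p ^ n)" for l
      by (metis power_mult)
    then show ?thesis
      by (simp add: frob_sum power_mult_distrib sum_distrib_left monom_power mult.assoc flip: tf_power)
  qed
  then have "(\<Sum>j\<in>J. to_fract (b j) * (\<Sum>l<p ^ (n - \<nu> j). to_fract (monom 1 l) * y (j, l) ^ (p ^ (n - \<nu> j))) ^ (p ^ \<nu> j))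
      = (\<Sum>j\<in>J. \<Sum>l<p ^ (n - \<nu> j). to_fract (?b j l) * y (j, l) ^ (p ^ n))" by simp
  also have "\<dots> = (\<Sum>(j, l)\<in>?C. to_fract (?b j l) * y (j, l) ^ (p ^ n))"
    using assms(1) by (subst sum.Sigma) auto
  also have "\<dots> = (\<Sum>(j, l)\<in>?C. \<Sum>k<p ^ n. to_fract (monom 1 k) * (to_fract (cp n (?b j l) k) * y (j, l)) ^ (p ^ n))"
  proof (intro sum.cong refl, clarify)
    fix j l assume "j \<in> J"
    then have "?b j l \<in> PF" using assms(3) by (intro PF_mult PF_monom) auto
    from arg_cong[OF cp_sum[OF this, of n], of to_fract]
    have "to_fract (?b j l) = (\<Sum>k<p ^ n. to_fract (monom 1 k) * to_fract (cp n (?b j l) k) ^ (p ^ n))"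
      by (simp add: tf_power)
    then show "to_fract (?b j l) * y (j, l) ^ (p ^ n)
        = (\<Sum>k<p ^ n. to_fract (monom 1 k) * (to_fract (cp n (?b j l) k) * y (j, l)) ^ (p ^ n))"
      by (simp add: sum_distrib_right power_mult_distrib mult.assoc)
  qed
  also have "\<dots> = (\<Sum>k<p ^ n. \<Sum>(j, l)\<in>?C. to_fract (monom 1 k) * (to_fract (cp n (?b j l) k) * y (j, l)) ^ (p ^ n))"
    by (simp add: case_prod_unfold sum.swap[of _ "{..<p ^ n}"])
  also have "\<dots> = (\<Sum>k<p ^ n. to_fract (monom 1 k) * (\<Sum>(j, l)\<in>?C. to_fract (cp n (?b j l) k) * y (j, l)) ^ (p ^ n))"
    by (simp add: frob_sum sum_distrib_left case_prod_unfold)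
  finally show ?thesis .
qed

text \<open>The bound of \<open>kernel_or_injective\<close> for entries of degree at most t + p^t
  and at most (t + 1) p^t columns, multiplied by p^t for the return from components to p-powers; the
  summand 2 covers a rounding and the factors z^l. It is independent of the constant of the old
  columns, so nothing accumulates when columns are added one by one.\<close>

definition hinc :: "nat \<Rightarrow> nat" where
  "hinc t = p ^ t * ((t + p ^ t) * 4 ^ Suc (Suc t * p ^ t) + 2)"

lemma CB_hinc: "hinc \<in> CB"
proof -
  have "(\<lambda>t. p ^ t * ((t + p ^ t) * 4 ^ (Suc (Suc t * p ^ t)) + 2)) \<in> CB"
    by (intro CB_mult CB_add_const CB_power CB_Suc CB_add CB_id p_ge_2) simp
  then show ?thesis unfolding hinc_def[abs_def] .
qed

text \<open>The distinguished column j0 has the largest order, since the others can be raised to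
  that order but not lowered; its entry is nonzero because it will be divided by.\<close>

definition syz :: "nat \<Rightarrow> (nat \<Rightarrow> nat \<Rightarrow> 'a poly poly) \<Rightarrow> nat set \<Rightarrow> (nat \<Rightarrow> nat) \<Rightarrow> nat \<Rightarrow> nat \<Rightarrow> (nat \<Rightarrow> 'a poly) \<Rightarrow> bool" where
  "syz r M J \<nu> t j0 v \<longleftrightarrow> j0 \<in> J \<and> (\<forall>j\<in>J. \<nu> j \<le> \<nu> j0) \<and> v j0 \<noteq> 0 \<and>
     (\<forall>j\<in>J. v j \<in> PF \<and> degree (v j) \<le> t) \<and>
     (\<forall>i<r. (\<Sum>j\<in>J. coeff (M i j) (\<nu> j) * v j ^ (p ^ \<nu> j)) = 0)"

text \<open>If the kernel vector at the common level does not involve the new column, it yields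
  arbitrarily large elements with vanishing top form in the old columns.\<close>

lemma TI_insert:
  assumes J: "finite J" "j0 \<notin> J" "\<And>j. j \<in> J \<Longrightarrow> \<nu> j \<le> \<nu> j0" "\<nu> j0 \<le> t" "card J \<le> t"
    and M: "\<And>i j. i < r \<Longrightarrow> j \<in> insert j0 J \<Longrightarrow> osz t (M i j)"
    and TI: "TI r M J \<nu> \<kappa>"
  shows "TI r M (insert j0 J) \<nu> (hinc t) \<or> (\<exists>v. syz r M (insert j0 J) \<nu> (hinc t) j0 v)"
proof -
  let ?J = "insert j0 J"
  define n where "n = \<nu> j0"
  define q where "q = p ^ n"
  \<comment> \<open>Column j contributes one unknown per component at level n; the column j0,
    already of order n, contributes exactly one.\<close>
  define C where "C = Sigma ?J (\<lambda>j. {..<p ^ (n - \<nu> j)})"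
  define b where "b i j = coeff (M i j) (\<nu> j)" for i j
  define A where "A ik jl = cp n (b (fst ik) (fst jl) * monom 1 (snd jl * p ^ \<nu> (fst jl))) (snd ik)"
    for ik jl :: "nat \<times> nat"
  let ?I = "{..<r} \<times> {..<q}" and ?S = "t + p ^ t"
  define \<kappa>1 where "\<kappa>1 = ?S * 4 ^ Suc (card C)"
  have \<nu>: "\<nu> j \<le> n" if "j \<in> ?J" for j using that J(3) by (auto simp: n_def)
  have pn: "p ^ (n - \<nu> j) * p ^ \<nu> j = q" if "j \<in> ?J" for j
    using \<nu>[OF that] by (simp add: q_def flip: power_add)
  have q: "q \<le> p ^ t" "1 \<le> q" using J(4) by (auto simp: q_def n_def p_power_le)
  have finC: "finite C" using J(1) by (auto simp: C_def)
  have b: "b i j \<in> PF" "degree (b i j) \<le> t" if "i < r" "j \<in> ?J" for i j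
    using M[OF that] by (auto simp: b_def osz_def)
  have l_le: "l * p ^ \<nu> j \<le> q" if "(j, l) \<in> C" for j l
  proof -
    have "l * p ^ \<nu> j \<le> p ^ (n - \<nu> j) * p ^ \<nu> j" using that by (intro mult_le_mono1) (auto simp: C_def)
    also have "\<dots> = q" by (rule pn) (use that in \<open>auto simp: C_def\<close>)
    finally show ?thesis .
  qed
  have A: "A ik jl \<in> PF \<and> degree (A ik jl) \<le> ?S" if ik: "ik \<in> ?I" and jl: "jl \<in> C" for ik jl
  proof
    have j: "fst jl \<in> ?J" and i: "fst ik < r" using ik jl by (auto simp: C_def)
    show "A ik jl \<in> PF" unfolding A_def by (intro cp_PF PF_mult PF_monom b i j) auto
    have "degree (A ik jl) \<le> degree (b (fst ik) (fst jl) * monom 1 (snd jl * p ^ \<nu> (fst jl)))"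
      unfolding A_def by (rule degree_cp)
    also have "\<dots> \<le> degree (b (fst ik) (fst jl)) + snd jl * p ^ \<nu> (fst jl)"
      by (rule order_trans[OF degree_mult_le]) (simp add: degree_monom_eq)
    also have "\<dots> \<le> ?S" using b(2)[OF i j] l_le[of "fst jl" "snd jl"] jl q by simp
    finally show "degree (A ik jl) \<le> ?S" .
  qed
  have cardC: "card C \<le> Suc t * p ^ t"
  proof -
    have "card C = (\<Sum>j\<in>?J. p ^ (n - \<nu> j))" unfolding C_def using J(1) by simp
    also have "\<dots> \<le> (\<Sum>j\<in>?J. p ^ t)" using J(4) by (intro sum_mono p_power_le) (simp add: n_def)
    also have "\<dots> = card ?J * p ^ t" by simp
    also have "\<dots> \<le> Suc t * p ^ t" using J(1,2,5) by (intro mult_le_mono1) simp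
    finally show ?thesis .
  qed
  have hinc: "p ^ t * (\<kappa>1 + 2) \<le> hinc t"
    unfolding \<kappa>1_def hinc_def using cardC
    by (intro mult_le_mono2 add_right_mono power_increasing) auto
  have ident: "(\<Sum>j\<in>?J. to_fract (b i j) * (\<Sum>l<p ^ (n - \<nu> j). to_fract (monom 1 l) * y (j, l) ^ (p ^ (n - \<nu> j))) ^ (p ^ \<nu> j))
    = (\<Sum>k<p ^ n. to_fract (monom 1 k) * (\<Sum>jl\<in>C. to_fract (A (i, k) jl) * y jl) ^ (p ^ n))"
    if "i < r" for i and y :: "nat \<times> nat \<Rightarrow> 'a poly fract"
    using level_identity[of ?J \<nu> n "b i" y] J(1) \<nu> b that by (simp add: C_def A_def case_prod_unfold)
  from kernel_or_injective[of C ?I A ?S, OF finC A] consider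
      (ker) c where "\<exists>jl\<in>C. c jl \<noteq> 0" "\<forall>jl\<in>C. c jl \<in> PF \<and> degree (c jl) \<le> \<kappa>1"
        "\<forall>ik\<in>?I. (\<Sum>jl\<in>C. A ik jl * c jl) = 0"
    | (inj) "\<And>x e. \<forall>jl\<in>C. x jl \<in> RR \<Longrightarrow> \<forall>ik\<in>?I. (\<Sum>jl\<in>C. to_fract (A ik jl) * x jl) \<in> Rd e \<Longrightarrow>
        \<forall>jl\<in>C. x jl \<in> Rd (e + \<kappa>1)"
    unfolding \<kappa>1_def by blast
  then show ?thesis
  proof cases
    case inj
    have "x j ^ (p ^ \<nu> j) \<in> Rd (e + hinc t)"
      if x: "\<forall>j\<in>?J. x j \<in> RR" and top: "\<forall>i<r. (\<Sum>j\<in>?J. to_fract (b i j) * x j ^ (p ^ \<nu> j)) \<in> Rd e"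
        and j: "j \<in> ?J" for x e j
    proof -
      \<comment> \<open>Components are bounded only when the bound on their sum is a multiple of q,
        so e is rounded up.\<close>
      define e1 where "e1 = e div q + 1"
      have e: "e \<le> q * e1" "q * e1 \<le> e + q"
      proof -
        have "e = q * (e div q) + e mod q" "e mod q < q" using q(2) by simp_all
        then have "e \<le> q * (e div q) + q" "q * (e div q) + q \<le> e + q" by linarith+
        then show "e \<le> q * e1" "q * e1 \<le> e + q" by (simp_all only: e1_def distrib_left mult_1_right)
      qed
      have "\<exists>y. \<forall>j\<in>?J. (\<forall>l<p ^ (n - \<nu> j). y (j, l) \<in> RR) \<and>
          x j = (\<Sum>l<p ^ (n - \<nu> j). to_fract (monom 1 l) * y (j, l) ^ (p ^ (n - \<nu> j)))"
      proof -
        have "\<forall>j\<in>?J. \<exists>y. (\<forall>l<p ^ (n - \<nu> j). y l \<in> RR) \<and>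
            x j = (\<Sum>l<p ^ (n - \<nu> j). to_fract (monom 1 l) * y l ^ (p ^ (n - \<nu> j)))"
          using RR_components x by blast
        from bchoice[OF this] obtain Y where "\<forall>j\<in>?J. (\<forall>l<p ^ (n - \<nu> j). Y j l \<in> RR) \<and>
            x j = (\<Sum>l<p ^ (n - \<nu> j). to_fract (monom 1 l) * Y j l ^ (p ^ (n - \<nu> j)))" ..
        then show ?thesis by (intro exI[of _ "\<lambda>jl. Y (fst jl) (snd jl)"]) (simp only: fst_conv snd_conv)
      qed
      then obtain y where y: "\<And>j l. j \<in> ?J \<Longrightarrow> l < p ^ (n - \<nu> j) \<Longrightarrow> y (j, l) \<in> RR"
        "\<And>j. j \<in> ?J \<Longrightarrow> x j = (\<Sum>l<p ^ (n - \<nu> j). to_fract (monom 1 l) * y (j, l) ^ (p ^ (n - \<nu> j)))"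
        by blast
      have yC: "\<forall>jl\<in>C. y jl \<in> RR" using y(1) by (auto simp: C_def)
      have "(\<Sum>jl\<in>C. to_fract (A (i, k) jl) * y jl) \<in> Rd e1" if i: "i < r" and k: "k < q" for i k
      proof (rule components_Rd[of n "\<lambda>k. \<Sum>jl\<in>C. to_fract (A (i, k) jl) * y jl"])
        show "(\<Sum>jl\<in>C. to_fract (A (i, k) jl) * y jl) \<in> RR" for k
          using yC by (intro RR_sum RR_mult) auto
        have "(\<Sum>k<p ^ n. to_fract (monom 1 k) * (\<Sum>jl\<in>C. to_fract (A (i, k) jl) * y jl) ^ (p ^ n))
            = (\<Sum>j\<in>?J. to_fract (b i j) * x j ^ (p ^ \<nu> j))"
          unfolding ident[OF i, symmetric] using y(2) by (intro sum.cong) auto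
        also have "\<dots> \<in> Rd (p ^ n * e1)"
          using top i e(1) by (auto simp flip: q_def elim!: Rd_monoD)
        finally show "(\<Sum>k<p ^ n. to_fract (monom 1 k) * (\<Sum>jl\<in>C. to_fract (A (i, k) jl) * y jl) ^ (p ^ n))
            \<in> Rd (p ^ n * e1)" .
      qed (use k q_def in auto)
      then have yb: "\<forall>jl\<in>C. y jl \<in> Rd (e1 + \<kappa>1)" using inj[of y e1] yC by auto
      have "x j ^ (p ^ \<nu> j) = (\<Sum>l<p ^ (n - \<nu> j). to_fract (monom 1 (l * p ^ \<nu> j)) * y (j, l) ^ q)"
        unfolding y(2)[OF j] using pn[OF j]
        by (simp add: frob_sum power_mult_distrib monom_power mult.commute flip: tf_power power_mult)
      also have "\<dots> \<in> Rd (q + q * (e1 + \<kappa>1))"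
      proof (intro Rd_sum Rd_tf_mult Rd_power)
        fix l assume "l \<in> {..<p ^ (n - \<nu> j)}"
        then have C: "(j, l) \<in> C" using j by (auto simp: C_def)
        show "y (j, l) \<in> Rd (e1 + \<kappa>1)" using yb C by blast
        show "degree (monom (1::'a) (l * p ^ \<nu> j)) \<le> q" using l_le[OF C] by (simp add: degree_monom_eq)
      qed
      finally show ?thesis
      proof (rule Rd_monoD)
        have "q + q * (e1 + \<kappa>1) = q * e1 + q * \<kappa>1 + q" by (simp add: algebra_simps)
        also have "\<dots> \<le> e + q * (\<kappa>1 + 2)" using e(2) by (simp add: algebra_simps)
        also have "\<dots> \<le> e + p ^ t * (\<kappa>1 + 2)" using q(1) by (intro add_left_mono mult_le_mono1)
        also have "\<dots> \<le> e + hinc t" using hinc by simp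
        finally show "q + q * (e1 + \<kappa>1) \<le> e + hinc t" .
      qed
    qed
    then have "TI r M ?J \<nu> (hinc t)" unfolding TI_def b_def by blast
    then show ?thesis ..
  next
    case ker
    define v where "v j = (\<Sum>l<p ^ (n - \<nu> j). monom 1 l * c (j, l) ^ (p ^ (n - \<nu> j)))" for j
    have v0: "v j0 = c (j0, 0)" by (simp add: v_def n_def)
    have rel: "(\<Sum>j\<in>?J. b i j * v j ^ (p ^ \<nu> j)) = 0" if "i < r" for i
    proof -
      have "(\<Sum>jl\<in>C. to_fract (A (i, k) jl) * to_fract (c jl)) = 0" if "k < p ^ n" for k
      proof -
        have "(\<Sum>jl\<in>C. A (i, k) jl * c jl) = 0" using ker(3) \<open>i < r\<close> that by (auto simp: q_def)
        from arg_cong[OF this, of to_fract] show ?thesis by simp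
      qed
      then have "(\<Sum>k<p ^ n. to_fract (monom 1 k) * (\<Sum>jl\<in>C. to_fract (A (i, k) jl) * to_fract (c jl)) ^ (p ^ n)) = 0"
        by (intro sum.neutral) (simp add: zero_power)
      with ident[OF that, of "\<lambda>jl. to_fract (c jl)"]
      have "to_fract (\<Sum>j\<in>?J. b i j * v j ^ (p ^ \<nu> j)) = 0"
        by (simp add: v_def tf_power)
      then show ?thesis by (simp only: to_fract_eq_0_iff)
    qed
    have vPF: "v j \<in> PF \<and> degree (v j) \<le> hinc t" if "j \<in> ?J" for j
    proof
      have cj: "c (j, l) \<in> PF \<and> degree (c (j, l)) \<le> \<kappa>1" if "l < p ^ (n - \<nu> j)" for l
        using ker(2) \<open>j \<in> ?J\<close> that by (auto simp: C_def)
      then show "v j \<in> PF" unfolding v_def by (intro PF_sum PF_mult PF_power PF_monom) auto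
      have le: "p ^ (n - \<nu> j) \<le> p ^ t" using J(4) by (intro p_power_le) (simp add: n_def)
      show "degree (v j) \<le> hinc t"
        unfolding v_def
      proof (intro degree_sum_le)
        fix l assume l: "l \<in> {..<p ^ (n - \<nu> j)}"
        have "degree (monom 1 l * c (j, l) ^ (p ^ (n - \<nu> j))) \<le> l + degree (c (j, l)) * p ^ (n - \<nu> j)"
          by (rule order_trans[OF degree_mult_le]) (intro add_mono degree_power_le, simp add: degree_monom_eq)
        also have "\<dots> \<le> p ^ t + \<kappa>1 * p ^ t"
          using cj l le by (intro add_mono mult_le_mono) auto
        also have "\<dots> \<le> p ^ t * (\<kappa>1 + 2)" by (simp add: algebra_simps)
        also note hinc
        finally show "degree (monom 1 l * c (j, l) ^ (p ^ (n - \<nu> j))) \<le> hinc t" .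
      qed auto
    qed
    show ?thesis
    proof (cases "v j0 = 0")
      case False
      then have "syz r M ?J \<nu> (hinc t) j0 v"
        using vPF rel J(3) by (auto simp: syz_def b_def)
      then show ?thesis by blast
    next
      case True
      obtain j l where jl: "(j, l) \<in> C" "c (j, l) \<noteq> 0" using ker(1) by auto
      have j: "j \<in> J"
      proof (rule ccontr)
        assume "j \<notin> J"
        then have "j = j0" "l = 0" using jl(1) by (auto simp: C_def n_def)
        then show False using jl(2) True v0 by simp
      qed
      have "v j \<noteq> 0"
      proof
        assume "v j = 0"
        then have "(\<Sum>l<p ^ (n - \<nu> j). monom 1 l * c (j, l) ^ (p ^ (n - \<nu> j)))
            = (\<Sum>l<p ^ (n - \<nu> j). monom 1 l * (\<lambda>_. 0) l ^ (p ^ (n - \<nu> j)))"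
          by (simp add: v_def zero_power)
        from comp_sum_inj[OF this, of l] show False using jl by (auto simp: C_def)
      qed
      \<comment> \<open>Multiplying v_j by z^(N p^(n - \<nu> j)) multiplies every top term by the
        same z^(N q). The relation among the old columns survives while the values outgrow
        \<kappa>.\<close>
      define N where "N = \<kappa> + degree (v j ^ (p ^ \<nu> j)) + 1"
      define x where "x j = to_fract (v j * monom 1 (N * p ^ (n - \<nu> j)))" for j
      have xp: "x j ^ (p ^ \<nu> j) = to_fract (v j ^ (p ^ \<nu> j)) * to_fract (monom 1 (N * q))" if "j \<in> ?J" for j
        using pn[OF that] by (simp add: x_def power_mult_distrib monom_power mult.assoc flip: tf_power)
      have "(\<Sum>j\<in>J. to_fract (b i j) * x j ^ (p ^ \<nu> j)) = 0" if "i < r" for i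
      proof -
        have "(\<Sum>j\<in>J. b i j * v j ^ (p ^ \<nu> j)) = 0"
          using rel[OF that] J(1,2) True by (simp add: zero_power)
        from arg_cong[OF this, of "\<lambda>w. to_fract w * to_fract (monom 1 (N * q))"]
        show ?thesis using xp by (simp add: sum_distrib_right mult.assoc)
      qed
      moreover have "\<forall>j\<in>J. x j \<in> RR" by (simp add: x_def del: to_fract_mult)
      ultimately have "x j ^ (p ^ \<nu> j) \<in> Rd (0 + \<kappa>)"
        using TI[unfolded TI_def, rule_format, of x 0 j] j by (simp add: b_def)
      then have "to_fract (v j ^ (p ^ \<nu> j)) * to_fract (monom 1 (N * q)) \<in> Rd \<kappa>" using xp j by simp
      then have "to_fract (monom 1 (N * q)) \<in> Rd (\<kappa> + degree (v j ^ (p ^ \<nu> j)))"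
        using \<open>v j \<noteq> 0\<close> by (intro Rd_cancel) auto
      then have "N * q \<le> \<kappa> + degree (v j ^ (p ^ \<nu> j))" by (simp only: z_power_Rd)
      moreover have "N * 1 \<le> N * q" using q(2) by (intro mult_le_mono2)
      ultimately show ?thesis by (simp add: N_def)
    qed
  qed
qed

text \<open>The column split off in the induction has the largest order, as \<open>TI_insert\<close>
  requires; the constant stays \<open>hinc t\<close> because it does not depend on the one supplied
  by the induction hypothesis.\<close>

lemma TI_or_syz:
  assumes "finite J" "card J \<le> t" "\<And>j. j \<in> J \<Longrightarrow> \<nu> j \<le> t"
    "\<And>i j. i < r \<Longrightarrow> j \<in> J \<Longrightarrow> osz t (M i j)"
  shows "TI r M J \<nu> (hinc t) \<or> (\<exists>J'\<subseteq>J. \<exists>j0 v. syz r M J' \<nu> (hinc t) j0 v)"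
  using assms
proof (induction "card J" arbitrary: J)
  case 0
  then show ?case by (simp add: TI_def)
next
  case (Suc n)
  then have "J \<noteq> {}" by auto
  obtain j0 where j0: "j0 \<in> J" "\<And>j. j \<in> J \<Longrightarrow> \<nu> j \<le> \<nu> j0"
  proof -
    have "Max (\<nu> ` J) \<in> \<nu> ` J" using \<open>J \<noteq> {}\<close> Suc.prems(1) by (intro Max_in) auto
    then obtain j0 where j0: "j0 \<in> J" "\<nu> j0 = Max (\<nu> ` J)" by (metis imageE)
    show ?thesis
    proof (rule that)
      show "\<nu> j \<le> \<nu> j0" if "j \<in> J" for j using that Suc.prems(1) j0(2) by simp
    qed (rule j0(1))
  qed
  define J1 where "J1 = J - {j0}"
  have J1: "J = insert j0 J1" "j0 \<notin> J1" "finite J1" using j0(1) Suc.prems(1) by (auto simp: J1_def)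
  have "card J = Suc (card J1)" unfolding J1(1) using J1(2,3) by simp
  then have card: "n = card J1" "card J1 \<le> t" using Suc.hyps(2) Suc.prems(2) by linarith+
  have "TI r M J1 \<nu> (hinc t) \<or> (\<exists>J'\<subseteq>J1. \<exists>j0 v. syz r M J' \<nu> (hinc t) j0 v)"
  proof (rule Suc.hyps(1)[OF card(1) J1(3) card(2)])
    show "\<nu> j \<le> t" if "j \<in> J1" for j using Suc.prems(3) that J1(1) by blast
    show "osz t (M i j)" if "i < r" "j \<in> J1" for i j using Suc.prems(4) that J1(1) by blast
  qed
  then show ?case
  proof
    assume TI: "TI r M J1 \<nu> (hinc t)"
    have "TI r M (insert j0 J1) \<nu> (hinc t) \<or> (\<exists>v. syz r M (insert j0 J1) \<nu> (hinc t) j0 v)"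
    proof (rule TI_insert[OF _ _ _ _ _ _ TI])
      show "finite J1" "j0 \<notin> J1" by (fact J1)+
      show "\<nu> j \<le> \<nu> j0" if "j \<in> J1" for j using j0(2) J1(1) that by blast
      show "\<nu> j0 \<le> t" using Suc.prems(3) j0(1) by simp
      show "card J1 \<le> t" by (rule card(2))
      show "osz t (M i j)" if "i < r" "j \<in> insert j0 J1" for i j using Suc.prems(4) that J1(1) by blast
    qed
    then show ?thesis using J1(1) by blast
  next
    assume "\<exists>J'\<subseteq>J1. \<exists>j0 v. syz r M J' \<nu> (hinc t) j0 v"
    then show ?thesis using J1(1) by blast
  qed
qed

section \<open>Column reduction\<close>

definition msz :: "nat \<Rightarrow> nat \<Rightarrow> nat \<Rightarrow> (nat \<Rightarrow> nat \<Rightarrow> 'a poly poly) \<Rightarrow> bool" where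
  "msz t r m M \<longleftrightarrow> (\<forall>i<r. \<forall>j<m. osz t (M i j))"

lemma msz_mono: "msz t r m M \<Longrightarrow> t \<le> u \<Longrightarrow> msz u r m M"
  unfolding msz_def using osz_mono by blast

text \<open>\<open>ord j\<close> is an upper bound for the order plus one: the value 0 forces the
  column to vanish, and the leading level is \<open>ord j - 1\<close>.\<close>

definition cols_below :: "nat \<Rightarrow> nat \<Rightarrow> (nat \<Rightarrow> nat \<Rightarrow> 'a poly poly) \<Rightarrow> (nat \<Rightarrow> nat) \<Rightarrow> bool" where
  "cols_below r m M ord \<longleftrightarrow> (\<forall>i<r. \<forall>j<m. \<forall>k\<ge>ord j. coeff (M i j) k = 0)"

abbreviation ap :: "nat \<Rightarrow> (nat \<Rightarrow> nat \<Rightarrow> 'a poly poly) \<Rightarrow> (nat \<Rightarrow> 'a poly fract) \<Rightarrow> nat \<Rightarrow> 'a poly fract" where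
  "ap m M x i \<equiv> (\<Sum>j<m. ev (M i j) (x j))"

definition nzcols :: "nat \<Rightarrow> (nat \<Rightarrow> nat) \<Rightarrow> nat set" where
  "nzcols m ord = {j. j < m \<and> ord j > 0}"

text \<open>T need not be invertible over R. The last clause asks only that its image reach every
  vector up to \<open>Rd t\<close>, which is enough because only bounds are sought.\<close>

definition reduces :: "nat \<Rightarrow> nat \<Rightarrow> nat \<Rightarrow> (nat \<Rightarrow> nat \<Rightarrow> 'a poly poly) \<Rightarrow> (nat \<Rightarrow> nat) \<Rightarrow>
    (nat \<Rightarrow> nat \<Rightarrow> 'a poly poly) \<Rightarrow> (nat \<Rightarrow> nat \<Rightarrow> 'a poly poly) \<Rightarrow> (nat \<Rightarrow> nat) \<Rightarrow> bool" where
  "reduces t r m M ord T U ord' \<longleftrightarrow> msz t m m T \<and> msz t r m U \<and> (\<forall>j<m. ord' j \<le> ord j) \<and>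
     cols_below r m U ord' \<and> TI r U (nzcols m ord') (\<lambda>j. ord' j - 1) t \<and>
     (\<forall>i<r. \<forall>j<m. \<forall>x. ev (U i j) x = ap m M (\<lambda>k. ev (T k j) x) i) \<and>
     (\<forall>x. (\<forall>j<m. x j \<in> RR) \<longrightarrow> (\<exists>y. (\<forall>j<m. y j \<in> RR) \<and> (\<forall>k<m. x k - ap m T y k \<in> Rd t)))"

lemma reducesD:
  assumes "reduces t r m M ord T U ord'"
  shows "msz t m m T" "msz t r m U" "\<And>j. j < m \<Longrightarrow> ord' j \<le> ord j" "cols_below r m U ord'"
    "TI r U (nzcols m ord') (\<lambda>j. ord' j - 1) t"
    "\<And>i j x. i < r \<Longrightarrow> j < m \<Longrightarrow> ev (U i j) x = ap m M (\<lambda>k. ev (T k j) x) i"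
    "\<And>x. \<forall>j<m. x j \<in> RR \<Longrightarrow> \<exists>y. (\<forall>j<m. y j \<in> RR) \<and> (\<forall>k<m. x k - ap m T y k \<in> Rd t)"
proof -
  note a = assms[unfolded reduces_def]
  show "msz t m m T" by (rule a[THEN conjunct1])
  note a = a[THEN conjunct2]
  show "msz t r m U" by (rule a[THEN conjunct1])
  note a = a[THEN conjunct2]
  show "\<And>j. j < m \<Longrightarrow> ord' j \<le> ord j" by (rule a[THEN conjunct1, rule_format])
  note a = a[THEN conjunct2]
  show "cols_below r m U ord'" by (rule a[THEN conjunct1])
  note a = a[THEN conjunct2]
  show "TI r U (nzcols m ord') (\<lambda>j. ord' j - 1) t" by (rule a[THEN conjunct1])
  note a = a[THEN conjunct2]
  show "\<And>i j x. i < r \<Longrightarrow> j < m \<Longrightarrow> ev (U i j) x = ap m M (\<lambda>k. ev (T k j) x) i"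
    by (rule a[THEN conjunct1, THEN spec, THEN mp, THEN spec, THEN mp, THEN spec])
  show "\<And>x. \<forall>j<m. x j \<in> RR \<Longrightarrow> \<exists>y. (\<forall>j<m. y j \<in> RR) \<and> (\<forall>k<m. x k - ap m T y k \<in> Rd t)"
    by (rule a[THEN conjunct2, THEN spec, THEN mp])
qed

lemma reducesI:
  assumes "msz t m m T" "msz t r m U" "\<And>j. j < m \<Longrightarrow> ord' j \<le> ord j" "cols_below r m U ord'"
    "TI r U (nzcols m ord') (\<lambda>j. ord' j - 1) t"
    "\<And>i j x. i < r \<Longrightarrow> j < m \<Longrightarrow> ev (U i j) x = ap m M (\<lambda>k. ev (T k j) x) i"
    "\<And>x. \<forall>j<m. x j \<in> RR \<Longrightarrow> \<exists>y. (\<forall>j<m. y j \<in> RR) \<and> (\<forall>k<m. x k - ap m T y k \<in> Rd t)"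
  shows "reduces t r m M ord T U ord'"
  unfolding reduces_def using assms(1-5)
  by (intro conjI allI impI assms(6) assms(7)) simp_all

lemma ap_delta: fixes j m :: nat shows "j < m \<Longrightarrow> (\<Sum>k<m. ev (M k) (ev (if k = j then 1 else 0) x)) = ev (M j) x"
proof -
  assume "j < m"
  have "(\<Sum>k<m. ev (M k) (ev (if k = j then 1 else 0) x)) = (\<Sum>k<m. if k = j then ev (M j) x else 0)"
    by (intro sum.cong) auto
  also have "\<dots> = ev (M j) x" using \<open>j < m\<close> by simp
  finally show ?thesis .
qed

text \<open>One step: a syzygy \<open>v\<close> whose leading column \<open>j0\<close> has maximal order lets us replace that
  column by one of smaller order, at the price of a bounded remainder, because
  \<open>x\<^sub>j\<^sub>0\<close> can be divided by \<open>v\<^sub>j\<^sub>0\<close>.\<close>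

lemma reduction_step:
  assumes M: "msz t r m M" "cols_below r m M ord"
    and syz: "syz r M J (\<lambda>j. ord j - 1) u j0 v" and J: "J \<subseteq> nzcols m ord" and u: "t \<le> u"
    and ord: "\<And>j. j < m \<Longrightarrow> ord j \<le> Suc u"
  obtains T M' where "msz (hoc u) r m M'" "msz u m m T" "cols_below r m M' (ord(j0 := ord j0 - 1))"
    "\<And>i j x. i < r \<Longrightarrow> j < m \<Longrightarrow> ev (M' i j) x = ap m M (\<lambda>k. ev (T k j) x) i"
    "\<And>x. (\<forall>j<m. x j \<in> RR) \<Longrightarrow> \<exists>y. (\<forall>j<m. y j \<in> RR) \<and> (\<forall>k<m. x k - ap m T y k \<in> Rd u)"
proof -
  define \<nu> where "\<nu> j = ord j - 1" for j
  have s: "j0 \<in> J" "\<And>j. j \<in> J \<Longrightarrow> \<nu> j \<le> \<nu> j0" "v j0 \<noteq> 0" "\<And>j. j \<in> J \<Longrightarrow> v j \<in> PF \<and> degree (v j) \<le> u"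
    "\<And>i. i < r \<Longrightarrow> (\<Sum>j\<in>J. coeff (M i j) (\<nu> j) * v j ^ (p ^ \<nu> j)) = 0"
    using syz by (auto simp: syz_def \<nu>_def)
  have Jm: "j < m" "ord j = Suc (\<nu> j)" if "j \<in> J" for j using that J by (auto simp: nzcols_def \<nu>_def)
  have finJ: "finite J" using Jm by (intro finite_subset[of J "{..<m}"]) auto
  have j0m: "j0 < m" using Jm s by blast
  \<comment> \<open>Composed with v_k \<tau>^(\<nu> j0 - \<nu> k), column k reaches level \<nu> j0,
    and the coefficients there add up to the syzygy, that is, to 0.\<close>
  define W where "W k = monom (v k) (\<nu> j0 - \<nu> k)" for k
  define T where "T k j = (if j = j0 then (if k \<in> J then W k else 0) else if k = j then 1 else 0)" for k j
  define M' where "M' i j = (if j = j0 then (\<Sum>k\<in>J. oc (M i k) (W k)) else M i j)" for i j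
  have \<nu>u: "\<nu> j0 \<le> u" using ord[OF j0m] by (simp add: \<nu>_def)
  have W: "osz u (W k)" if "k \<in> J" for k
    unfolding W_def using s(4)[OF that] \<nu>u by (intro osz_monom) auto
  have Mu: "osz u (M i j)" if "i < r" "j < m" for i j
    using M(1) that u osz_mono unfolding msz_def by blast
  have huc: "u \<le> hoc u" by (simp add: hoc_def)
  show ?thesis
  proof
    show "msz (hoc u) r m M'"
      unfolding msz_def M'_def using W Mu Jm(1) huc by (auto intro!: osz_sum osz_oc intro: osz_mono)
    show "msz u m m T" unfolding msz_def T_def using W by auto
    show "cols_below r m M' (ord(j0 := ord j0 - 1))"
      unfolding cols_below_def
    proof (intro allI impI)
      fix i j k assume ijk: "i < r" "j < m" "(ord(j0 := ord j0 - 1)) j \<le> k"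
      show "coeff (M' i j) k = 0"
      proof (cases "j = j0")
        case False
        then show ?thesis using M(2) ijk by (auto simp: cols_below_def M'_def)
      next
        case True
        then have k: "\<nu> j0 \<le> k" using ijk(3) by (simp add: \<nu>_def)
        have c: "coeff (oc (M i l) (W l)) k = (if k = \<nu> j0 then coeff (M i l) (\<nu> l) * v l ^ (p ^ \<nu> l) else 0)"
          if l: "l \<in> J" for l
        proof (cases "k = \<nu> j0")
          case True
          then show ?thesis using s(2)[OF l] by (simp add: coeff_oc_monom W_def)
        next
          case False
          then have "ord l \<le> k - (\<nu> j0 - \<nu> l)" using k s(2)[OF l] Jm(2)[OF l] by simp
          then have "coeff (M i l) (k - (\<nu> j0 - \<nu> l)) = 0"
            using M(2) ijk(1) Jm(1)[OF l] by (simp add: cols_below_def)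
          then show ?thesis using False by (simp add: coeff_oc_monom W_def)
        qed
        show ?thesis
        proof (cases "k = \<nu> j0")
          case True
          then show ?thesis using c s(5)[OF ijk(1)] by (simp add: M'_def \<open>j = j0\<close> coeff_sum)
        next
          case False
          then show ?thesis using c by (simp add: M'_def \<open>j = j0\<close> coeff_sum)
        qed
      qed
    qed
    show "ev (M' i j) x = ap m M (\<lambda>k. ev (T k j) x) i" if "i < r" "j < m" for i j x
    proof (cases "j = j0")
      case True
      have "ev (M' i j) x = (\<Sum>k\<in>J. ev (M i k) (ev (W k) x))"
        by (simp add: M'_def True ev_sum ev_oc)
      also have "\<dots> = (\<Sum>k<m. ev (M i k) (ev (T k j) x))"
        by (rule sum.mono_neutral_cong_left) (use Jm(1) in \<open>auto simp: T_def True\<close>)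
      finally show ?thesis .
    next
      case False
      then show ?thesis using ap_delta[OF that(2), of "M i" x] by (simp add: M'_def T_def)
    qed
    show "\<exists>y. (\<forall>j<m. y j \<in> RR) \<and> (\<forall>k<m. x k - ap m T y k \<in> Rd u)" if x: "\<forall>j<m. x j \<in> RR" for x
    proof -
      obtain y0 \<rho> where y0: "y0 \<in> RR" "\<rho> \<in> Rd (degree (v j0))" "x j0 = to_fract (v j0) * y0 + \<rho>"
        using RR_division[OF s(3)] x j0m by blast
      \<comment> \<open>In the coordinate j0 the operator T is multiplication by v_j0, so y0 is the
        quotient; the other coordinates compensate for what \<open>W j\<close> adds to them.\<close>
      define y where "y j = (if j = j0 then y0 else if j \<in> J then x j - ev (W j) y0 else x j)" for j
      have ap: "ap m T y k = (if k \<in> J then ev (W k) y0 else 0) + (if k = j0 then 0 else y k)"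
        if k: "k < m" for k
      proof -
        have "ap m T y k = ev (T k j0) (y j0) + (\<Sum>j\<in>{..<m} - {j0}. ev (T k j) (y j))"
          using j0m by (subst sum.remove[of _ j0]) auto
        also have "(\<Sum>j\<in>{..<m} - {j0}. ev (T k j) (y j)) = (\<Sum>j\<in>{..<m} - {j0}. if j = k then y k else 0)"
          by (intro sum.cong) (auto simp: T_def)
        also have "\<dots> = (if k = j0 then 0 else y k)" using k by simp
        finally show ?thesis by (simp add: T_def y_def)
      qed
      have "x k - ap m T y k \<in> Rd u" if k: "k < m" for k
      proof (cases "k = j0")
        case True
        have "ev (W j0) y0 = to_fract (v j0) * y0" by (simp add: W_def ev_monom)
        then have "x k - ap m T y k = \<rho>" using ap[OF k] s(1) True y0(3) by simp
        then show ?thesis using y0(2) s(4)[OF s(1)] Rd_monoD by metis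
      next
        case False
        then have "x k - ap m T y k = 0" using ap[OF k] by (simp add: y_def)
        then show ?thesis by simp
      qed
      moreover have "\<forall>j<m. y j \<in> RR" unfolding y_def using x y0(1) by (auto intro: RR_diff ev_RR)
      ultimately show ?thesis by blast
    qed
  qed
qed

lemma ap_comp:
  "ap m M (ap m T y) i = (\<Sum>j<m. ap m M (\<lambda>k. ev (T k j) (y j)) i)"
  by (simp add: ev_x_sum) (rule sum.swap)

lemma reduces_trans:
  assumes 1: "msz u m m T1" "\<And>i j x. i < r \<Longrightarrow> j < m \<Longrightarrow> ev (M1 i j) x = ap m M (\<lambda>k. ev (T1 k j) x) i"
    "\<And>x. (\<forall>j<m. x j \<in> RR) \<Longrightarrow> \<exists>y. (\<forall>j<m. y j \<in> RR) \<and> (\<forall>k<m. x k - ap m T1 y k \<in> Rd u)"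
    and 2: "reduces u r m M1 ord1 T2 U ord'" and ord: "\<And>j. j < m \<Longrightarrow> ord1 j \<le> ord j"
  shows "reduces (hoc u) r m M ord (\<lambda>k j. \<Sum>l<m. oc (T1 k l) (T2 l j)) U ord'"
proof -
  let ?T = "\<lambda>k j. \<Sum>l<m. oc (T1 k l) (T2 l j)"
  have u: "u \<le> hoc u" by (simp add: hoc_def)
  have evT: "ev (?T k j) x = ap m T1 (\<lambda>l. ev (T2 l j) x) k" for k j x
    by (simp add: ev_sum ev_oc)
  note r2 = reducesD[OF 2]
  have "msz (hoc u) m m ?T"
    using 1(1) r2(1) unfolding msz_def by (auto intro!: osz_sum osz_oc)
  moreover have "msz (hoc u) r m U" by (rule msz_mono[OF r2(2) u])
  moreover have "ord' j \<le> ord j" if "j < m" for j using r2(3)[OF that] ord[OF that] by simp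
  moreover note r2(4)
  moreover note TI_mono[OF r2(5) u]
  moreover have "ev (U i j) x = ap m M (\<lambda>k. ev (?T k j) x) i" if "i < r" "j < m" for i j x
  proof -
    have "ev (U i j) x = ap m M1 (\<lambda>k. ev (T2 k j) x) i" by (rule r2(6)[OF that])
    also have "\<dots> = (\<Sum>l<m. ap m M (\<lambda>k. ev (T1 k l) (ev (T2 l j) x)) i)"
      using 1(2)[OF that(1)] by (intro sum.cong) auto
    also have "\<dots> = ap m M (ap m T1 (\<lambda>l. ev (T2 l j) x)) i" by (rule ap_comp[symmetric])
    finally show ?thesis by (simp only: evT)
  qed
  moreover have "\<exists>y. (\<forall>j<m. y j \<in> RR) \<and> (\<forall>k<m. x k - ap m ?T y k \<in> Rd (hoc u))"
    if x: "\<forall>j<m. x j \<in> RR" for x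
  proof -
    obtain w where w: "\<forall>j<m. w j \<in> RR" "\<forall>k<m. x k - ap m T1 w k \<in> Rd u" using 1(3)[OF x] by blast
    obtain y where y: "\<forall>j<m. y j \<in> RR" "\<forall>k<m. w k - ap m T2 y k \<in> Rd u"
      using r2(7)[OF w(1)] by blast
    have "x k - ap m ?T y k \<in> Rd (hoc u)" if k: "k < m" for k
    proof -
      have "ap m ?T y k = (\<Sum>j<m. ap m T1 (\<lambda>l. ev (T2 l j) (y j)) k)" by (simp only: evT)
      also have "\<dots> = ap m T1 (ap m T2 y) k" by (rule ap_comp[symmetric])
      finally have "x k - ap m ?T y k = (x k - ap m T1 w k) + (\<Sum>j<m. ev (T1 k j) (w j - ap m T2 y j))"
        by (simp add: ev_x_diff sum_subtractf)
      also have "\<dots> \<in> Rd (hoc u)"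
      proof (rule Rd_add)
        show "x k - ap m T1 w k \<in> Rd (hoc u)" by (rule Rd_monoD[OF _ u]) (use w(2) k in blast)
        show "(\<Sum>j<m. ev (T1 k j) (w j - ap m T2 y j)) \<in> Rd (hoc u)"
          using y(2) 1(1) k by (intro Rd_sum ev_Rd_hoc) (auto simp: msz_def)
      qed
      finally show ?thesis .
    qed
    then show ?thesis using y(1) by blast
  qed
  ultimately show ?thesis by (rule reducesI)
qed

lemma reduces_id:
  assumes "msz t r m M" "cols_below r m M ord" "TI r M (nzcols m ord) (\<lambda>j. ord j - 1) t"
  shows "reduces t r m M ord (\<lambda>k j. if k = j then 1 else 0) M ord"
proof -
  have "\<exists>y. (\<forall>j<m. y j \<in> RR) \<and> (\<forall>k<m. x k - ap m (\<lambda>k j. if k = j then 1 else 0) y k \<in> Rd t)"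
    if x: "\<forall>j<m. x j \<in> RR" for x
  proof (intro exI[of _ x] conjI allI impI x[rule_format])
    fix k assume "k < m"
    have "(\<Sum>j<m. ev (if k = j then 1 else 0) (x j)) = (\<Sum>j<m. if j = k then x k else 0)"
      by (intro sum.cong) auto
    then show "x k - ap m (\<lambda>k j. if k = j then 1 else 0) x k \<in> Rd t" using \<open>k < m\<close> by simp
  qed
  note ex = this
  show ?thesis
  proof (rule reducesI[OF _ assms(1) _ assms(2,3)])
    show "msz t m m (\<lambda>k j. if k = j then 1 else 0)" by (auto simp: msz_def)
    show "ev (M i j) x = ap m M (\<lambda>k. ev (if k = j then 1 else 0) x) i" if "j < m" for i j x
      by (rule ap_delta[OF that, symmetric])
  qed (use ex in simp_all)
qed

text \<open>Each reduction enlarges the matrix by \<open>hoc (hinc t)\<close> on the way down, and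
  composing the transformations costs one \<open>hoc\<close> per step on the way back. Iterates are
  used so that \<open>CB_funpow\<close> applies; the recursion is \<open>hred_Suc\<close>.\<close>

definition hred :: "nat \<Rightarrow> nat \<Rightarrow> nat" where
  "hred k t = (hoc ^^ k) (hinc (((\<lambda>t. hoc (hinc t)) ^^ k) t))"

lemma CB_hoc_hinc: "(\<lambda>t. hoc (hinc t)) \<in> CB"
  by (rule CB_comp[OF CB_hoc CB_hinc])

lemma hred_Suc: "hred (Suc k) t = hoc (hred k (hoc (hinc t)))"
proof -
  have "((\<lambda>t. hoc (hinc t)) ^^ Suc k) t = ((\<lambda>t. hoc (hinc t)) ^^ k) (hoc (hinc t))"
    by (simp only: funpow_Suc_right o_apply)
  then show ?thesis unfolding hred_def by simp
qed

lemma hred_ge: "hoc (hinc t) \<le> hred (Suc k) t" and hred_ge': "hinc t \<le> hred k t"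
proof -
  have 1: "hinc t \<le> hred k t" for k t
  proof -
    have "t \<le> ((\<lambda>t. hoc (hinc t)) ^^ k) t"
      using CB_funpow_le[OF CB_hoc_hinc, of 0 k t t] by simp
    then have "hinc t \<le> hinc (((\<lambda>t. hoc (hinc t)) ^^ k) t)" by (rule CB_mono[OF CB_hinc])
    also have "\<dots> \<le> hred k t" unfolding hred_def
      using CB_funpow_le[OF CB_hoc, of 0 k] by simp
    finally show ?thesis .
  qed
  show "hinc t \<le> hred k t" by (rule 1)
  have "hoc (hinc t) \<le> hinc (hoc (hinc t))" by (rule CB_ge[OF CB_hinc])
  also have "\<dots> \<le> hred k (hoc (hinc t))" by (rule 1)
  also have "\<dots> \<le> hred (Suc k) t" unfolding hred_Suc by (rule CB_ge[OF CB_hoc])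
  finally show "hoc (hinc t) \<le> hred (Suc k) t" .
qed

lemma reduces_mono: "reduces t r m M ord T U ord' \<Longrightarrow> t \<le> u \<Longrightarrow> reduces u r m M ord T U ord'"
proof -
  assume r: "reduces t r m M ord T U ord'" and le: "t \<le> u"
  note r2 = reducesD[OF r]
  show ?thesis
  proof (rule reducesI[OF msz_mono[OF r2(1) le] msz_mono[OF r2(2) le] r2(3,4) TI_mono[OF r2(5) le] r2(6)])
    fix x assume "\<forall>j<m. x j \<in> RR"
    from r2(7)[OF this] show "\<exists>y. (\<forall>j<m. y j \<in> RR) \<and> (\<forall>k<m. x k - ap m T y k \<in> Rd u)"
      using Rd_monoD[OF _ le] by blast
  qed assumption+
qed

text \<open>The sum of all \<open>ord j\<close> is the termination measure: as long as leading forms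
  are dependent, one step lowers it.\<close>

lemma column_reduction_aux:
  assumes "m \<le> t" "msz t r m M" "cols_below r m M ord" "\<And>j. j < m \<Longrightarrow> ord j \<le> Suc t" "(\<Sum>j<m. ord j) \<le> k"
  shows "\<exists>T U ord'. reduces (hred k t) r m M ord T U ord'"
  using assms
proof (induction k arbitrary: t M ord)
  case 0
  then have ord0: "ord j = 0" if "j < m" for j using that by simp
  then have "nzcols m ord = {}" by (auto simp: nzcols_def)
  then have "TI r M (nzcols m ord) (\<lambda>j. ord j - 1) t" by (simp add: TI_def)
  from reduces_mono[OF reduces_id[OF 0(2,3) this], of "hred 0 t"]
  show ?case using CB_ge[OF CB_hinc, of t] by (auto simp: hred_def)
next
  case (Suc k)
  have tinc: "t \<le> hinc t" by (rule CB_ge[OF CB_hinc])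
  have sub: "nzcols m ord \<subseteq> {..<m}" by (auto simp: nzcols_def)
  have "card (nzcols m ord) \<le> t" using card_mono[OF _ sub] Suc.prems(1) by simp
  moreover have "finite (nzcols m ord)" using sub by (rule finite_subset) simp
  moreover have "ord j - 1 \<le> t" if "j \<in> nzcols m ord" for j
  proof -
    have "j < m" using that by (simp add: nzcols_def)
    from Suc.prems(4)[OF this] show ?thesis by linarith
  qed
  moreover have "osz t (M i j)" if "i < r" "j \<in> nzcols m ord" for i j
    using that Suc.prems(2) by (simp add: nzcols_def msz_def)
  ultimately have "TI r M (nzcols m ord) (\<lambda>j. ord j - 1) (hinc t)
      \<or> (\<exists>J\<subseteq>nzcols m ord. \<exists>j0 v. syz r M J (\<lambda>j. ord j - 1) (hinc t) j0 v)"
    by (intro TI_or_syz)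
  then consider "TI r M (nzcols m ord) (\<lambda>j. ord j - 1) (hinc t)"
    | J j0 v where "J \<subseteq> nzcols m ord" "syz r M J (\<lambda>j. ord j - 1) (hinc t) j0 v"
    by (elim disjE exE conjE)
  then show ?case
  proof cases
    case 1
    have "msz (hinc t) r m M" by (rule msz_mono[OF Suc.prems(2) tinc])
    from reduces_mono[OF reduces_id[OF this Suc.prems(3) 1] hred_ge'] show ?thesis by (intro exI)
  next
    case (2 J j0 v)
    have ordle: "ord j \<le> Suc (hinc t)" if "j < m" for j
      using Suc.prems(4)[OF that] tinc by simp
    obtain T1 M1 where step: "msz (hoc (hinc t)) r m M1" "msz (hinc t) m m T1"
      "cols_below r m M1 (ord(j0 := ord j0 - 1))"
      "\<And>i j x. i < r \<Longrightarrow> j < m \<Longrightarrow> ev (M1 i j) x = ap m M (\<lambda>k. ev (T1 k j) x) i"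
      "\<And>x. (\<forall>j<m. x j \<in> RR) \<Longrightarrow> \<exists>y. (\<forall>j<m. y j \<in> RR) \<and> (\<forall>k<m. x k - ap m T1 y k \<in> Rd (hinc t))"
      by (rule reduction_step[OF Suc.prems(2,3) 2(2,1) tinc ordle], assumption) (rule that, assumption+)
    let ?ord = "ord(j0 := ord j0 - 1)" and ?h = "hoc (hinc t)"
    have j0: "j0 < m" "ord j0 > 0" using 2 by (auto simp: syz_def nzcols_def)
    have le: "hinc t \<le> ?h" by (rule CB_ge[OF CB_hoc])
    have "(\<Sum>j<m. ?ord j) < (\<Sum>j<m. ord j)"
    proof (rule sum_strict_mono_ex1)
      show "\<exists>j\<in>{..<m}. ?ord j < ord j" using j0 by (intro bexI[of _ j0]) simp_all
    qed simp_all
    then have sum: "(\<Sum>j<m. ?ord j) \<le> k" using Suc.prems(5) by simp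
    have m: "m \<le> ?h" using Suc.prems(1) tinc le by simp
    have ord': "?ord j \<le> Suc ?h" if "j < m" for j
    proof -
      have "?ord j \<le> ord j" by simp
      with ordle[OF that] le show ?thesis by linarith
    qed
    have "\<exists>T U ord'. reduces (hred k ?h) r m M1 ?ord T U ord'"
      by (rule Suc.IH[OF m step(1,3) _ sum]) (rule ord')
    then obtain T2 U ord' where 2: "reduces (hred k ?h) r m M1 ?ord T2 U ord'"
      by (elim exE)
    let ?u = "hred k ?h"
    have u: "hinc t \<le> ?u" using le hred_ge'[of ?h k] CB_ge[OF CB_hinc, of ?h] by simp
    have ex: "\<exists>y. (\<forall>j<m. y j \<in> RR) \<and> (\<forall>k<m. x k - ap m T1 y k \<in> Rd ?u)" if "\<forall>j<m. x j \<in> RR" for x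
      using step(5)[OF that] Rd_monoD[OF _ u] by blast
    have "reduces (hoc ?u) r m M ord (\<lambda>k j. \<Sum>l<m. oc (T1 k l) (T2 l j)) U ord'"
    proof (rule reduces_trans[OF msz_mono[OF step(2) u] step(4) ex 2])
      show "ord j \<ge> ?ord j" for j by simp
    qed
    then show ?thesis unfolding hred_Suc by (intro exI)
  qed
qed

text \<open>At most t columns, each starting with \<open>ord\<close> equal to t + 1, allow at most t
  (t + 1) reduction steps.\<close>

definition hcr :: "nat \<Rightarrow> nat" where "hcr t = hred (t * Suc t) t"

lemma CB_hcr: "hcr \<in> CB"
proof -
  have "(\<lambda>t. t * Suc t) \<in> CB" by (intro CB_intros)
  then have "(\<lambda>t. ((\<lambda>t. hoc (hinc t)) ^^ (t * Suc t)) t) \<in> CB"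
    by (rule CB_funpow[OF CB_hoc_hinc _ CB_id])
  from CB_funpow[OF CB_hoc \<open>(\<lambda>t. t * Suc t) \<in> CB\<close> CB_comp[OF CB_hinc this]]
  show ?thesis by (simp add: hcr_def[abs_def] hred_def)
qed

lemma column_reduction:
  assumes "m \<le> t" "msz t r m M"
  shows "\<exists>T U ord'. reduces (hcr t) r m M (\<lambda>_. Suc t) T U ord'"
  unfolding hcr_def
proof (rule column_reduction_aux)
  show "cols_below r m M (\<lambda>_. Suc t)"
    unfolding cols_below_def
  proof (intro allI impI)
    fix i j k assume "i < r" "j < m" "Suc t \<le> k"
    then have "degree (M i j) < k" using assms(2) by (auto simp: msz_def osz_def Suc_le_eq intro: le_less_trans)
    then show "coeff (M i j) k = 0" by (rule coeff_eq_0)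
  qed
  have "(\<Sum>j<m. Suc t) = m * Suc t" by simp
  also have "\<dots> \<le> t * Suc t" using assms(1) by (rule mult_le_mono1)
  finally show "(\<Sum>j<m. Suc t) \<le> t * Suc t" .
qed (use assms in auto)

section \<open>Bounded solutions of linear systems\<close>

definition htb :: "nat \<Rightarrow> nat" where "htb t = 2 * (t + t + p ^ t)"

lemma CB_htb: "htb \<in> CB"
proof -
  have "(\<lambda>t. 2 * (t + t + p ^ t)) \<in> CB" by (intro CB_mult_const CB_intros p_ge_2) simp
  then show ?thesis by (simp add: htb_def[abs_def])
qed

text \<open>Let E be the least common bound of the x_j^(p^\<nu> j). A term of lower order is at most
  about E / p, hence E / 2, so independence of the leading forms gives E \<le> max d (t + E / 2 +
  p^t) + t. Solving for E yields \<open>htb\<close>.\<close>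

lemma TI_bounded:
  assumes TI: "TI r U J \<nu> t" and J: "finite J" "\<And>j. j \<in> J \<Longrightarrow> \<nu> j \<le> t"
    and U: "\<And>i j. i < r \<Longrightarrow> j \<in> J \<Longrightarrow> osz t (U i j)"
      "\<And>i j k. i < r \<Longrightarrow> j \<in> J \<Longrightarrow> \<nu> j < k \<Longrightarrow> coeff (U i j) k = 0"
    and x: "\<And>j. j \<in> J \<Longrightarrow> x j \<in> RR" "\<And>i. i < r \<Longrightarrow> (\<Sum>j\<in>J. ev (U i j) (x j)) \<in> Rd d"
    and j: "j \<in> J"
  shows "x j ^ (p ^ \<nu> j) \<in> Rd (d + htb t)"
proof -
  define P where "P E \<longleftrightarrow> (\<forall>j\<in>J. x j ^ (p ^ \<nu> j) \<in> Rd E)" for E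
  have "\<exists>E. P E" unfolding P_def using RR_common[of J "\<lambda>j. x j ^ (p ^ \<nu> j)"] J(1) x(1) RR_power by blast
  define E where "E = (LEAST E. P E)"
  have PE: "P E" unfolding E_def using \<open>\<exists>E. P E\<close> by (rule LeastI_ex)
  have least: "E \<le> E'" if "P E'" for E' unfolding E_def using that by (rule Least_le)
  define B where "B = t + E div 2 + p ^ t"
  define low where "low i = (\<Sum>j\<in>J. \<Sum>k<\<nu> j. to_fract (coeff (U i j) k) * x j ^ (p ^ k))" for i
  have low: "low i \<in> Rd B" if "i < r" for i
    unfolding low_def
  proof (intro Rd_sum)
    fix j k assume jk: "j \<in> J" "k \<in> {..<\<nu> j}"
    let ?e = "E div p ^ \<nu> j"
    have "E = p ^ \<nu> j * ?e + E mod p ^ \<nu> j" "E mod p ^ \<nu> j < p ^ \<nu> j" by simp_all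
    then have "E \<le> p ^ \<nu> j * ?e + p ^ \<nu> j" by linarith
    then have "E \<le> p ^ \<nu> j * (?e + 1)" by simp
    then have "x j ^ (p ^ \<nu> j) \<in> Rd (p ^ \<nu> j * (?e + 1))" using PE jk(1) Rd_monoD unfolding P_def by blast
    then have "x j \<in> Rd (?e + 1)" using x(1)[OF jk(1)] by (rule Rd_pth_root[rotated])
    then have "to_fract (coeff (U i j) k) * x j ^ (p ^ k) \<in> Rd (t + p ^ k * (?e + 1))"
      using U(1)[OF that jk(1)] by (intro Rd_tf_mult Rd_power) (auto simp: osz_def)
    moreover have "p ^ k * (?e + 1) \<le> E div 2 + p ^ t"
    proof -
      have "2 * (p ^ k * ?e) \<le> p * (p ^ k * ?e)" using p_ge_2 by (rule mult_le_mono1)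
      also have "\<dots> = p ^ Suc k * ?e" by simp
      also have "\<dots> \<le> p ^ \<nu> j * ?e" using jk(2) by (intro mult_le_mono1 p_power_le) simp
      also have "\<dots> \<le> E" by simp
      finally have "p ^ k * ?e \<le> E div 2" by simp
      moreover have "p ^ k \<le> p ^ t" using jk J(2)[OF jk(1)] by (intro p_power_le) simp
      ultimately show ?thesis by simp
    qed
    ultimately show "to_fract (coeff (U i j) k) * x j ^ (p ^ k) \<in> Rd B"
      unfolding B_def by (elim Rd_monoD) simp
  qed
  have top: "(\<Sum>j\<in>J. to_fract (coeff (U i j) (\<nu> j)) * x j ^ (p ^ \<nu> j)) \<in> Rd (max d B)" if i: "i < r" for i
  proof -
    have "ev (U i j) (x j) = (\<Sum>k<\<nu> j. to_fract (coeff (U i j) k) * x j ^ (p ^ k))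
        + to_fract (coeff (U i j) (\<nu> j)) * x j ^ (p ^ \<nu> j)" if "j \<in> J" for j
    proof -
      have "degree (U i j) \<le> \<nu> j" using U(2)[OF i that] by (intro degree_le) auto
      then show ?thesis by (simp add: ev_le lessThan_Suc_atMost[symmetric])
    qed
    then have "(\<Sum>j\<in>J. ev (U i j) (x j)) - low i = (\<Sum>j\<in>J. to_fract (coeff (U i j) (\<nu> j)) * x j ^ (p ^ \<nu> j))"
      by (simp add: low_def sum.distrib)
    moreover have "(\<Sum>j\<in>J. ev (U i j) (x j)) - low i \<in> Rd (max d B)"
      by (rule Rd_diff[OF Rd_monoD[OF x(2)[OF i]] Rd_monoD[OF low[OF i]]]) simp_all
    ultimately show ?thesis by simp
  qed
  have "P (max d B + t)"
    unfolding P_def using TI[unfolded TI_def, rule_format, OF x(1) top] by blast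
  then have "E \<le> max d B + t" by (rule least)
  then have "E \<le> d + t \<or> E \<le> t + E div 2 + p ^ t + t" unfolding B_def by linarith
  then have "E \<le> d + htb t" unfolding htb_def by auto
  then show ?thesis using PE j Rd_monoD unfolding P_def by blast
qed

definition hkey :: "nat \<Rightarrow> nat" where
  "hkey t = hcr t + p ^ hcr t * (hcr t + (hcr t + p ^ hcr t * hcr t) + htb (hcr t)) + hcr t"

lemma CB_hkey: "hkey \<in> CB"
proof -
  have "(\<lambda>u. u + p ^ u * (u + (u + p ^ u * u) + htb u) + u) \<in> CB"
    by (intro CB_intros p_ge_2 CB_htb)
  from CB_comp[OF this CB_hcr] show ?thesis by (simp add: hkey_def[abs_def])
qed

text \<open>Columns of T that M sends to 0 give elements of the kernel. On the remaining columns
  leading forms are independent, so by \<open>TI_bounded\<close> their coordinates are bounded and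
  only add to the error.\<close>

lemma kernel_parametrization:
  assumes "m \<le> t" "msz t r m M"
  shows "\<exists>V. msz (hkey t) m m V \<and> (\<forall>i<r. \<forall>j<m. \<forall>y. ap m M (\<lambda>k. ev (V k j) y) i = 0) \<and>
    (\<forall>x d. (\<forall>j<m. x j \<in> RR) \<longrightarrow> (\<forall>i<r. ap m M x i \<in> Rd d) \<longrightarrow>
      (\<exists>y. (\<forall>j<m. y j \<in> RR) \<and> (\<forall>k<m. x k - ap m V y k \<in> Rd (hkey (t + d)))))"
proof -
  obtain T U ord where red: "reduces (hcr t) r m M (\<lambda>_. Suc t) T U ord"
    using column_reduction[OF assms] by (elim exE)
  define V where "V k j = (if ord j = 0 then T k j else 0)" for k j
  let ?a = "hcr t"
  have ta: "t \<le> ?a" by (rule CB_ge[OF CB_hcr])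
  have akey: "?a \<le> hkey t" unfolding hkey_def by (rule le_add2)
  note T = reducesD(1)[OF red] and U = reducesD(2,4,5)[OF red] and UM = reducesD(6)[OF red]
    and ord = reducesD(3)[OF red] and ex = reducesD(7)[OF red]
  have U0: "U i j = 0" if "i < r" "j < m" "ord j = 0" for i j
    using U(2) that by (intro poly_eqI) (simp add: cols_below_def)
  have "msz (hkey t) m m V"
    using msz_mono[OF T akey] by (auto simp: msz_def V_def)
  moreover have "ap m M (\<lambda>k. ev (V k j) y) i = 0" if "i < r" "j < m" for i j y
  proof (cases "ord j = 0")
    case True
    have "ap m M (\<lambda>k. ev (V k j) y) i = ap m M (\<lambda>k. ev (T k j) y) i"
      by (simp add: V_def True)
    also have "\<dots> = ev (U i j) y" by (rule UM[OF that, symmetric])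
    finally show ?thesis by (simp only: U0[OF that True] ev_0)
  next
    case False
    show ?thesis by (rule sum.neutral) (simp add: V_def False)
  qed
  moreover have "\<exists>y. (\<forall>j<m. y j \<in> RR) \<and> (\<forall>k<m. x k - ap m V y k \<in> Rd (hkey (t + d)))"
    if x: "\<forall>j<m. x j \<in> RR" and Mx: "\<forall>i<r. ap m M x i \<in> Rd d" for x d
  proof -
    obtain y where y: "\<forall>j<m. y j \<in> RR" "\<forall>k<m. x k - ap m T y k \<in> Rd ?a" using ex[OF x] by blast
    let ?u = "hcr (t + d)"
    have au: "?a \<le> ?u" by (intro CB_mono[OF CB_hcr]) simp
    have du: "t + d \<le> ?u" by (rule CB_ge[OF CB_hcr])
    let ?N = "nzcols m ord"
    let ?d = "?u + (?u + p ^ ?u * ?u)"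
    have sumN: "(\<Sum>j\<in>?N. f j) = (\<Sum>j<m. f j)" if "\<And>j. j < m \<Longrightarrow> ord j = 0 \<Longrightarrow> f j = 0"
      for f :: "nat \<Rightarrow> 'a poly fract"
      by (rule sum.mono_neutral_left) (use that in \<open>auto simp: nzcols_def\<close>)
    have "(\<Sum>j\<in>?N. ev (U i j) (y j)) \<in> Rd ?d" if i: "i < r" for i
    proof -
      have "(\<Sum>j\<in>?N. ev (U i j) (y j)) = (\<Sum>j<m. ev (U i j) (y j))"
        by (rule sumN) (simp add: U0 i)
      also have "\<dots> = ap m M (ap m T y) i"
        unfolding ap_comp using UM[OF i] by (intro sum.cong) simp_all
      also have "\<dots> = ap m M x i - (\<Sum>k<m. ev (M i k) (x k - ap m T y k))"
        by (simp add: ev_x_diff sum_subtractf)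
      also have "\<dots> \<in> Rd ?d"
      proof (rule Rd_diff)
        have "d \<le> ?d" using du by linarith
        then show "ap m M x i \<in> Rd ?d" by (rule Rd_monoD[rotated]) (use Mx i in blast)
        have "(\<Sum>k<m. ev (M i k) (x k - ap m T y k)) \<in> Rd (t + p ^ t * ?a)"
          using y(2) assms(2) i by (intro Rd_sum ev_Rd) (auto simp: msz_def)
        moreover have "t + p ^ t * ?a \<le> ?d"
        proof -
          have "p ^ t * ?a \<le> p ^ ?u * ?u" by (rule mult_le_mono[OF p_power_le au]) (use du in linarith)
          then show ?thesis using du by linarith
        qed
        ultimately show "(\<Sum>k<m. ev (M i k) (x k - ap m T y k)) \<in> Rd ?d" by (rule Rd_monoD)
      qed
      finally show ?thesis .
    qed
    note sumU = this
    have yp: "y j ^ (p ^ (ord j - 1)) \<in> Rd (?d + htb ?a)" if j: "j \<in> ?N" for j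
    proof (rule TI_bounded[OF U(3) _ _ _ _ _ sumU j])
      show "finite ?N" by (rule finite_subset[of _ "{..<m}"]) (auto simp: nzcols_def)
      show "ord j - 1 \<le> ?a" if "j \<in> ?N" for j
      proof -
        have "j < m" using that by (simp add: nzcols_def)
        from ord[OF this] ta show ?thesis by linarith
      qed
      show "osz ?a (U i j)" if "i < r" "j \<in> ?N" for i j using U(1) that by (simp add: msz_def nzcols_def)
      show "coeff (U i j) k = 0" if "i < r" "j \<in> ?N" "ord j - 1 < k" for i j k
        using U(2) that by (simp add: cols_below_def nzcols_def)
      show "y j \<in> RR" if "j \<in> ?N" for j using y(1) that by (simp add: nzcols_def)
    qed
    have yb: "y j \<in> Rd (?d + htb ?u)" if j: "j \<in> ?N" for j
    proof (rule Rd_pth_root[where n = "ord j - 1"])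
      show "y j \<in> RR" using y(1) j by (simp add: nzcols_def)
      have "htb ?a \<le> htb ?u" by (rule CB_mono[OF CB_htb au])
      then have "?d + htb ?a \<le> 1 * (?d + htb ?u)" by simp
      also have "\<dots> \<le> p ^ (ord j - 1) * (?d + htb ?u)" by (rule mult_le_mono1) simp
      finally have "?d + htb ?a \<le> p ^ (ord j - 1) * (?d + htb ?u)" .
      with yp[OF j] show "y j ^ (p ^ (ord j - 1)) \<in> Rd (p ^ (ord j - 1) * (?d + htb ?u))"
        by (rule Rd_monoD)
    qed
    have "x k - ap m V y k \<in> Rd (hkey (t + d))" if k: "k < m" for k
    proof -
      have "ap m T y k - ap m V y k = (\<Sum>j<m. if ord j = 0 then 0 else ev (T k j) (y j))"
        unfolding sum_subtractf[symmetric] by (rule sum.cong) (simp_all add: V_def)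
      also have "\<dots> = (\<Sum>j\<in>?N. if ord j = 0 then 0 else ev (T k j) (y j))" by (rule sumN[symmetric]) simp
      also have "\<dots> = (\<Sum>j\<in>?N. ev (T k j) (y j))" by (intro sum.cong) (auto simp: nzcols_def)
      also have "\<dots> \<in> Rd (?u + p ^ ?u * (?d + htb ?u))"
      proof (intro Rd_sum)
        fix j assume j: "j \<in> ?N"
        then have "osz ?u (T k j)" using msz_mono[OF T au] k by (simp add: msz_def nzcols_def)
        then show "ev (T k j) (y j) \<in> Rd (?u + p ^ ?u * (?d + htb ?u))" using yb[OF j] by (rule ev_Rd)
      qed
      finally have 1: "ap m T y k - ap m V y k \<in> Rd (hkey (t + d))"
        by (rule Rd_monoD) (unfold hkey_def, rule le_add1)
      have "?a \<le> hkey (t + d)" unfolding hkey_def by (rule order_trans[OF au le_add2])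
      then have "x k - ap m T y k \<in> Rd (hkey (t + d))" by (rule Rd_monoD[rotated]) (use y(2) k in blast)
      from Rd_add[OF this 1] show ?thesis by simp
    qed
    then show ?thesis using y(1) by blast
  qed
  ultimately show ?thesis by blast
qed

section \<open>Positive primitive subgroups\<close>

text \<open>The points w are infinite sequences of which the first t coordinates matter. The
  unknowns \<xi> range over R; the unknowns \<eta> range over \<open>Rd 0\<close>, a copy of F, so
  that membership in F is a condition of this kind.\<close>

definition PPm :: "nat \<Rightarrow> (nat \<Rightarrow> nat \<Rightarrow> 'a poly poly) \<Rightarrow> (nat \<Rightarrow> nat \<Rightarrow> 'a poly poly) \<Rightarrow>
    (nat \<Rightarrow> nat \<Rightarrow> 'a poly poly) \<Rightarrow> (nat \<Rightarrow> 'a poly fract) set" where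
  "PPm t B M N = {w. \<exists>\<xi> \<eta>. (\<forall>j<t. \<xi> j \<in> RR) \<and> (\<forall>j<t. \<eta> j \<in> Rd 0) \<and>
     (\<forall>i<t. ap t B w i + ap t M \<xi> i + ap t N \<eta> i = 0)}"

definition PP :: "nat \<Rightarrow> (nat \<Rightarrow> 'a poly fract) set set" where
  "PP t = {PPm t B M N | B M N. msz t t t B \<and> msz t t t M \<and> msz t t t N}"

definition fib0 :: "nat \<Rightarrow> (nat \<Rightarrow> 'a poly fract) set \<Rightarrow> 'a poly fract set" where
  "fib0 i G = {x \<in> RR. (\<lambda>_. 0)(i := x) \<in> G}"

text \<open>Appends the column of B at i0 to M, so that the coordinate i0 of w becomes the unknown
  with index t.\<close>

definition ext :: "nat \<Rightarrow> nat \<Rightarrow> (nat \<Rightarrow> nat \<Rightarrow> 'a poly poly) \<Rightarrow> (nat \<Rightarrow> nat \<Rightarrow> 'a poly poly) \<Rightarrow> nat \<Rightarrow> nat \<Rightarrow> 'a poly poly" where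
  "ext t i0 B M i j = (if j < t then M i j else B i i0)"

lemma ap_ext: "ap (Suc t) (ext t i0 B M) X i = ap t M X i + ev (B i i0) (X t)"
  by (simp add: ext_def)

lemma msz_ext: "msz t t t B \<Longrightarrow> msz t t t M \<Longrightarrow> i0 < t \<Longrightarrow> msz (Suc t) t (Suc t) (ext t i0 B M)"
  unfolding msz_def ext_def using osz_mono[of t _ "Suc t"] by simp

lemma ap_upd:
  assumes "i0 < t"
  shows "ap t B (w(i0 := x)) i = ap t B (w(i0 := 0)) i + ev (B i i0) x"
proof -
  have "ap t B (w(i0 := x)) i = ev (B i i0) x + (\<Sum>j\<in>{..<t} - {i0}. ev (B i j) (w j))" for x
    using assms by (subst sum.remove[of _ i0]) (auto intro!: sum.cong)
  from this[of x] this[of 0] show ?thesis by simp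
qed

lemma ap_Rd: "msz t r m M \<Longrightarrow> i < r \<Longrightarrow> (\<And>j. j < m \<Longrightarrow> x j \<in> Rd d) \<Longrightarrow> ap m M x i \<in> Rd (t + p ^ t * d)"
  by (intro Rd_sum ev_Rd) (auto simp: msz_def)

definition hbnd :: "nat \<Rightarrow> nat" where "hbnd n = hkey (Suc n + (n + p ^ n * n))"

lemma CB_hbnd: "hbnd \<in> CB"
proof -
  have "(\<lambda>n. Suc n + (n + p ^ n * n)) \<in> CB" by (intro CB_intros p_ge_2)
  from CB_comp[OF CB_hkey this] show ?thesis by (simp add: hbnd_def[abs_def])
qed

text \<open>With the coordinate i0 among the unknowns, the right-hand side of the system is bounded:
  w is bounded away from i0 and \<eta> lies in \<open>Rd 0\<close>. Subtracting an element of the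
  parametrized kernel bounds the solution without changing its image.\<close>

lemma fibre_bounded:
  assumes G: "G \<in> PP t" and i0: "i0 < t" and x: "x \<in> RR" "w(i0 := x) \<in> G"
    and w: "\<And>j. j < t \<Longrightarrow> w j \<in> Rd d"
  shows "\<exists>x'\<in>Rd (hbnd (t + d)). w(i0 := x') \<in> G"
proof -
  obtain B M N where BMN: "G = PPm t B M N" "msz t t t B" "msz t t t M" "msz t t t N"
    using G by (auto simp: PP_def)
  obtain \<xi> \<eta> where \<xi>: "\<And>j. j < t \<Longrightarrow> \<xi> j \<in> RR" "\<And>j. j < t \<Longrightarrow> \<eta> j \<in> Rd 0"
    "\<And>i. i < t \<Longrightarrow> ap t B (w(i0 := x)) i + ap t M \<xi> i + ap t N \<eta> i = 0"
    using x(2) unfolding BMN(1) PPm_def by blast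
  define M' where "M' = ext t i0 B M"
  define X where "X = \<xi>(t := x)"
  have X\<xi>: "ap t M X i = ap t M \<xi> i" for i by (intro sum.cong) (auto simp: X_def)
  have X: "\<forall>j<Suc t. X j \<in> RR" using \<xi>(1) x(1) by (simp add: X_def less_Suc_eq)
  define n where "n = t + d"
  define d' where "d' = n + p ^ n * n"
  have key: "ap (Suc t) M' X i = - ap t B (w(i0 := 0)) i - ap t N \<eta> i" if "i < t" for i
  proof -
    have "ap (Suc t) M' X i = ap t M \<xi> i + ev (B i i0) x"
      unfolding M'_def ap_ext X\<xi> by (simp add: X_def)
    moreover have "ap t B (w(i0 := 0)) i + ev (B i i0) x + ap t M \<xi> i + ap t N \<eta> i = 0"
      using \<xi>(3)[OF that] ap_upd[OF i0, where B = B and x = x and i = i] by simp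
    ultimately show ?thesis by (simp add: algebra_simps eq_neg_iff_add_eq_0)
  qed
  have "ap (Suc t) M' X i \<in> Rd d'" if i: "i < t" for i
  proof -
    have "ap t B (w(i0 := 0)) i \<in> Rd (t + p ^ t * d)" by (rule ap_Rd[OF BMN(2) i]) (use w in auto)
    moreover have "ap t N \<eta> i \<in> Rd (t + p ^ t * 0)" by (rule ap_Rd[OF BMN(4) i \<xi>(2)])
    moreover have "t + p ^ t * d \<le> d'" "t + p ^ t * 0 \<le> d'"
    proof -
      have "p ^ t * d \<le> p ^ n * n" by (rule mult_le_mono[OF p_power_le]) (simp_all add: n_def)
      then show "t + p ^ t * d \<le> d'" "t + p ^ t * 0 \<le> d'" unfolding d'_def by (simp_all add: n_def)
    qed
    ultimately have "- ap t B (w(i0 := 0)) i - ap t N \<eta> i \<in> Rd d'"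
      by (intro Rd_diff Rd_uminus) (rule Rd_monoD; assumption)+
    then show ?thesis by (simp only: key[OF i])
  qed
  then have val: "\<forall>i<t. ap (Suc t) M' X i \<in> Rd d'" by blast
  have "msz (Suc t) t (Suc t) M'" unfolding M'_def by (rule msz_ext[OF BMN(2,3) i0])
  from kernel_parametrization[OF order_refl this] obtain V
    where V: "\<forall>i<t. \<forall>j<Suc t. \<forall>y. ap (Suc t) M' (\<lambda>k. ev (V k j) y) i = 0"
      "\<forall>x d. (\<forall>j<Suc t. x j \<in> RR) \<longrightarrow> (\<forall>i<t. ap (Suc t) M' x i \<in> Rd d) \<longrightarrow>
        (\<exists>y. (\<forall>j<Suc t. y j \<in> RR) \<and> (\<forall>k<Suc t. x k - ap (Suc t) V y k \<in> Rd (hkey (Suc t + d))))"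
    by (elim exE conjE)
  from V(2)[THEN spec, THEN spec, THEN mp, THEN mp, OF X val] obtain y
    where y: "\<forall>j<Suc t. y j \<in> RR" "\<forall>k<Suc t. X k - ap (Suc t) V y k \<in> Rd (hkey (Suc t + d'))"
    by (elim exE conjE)
  define X' where "X' k = X k - ap (Suc t) V y k" for k
  have "hkey (Suc t + d') \<le> hbnd (t + d)"
    unfolding hbnd_def d'_def n_def by (rule CB_mono[OF CB_hkey]) simp
  then have X': "X' k \<in> Rd (hbnd (t + d))" if "k < Suc t" for k
    using y(2) that Rd_monoD unfolding X'_def by blast
  have MX': "ap (Suc t) M' X' i = ap (Suc t) M' X i" if i: "i < t" for i
  proof -
    have "ap (Suc t) M' (ap (Suc t) V y) i = 0"
      unfolding ap_comp by (rule sum.neutral) (use V(1) i in auto)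
    moreover have "ap (Suc t) M' X' i = ap (Suc t) M' X i - ap (Suc t) M' (ap (Suc t) V y) i"
      unfolding X'_def ev_x_diff sum_subtractf by (rule refl)
    ultimately show ?thesis by simp
  qed
  have "ap t B (w(i0 := X' t)) i + ap t M X' i + ap t N \<eta> i = 0" if i: "i < t" for i
  proof -
    have aux: "(c + b) + a + d = 0" if "a + b = - c - d" for a b c d :: "'a poly fract"
    proof -
      have "(c + b) + a + d = (a + b) + c + d" by (simp add: ac_simps)
      then show ?thesis by (simp add: that)
    qed
    have "ap t M X' i + ev (B i i0) (X' t) = - ap t B (w(i0 := 0)) i - ap t N \<eta> i"
      using MX'[OF i] unfolding key[OF i] by (simp only: M'_def ap_ext)
    then show ?thesis unfolding ap_upd[OF i0, where B = B and x = "X' t" and i = i] by (rule aux)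
  qed
  moreover have "\<forall>j<t. X' j \<in> RR" using Rd_RR[OF X'] by simp
  ultimately have "w(i0 := X' t) \<in> G"
    unfolding BMN(1) PPm_def using \<xi>(2) by (intro CollectI exI[of _ X'] exI[of _ \<eta>]) simp
  then show ?thesis using X'[of t] by blast
qed

text \<open>A subgroup of R known up to \<open>Rd a\<close> through operators with independent
  leading forms; the form in which two subgroups can be compared.\<close>

definition par :: "nat \<Rightarrow> 'a poly fract set \<Rightarrow> nat set \<Rightarrow> (nat \<Rightarrow> 'a poly poly) \<Rightarrow> (nat \<Rightarrow> nat) \<Rightarrow> bool" where
  "par a G J U \<nu> \<longleftrightarrow> J \<subseteq> {..<a} \<and> TI 1 (\<lambda>_. U) J \<nu> a \<and>
     (\<forall>j\<in>J. \<nu> j \<le> a \<and> osz a (U j) \<and> (\<forall>k>\<nu> j. coeff (U j) k = 0) \<and> (\<forall>y\<in>RR. ev (U j) y \<in> G)) \<and>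
     (\<forall>g\<in>G. \<exists>y. (\<forall>j\<in>J. y j \<in> RR) \<and> g - (\<Sum>j\<in>J. ev (U j) (y j)) \<in> Rd a)"

definition hpar :: "nat \<Rightarrow> nat" where "hpar t = hoc (hcr (hkey (Suc (t + t))))"

lemma CB_hpar: "hpar \<in> CB"
proof -
  have "(\<lambda>t. Suc (t + t)) \<in> CB" by (intro CB_intros)
  from CB_comp[OF CB_hoc CB_comp[OF CB_hcr CB_comp[OF CB_hkey this]]]
  show ?thesis by (simp add: hpar_def[abs_def])
qed

text \<open>Row t of the kernel parametrization describes the fibre up to a bounded error. A second
  column reduction, of this single row, makes its leading forms independent.\<close>

lemma fibre_parametrization:
  assumes G: "G \<in> PP t" and i0: "i0 < t"
  shows "\<exists>J U \<nu>. par (hpar t) (fib0 i0 G) J U \<nu>"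
proof -
  obtain B M N where BMN: "G = PPm t B M N" "msz t t t B" "msz t t t M" "msz t t t N"
    using G by (auto simp: PP_def)
  define M' where "M' = ext t i0 B M"
  let ?h = "hkey (Suc (t + t))"
  let ?a = "hcr ?h"
  have h: "hkey (Suc t) \<le> ?h" "Suc t \<le> ?h"
    using CB_mono[OF CB_hkey, of "Suc t" "Suc (t + t)"] CB_ge[OF CB_hkey, of "Suc t"] by simp_all
  have ha: "?h \<le> ?a" "?a \<le> hpar t" unfolding hpar_def by (rule CB_ge[OF CB_hcr], rule CB_ge[OF CB_hoc])
  have "msz (Suc t) t (Suc t) M'" unfolding M'_def by (rule msz_ext[OF BMN(2,3) i0])
  from kernel_parametrization[OF order_refl this] obtain V
    where V: "msz (hkey (Suc t)) (Suc t) (Suc t) V"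
      "\<forall>i<t. \<forall>j<Suc t. \<forall>y. ap (Suc t) M' (\<lambda>k. ev (V k j) y) i = 0"
      "\<forall>x d. (\<forall>j<Suc t. x j \<in> RR) \<longrightarrow> (\<forall>i<t. ap (Suc t) M' x i \<in> Rd d) \<longrightarrow>
        (\<exists>y. (\<forall>j<Suc t. y j \<in> RR) \<and> (\<forall>k<Suc t. x k - ap (Suc t) V y k \<in> Rd (hkey (Suc t + d))))"
    by (elim exE conjE)
  have inG: "ap (Suc t) V y t \<in> fib0 i0 G" if y: "\<forall>j<Suc t. y j \<in> RR" for y
  proof -
    let ?X = "ap (Suc t) V y"
    have RRX: "?X k \<in> RR" for k using y by (intro RR_sum ev_RR) simp
    have "ap (Suc t) M' ?X i = 0" if "i < t" for i
      unfolding ap_comp by (rule sum.neutral) (use V(2) that in auto)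
    then have "ap t M ?X i + ev (B i i0) (?X t) = 0" if "i < t" for i
      using that unfolding M'_def ap_ext by blast
    moreover have "ap t B ((\<lambda>_. 0)(i0 := 0)) i = 0" for i by (rule sum.neutral) simp
    moreover have "ap t N (\<lambda>_. 0) i = 0" for i by (rule sum.neutral) simp
    ultimately have "ap t B ((\<lambda>_. 0)(i0 := ?X t)) i + ap t M ?X i + ap t N (\<lambda>_. 0) i = 0" if "i < t" for i
      using that unfolding ap_upd[OF i0, where B = B and x = "?X t" and i = i] by (simp add: add.commute)
    then have "(\<lambda>_. 0)(i0 := ?X t) \<in> G"
      unfolding BMN(1) PPm_def using RRX by (intro CollectI exI[of _ ?X] exI[of _ "\<lambda>_. 0"]) simp
    then show ?thesis using RRX by (simp add: fib0_def del: sum.lessThan_Suc)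
  qed
  define M1 where "M1 i j = V t j" for i :: nat and j
  have "msz ?h 1 (Suc t) M1" using msz_mono[OF V(1) h(1)] by (simp add: msz_def M1_def)
  from column_reduction[OF h(2) this] obtain T U ord where red: "reduces ?a 1 (Suc t) M1 (\<lambda>_. Suc ?h) T U ord"
    by (elim exE)
  note r = reducesD[OF red]
  define J where "J = nzcols (Suc t) ord"
  have Jlt: "j < Suc t" if "j \<in> J" for j using that by (simp add: J_def nzcols_def)
  have U0: "U 0 j = 0" if "j < Suc t" "j \<notin> J" for j
    using r(4) that by (intro poly_eqI) (simp add: cols_below_def J_def nzcols_def)
  have UV: "ev (U 0 j) x = ap (Suc t) V (\<lambda>k. ev (T k j) x) t" if "j < Suc t" for j x
    using r(6)[OF zero_less_one that] by (simp only: M1_def)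
  have "par (hpar t) (fib0 i0 G) J (U 0) (\<lambda>j. ord j - 1)"
    unfolding par_def
  proof (intro conjI ballI allI impI)
    show "J \<subseteq> {..<hpar t}"
    proof
      fix j assume "j \<in> J"
      from Jlt[OF this] have "j < hpar t" using h(2) ha by linarith
      then show "j \<in> {..<hpar t}" by simp
    qed
    have "TI 1 U J (\<lambda>j. ord j - 1) ?a" using r(5) by (simp add: J_def)
    then have "TI 1 (\<lambda>_. U 0) J (\<lambda>j. ord j - 1) ?a" by (simp add: TI_def)
    then show "TI 1 (\<lambda>_. U 0) J (\<lambda>j. ord j - 1) (hpar t)" by (rule TI_mono) (rule ha)
    show "ord j - 1 \<le> hpar t" if "j \<in> J" for j using r(3)[OF Jlt[OF that]] ha by linarith
    show "osz (hpar t) (U 0 j)" if "j \<in> J" for j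
      using msz_mono[OF r(2) ha(2)] Jlt[OF that] by (simp add: msz_def)
    show "coeff (U 0 j) k = 0" if "j \<in> J" "ord j - 1 < k" for j k
      using r(4) Jlt[OF that(1)] that(2) by (simp add: cols_below_def)
    show "ev (U 0 j) y \<in> fib0 i0 G" if "j \<in> J" "y \<in> RR" for j y
      unfolding UV[OF Jlt[OF that(1)]] by (rule inG) (simp add: ev_RR that(2))
    fix g assume g: "g \<in> fib0 i0 G"
    then obtain \<xi> \<eta> where \<xi>: "g \<in> RR" "\<And>j. j < t \<Longrightarrow> \<xi> j \<in> RR" "\<And>j. j < t \<Longrightarrow> \<eta> j \<in> Rd 0"
      "\<And>i. i < t \<Longrightarrow> ap t B ((\<lambda>_. 0)(i0 := g)) i + ap t M \<xi> i + ap t N \<eta> i = 0"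
      unfolding BMN(1) PPm_def fib0_def by blast
    define X where "X = \<xi>(t := g)"
    have X\<xi>: "ap t M X i = ap t M \<xi> i" for i by (intro sum.cong) (auto simp: X_def)
    have X: "\<forall>j<Suc t. X j \<in> RR" using \<xi>(1,2) by (simp add: X_def less_Suc_eq)
    have "ap (Suc t) M' X i \<in> Rd t" if i: "i < t" for i
    proof -
      have "ap t B ((\<lambda>_. 0)(i0 := 0)) i = 0" by (rule sum.neutral) simp
      then have "ev (B i i0) g + ap t M \<xi> i + ap t N \<eta> i = 0"
        using \<xi>(4)[OF i] unfolding ap_upd[OF i0, where B = B and x = g and i = i] by simp
      then have "ap (Suc t) M' X i = - ap t N \<eta> i"
        unfolding M'_def ap_ext X\<xi> by (simp add: X_def algebra_simps eq_neg_iff_add_eq_0)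
      moreover have "ap t N \<eta> i \<in> Rd (t + p ^ t * 0)" by (rule ap_Rd[OF BMN(4) i \<xi>(3)])
      ultimately show ?thesis using Rd_uminus by simp
    qed
    then have val: "\<forall>i<t. ap (Suc t) M' X i \<in> Rd t" by blast
    from V(3)[THEN spec, THEN spec, THEN mp, THEN mp, OF X val] obtain y
      where y: "\<forall>j<Suc t. y j \<in> RR" "\<forall>k<Suc t. X k - ap (Suc t) V y k \<in> Rd (hkey (Suc t + t))"
      by (elim exE conjE)
    have gy: "g - ap (Suc t) V y t \<in> Rd ?h"
      using y(2)[rule_format, of t] by (simp add: X_def del: sum.lessThan_Suc)
    obtain u where u: "\<forall>j<Suc t. u j \<in> RR" "\<forall>k<Suc t. y k - ap (Suc t) T u k \<in> Rd ?a"
      using r(7)[OF y(1)] by (elim exE conjE)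
    have "(\<Sum>j\<in>J. ev (U 0 j) (u j)) = (\<Sum>j<Suc t. ev (U 0 j) (u j))"
      by (rule sum.mono_neutral_left) (use U0 Jlt in auto)
    also have "\<dots> = (\<Sum>j<Suc t. ap (Suc t) V (\<lambda>k. ev (T k j) (u j)) t)"
      by (rule sum.cong[OF refl]) (rule UV, simp)
    also have "\<dots> = ap (Suc t) V (ap (Suc t) T u) t" by (rule ap_comp[symmetric])
    finally have "g - (\<Sum>j\<in>J. ev (U 0 j) (u j)) = (g - ap (Suc t) V y t)
        + (\<Sum>k<Suc t. ev (V t k) (y k - ap (Suc t) T u k))"
      unfolding ev_x_diff sum_subtractf by (simp del: sum.lessThan_Suc)
    also have "\<dots> \<in> Rd (hpar t)"
    proof (rule Rd_add)
      show "g - ap (Suc t) V y t \<in> Rd (hpar t)" by (rule Rd_monoD[OF gy order_trans[OF ha]])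
      show "(\<Sum>k<Suc t. ev (V t k) (y k - ap (Suc t) T u k)) \<in> Rd (hpar t)"
        unfolding hpar_def
      proof (intro Rd_sum ev_Rd_hoc)
        fix k assume "k \<in> {..<Suc t}"
        then show "osz ?a (V t k)" "y k - ap (Suc t) T u k \<in> Rd ?a"
          using msz_mono[OF V(1) order_trans[OF h(1) ha(1)]] u(2) by (auto simp: msz_def)
      qed
    qed
    finally show "\<exists>y. (\<forall>j\<in>J. y j \<in> RR) \<and> g - (\<Sum>j\<in>J. ev (U 0 j) (y j)) \<in> Rd (hpar t)"
      using u(1) Jlt by blast
  qed
  then show ?thesis by blast
qed

lemma fib0_RR: "fib0 i G \<subseteq> RR" by (auto simp: fib0_def)

lemma PPm_0: "(\<lambda>_. 0) \<in> PPm t B M N"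
proof -
  have "ap t A (\<lambda>_. 0) i = 0" for A i by (rule sum.neutral) simp
  then show ?thesis unfolding PPm_def by (intro CollectI exI[of _ "\<lambda>_. 0"]) simp
qed

lemma PPm_diff: "v \<in> PPm t B M N \<Longrightarrow> w \<in> PPm t B M N \<Longrightarrow> (\<lambda>j. v j - w j) \<in> PPm t B M N"
proof -
  assume v: "v \<in> PPm t B M N" and w: "w \<in> PPm t B M N"
  obtain \<xi> \<eta> where 1: "\<forall>j<t. \<xi> j \<in> RR" "\<forall>j<t. \<eta> j \<in> Rd 0" "\<forall>i<t. ap t B v i + ap t M \<xi> i + ap t N \<eta> i = 0"
    using v unfolding PPm_def by blast
  obtain \<xi>' \<eta>' where 2: "\<forall>j<t. \<xi>' j \<in> RR" "\<forall>j<t. \<eta>' j \<in> Rd 0" "\<forall>i<t. ap t B w i + ap t M \<xi>' i + ap t N \<eta>' i = 0"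
    using w unfolding PPm_def by blast
  have d: "ap t A (\<lambda>j. a j - b j) i = ap t A a i - ap t A b i" for A a b i
    by (simp add: ev_x_diff sum_subtractf)
  have "ap t B (\<lambda>j. v j - w j) i + ap t M (\<lambda>j. \<xi> j - \<xi>' j) i + ap t N (\<lambda>j. \<eta> j - \<eta>' j) i = 0" if "i < t" for i
  proof -
    have "ap t B (\<lambda>j. v j - w j) i + ap t M (\<lambda>j. \<xi> j - \<xi>' j) i + ap t N (\<lambda>j. \<eta> j - \<eta>' j) i
      = (ap t B v i + ap t M \<xi> i + ap t N \<eta> i) - (ap t B w i + ap t M \<xi>' i + ap t N \<eta>' i)"
      unfolding d by simp
    then show ?thesis using 1(3) 2(3) that by simp
  qed
  then show ?thesis
    unfolding PPm_def using 1(1,2) 2(1,2) RR_diff Rd_diff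
    by (intro CollectI exI[of _ "\<lambda>j. \<xi> j - \<xi>' j"] exI[of _ "\<lambda>j. \<eta> j - \<eta>' j"]) simp
qed

lemma PP_0: "G \<in> PP t \<Longrightarrow> (\<lambda>_. 0) \<in> G"
  by (auto simp: PP_def PPm_0)

lemma PP_diff: "G \<in> PP t \<Longrightarrow> v \<in> G \<Longrightarrow> w \<in> G \<Longrightarrow> (\<lambda>j. v j - w j) \<in> G"
  by (auto simp: PP_def PPm_diff)

lemma fib0_0: "G \<in> PP t \<Longrightarrow> 0 \<in> fib0 i G"
  using PP_0[of G t] by (simp add: fib0_def fun_upd_idem)

lemma fib0_diff: "G \<in> PP t \<Longrightarrow> x \<in> fib0 i G \<Longrightarrow> y \<in> fib0 i G \<Longrightarrow> x - y \<in> fib0 i G"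
proof -
  assume G: "G \<in> PP t" and xy: "x \<in> fib0 i G" "y \<in> fib0 i G"
  have "(\<lambda>j. ((\<lambda>_. 0)(i := x)) j - ((\<lambda>_. 0)(i := y)) j) \<in> G"
    by (rule PP_diff[OF G]) (use xy in \<open>auto simp only: fib0_def mem_Collect_eq\<close>)
  moreover have "(\<lambda>j. ((\<lambda>_. 0)(i := x)) j - ((\<lambda>_. 0)(i := y)) j) = (\<lambda>_. 0)(i := x - y)" by auto
  ultimately show ?thesis using xy RR_diff by (simp add: fib0_def)
qed

lemma Rd_tf_degree: "to_fract f \<in> Rd d \<Longrightarrow> degree f \<le> d"
proof -
  assume "to_fract f \<in> Rd d"
  then obtain g where g: "degree g \<le> D * d" "to_fract f = to_fract g / to_fract s ^ d" by (rule RdE)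
  then have "to_fract (f * s ^ d) = to_fract g" by (simp add: tf_power field_simps)
  then have "g = f * s ^ d" using to_fract_eq_iff by metis
  then have "f \<noteq> 0 \<Longrightarrow> degree g = degree f + d * degree s"
    by (simp add: degree_mult_eq degree_power_eq)
  with g(1) show "degree f \<le> d" by (cases "f = 0") simp_all
qed

lemma ev_Rd_degree:
  assumes "degree P \<le> n" "\<And>i. degree (coeff P i) \<le> c" "x \<in> Rd e"
  shows "ev P x \<in> Rd (c + p ^ n * e)"
  unfolding ev_def
proof (intro Rd_sum)
  fix i assume "i \<in> {..degree P}"
  then have "i \<le> n" using assms(1) by simp
  have "to_fract (coeff P i) * x ^ (p ^ i) \<in> Rd (c + p ^ i * e)"
    using assms by (intro Rd_tf_mult Rd_power)
  then show "to_fract (coeff P i) * x ^ (p ^ i) \<in> Rd (c + p ^ n * e)"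
    by (rule Rd_monoD) (simp add: p_power_le \<open>i \<le> n\<close>)
qed

section \<open>The index of one fibre subgroup in another\<close>

definition hq :: "nat \<Rightarrow> nat" where "hq a = hoc (a + p ^ a)"
definition hs :: "nat \<Rightarrow> nat" where "hs a = hoc (hinc (hq a))"

lemma CB_hq: "hq \<in> CB"
proof -
  have "(\<lambda>a. a + p ^ a) \<in> CB" by (intro CB_intros p_ge_2)
  from CB_comp[OF CB_hoc this] show ?thesis by (simp add: hq_def[abs_def])
qed

lemma CB_hs: "hs \<in> CB"
  using CB_comp[OF CB_hoc CB_comp[OF CB_hinc CB_hq]] by (simp add: hs_def[abs_def])

text \<open>U_j composed with z^l \<tau>^(a - \<nu> j): the contribution of the l-th component of
  the argument. Its order is at most a, assigned as common level, so it can play the maximal column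
  in \<open>TI_insert\<close>.\<close>

definition qcol :: "nat \<Rightarrow> (nat \<Rightarrow> 'a poly poly) \<Rightarrow> (nat \<Rightarrow> nat) \<Rightarrow> nat \<Rightarrow> nat \<Rightarrow> 'a poly poly" where
  "qcol a U \<nu> j l = oc (U j) (monom (monom 1 l) (a - \<nu> j))"

lemma ev_qcol: "ev (qcol a U \<nu> j l) x = ev (U j) (to_fract (monom 1 l) * x ^ (p ^ (a - \<nu> j)))"
  by (simp add: qcol_def ev_oc ev_monom)

lemma coeff_qcol_above:
  assumes "par a G J U \<nu>" "j \<in> J" "a < k"
  shows "coeff (qcol a U \<nu> j l) k = 0"
proof (cases "a - \<nu> j \<le> k")
  case True
  have "\<nu> j \<le> a" using assms by (auto simp: par_def)
  then have "\<nu> j < k - (a - \<nu> j)" using assms(3) True by linarith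
  then have "coeff (U j) (k - (a - \<nu> j)) = 0" using assms(1,2) by (auto simp: par_def)
  then show ?thesis by (simp add: qcol_def coeff_oc_monom)
next
  case False
  then show ?thesis by (simp add: qcol_def coeff_oc_monom)
qed

lemma osz_qcol:
  assumes "par a G J U \<nu>" "j \<in> J" "l < p ^ (a - \<nu> j)"
  shows "osz (hq a) (qcol a U \<nu> j l)"
  unfolding qcol_def hq_def
proof (rule osz_oc)
  show "osz (a + p ^ a) (U j)" using assms osz_mono[of a "U j" "a + p ^ a"] by (auto simp: par_def)
  have "p ^ (a - \<nu> j) \<le> p ^ a" by (rule p_power_le) simp
  then show "osz (a + p ^ a) (monom (monom 1 l) (a - \<nu> j))"
    using assms(3) by (intro osz_monom PF_monom) (simp_all add: degree_monom_eq)
qed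

text \<open>If adjoining a component of the column \<open>U\<^sub>j\<close> to the columns \<open>W\<close> creates no
  syzygy, that component gives infinitely many classes modulo \<open>K\<close>.\<close>

lemma independent_component:
  assumes K: "par a K JW W \<nu>W" and G: "par a G J U \<nu>" and j: "j \<in> J" and l: "l < p ^ (a - \<nu> j)"
    and TI: "TI 1 (\<lambda>_. W(a := qcol a U \<nu> j l)) (insert a JW) (\<nu>W(a := a)) (hinc (hq a))"
    and y: "y \<in> RR" "ev (qcol a U \<nu> j l) y \<in> K"
  shows "y \<in> Rd (a + htb (hinc (hq a)))"
proof -
  let ?Q = "qcol a U \<nu> j l" and ?h = "hinc (hq a)"
  have JW: "JW \<subseteq> {..<a}" "finite JW" using K by (auto simp: par_def intro: finite_subset)
  then have "a \<notin> JW" by auto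
  have ah: "a \<le> ?h"
    by (rule order_trans[OF _ CB_ge[OF CB_hinc]]) (rule CB_ge[OF CB_hq])
  have Qh: "osz ?h ?Q" by (rule osz_mono[OF osz_qcol[OF G j l] CB_ge[OF CB_hinc]])
  obtain x where x: "\<forall>j\<in>JW. x j \<in> RR" "ev ?Q y - (\<Sum>j\<in>JW. ev (W j) (x j)) \<in> Rd a"
    using K y(2) unfolding par_def by blast
  \<comment> \<open>The index a is free for the new column because \<open>JW\<close> lies below
    a.\<close>
  define X where "X = (\<lambda>j. if j = a then y else - x j)"
  have "(\<Sum>j\<in>insert a JW. ev ((W(a := ?Q)) j) (X j)) = ev ?Q y - (\<Sum>j\<in>JW. ev (W j) (x j))"
  proof -
    have "(\<Sum>j\<in>JW. ev ((W(a := ?Q)) j) (X j)) = (\<Sum>j\<in>JW. - ev (W j) (x j))"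
      using \<open>a \<notin> JW\<close> by (intro sum.cong) (auto simp: X_def ev_x_uminus)
    then show ?thesis using JW(2) \<open>a \<notin> JW\<close> by (simp add: X_def sum_negf)
  qed
  then have val: "(\<Sum>j\<in>insert a JW. ev ((W(a := ?Q)) j) (X j)) \<in> Rd a" using x(2) by simp
  have "X a ^ (p ^ ((\<nu>W(a := a)) a)) \<in> Rd (a + htb ?h)"
  proof (rule TI_bounded[OF TI])
    show "finite (insert a JW)" using JW(2) by simp
    show "(\<nu>W(a := a)) i \<le> ?h" if "i \<in> insert a JW" for i
      using that K ah by (auto simp: par_def intro: order_trans)
    show "osz ?h ((W(a := ?Q)) j)" if "j \<in> insert a JW" for j
      using that K Qh osz_mono[OF _ ah] by (auto simp: par_def)
    show "coeff ((W(a := ?Q)) j) k = 0" if "j \<in> insert a JW" "(\<nu>W(a := a)) j < k" for j k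
      using that K coeff_qcol_above[OF G j] \<open>a \<notin> JW\<close> by (auto simp: par_def split: if_splits)
    show "X j \<in> RR" if "j \<in> insert a JW" for j
      using that x(1) y(1) by (auto simp: X_def RR_uminus)
  qed (use val in auto)
  then have "y ^ (p ^ a) \<in> Rd (a + htb ?h)" by (simp add: X_def)
  moreover have "1 * (a + htb ?h) \<le> p ^ a * (a + htb ?h)" by (rule mult_le_mono1) simp
  ultimately have "y ^ (p ^ a) \<in> Rd (p ^ a * (a + htb ?h))" using Rd_monoD by simp
  then show ?thesis by (rule Rd_pth_root[OF y(1)])
qed

text \<open>If adjoining the component creates a syzygy, its values can be lowered modulo \<open>K\<close>.\<close>

lemma dependent_component:
  assumes K: "par a K JW W \<nu>W" and G: "par a G J U \<nu>" and j: "j \<in> J" and l: "l < p ^ (a - \<nu> j)"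
    and syz: "syz 1 (\<lambda>_. W(a := qcol a U \<nu> j l)) (insert a JW) (\<nu>W(a := a)) (hinc (hq a)) a v"
    and y: "y \<in> Rd e" and a: "a \<ge> 1"
  shows "\<exists>x. (\<forall>i\<in>JW. x i \<in> RR) \<and>
    ev (qcol a U \<nu> j l) y - (\<Sum>i\<in>JW. ev (W i) (x i)) \<in> Rd (hoc (hs a) + p ^ (a - 1) * e)"
proof -
  let ?Q = "qcol a U \<nu> j l" and ?h = "hinc (hq a)" and ?H = "hs a"
  have JW: "JW \<subseteq> {..<a}" "finite JW" using K by (auto simp: par_def intro: finite_subset)
  then have aJ: "a \<notin> JW" by auto
  have h: "hq a \<le> ?h" "a \<le> ?h" "?h \<le> ?H"
    using CB_ge[OF CB_hinc, of "hq a"] CB_ge[OF CB_hq, of a] CB_ge[OF CB_hoc, of ?h] by (auto simp: hs_def)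
  have v: "v a \<noteq> 0" "\<And>i. i \<in> insert a JW \<Longrightarrow> v i \<in> PF \<and> degree (v i) \<le> ?h"
    "(\<Sum>i\<in>insert a JW. coeff ((W(a := ?Q)) i) ((\<nu>W(a := a)) i) * v i ^ (p ^ ((\<nu>W(a := a)) i))) = 0"
    using syz by (auto simp: syz_def)
  have rel: "coeff ?Q a * v a ^ (p ^ a) + (\<Sum>i\<in>JW. coeff (W i) (\<nu>W i) * v i ^ (p ^ \<nu>W i)) = 0"
  proof -
    have "(\<Sum>i\<in>JW. coeff ((W(a := ?Q)) i) ((\<nu>W(a := a)) i) * v i ^ (p ^ ((\<nu>W(a := a)) i)))
        = (\<Sum>i\<in>JW. coeff (W i) (\<nu>W i) * v i ^ (p ^ \<nu>W i))"
      using aJ by (intro sum.cong) auto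
    then show ?thesis using v(3) JW(2) aJ by simp
  qed
  have W: "\<nu>W i \<le> a" "osz a (W i)" "\<And>k. \<nu>W i < k \<Longrightarrow> coeff (W i) k = 0" if "i \<in> JW" for i
    using K that by (auto simp: par_def)
  define m where "m i = monom (v i) (a - \<nu>W i)" for i
  \<comment> \<open>The syzygy kills the coefficient of \<tau>^a, so P has order at most a - 1.
    Writing y as v_a u plus a bounded remainder, the column at y equals P u modulo K and bounded
    terms; this gains a factor p over the order a.\<close>
  define P where "P = oc ?Q (monom (v a) 0) + (\<Sum>i\<in>JW. oc (W i) (m i))"
  have oszP: "osz ?H P"
    unfolding P_def hs_def
  proof (intro osz_add osz_sum osz_oc)
    show "osz ?h ?Q" by (rule osz_mono[OF osz_qcol[OF G j l] h(1)])
    show "osz ?h (monom (v a) 0)" using v(2) by (intro osz_monom) auto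
    show "osz ?h (W i)" if "i \<in> JW" for i by (rule osz_mono[OF W(2)[OF that] h(2)])
    show "osz ?h (m i)" if "i \<in> JW" for i
      unfolding m_def using v(2)[of i] that h(2) by (intro osz_monom) auto
  qed
  have "coeff P k = 0" if k: "a \<le> k" for k
  proof -
    have c: "coeff (oc (W i) (m i)) k = (if k = a then coeff (W i) (\<nu>W i) * v i ^ (p ^ \<nu>W i) else 0)"
      if i: "i \<in> JW" for i
    proof (cases "k = a")
      case True
      then show ?thesis using W(1)[OF i] by (simp add: coeff_oc_monom m_def)
    next
      case False
      then have "\<nu>W i < k - (a - \<nu>W i)" using k W(1)[OF i] by linarith
      then show ?thesis using False W(3)[OF i] by (simp add: coeff_oc_monom m_def)
    qed
    have "coeff (oc ?Q (monom (v a) 0)) k = (if k = a then coeff ?Q a * v a ^ (p ^ a) else 0)"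
      using k coeff_qcol_above[OF G j, of k l] by (simp add: coeff_oc_monom)
    then have "coeff P k = (if k = a then coeff ?Q a * v a ^ (p ^ a)
        + (\<Sum>i\<in>JW. coeff (W i) (\<nu>W i) * v i ^ (p ^ \<nu>W i)) else 0)"
      using c by (simp add: P_def coeff_sum)
    then show ?thesis using rel by simp
  qed
  then have degP: "degree P \<le> a - 1" using a by (intro degree_le) auto
  have yRR: "y \<in> RR" using y by (rule Rd_RR)
  have "y \<in> RR" by (rule yRR)
  obtain u \<rho> where u: "u \<in> RR" "\<rho> \<in> Rd (degree (v a))" "y = to_fract (v a) * u + \<rho>"
    using RR_division[OF v(1) yRR] by blast
  have \<rho>: "\<rho> \<in> Rd ?h" using u(2) v(2)[of a] Rd_monoD by blast
  have "to_fract (v a) * u = y - \<rho>" by (simp add: u(3))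
  also have "\<dots> \<in> Rd (e + ?h)" by (intro Rd_diff) (rule Rd_monoD[OF y], simp, rule Rd_monoD[OF \<rho>], simp)
  finally have "u \<in> Rd (e + ?h + degree (v a))" by (rule Rd_cancel[OF v(1) u(1)])
  moreover have "degree (v a) \<le> ?h" using v(2)[of a] by simp
  ultimately have ub: "u \<in> Rd (e + 2 * ?h)" by (elim Rd_monoD) linarith
  define x where "x i = - (to_fract (v i) * u ^ (p ^ (a - \<nu>W i)))" for i
  have "ev P u = ev ?Q (to_fract (v a) * u) - (\<Sum>i\<in>JW. ev (W i) (x i))"
    by (simp add: P_def ev_add ev_sum ev_oc ev_monom m_def x_def ev_x_uminus sum_negf)
  then have "ev ?Q y - (\<Sum>i\<in>JW. ev (W i) (x i)) = ev P u + ev ?Q \<rho>"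
    by (simp add: u(3) ev_x_add)
  also have "\<dots> \<in> Rd (hoc ?H + p ^ (a - 1) * e)"
  proof (rule Rd_add)
    have "ev P u \<in> Rd (?H + p ^ (a - 1) * (e + 2 * ?h))"
      using oszP ub by (intro ev_Rd_degree[OF degP]) (auto simp: osz_def)
    moreover have "?H + p ^ (a - 1) * (e + 2 * ?h) \<le> hoc ?H + p ^ (a - 1) * e"
    proof -
      have "p ^ (a - 1) * (p * ?h) \<le> p ^ ?H * ?H"
      proof -
        have "p ^ (a - 1) * (p * ?h) = p ^ Suc (a - 1) * ?h" by simp
        also have "\<dots> \<le> p ^ ?H * ?H" using h a by (intro mult_le_mono p_power_le) auto
        finally show ?thesis .
      qed
      moreover have "p ^ (a - 1) * (2 * ?h) \<le> p ^ (a - 1) * (p * ?h)"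
        using p_ge_2 by (intro mult_le_mono2 mult_le_mono1)
      ultimately have "p ^ (a - 1) * (2 * ?h) \<le> ?H * p ^ ?H" by (simp only: mult.commute[of ?H])
      then show ?thesis unfolding hoc_def distrib_left by linarith
    qed
    ultimately show "ev P u \<in> Rd (hoc ?H + p ^ (a - 1) * e)" by (rule Rd_monoD)
    have "ev ?Q \<rho> \<in> Rd (hoc ?H)"
      by (rule ev_Rd_hoc[OF osz_mono[OF osz_qcol[OF G j l] order_trans[OF h(1,3)]] Rd_monoD[OF \<rho> h(3)]])
    then show "ev ?Q \<rho> \<in> Rd (hoc ?H + p ^ (a - 1) * e)" by (rule Rd_monoD) simp
  qed
  finally have "ev ?Q y - (\<Sum>i\<in>JW. ev (W i) (x i)) \<in> Rd (hoc ?H + p ^ (a - 1) * e)" .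
  moreover have "\<forall>i\<in>JW. x i \<in> RR" using u(1) by (auto simp: x_def intro!: RR_uminus RR_mult RR_power)
  ultimately show ?thesis by blast
qed

definition hC :: "nat \<Rightarrow> nat" where
  "hC a = hoc (hs a) + (a + htb a + p ^ a) + a"

definition hidx :: "nat \<Rightarrow> nat" where
  "hidx n = (let a = hpar n in Suc (2 * hC a) + hoc (hq a + (Suc (a + htb (hinc (hq a))) + n)))"

lemma CB_hC: "hC \<in> CB"
proof -
  have "(\<lambda>a. hoc (hs a)) \<in> CB" by (rule CB_comp[OF CB_hoc CB_hs])
  then have "(\<lambda>a. hoc (hs a) + (a + htb a + p ^ a) + a) \<in> CB"
    by (intro CB_add CB_id CB_htb CB_power p_ge_2)
  then show ?thesis by (simp add: hC_def[abs_def])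
qed

lemma CB_hidx: "hidx \<in> CB"
proof -
  have 1: "(\<lambda>n. Suc (2 * hC (hpar n))) \<in> CB"
    using CB_comp[OF CB_hC CB_hpar] by (intro CB_Suc CB_mult_const) simp_all
  have "(\<lambda>n. htb (hinc (hq (hpar n)))) \<in> CB"
    by (rule CB_comp[OF CB_htb CB_comp[OF CB_hinc CB_comp[OF CB_hq CB_hpar]]])
  then have "(\<lambda>n. hq (hpar n) + (Suc (hpar n + htb (hinc (hq (hpar n)))) + n)) \<in> CB"
    by (intro CB_add CB_Suc CB_id CB_hpar CB_comp[OF CB_hq CB_hpar])
  from CB_add[OF 1 CB_comp[OF CB_hoc this]] show ?thesis by (simp add: hidx_def[abs_def] Let_def)
qed

text \<open>If some component of a column of G is independent of K, it serves as Q. If all are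
  dependent, every component can be lowered modulo K by \<open>dependent_component\<close>, and
  since p \<ge> 2 an element of G is moved to about half its size; this is iterated.\<close>

lemma index_alternative_par:
  assumes K: "par a K JW W \<nu>W" and G: "par a G J U \<nu>" and a: "a \<ge> 1"
    and sub: "K \<subseteq> G" "0 \<in> K" "\<And>x y. x \<in> K \<Longrightarrow> y \<in> K \<Longrightarrow> x - y \<in> K"
    "\<And>x y. x \<in> G \<Longrightarrow> y \<in> G \<Longrightarrow> x - y \<in> G" "G \<subseteq> RR"
  shows "(\<forall>g\<in>G. \<exists>k\<in>K. g - k \<in> Rd (Suc (2 * hC a))) \<or>
    (\<exists>Q. osz (hq a) Q \<and> (\<forall>y\<in>RR. ev Q y \<in> G) \<and> (\<forall>y\<in>RR. ev Q y \<in> K \<longrightarrow> y \<in> Rd (a + htb (hinc (hq a)))))"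
proof (cases "\<exists>j\<in>J. \<exists>l<p ^ (a - \<nu> j). TI 1 (\<lambda>_. W(a := qcol a U \<nu> j l)) (insert a JW) (\<nu>W(a := a)) (hinc (hq a))")
  case True
  then obtain j l where jl: "j \<in> J" "l < p ^ (a - \<nu> j)"
    "TI 1 (\<lambda>_. W(a := qcol a U \<nu> j l)) (insert a JW) (\<nu>W(a := a)) (hinc (hq a))" by blast
  have "ev (qcol a U \<nu> j l) y \<in> G" if "y \<in> RR" for y
  proof -
    have "to_fract (monom 1 l) * y ^ (p ^ (a - \<nu> j)) \<in> RR" using that by (intro RR_mult RR_power RR_tf)
    then show ?thesis unfolding ev_qcol using G jl(1) unfolding par_def by blast
  qed
  moreover have "osz (hq a) (qcol a U \<nu> j l)" by (rule osz_qcol[OF G jl(1,2)])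
  moreover note independent_component[OF K G jl]
  ultimately show ?thesis by blast
next
  case False
  have JW: "JW \<subseteq> {..<a}" "finite JW" using K by (auto simp: par_def intro: finite_subset)
  then have aJ: "a \<notin> JW" by auto
  have finJ: "finite J" using G by (auto simp: par_def intro: finite_subset)
  have aq: "a \<le> hq a" by (rule CB_ge[OF CB_hq])
  have syz: "\<exists>v. syz 1 (\<lambda>_. W(a := qcol a U \<nu> j l)) (insert a JW) (\<nu>W(a := a)) (hinc (hq a)) a v"
    if jl: "j \<in> J" "l < p ^ (a - \<nu> j)" for j l
  proof -
    let ?Q = "qcol a U \<nu> j l"
    have W: "\<nu>W i \<le> a" "osz a (W i)" if "i \<in> JW" for i using K that by (auto simp: par_def)
    have "TI 1 (\<lambda>_. W) JW \<nu>W a" using K by (simp add: par_def)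
    moreover have "(\<Sum>j\<in>JW. to_fract (coeff ((W(a := ?Q)) j) ((\<nu>W(a := a)) j)) * x j ^ (p ^ (\<nu>W(a := a)) j))
        = (\<Sum>j\<in>JW. to_fract (coeff (W j) (\<nu>W j)) * x j ^ (p ^ \<nu>W j))" for x
      using aJ by (intro sum.cong) auto
    moreover have "(\<nu>W(a := a)) j = \<nu>W j" if "j \<in> JW" for j using aJ that by auto
    ultimately have TI: "TI 1 (\<lambda>_. W(a := ?Q)) JW (\<nu>W(a := a)) a" unfolding TI_def by simp
    have "TI 1 (\<lambda>_. W(a := ?Q)) (insert a JW) (\<nu>W(a := a)) (hinc (hq a)) \<or>
        (\<exists>v. syz 1 (\<lambda>_. W(a := ?Q)) (insert a JW) (\<nu>W(a := a)) (hinc (hq a)) a v)"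
    proof (rule TI_insert[OF JW(2) aJ _ _ _ _ TI])
      show "(\<nu>W(a := a)) i \<le> (\<nu>W(a := a)) a" if "i \<in> JW" for i using W[OF that] by simp
      show "(\<nu>W(a := a)) a \<le> hq a" using aq by simp
      have "card JW \<le> a" using card_mono[OF _ JW(1)] by simp
      then show "card JW \<le> hq a" using aq by simp
      show "osz (hq a) ((W(a := ?Q)) i)" if "i \<in> insert a JW" for i
        using that W(2) osz_mono[OF _ aq] osz_qcol[OF G jl] by auto
    qed
    then show ?thesis using False jl by blast
  qed
  have U: "\<nu> j \<le> a" "osz a (U j)" "\<And>k. \<nu> j < k \<Longrightarrow> coeff (U j) k = 0" "\<And>y. y \<in> RR \<Longrightarrow> ev (U j) y \<in> G"
    if "j \<in> J" for j using G that by (auto simp: par_def)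
  have WK: "ev (W i) y \<in> K" if "i \<in> JW" "y \<in> RR" for i y using K that by (auto simp: par_def)
  have K_add: "x + y \<in> K" if "x \<in> K" "y \<in> K" for x y
    using sub(3)[OF that(1) sub(3)[OF sub(2) that(2)]] by simp
  have K_sum: "sum f A \<in> K" if "\<And>i. i \<in> A \<Longrightarrow> f i \<in> K" for f and A :: "nat set"
    using that by (induction A rule: infinite_finite_induct) (auto simp: sub(2) K_add)
  have K_sum': "sum f A \<in> K" if "\<And>i. i \<in> A \<Longrightarrow> f i \<in> K" for f and A :: "(nat \<times> nat) set"
    using that by (induction A rule: infinite_finite_induct) (auto simp: sub(2) K_add)
  have step: "\<exists>k\<in>K. g - k \<in> Rd (d div 2 + hC a)" if g: "g \<in> G" "g \<in> Rd d" for g d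
  proof -
    obtain y where y: "\<forall>j\<in>J. y j \<in> RR" "g - (\<Sum>j\<in>J. ev (U j) (y j)) \<in> Rd a"
      using G g(1) by (auto simp: par_def)
    define E where "E = d + a + htb a"
    define e where "e = E div p ^ a + 1"
    have "E = p ^ a * (E div p ^ a) + E mod p ^ a" "E mod p ^ a < p ^ a" by simp_all
    then have "E \<le> p ^ a * (E div p ^ a) + p ^ a" by linarith
    then have Ee: "E \<le> p ^ a * e" by (simp add: e_def)
    have Ub: "(\<Sum>j\<in>J. ev (U j) (y j)) \<in> Rd (d + a)"
    proof -
      have "g - (g - (\<Sum>j\<in>J. ev (U j) (y j))) \<in> Rd (d + a)"
        by (rule Rd_diff) (rule Rd_monoD[OF g(2)], simp, rule Rd_monoD[OF y(2)], simp)
      then show ?thesis by simp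
    qed
    have TIU: "TI 1 (\<lambda>_. U) J \<nu> a" using G by (simp add: par_def)
    have yp: "y j ^ (p ^ \<nu> j) \<in> Rd E" if j: "j \<in> J" for j
      unfolding E_def by (rule TI_bounded[OF TIU finJ _ _ _ _ _ j]) (use U y(1) Ub in auto)
    have "y j \<in> Rd (p ^ (a - \<nu> j) * e)" if j: "j \<in> J" for j
    proof (rule Rd_pth_root)
      show "y j \<in> RR" using y(1) j by blast
      have "p ^ \<nu> j * (p ^ (a - \<nu> j) * e) = p ^ a * e"
        using U(1)[OF j] by (simp add: mult.assoc[symmetric] power_add[symmetric])
      then show "y j ^ (p ^ \<nu> j) \<in> Rd (p ^ \<nu> j * (p ^ (a - \<nu> j) * e))"
        using Rd_monoD[OF yp[OF j] Ee] by (simp only:)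
    qed
    then have "\<forall>j\<in>J. \<exists>w. (\<forall>l<p ^ (a - \<nu> j). w l \<in> Rd e) \<and>
        y j = (\<Sum>l<p ^ (a - \<nu> j). to_fract (monom 1 l) * w l ^ (p ^ (a - \<nu> j)))"
      using Rd_components by blast
    from bchoice[OF this] obtain w where w: "\<forall>j\<in>J. (\<forall>l<p ^ (a - \<nu> j). w j l \<in> Rd e) \<and>
        y j = (\<Sum>l<p ^ (a - \<nu> j). to_fract (monom 1 l) * w j l ^ (p ^ (a - \<nu> j)))" ..
    define C where "C = Sigma J (\<lambda>j. {..<p ^ (a - \<nu> j)})"
    let ?B = "hoc (hs a) + p ^ (a - 1) * e"
    have "ev (U j) (y j) = (\<Sum>l<p ^ (a - \<nu> j). ev (qcol a U \<nu> j l) (w j l))" if "j \<in> J" for j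
    proof -
      have "ev (U j) (y j) = ev (U j) (\<Sum>l<p ^ (a - \<nu> j). to_fract (monom 1 l) * w j l ^ (p ^ (a - \<nu> j)))"
        using w that by (intro arg_cong[of _ _ "ev (U j)"]) blast
      then show ?thesis by (simp only: ev_x_sum ev_qcol)
    qed
    then have Usum: "(\<Sum>j\<in>J. ev (U j) (y j)) = (\<Sum>(j, l)\<in>C. ev (qcol a U \<nu> j l) (w j l))"
      unfolding C_def using finJ by (simp add: sum.Sigma)
    have "\<forall>jl\<in>C. \<exists>k\<in>K. ev (qcol a U \<nu> (fst jl) (snd jl)) (w (fst jl) (snd jl)) - k \<in> Rd ?B"
    proof
      fix jl assume "jl \<in> C"
      then have jl: "fst jl \<in> J" "snd jl < p ^ (a - \<nu> (fst jl))" by (auto simp: C_def)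
      obtain v where v: "syz 1 (\<lambda>_. W(a := qcol a U \<nu> (fst jl) (snd jl))) (insert a JW) (\<nu>W(a := a)) (hinc (hq a)) a v"
        using syz[OF jl] by blast
      have "w (fst jl) (snd jl) \<in> Rd e" using w jl by blast
      from dependent_component[OF K G jl v this a] obtain x where x: "\<forall>i\<in>JW. x i \<in> RR"
        "ev (qcol a U \<nu> (fst jl) (snd jl)) (w (fst jl) (snd jl)) - (\<Sum>i\<in>JW. ev (W i) (x i)) \<in> Rd ?B" by blast
      have "(\<Sum>i\<in>JW. ev (W i) (x i)) \<in> K" using x(1) by (intro K_sum WK) auto
      then show "\<exists>k\<in>K. ev (qcol a U \<nu> (fst jl) (snd jl)) (w (fst jl) (snd jl)) - k \<in> Rd ?B"
        using x(2) by blast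
    qed
    from bchoice[OF this[unfolded Bex_def]] obtain k where k: "\<forall>jl\<in>C. k jl \<in> K \<and>
        ev (qcol a U \<nu> (fst jl) (snd jl)) (w (fst jl) (snd jl)) - k jl \<in> Rd ?B" ..
    have "g - sum k C = (g - (\<Sum>j\<in>J. ev (U j) (y j)))
        + (\<Sum>jl\<in>C. ev (qcol a U \<nu> (fst jl) (snd jl)) (w (fst jl) (snd jl)) - k jl)"
      unfolding Usum sum_subtractf by (simp add: case_prod_unfold)
    also have "\<dots> \<in> Rd (?B + a)"
    proof (rule Rd_add)
      show "g - (\<Sum>j\<in>J. ev (U j) (y j)) \<in> Rd (?B + a)" by (rule Rd_monoD[OF y(2)]) simp
      have "(\<Sum>jl\<in>C. ev (qcol a U \<nu> (fst jl) (snd jl)) (w (fst jl) (snd jl)) - k jl) \<in> Rd ?B"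
        using k by (intro Rd_sum) blast
      then show "(\<Sum>jl\<in>C. ev (qcol a U \<nu> (fst jl) (snd jl)) (w (fst jl) (snd jl)) - k jl) \<in> Rd (?B + a)"
        by (rule Rd_monoD) simp
    qed
    finally have "g - sum k C \<in> Rd (d div 2 + hC a)"
    proof (rule Rd_monoD)
      let ?f = "E div p ^ a"
      have "2 * (p ^ (a - 1) * ?f) \<le> p * (p ^ (a - 1) * ?f)" using p_ge_2 by (rule mult_le_mono1)
      also have "\<dots> = p ^ Suc (a - 1) * ?f" by simp
      also have "\<dots> = p ^ a * ?f" using a by simp
      also have "\<dots> \<le> E" by simp
      finally have "p ^ (a - 1) * ?f \<le> E div 2" by simp
      moreover have "E div 2 \<le> d div 2 + (a + htb a)" unfolding E_def by linarith
      moreover have "p ^ (a - 1) \<le> p ^ a" by (rule p_power_le) simp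
      ultimately show "?B + a \<le> d div 2 + hC a" by (simp add: e_def hC_def)
    qed
    moreover have "sum k C \<in> K" using k by (intro K_sum') blast
    ultimately show ?thesis by blast
  qed
  \<comment> \<open>\<open>d div 2 + hC a\<close> is smaller than d as soon as d exceeds
    \<open>Suc (2 * hC a)\<close>, where the descent stops.\<close>
  have "\<exists>k\<in>K. g - k \<in> Rd (Suc (2 * hC a))" if "g \<in> G" "g \<in> Rd d" for g d
    using that
  proof (induction d arbitrary: g rule: less_induct)
    case (less d)
    show ?case
    proof (cases "d \<le> Suc (2 * hC a)")
      case True
      then show ?thesis using less.prems(2) sub(2) Rd_monoD by (intro bexI[of _ 0]) auto
    next
      case False
      obtain k where k: "k \<in> K" "g - k \<in> Rd (d div 2 + hC a)" using step[OF less.prems] by blast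
      have "d div 2 + hC a < d" using False by linarith
      moreover have "g - k \<in> G" using sub(1,4) less.prems(1) k(1) by blast
      ultimately obtain k' where k': "k' \<in> K" "g - k - k' \<in> Rd (Suc (2 * hC a))"
        using less.IH k(2) by blast
      then show ?thesis using K_add[OF k(1)] by (intro bexI[of _ "k + k'"]) (auto simp: diff_diff_add)
    qed
  qed
  then have "\<forall>g\<in>G. \<exists>k\<in>K. g - k \<in> Rd (Suc (2 * hC a))" using sub(5) by (blast elim: RRE)
  then show ?thesis ..
qed

text \<open>In the second case Q is evaluated at powers of z beyond the bound on the preimage of K:
  a difference of two of them has too large a degree to lie in it. The first case does not assert
  finite index, as \<open>Rd (hidx t)\<close> may be infinite.\<close>

lemma index_alternative:
  assumes G: "G \<in> PP t" and K: "K \<in> PP t" and i: "i < t" and sub: "fib0 i K \<subseteq> fib0 i G"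
  shows "(\<forall>g\<in>fib0 i G. \<exists>k\<in>fib0 i K. g - k \<in> Rd (hidx t)) \<or>
    (\<forall>b. \<exists>g. (\<forall>m\<le>b. g m \<in> fib0 i G \<inter> Rd (hidx (t + b))) \<and> (\<forall>m\<le>b. \<forall>n<m. g m - g n \<notin> fib0 i K))"
proof -
  obtain J U \<nu> where pG: "par (hpar t) (fib0 i G) J U \<nu>" using fibre_parametrization[OF G i] by blast
  obtain JW W \<nu>W where pK: "par (hpar t) (fib0 i K) JW W \<nu>W" using fibre_parametrization[OF K i] by blast
  let ?a = "hpar t"
  have a: "?a \<ge> 1" using CB_ge[OF CB_hpar, of t] i by linarith
  from index_alternative_par[OF pK pG a sub fib0_0[OF K] fib0_diff[OF K] fib0_diff[OF G] fib0_RR]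
  consider (1) "\<forall>g\<in>fib0 i G. \<exists>k\<in>fib0 i K. g - k \<in> Rd (Suc (2 * hC ?a))"
    | (2) Q where "osz (hq ?a) Q" "\<forall>y\<in>RR. ev Q y \<in> fib0 i G"
      "\<forall>y\<in>RR. ev Q y \<in> fib0 i K \<longrightarrow> y \<in> Rd (?a + htb (hinc (hq ?a)))"
    by blast
  then show ?thesis
  proof cases
    case 1
    have "Suc (2 * hC ?a) \<le> hidx t" by (simp add: hidx_def Let_def)
    then have "\<forall>g\<in>fib0 i G. \<exists>k\<in>fib0 i K. g - k \<in> Rd (hidx t)" using 1 Rd_monoD by blast
    then show ?thesis ..
  next
    case 2
    let ?e = "?a + htb (hinc (hq ?a))"
    have "\<exists>g. (\<forall>m\<le>b. g m \<in> fib0 i G \<inter> Rd (hidx (t + b))) \<and> (\<forall>m\<le>b. \<forall>n<m. g m - g n \<notin> fib0 i K)" for b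
    proof (intro exI[of _ "\<lambda>m. ev Q (to_fract (monom 1 (Suc ?e + m)))"] conjI allI impI)
      fix m assume m: "m \<le> b"
      let ?a' = "hpar (t + b)"
      let ?n = "hq ?a' + (Suc (?a' + htb (hinc (hq ?a'))) + (t + b))"
      have aa: "?a \<le> ?a'" by (rule CB_mono[OF CB_hpar]) simp
      have qq: "hq ?a \<le> hq ?a'" by (rule CB_mono[OF CB_hq aa])
      have ee: "htb (hinc (hq ?a)) \<le> htb (hinc (hq ?a'))"
        by (rule CB_mono[OF CB_htb CB_mono[OF CB_hinc qq]])
      have "osz ?n Q" by (rule osz_mono[OF 2(1)]) (use qq in simp)
      moreover have "to_fract (monom 1 (Suc ?e + m)) \<in> Rd ?n"
        unfolding z_power_Rd using aa ee m by simp
      ultimately have "ev Q (to_fract (monom 1 (Suc ?e + m))) \<in> Rd (hoc ?n)" by (rule ev_Rd_hoc)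
      then have "ev Q (to_fract (monom 1 (Suc ?e + m))) \<in> Rd (hidx (t + b))"
        by (rule Rd_monoD) (simp add: hidx_def Let_def)
      then show "ev Q (to_fract (monom 1 (Suc ?e + m))) \<in> fib0 i G \<inter> Rd (hidx (t + b))" using 2(2) by simp
      fix n assume n: "n < m"
      show "ev Q (to_fract (monom 1 (Suc ?e + m))) - ev Q (to_fract (monom 1 (Suc ?e + n))) \<notin> fib0 i K"
      proof
        let ?f = "monom 1 (Suc ?e + m) - monom 1 (Suc ?e + n) :: 'a poly"
        assume "ev Q (to_fract (monom 1 (Suc ?e + m))) - ev Q (to_fract (monom 1 (Suc ?e + n))) \<in> fib0 i K"
        then have "ev Q (to_fract ?f) \<in> fib0 i K" by (simp only: to_fract_diff ev_x_diff)
        then have "to_fract ?f \<in> Rd ?e" using 2(3) RR_tf by blast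
        then have "degree ?f \<le> ?e" by (rule Rd_tf_degree)
        moreover have "coeff ?f (Suc ?e + m) = 1" using n by simp
        ultimately show False by (metis add_leD1 coeff_eq_0 le_imp_less_Suc less_le_trans le_add1 zero_neq_one)
      qed
    qed
    then show ?thesis by blast
  qed
qed

end

section \<open>Cosets in abelian groups\<close>

definition sg :: "'b::ab_group_add set \<Rightarrow> bool" where
  "sg A \<longleftrightarrow> 0 \<in> A \<and> (\<forall>x\<in>A. \<forall>y\<in>A. x - y \<in> A)"

definition coset :: "'b::ab_group_add set \<Rightarrow> 'b \<Rightarrow> 'b set" where
  "coset K g = (\<lambda>k. g + k) ` K"

definition fi :: "'b::ab_group_add set \<Rightarrow> 'b set \<Rightarrow> bool" where
  "fi G K \<longleftrightarrow> finite (coset K ` G)"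

lemma sg_0: "sg A \<Longrightarrow> 0 \<in> A" and sg_diff: "sg A \<Longrightarrow> x \<in> A \<Longrightarrow> y \<in> A \<Longrightarrow> x - y \<in> A"
  by (auto simp: sg_def)

lemma sg_uminus: "sg A \<Longrightarrow> x \<in> A \<Longrightarrow> - x \<in> A"
proof -
  assume A: "sg A" and x: "x \<in> A"
  have "0 - x \<in> A" by (rule sg_diff[OF A sg_0[OF A] x])
  then show ?thesis by simp
qed

lemma sg_add: "sg A \<Longrightarrow> x \<in> A \<Longrightarrow> y \<in> A \<Longrightarrow> x + y \<in> A"
proof -
  assume A: "sg A" and xy: "x \<in> A" "y \<in> A"
  have "x - (- y) \<in> A" by (rule sg_diff[OF A xy(1) sg_uminus[OF A xy(2)]])
  then show ?thesis by simp
qed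

lemma sg_Int: "sg A \<Longrightarrow> sg B \<Longrightarrow> sg (A \<inter> B)"
  by (auto simp: sg_def)

lemma coset_eq:
  assumes "sg K"
  shows "coset K g = coset K h \<longleftrightarrow> g - h \<in> K"
proof
  assume "coset K g = coset K h"
  moreover have "g \<in> coset K g" using sg_0[OF assms] by (force simp: coset_def)
  ultimately obtain k where "k \<in> K" "g = h + k" by (auto simp: coset_def)
  then show "g - h \<in> K" by simp
next
  assume gh: "g - h \<in> K"
  have "coset K a \<subseteq> coset K b" if "a - b \<in> K" for a b
  proof
    fix z assume "z \<in> coset K a"
    then obtain k where "k \<in> K" "z = a + k" by (auto simp: coset_def)
    then have z: "z = b + ((a - b) + k)" "(a - b) + k \<in> K" using sg_add[OF assms that] by auto
    show "z \<in> coset K b" unfolding coset_def by (rule image_eqI[where x = "(a - b) + k"]) (use z in simp_all)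
  qed
  moreover have "h - g \<in> K" using sg_uminus[OF assms gh] by simp
  ultimately show "coset K g = coset K h" using gh by blast
qed

lemma coset_add: "coset K (a + g) = (\<lambda>z. a + z) ` coset K g"
  by (auto simp: coset_def image_image add.assoc)

lemma finite_image_factor:
  assumes "finite (h ` G)" "\<And>x y. x \<in> G \<Longrightarrow> y \<in> G \<Longrightarrow> h x = h y \<Longrightarrow> f x = f y"
  shows "finite (f ` G)"
proof (rule finite_subset)
  show "f ` G \<subseteq> (\<lambda>z. f (SOME g. g \<in> G \<and> h g = z)) ` (h ` G)"
  proof
    fix v assume "v \<in> f ` G"
    then obtain x where x: "x \<in> G" "v = f x" by blast
    define y where "y = (SOME g. g \<in> G \<and> h g = h x)"
    have "y \<in> G \<and> h y = h x"
      unfolding y_def by (rule someI[of _ x]) (use x in simp)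
    then have "v = f y" using assms(2)[of y x] x by simp
    then show "v \<in> (\<lambda>z. f (SOME g. g \<in> G \<and> h g = z)) ` (h ` G)"
      using x(1) by (intro image_eqI[where x = "h x"]) (simp_all add: y_def)
  qed
qed (use assms(1) in blast)

lemma fi_Int:
  assumes "sg K1" "sg K2" "fi G K1" "fi G K2"
  shows "fi G (K1 \<inter> K2)"
  unfolding fi_def
proof (rule finite_image_factor[where h = "\<lambda>g. (coset K1 g, coset K2 g)"])
  show "finite ((\<lambda>g. (coset K1 g, coset K2 g)) ` G)"
    by (rule finite_subset[of _ "coset K1 ` G \<times> coset K2 ` G"]) (use assms in \<open>auto simp: fi_def\<close>)
qed (use assms sg_Int[OF assms(1,2)] in \<open>auto simp: coset_eq\<close>)

lemma fi_mono:
  assumes "sg K" "sg K'" "K \<subseteq> K'" "fi G K"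
  shows "fi G K'"
  unfolding fi_def
  by (rule finite_image_factor[OF assms(4)[unfolded fi_def]]) (use assms in \<open>auto simp: coset_eq\<close>)

lemma fi_refl: "sg G \<Longrightarrow> fi G G"
  unfolding fi_def
proof (rule finite_subset)
  assume "sg G"
  then have "coset G x = coset G 0" if "x \<in> G" for x using coset_eq[of G x 0] that by simp
  then show "coset G ` G \<subseteq> {coset G 0}" by blast
qed simp

lemma fi_trans:
  assumes "sg G" "sg K" "sg L" "L \<subseteq> K" "K \<subseteq> G" "fi G K" "fi K L"
  shows "fi G L"
proof -
  define r where "r C = (SOME g. g \<in> G \<and> coset K g = C)" for C
  have r: "r (coset K g) \<in> G \<and> coset K (r (coset K g)) = coset K g" if "g \<in> G" for g
    unfolding r_def by (rule someI[of _ g]) (use that in simp)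
  have "coset L ` G \<subseteq> (\<lambda>(C, E). (\<lambda>z. r C + z) ` E) ` (coset K ` G \<times> coset L ` K)"
  proof
    fix v assume "v \<in> coset L ` G"
    then obtain g where g: "g \<in> G" "v = coset L g" by blast
    have "g - r (coset K g) \<in> K" using r[OF g(1)] coset_eq[OF assms(2), of g "r (coset K g)"] by simp
    moreover have "v = (\<lambda>z. r (coset K g) + z) ` coset L (g - r (coset K g))"
      using coset_add[of L "r (coset K g)" "g - r (coset K g)"] g(2) by simp
    ultimately show "v \<in> (\<lambda>(C, E). (\<lambda>z. r C + z) ` E) ` (coset K ` G \<times> coset L ` K)"
      using g(1) by (intro image_eqI[of _ _ "(coset K g, coset L (g - r (coset K g)))"]) auto
  qed
  then show ?thesis
    unfolding fi_def by (rule finite_subset) (use assms(6,7) in \<open>auto simp: fi_def\<close>)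
qed

lemma incongruent_not_fi:
  assumes "sg K" "\<And>b. \<exists>g::nat \<Rightarrow> 'b::ab_group_add. (\<forall>m\<le>b. g m \<in> G) \<and> (\<forall>m\<le>b. \<forall>n<m. g m - g n \<notin> K)"
  shows "\<not> fi G K"
proof
  assume fin: "fi G K"
  obtain g :: "nat \<Rightarrow> 'b" where g: "\<forall>m\<le>card (coset K ` G). g m \<in> G"
    "\<forall>m\<le>card (coset K ` G). \<forall>n<m. g m - g n \<notin> K"
    using assms(2)[of "card (coset K ` G)"] by blast
  let ?c = "card (coset K ` G)"
  have "inj_on (\<lambda>m. coset K (g m)) {..?c}"
  proof (rule inj_onI)
    fix m n assume mn: "m \<in> {..?c}" "n \<in> {..?c}" "coset K (g m) = coset K (g n)"
    show "m = n"
    proof (rule ccontr)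
      assume "m \<noteq> n"
      then consider "n < m" | "m < n" by linarith
      then show False
      proof cases
        case 1
        then show False using mn g(2) coset_eq[OF assms(1), of "g m" "g n"] by simp
      next
        case 2
        then show False using mn g(2) coset_eq[OF assms(1), of "g n" "g m"] by simp
      qed
    qed
  qed
  then have "card ((\<lambda>m. coset K (g m)) ` {..?c}) = Suc ?c" by (simp add: card_image)
  moreover have "(\<lambda>m. coset K (g m)) ` {..?c} \<subseteq> coset K ` G" using g(1) by auto
  ultimately have "Suc ?c \<le> ?c" using card_mono[OF fin[unfolded fi_def]] by metis
  then show False by simp
qed

lemma not_fi_incongruent:
  assumes "sg K" "\<not> fi G K"
  shows "\<exists>g::nat \<Rightarrow> 'b::ab_group_add. (\<forall>m. g m \<in> G) \<and> (\<forall>m n. n < m \<longrightarrow> g m - g n \<notin> K)"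
proof -
  obtain f :: "nat \<Rightarrow> 'b set" where f: "inj f" "range f \<subseteq> coset K ` G"
    using assms(2) infinite_countable_subset unfolding fi_def by blast
  then have "\<forall>m. \<exists>g. g \<in> G \<and> f m = coset K g" by blast
  then obtain g where g: "\<forall>m. g m \<in> G \<and> f m = coset K (g m)" by metis
  have "g m - g n \<notin> K" if "n < m" for m n
  proof
    assume "g m - g n \<in> K"
    then have "f m = f n" using g coset_eq[OF assms(1)] by metis
    then show False using f(1) that by (auto dest: injD)
  qed
  then show ?thesis using g by blast
qed

text \<open>Positive characteristic enters here: a new generator has additive order at most q, so
  adjoining it multiplies the size by at most q.\<close>

lemma finite_subgroup:
  fixes A :: "'b::comm_ring_1 set"
  assumes "finite Y" "Y \<subseteq> A" "sg A" "of_nat q = (0::'b)" "q > 0"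
  shows "\<exists>X. finite X \<and> Y \<subseteq> X \<and> X \<subseteq> A \<and> sg X"
  using assms(1,2)
proof (induction Y rule: finite_induct)
  case empty
  have "sg {0::'b}" by (simp add: sg_def)
  then show ?case using sg_0[OF assms(3)] by (intro exI[of _ "{0}"]) auto
next
  case (insert y Y)
  then obtain X where X: "finite X" "Y \<subseteq> X" "X \<subseteq> A" "sg X" by auto
  define Z where "Z = (\<lambda>(x, n). x + of_nat n * y) ` (X \<times> {..<q})"
  have mult: "of_nat n * y \<in> A" for n
    using insert.prems sg_0[OF assms(3)] sg_add[OF assms(3)] by (induction n) (auto simp: algebra_simps)
  have Zmod: "x + of_nat n * y \<in> Z" if "x \<in> X" for x n
  proof -
    have "of_nat n = (of_nat (n mod q) + of_nat q * of_nat (n div q) :: 'b)"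
      by (metis mod_mult_div_eq of_nat_add of_nat_mult)
    then have "of_nat n = (of_nat (n mod q) :: 'b)" using assms(4) by simp
    then have "x + of_nat n * y = (\<lambda>(x, n). x + of_nat n * y) (x, n mod q)" by (simp only: prod.case)
    moreover have "(x, n mod q) \<in> X \<times> {..<q}" using that assms(5) by simp
    ultimately show ?thesis unfolding Z_def by (rule image_eqI)
  qed
  have "sg Z"
    unfolding sg_def
  proof (intro conjI ballI)
    show "0 \<in> Z" using Zmod[OF sg_0[OF X(4)], of 0] by simp
    fix u v assume "u \<in> Z" "v \<in> Z"
    then obtain x n x' n' where uv: "x \<in> X" "u = x + of_nat n * y" "x' \<in> X" "n' < q" "v = x' + of_nat n' * y"
      by (auto simp: Z_def)
    have "of_nat (q - n') = (- of_nat n' :: 'b)" using uv(4) assms(4) by (simp add: of_nat_diff)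
    then have eq: "u - v = (x - x') + of_nat (n + (q - n')) * y" using uv by (simp add: algebra_simps)
    show "u - v \<in> Z" unfolding eq by (rule Zmod) (rule sg_diff[OF X(4) uv(1,3)])
  qed
  moreover have "finite Z" using X(1) by (simp add: Z_def)
  moreover have "insert y Y \<subseteq> Z"
    using Zmod[OF sg_0[OF X(4)], of 1] Zmod[of _ 0] X(2) by auto
  moreover have "Z \<subseteq> A" using X(3) mult sg_add[OF assms(3)] by (auto simp: Z_def)
  ultimately show ?case by blast
qed

text \<open>Count inside a finite subgroup containing enough representatives.\<close>

lemma avoid_cosets:
  fixes A :: "'b::comm_ring_1 set"
  assumes A: "sg A" "of_nat q = (0::'b)" "q > 0" and fin: "finite \<B>" "card \<B> \<le> b"
    and S: "\<And>H x y. H \<in> \<B> \<Longrightarrow> x \<in> S H \<Longrightarrow> y \<in> S H \<Longrightarrow> x - y \<in> L H"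
    and g: "\<And>H. H \<in> \<B> \<Longrightarrow> \<exists>g::nat \<Rightarrow> 'b. (\<forall>m\<le>b. g m \<in> A) \<and> (\<forall>m\<le>b. \<forall>n<m. g m - g n \<notin> L H)"
    and L: "\<And>H. H \<in> \<B> \<Longrightarrow> sg (L H)"
  shows "\<exists>x\<in>A. \<forall>H\<in>\<B>. x \<notin> S H"
proof -
  have "\<forall>H\<in>\<B>. \<exists>g. (\<forall>m\<le>b. g m \<in> A) \<and> (\<forall>m\<le>b. \<forall>n<m. g m - g n \<notin> L H)" using g by blast
  from bchoice[OF this] obtain g where g: "\<And>H m. H \<in> \<B> \<Longrightarrow> m \<le> b \<Longrightarrow> g H m \<in> A"
    "\<And>H m n. H \<in> \<B> \<Longrightarrow> m \<le> b \<Longrightarrow> n < m \<Longrightarrow> g H m - g H n \<notin> L H" by blast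
  define Y where "Y = (\<Union>H\<in>\<B>. g H ` {..b})"
  have "finite Y" "Y \<subseteq> A" using fin(1) g(1) by (auto simp: Y_def)
  from finite_subgroup[OF this A] obtain X where X: "finite X" "Y \<subseteq> X" "X \<subseteq> A" "sg X" by blast
  \<comment> \<open>The b + 1 translates of \<open>S H \<inter> X\<close> by the elements
    \<open>g H m\<close> are disjoint inside X. With at most b conditions, the sets
    \<open>S H\<close> therefore cannot cover X.\<close>
  have small: "Suc b * card (S H \<inter> X) \<le> card X" if H: "H \<in> \<B>" for H
  proof -
    define T where "T m = (\<lambda>x. x + g H m) ` (S H \<inter> X)" for m
    have gX: "g H m \<in> X" if "m \<le> b" for m using X(2) H that by (auto simp: Y_def)
    have disj: "T m \<inter> T n = {}" if mn: "m \<le> b" "n < m" for m n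
    proof (rule ccontr)
      assume "T m \<inter> T n \<noteq> {}"
      then obtain x y where xy: "x \<in> S H" "y \<in> S H" "x + g H m = y + g H n" by (auto simp: T_def)
      then have "g H m - g H n = y - x" by (simp add: algebra_simps)
      then show False using S[OF H xy(2,1)] g(2)[OF H mn] by simp
    qed
    have "T m \<inter> T n = {}" if "m \<le> b" "n \<le> b" "m \<noteq> n" for m n
      using disj[of m n] disj[of n m] that by (metis Int_commute linorder_neqE_nat)
    then have "card (\<Union>m\<le>b. T m) = (\<Sum>m\<le>b. card (T m))"
      using X(1) by (intro card_UN_disjoint) (auto simp: T_def)
    also have "\<dots> = (\<Sum>m\<le>b. card (S H \<inter> X))"
      unfolding T_def by (intro sum.cong refl card_image) (auto simp: inj_on_def)
    finally have "card (\<Union>m\<le>b. T m) = Suc b * card (S H \<inter> X)" by simp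
    moreover have "(\<Union>m\<le>b. T m) \<subseteq> X" using gX sg_add[OF X(4)] by (auto simp: T_def)
    ultimately show ?thesis using card_mono[OF X(1)] by metis
  qed
  have "card (\<Union>H\<in>\<B>. S H \<inter> X) \<le> (\<Sum>H\<in>\<B>. card (S H \<inter> X))" by (rule card_UN_le[OF fin(1)])
  then have "Suc b * card (\<Union>H\<in>\<B>. S H \<inter> X) \<le> (\<Sum>H\<in>\<B>. Suc b * card (S H \<inter> X))"
    using mult_le_mono2[of _ _ "Suc b"] by (simp only: sum_distrib_left[symmetric])
  also have "\<dots> \<le> (\<Sum>H\<in>\<B>. card X)" by (rule sum_mono) (rule small)
  also have "\<dots> \<le> b * card X" using fin(2) by simp
  also have "\<dots> < Suc b * card X" using X(1) sg_0[OF X(4)] card_gt_0_iff by auto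
  finally have "card (\<Union>H\<in>\<B>. S H \<inter> X) < card X" by (metis mult_less_cancel1)
  then have "(\<Union>H\<in>\<B>. S H \<inter> X) \<noteq> X" by auto
  then obtain x where "x \<in> X" "\<forall>H\<in>\<B>. x \<notin> S H" by blast
  then show ?thesis using X(3) by blast
qed

context frob_ring
begin

section \<open>Closure properties of positive primitive subgroups\<close>

lemma sum_split_add: "(\<Sum>j<t + u. f j) = (\<Sum>j<t. f j) + (\<Sum>j<u. f (t + j))" for u :: nat
  by (induction u) (simp_all add: add.assoc)

lemma PP_UNIV: "UNIV \<in> PP t"
proof -
  have z: "ap t (\<lambda>i j. 0) x i = 0" for x i by simp
  have "PPm t (\<lambda>i j. 0) (\<lambda>i j. 0) (\<lambda>i j. 0) = UNIV"
    unfolding PPm_def by (auto intro!: exI[of _ "\<lambda>_. 0"])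
  moreover have "msz t t t (\<lambda>i j. 0)" by (simp add: msz_def)
  ultimately show ?thesis unfolding PP_def by blast
qed

lemma PP_Int:
  assumes "G \<in> PP t" "H \<in> PP u"
  shows "G \<inter> H \<in> PP (t + u)"
proof -
  obtain B1 M1 N1 where 1: "G = PPm t B1 M1 N1" "msz t t t B1" "msz t t t M1" "msz t t t N1"
    using assms(1) by (auto simp: PP_def)
  obtain B2 M2 N2 where 2: "H = PPm u B2 M2 N2" "msz u u u B2" "msz u u u M2" "msz u u u N2"
    using assms(2) by (auto simp: PP_def)
  define B where "B i j = (if i < t then (if j < t then B1 i j else 0) else if j < u then B2 (i - t) j else 0)" for i j
  define dg where "dg M M' i j = (if i < t then (if j < t then M i j else 0) else if t \<le> j then M' (i - t) (j - t) else 0)"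
    for M M' :: "nat \<Rightarrow> nat \<Rightarrow> 'a poly poly" and i j
  have B1: "ap (t + u) B w i = ap t B1 w i" if "i < t" for w i
    unfolding sum_split_add using that by (simp add: B_def)
  have B2: "ap (t + u) B w (t + i) = ap u B2 w i" for w i
  proof -
    have "ap (u + t) B w (t + i) = ap u B2 w i" unfolding sum_split_add by (simp add: B_def)
    then show ?thesis by (simp add: add.commute)
  qed
  have dg1: "ap (t + u) (dg M M') x i = ap t M x i" if "i < t" for M M' x i
    unfolding sum_split_add using that by (simp add: dg_def)
  have dg2: "ap (t + u) (dg M M') x (t + i) = ap u M' (\<lambda>j. x (t + j)) i" for M M' x i
    unfolding sum_split_add by (simp add: dg_def)
  have "G \<inter> H = PPm (t + u) B (dg M1 M2) (dg N1 N2)"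
  proof (intro equalityI subsetI)
    fix w assume w: "w \<in> G \<inter> H"
    obtain \<xi> \<eta> where a: "\<forall>j<t. \<xi> j \<in> RR" "\<forall>j<t. \<eta> j \<in> Rd 0" "\<forall>i<t. ap t B1 w i + ap t M1 \<xi> i + ap t N1 \<eta> i = 0"
      using w unfolding 1 PPm_def by blast
    obtain \<xi>' \<eta>' where b: "\<forall>j<u. \<xi>' j \<in> RR" "\<forall>j<u. \<eta>' j \<in> Rd 0" "\<forall>i<u. ap u B2 w i + ap u M2 \<xi>' i + ap u N2 \<eta>' i = 0"
      using w unfolding 2 PPm_def by blast
    define X where "X j = (if j < t then \<xi> j else \<xi>' (j - t))" for j
    define E where "E j = (if j < t then \<eta> j else \<eta>' (j - t))" for j
    have X1: "ap t M X i = ap t M \<xi> i" "ap t M E i = ap t M \<eta> i" for M i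
      by (auto intro!: sum.cong simp: X_def E_def)
    have X2: "ap u M (\<lambda>j. X (t + j)) i = ap u M \<xi>' i" "ap u M (\<lambda>j. E (t + j)) i = ap u M \<eta>' i" for M i
      by (auto intro!: sum.cong simp: X_def E_def)
    have "ap (t + u) B w i + ap (t + u) (dg M1 M2) X i + ap (t + u) (dg N1 N2) E i = 0" if i: "i < t + u" for i
    proof (cases "i < t")
      case True
      then show ?thesis unfolding B1[OF True] dg1[OF True] X1 using a(3) by blast
    next
      case False
      then obtain k where k: "i = t + k" "k < u" using i by (metis add_less_cancel_left le_Suc_ex not_less)
      then show ?thesis unfolding k(1) B2 dg2 X2 using b(3) by blast
    qed
    moreover have "\<forall>j<t + u. X j \<in> RR" "\<forall>j<t + u. E j \<in> Rd 0"
      using a(1,2) b(1,2) by (auto simp: X_def E_def)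
    ultimately show "w \<in> PPm (t + u) B (dg M1 M2) (dg N1 N2)" unfolding PPm_def by blast
  next
    fix w assume "w \<in> PPm (t + u) B (dg M1 M2) (dg N1 N2)"
    then obtain X E where a: "\<forall>j<t + u. X j \<in> RR" "\<forall>j<t + u. E j \<in> Rd 0"
      "\<forall>i<t + u. ap (t + u) B w i + ap (t + u) (dg M1 M2) X i + ap (t + u) (dg N1 N2) E i = 0"
      unfolding PPm_def by blast
    have "ap t B1 w i + ap t M1 X i + ap t N1 E i = 0" if "i < t" for i
      using a(3)[rule_format, of i] that unfolding B1[OF that] dg1[OF that] by simp
    then have "w \<in> G" unfolding 1 PPm_def using a(1,2) by (intro CollectI exI[of _ X] exI[of _ E]) simp
    moreover have "ap u B2 w i + ap u M2 (\<lambda>j. X (t + j)) i + ap u N2 (\<lambda>j. E (t + j)) i = 0" if "i < u" for i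
      using a(3)[rule_format, of "t + i"] that unfolding B2 dg2 by simp
    then have "w \<in> H"
      unfolding 2 PPm_def using a(1,2)
      by (intro CollectI exI[of _ "\<lambda>j. X (t + j)"] exI[of _ "\<lambda>j. E (t + j)"]) simp
    ultimately show "w \<in> G \<inter> H" by blast
  qed
  moreover have tu: "osz (t + u) P" if "osz t P" for P by (rule osz_mono[OF that]) simp
  moreover have ut: "osz (t + u) P" if "osz u P" for P by (rule osz_mono[OF that]) simp
  have "msz (t + u) (t + u) (t + u) B"
    using 1(2) 2(2) by (auto simp: msz_def B_def intro: tu ut)
  moreover have "msz (t + u) (t + u) (t + u) (dg M M')" if "msz t t t M" "msz u u u M'" for M M'
    using that by (auto simp: msz_def dg_def intro: tu ut)
  ultimately show ?thesis unfolding PP_def using 1(3,4) 2(3,4) by blast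
qed

lemma PP_mono: "t \<le> u \<Longrightarrow> PP t \<subseteq> PP u"
proof
  fix G assume "t \<le> u" "G \<in> PP t"
  then show "G \<in> PP u" using PP_Int[OF _ PP_UNIV, of G t "u - t"] by simp
qed

lemma PP_Inter: "finite \<C> \<Longrightarrow> \<C> \<subseteq> PP t \<Longrightarrow> \<Inter>\<C> \<in> PP (card \<C> * t)"
proof (induction \<C> rule: finite_induct)
  case (insert G \<C>)
  then have "G \<inter> \<Inter>\<C> \<in> PP (t + card \<C> * t)" by (intro PP_Int) auto
  then show ?case using insert.hyps by simp
qed (simp add: PP_UNIV)

lemma PP_proj:
  assumes "G \<in> PP t" "i0 < t"
  shows "{w. \<exists>x\<in>RR. w(i0 := x) \<in> G} \<in> PP (Suc t)"
proof -
  obtain B M N where BMN: "G = PPm t B M N" "msz t t t B" "msz t t t M" "msz t t t N"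
    using assms(1) by (auto simp: PP_def)
  define B' where "B' i j = (if i < t \<and> j < t \<and> j \<noteq> i0 then B i j else 0)" for i j
  define M' where "M' i j = (if i < t then ext t i0 B M i j else 0)" for i j
  define N' where "N' i j = (if i < t \<and> j < t then N i j else 0)" for i j
  have B': "ap (Suc t) B' w i = ap t B (w(i0 := 0)) i" if "i < t" for w i
    using that by (auto simp: B'_def intro!: sum.cong)
  have M': "ap (Suc t) M' x i = ap t M x i + ev (B i i0) (x t)" if "i < t" for x i
    using that ap_ext[of t i0 B M i x] by (simp add: M'_def)
  have N': "ap (Suc t) N' x i = ap t N x i" if "i < t" for x i
    using that by (simp add: N'_def)
  have top: "ap (Suc t) B' w t + ap (Suc t) M' x t + ap (Suc t) N' y t = 0" for w x y
    by (simp only: B'_def M'_def N'_def less_irrefl if_False simp_thms ev_0 sum.neutral_const add_0)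
  have "{w. \<exists>x\<in>RR. w(i0 := x) \<in> G} = PPm (Suc t) B' M' N'"
  proof (intro equalityI subsetI)
    fix w assume "w \<in> {w. \<exists>x\<in>RR. w(i0 := x) \<in> G}"
    then obtain x where x: "x \<in> RR" "w(i0 := x) \<in> G" by blast
    have "w(i0 := x) \<in> PPm t B M N" using x(2) by (simp only: BMN(1))
    then obtain \<xi> \<eta> where a: "\<forall>j<t. \<xi> j \<in> RR" "\<forall>j<t. \<eta> j \<in> Rd 0"
      "\<forall>i<t. ap t B (w(i0 := x)) i + ap t M \<xi> i + ap t N \<eta> i = 0"
      unfolding PPm_def mem_Collect_eq by (elim exE conjE)
    have X: "ap t M (\<xi>(t := x)) i = ap t M \<xi> i" "ap t N (\<eta>(t := 0)) i = ap t N \<eta> i" for i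
      by (rule sum.cong, simp, simp)+
    have "ap (Suc t) B' w i + ap (Suc t) M' (\<xi>(t := x)) i + ap (Suc t) N' (\<eta>(t := 0)) i = 0" if i: "i < Suc t" for i
    proof (cases "i < t")
      case True
      have "ap t B (w(i0 := 0)) i + ev (B i i0) x + ap t M \<xi> i + ap t N \<eta> i = 0"
        using a(3)[rule_format, OF True] unfolding ap_upd[OF assms(2), where B = B and x = x and i = i] .
      then show ?thesis unfolding B'[OF True] M'[OF True] N'[OF True] X by (simp only: ac_simps fun_upd_same)
    next
      case False
      then have "i = t" using i by simp
      then show ?thesis using top by blast
    qed
    moreover have "\<forall>j<Suc t. (\<xi>(t := x)) j \<in> RR" "\<forall>j<Suc t. (\<eta>(t := 0)) j \<in> Rd 0"
      using a(1,2) x(1) by (simp_all add: less_Suc_eq)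
    ultimately show "w \<in> PPm (Suc t) B' M' N'" unfolding PPm_def by blast
  next
    fix w assume "w \<in> PPm (Suc t) B' M' N'"
    then obtain X E where a: "\<forall>j<Suc t. X j \<in> RR" "\<forall>j<Suc t. E j \<in> Rd 0"
      "\<forall>i<Suc t. ap (Suc t) B' w i + ap (Suc t) M' X i + ap (Suc t) N' E i = 0"
      unfolding PPm_def mem_Collect_eq by (elim exE conjE)
    have "ap t B (w(i0 := X t)) i + ap t M X i + ap t N E i = 0" if "i < t" for i
      using a(3)[rule_format, of i] that
      unfolding B'[OF that] M'[OF that] N'[OF that] ap_upd[OF assms(2), where B = B and x = "X t" and i = i]
      by (simp only: ac_simps less_SucI simp_thms)
    then have "w(i0 := X t) \<in> PPm t B M N"
      unfolding PPm_def using a(1,2) by (intro CollectI exI[of _ X] exI[of _ E] conjI allI impI) simp_all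
    then have "w(i0 := X t) \<in> G" by (simp only: BMN(1))
    then show "w \<in> {w. \<exists>x\<in>RR. w(i0 := x) \<in> G}" using a(1) by blast
  qed
  moreover have up: "osz (Suc t) P" if "osz t P" for P by (rule osz_mono[OF that]) simp
  have "msz (Suc t) (Suc t) (Suc t) B'" "msz (Suc t) (Suc t) (Suc t) N'"
    using BMN(2,4) by (auto simp: msz_def B'_def N'_def intro!: up)
  moreover have "msz (Suc t) (Suc t) (Suc t) M'"
    using msz_ext[OF BMN(2,3) assms(2)] by (auto simp: msz_def M'_def)
  ultimately show ?thesis unfolding PP_def by blast
qed

section \<open>There are few positive primitive subgroups of bounded size\<close>

lemma PF_coeff_of_nat:
  assumes "c \<in> (\<int> :: 'a set)"
  shows "\<exists>k<p. c = of_nat k"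
proof -
  obtain m where m: "c = of_int m" using assms by (auto elim: Ints_cases)
  have "of_int m = (of_int (m mod int p) + of_int (int p) * of_int (m div int p) :: 'a)"
    by (metis mod_mult_div_eq of_int_add of_int_mult)
  moreover have "of_int (int p) = (0::'a)" using of_nat_CHAR[where ?'a = 'a] by (simp add: char_p)
  ultimately have "c = of_int (m mod int p)" using m by simp
  also have "\<dots> = of_nat (nat (m mod int p))" using p_pos by simp
  finally show ?thesis using p_pos by (intro exI[of _ "nat (m mod int p)"]) (auto simp: nat_less_iff)
qed

lemma card_osz: "finite {P. osz t P} \<and> card {P. osz t P} \<le> p ^ (Suc t * Suc t)"
proof -
  define F :: "(nat \<times> nat \<Rightarrow> nat) \<Rightarrow> 'a poly poly"
    where "F f = (\<Sum>i\<le>t. monom (\<Sum>j\<le>t. monom (of_nat (f (i, j))) j) i)" for f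
  let ?A = "({..t} \<times> {..t}) \<rightarrow>\<^sub>E {..<p}"
  have sub: "{P. osz t P} \<subseteq> F ` ?A"
  proof
    fix P assume "P \<in> {P. osz t P}"
    then have P: "degree P \<le> t" "\<And>i. degree (coeff P i) \<le> t" "\<And>i j. coeff (coeff P i) j \<in> \<int>"
      by (auto simp: osz_def PF_coeff)
    have "\<forall>ij. \<exists>k<p. coeff (coeff P (fst ij)) (snd ij) = of_nat k" using P(3) PF_coeff_of_nat by blast
    then obtain f where f: "\<And>ij. f ij < p" "\<And>ij. coeff (coeff P (fst ij)) (snd ij) = of_nat (f ij)" by metis
    have "F (restrict f ({..t} \<times> {..t})) = (\<Sum>i\<le>t. monom (\<Sum>j\<le>t. monom (coeff (coeff P i) j) j) i)"
      unfolding F_def using f(2)[of "(_, _)"] by (intro sum.cong arg_cong2[of _ _ _ _ monom] refl) auto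
    also have "\<dots> = (\<Sum>i\<le>t. monom (coeff P i) i)"
      using P(2) by (simp add: poly_as_sum_of_monoms')
    also have "\<dots> = P" using P(1) by (rule poly_as_sum_of_monoms')
    finally show "P \<in> F ` ?A" using f(1) by (intro image_eqI[of _ _ "restrict f ({..t} \<times> {..t})"]) auto
  qed
  have fin: "finite ?A" by (intro finite_PiE) auto
  have "card {P. osz t P} \<le> card (F ` ?A)" using sub fin by (intro card_mono) auto
  also have "\<dots> \<le> card ?A" using fin by (rule card_image_le)
  also have "\<dots> = p ^ (Suc t * Suc t)" by (simp add: card_PiE card_cartesian_product)
  finally show ?thesis using finite_subset[OF sub] fin by blast
qed

definition hcard :: "nat \<Rightarrow> nat" where
  "hcard t = p ^ (t + 3 * ((Suc t * Suc t) * (t * t)))"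

lemma CB_hcard: "hcard \<in> CB"
proof -
  have "(\<lambda>t. p ^ (t + 3 * ((Suc t * Suc t) * (t * t)))) \<in> CB"
    by (intro CB_power CB_add CB_id CB_mult_const CB_mult CB_Suc p_ge_2) simp
  then show ?thesis by (simp add: hcard_def[abs_def])
qed

lemma PPm_cong:
  assumes "\<And>i j. i < t \<Longrightarrow> j < t \<Longrightarrow> B i j = B' i j \<and> M i j = M' i j \<and> N i j = N' i j"
  shows "PPm t B M N = PPm t B' M' N'"
proof -
  have "ap t B w i + ap t M x i + ap t N y i = ap t B' w i + ap t M' x i + ap t N' y i" if "i < t" for w x y i
    using assms[OF that] by simp
  then show ?thesis unfolding PPm_def by simp
qed

lemma card_PP: "finite (PP t)" "card (PP t) \<le> hcard t"
proof -
  let ?O = "{P. osz t P}" and ?I = "{..<t} \<times> {..<t}"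
  let ?A = "?I \<rightarrow>\<^sub>E ?O"
  define F where "F = (\<lambda>(B, M, N). PPm t (curry B) (curry M) (curry N))"
  have sub: "PP t \<subseteq> F ` (?A \<times> ?A \<times> ?A)"
  proof
    fix G assume "G \<in> PP t"
    then obtain B M N where G: "G = PPm t B M N" "msz t t t B" "msz t t t M" "msz t t t N"
      by (auto simp: PP_def)
    define r where "r M = restrict (\<lambda>(i, j). M i j) ?I" for M :: "nat \<Rightarrow> nat \<Rightarrow> 'a poly poly"
    have "r M \<in> ?A" if "msz t t t M" for M using that by (auto simp: r_def msz_def)
    moreover have "G = F (r B, r M, r N)"
      unfolding G(1) F_def prod.case by (rule PPm_cong) (simp add: r_def)
    ultimately show "G \<in> F ` (?A \<times> ?A \<times> ?A)" using G(2-4) by blast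
  qed
  have finA: "finite ?A" using card_osz by (intro finite_PiE) auto
  then have fin: "finite (?A \<times> ?A \<times> ?A)" by blast
  show "finite (PP t)" using finite_subset[OF sub] fin by blast
  have "card (PP t) \<le> card (F ` (?A \<times> ?A \<times> ?A))" using sub fin by (intro card_mono) auto
  also have "\<dots> \<le> card (?A \<times> ?A \<times> ?A)" using fin by (rule card_image_le)
  also have "\<dots> = card ?A * (card ?A * card ?A)" by (simp add: card_cartesian_product)
  also have "\<dots> \<le> p ^ ((Suc t * Suc t) * (t * t)) * (p ^ ((Suc t * Suc t) * (t * t)) * p ^ ((Suc t * Suc t) * (t * t)))"
  proof -
    have "card ?A = card ?O ^ (t * t)" by (simp add: card_PiE card_cartesian_product)
    also have "\<dots> \<le> (p ^ (Suc t * Suc t)) ^ (t * t)" using card_osz by (intro power_mono) auto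
    finally have "card ?A \<le> p ^ ((Suc t * Suc t) * (t * t))" by (simp only: power_mult)
    then show ?thesis by (intro mult_le_mono)
  qed
  also have "\<dots> = p ^ (3 * ((Suc t * Suc t) * (t * t)))"
    by (simp only: power_add[symmetric]) (simp add: numeral_3_eq_3)
  also have "\<dots> \<le> hcard t" unfolding hcard_def by (rule p_power_le) simp
  finally show "card (PP t) \<le> hcard t" .
qed

end

lemma card_Union_eq:
  fixes X Y :: "'a \<Rightarrow> 'b set"
  assumes "finite A" "\<And>a. a \<in> A \<Longrightarrow> finite (X a)" "\<And>a. a \<in> A \<Longrightarrow> finite (Y a)"
    and "\<And>B. B \<subseteq> A \<Longrightarrow> B \<noteq> {} \<Longrightarrow> card (\<Inter>a\<in>B. X a) = card (\<Inter>a\<in>B. Y a)"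
  shows "card (\<Union>a\<in>A. X a) = card (\<Union>a\<in>A. Y a)"
proof -
  interpret Incl_Excl finite "int \<circ> card :: 'b set \<Rightarrow> int"
    by unfold_locales (auto simp: card_Un_disjnt)
  have "(int \<circ> card) (\<Union>a\<in>A. X a)
      = (\<Sum>B | B \<subseteq> A \<and> B \<noteq> {}. (- 1) ^ (card B + 1) * (int \<circ> card) (\<Inter>a\<in>B. X a))"
    by (rule restricted_indexed[OF assms(1,2)])
  also have "\<dots> = (\<Sum>B | B \<subseteq> A \<and> B \<noteq> {}. (- 1) ^ (card B + 1) * (int \<circ> card) (\<Inter>a\<in>B. Y a))"
    by (rule sum.cong) (simp_all add: assms(4))
  also have "\<dots> = (int \<circ> card) (\<Union>a\<in>A. Y a)"
    by (rule restricted_indexed[OF assms(1,3), symmetric])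
  finally have "(int \<circ> card) (\<Union>a\<in>A. X a) = (int \<circ> card) (\<Union>a\<in>A. Y a)" .
  then show ?thesis by simp
qed

context frob_ring
begin

section \<open>The back-and-forth property\<close>

definition fib :: "nat \<Rightarrow> (nat \<Rightarrow> 'a poly fract) set \<Rightarrow> (nat \<Rightarrow> 'a poly fract) \<Rightarrow> 'a poly fract set" where
  "fib i G w = {x \<in> RR. w(i := x) \<in> G}"

lemma sg_fib0: "G \<in> PP t \<Longrightarrow> sg (fib0 i G)"
  unfolding sg_def by (intro conjI ballI) (rule fib0_0, assumption, rule fib0_diff)

lemma fib_diff: "G \<in> PP t \<Longrightarrow> x \<in> fib i G w \<Longrightarrow> y \<in> fib i G w \<Longrightarrow> x - y \<in> fib0 i G"
proof -
  assume G: "G \<in> PP t" and xy: "x \<in> fib i G w" "y \<in> fib i G w"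
  have "(\<lambda>j. (w(i := x)) j - (w(i := y)) j) \<in> G"
    by (rule PP_diff[OF G]) (use xy in \<open>auto simp only: fib_def mem_Collect_eq\<close>)
  moreover have "(\<lambda>j. (w(i := x)) j - (w(i := y)) j) = (\<lambda>_. 0)(i := x - y)" by auto
  ultimately have "(\<lambda>_. 0)(i := x - y) \<in> G" by (simp only:)
  moreover have "x - y \<in> RR" using xy by (intro RR_diff) (simp_all add: fib_def)
  ultimately show ?thesis by (simp add: fib0_def)
qed

lemma fib_add: "G \<in> PP t \<Longrightarrow> x \<in> fib i G w \<Longrightarrow> g \<in> fib0 i G \<Longrightarrow> x + g \<in> fib i G w"
proof -
  assume G: "G \<in> PP t" and x: "x \<in> fib i G w" and g: "g \<in> fib0 i G"
  have "- g \<in> fib0 i G" by (rule sg_uminus[OF sg_fib0[OF G] g])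
  then have "(\<lambda>j. (w(i := x)) j - ((\<lambda>_. 0)(i := - g)) j) \<in> G"
    by (intro PP_diff[OF G]) (use x in \<open>auto simp only: fib_def fib0_def mem_Collect_eq\<close>)
  moreover have "(\<lambda>j. (w(i := x)) j - ((\<lambda>_. 0)(i := - g)) j) = w(i := x + g)" by auto
  ultimately have "w(i := x + g) \<in> G" by (simp only:)
  moreover have "x + g \<in> RR" using x g by (intro RR_add) (simp_all add: fib0_def fib_def)
  ultimately show ?thesis by (simp add: fib_def)
qed

lemma fib_eq_translate:
  assumes "G \<in> PP t" "x \<in> fib i G w"
  shows "fib i G w = (\<lambda>g. x + g) ` fib0 i G"
proof (intro equalityI subsetI)
  fix y assume "y \<in> fib i G w"
  then have "y - x \<in> fib0 i G" by (rule fib_diff[OF assms(1) _ assms(2)])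
  then show "y \<in> (\<lambda>g. x + g) ` fib0 i G" by (intro image_eqI[where x = "y - x"]) simp_all
next
  fix y assume "y \<in> (\<lambda>g. x + g) ` fib0 i G"
  then obtain g where g: "g \<in> fib0 i G" "y = x + g" by (rule imageE)
  show "y \<in> fib i G w" unfolding g(2) by (rule fib_add[OF assms g(1)])
qed

lemma card_coset_fib:
  assumes "E \<in> PP t" "fib i E w \<noteq> {}"
  shows "card (coset K ` fib i E w) = card (coset K ` fib0 i E)"
proof -
  obtain x where x: "x \<in> fib i E w" using assms(2) by blast
  have "coset K ` fib i E w = (\<lambda>C. (\<lambda>z. x + z) ` C) ` (coset K ` fib0 i E)"
    unfolding fib_eq_translate[OF assms(1) x] by (simp add: image_image coset_add)
  moreover have "inj_on (\<lambda>C. (\<lambda>z. x + z) ` C) (coset K ` fib0 i E)"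
  proof (rule inj_onI)
    fix C C' assume "(\<lambda>z. x + z) ` C = (\<lambda>z. x + z) ` C'"
    then show "C = C'" using inj_image_eq_iff[of "\<lambda>z. x + z" C C'] by (simp add: inj_def)
  qed
  ultimately show ?thesis by (simp add: card_image)
qed

definition eqv :: "nat \<Rightarrow> (nat \<Rightarrow> 'a poly fract) \<Rightarrow> (nat \<Rightarrow> 'a poly fract) \<Rightarrow> bool" where
  "eqv t w w' \<longleftrightarrow> (\<forall>G\<in>PP t. w \<in> G \<longleftrightarrow> w' \<in> G)"

lemma eqv_mono: "eqv u w w' \<Longrightarrow> t \<le> u \<Longrightarrow> eqv t w w'"
  unfolding eqv_def using PP_mono[of t u] by (metis subsetD)

definition hI :: "nat \<Rightarrow> nat" where "hI t = hcard t * t + t"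
definition hS :: "nat \<Rightarrow> nat" where "hS t = Suc (hI t)"
definition hEF :: "nat \<Rightarrow> nat" where
  "hEF n = hbnd (hI n + n) + hidx (hI n) + hidx (hI n + hcard n)"

lemma CB_hI: "hI \<in> CB"
proof -
  have "(\<lambda>t. hcard t * t + t) \<in> CB" by (intro CB_add CB_mult CB_hcard CB_id)
  then show ?thesis by (simp add: hI_def[abs_def])
qed

lemma CB_hS: "hS \<in> CB"
  using CB_Suc[OF CB_hI] by (simp add: hS_def[abs_def])

lemma CB_hEF: "hEF \<in> CB"
proof -
  have 1: "(\<lambda>n. hbnd (hI n + n)) \<in> CB" by (rule CB_comp[OF CB_hbnd CB_add[OF CB_hI CB_id]])
  have 2: "(\<lambda>n. hidx (hI n)) \<in> CB" by (rule CB_comp[OF CB_hidx CB_hI])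
  have 3: "(\<lambda>n. hidx (hI n + hcard n)) \<in> CB" by (rule CB_comp[OF CB_hidx CB_add[OF CB_hI CB_hcard]])
  from CB_add[OF CB_add[OF 1 2] 3] show ?thesis by (simp add: hEF_def[abs_def])
qed

lemma Inter_PP: "\<C> \<subseteq> PP t \<Longrightarrow> \<Inter>\<C> \<in> PP (hI t)"
proof -
  assume sub: "\<C> \<subseteq> PP t"
  have fin: "finite \<C>" using sub card_PP(1) by (rule finite_subset)
  have "card \<C> \<le> hcard t" by (rule order_trans[OF card_mono[OF card_PP(1) sub] card_PP(2)])
  then have "card \<C> * t \<le> hcard t * t" by (rule mult_le_mono1)
  then have "card \<C> * t \<le> hI t" unfolding hI_def by (rule trans_le_add1)
  from PP_mono[OF this] PP_Inter[OF fin sub] show ?thesis by (rule subsetD)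
qed

lemma fi_witness_bounded:
  assumes G: "G \<in> PP t" and K: "K \<in> PP t" and i: "i < t" and sub: "fib0 i K \<subseteq> fib0 i G"
    and nfi: "\<not> fi (fib0 i G) (fib0 i K)"
  shows "\<exists>g::nat \<Rightarrow> _. (\<forall>m\<le>b. g m \<in> fib0 i G \<inter> Rd (hidx (t + b))) \<and> (\<forall>m\<le>b. \<forall>n<m. g m - g n \<notin> fib0 i K)"
  using index_alternative[OF G K i sub]
proof
  assume rep: "\<forall>g\<in>fib0 i G. \<exists>k\<in>fib0 i K. g - k \<in> Rd (hidx t)"
  have sK: "sg (fib0 i K)" and sG: "sg (fib0 i G)" by (rule sg_fib0[OF K], rule sg_fib0[OF G])
  obtain g :: "nat \<Rightarrow> _" where g: "\<forall>m. g m \<in> fib0 i G" "\<forall>m n. n < m \<longrightarrow> g m - g n \<notin> fib0 i K"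
    using not_fi_incongruent[OF sK nfi] by (elim exE conjE)
  have "\<forall>m. \<exists>k. k \<in> fib0 i K \<and> g m - k \<in> Rd (hidx t)"
  proof
    fix m
    show "\<exists>k. k \<in> fib0 i K \<and> g m - k \<in> Rd (hidx t)"
      using bspec[OF rep g(1)[THEN spec, of m]] by (simp only: Bex_def)
  qed
  from choice[OF this] obtain k where k: "\<forall>m. k m \<in> fib0 i K \<and> g m - k m \<in> Rd (hidx t)" ..
  have le: "hidx t \<le> hidx (t + b)" by (rule CB_mono[OF CB_hidx]) simp
  show ?thesis
  proof (intro exI[of _ "\<lambda>m. g m - k m"] conjI allI impI)
    fix m
    have "k m \<in> fib0 i G" by (rule subsetD[OF sub k[THEN spec, THEN conjunct1]])
    then have "g m - k m \<in> fib0 i G" by (rule sg_diff[OF sG g(1)[THEN spec]])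
    moreover have "g m - k m \<in> Rd (hidx (t + b))" by (rule Rd_monoD[OF k[THEN spec, THEN conjunct2] le])
    ultimately show "g m - k m \<in> fib0 i G \<inter> Rd (hidx (t + b))" by (rule IntI)
    fix n assume nm: "n < m"
    show "g m - k m - (g n - k n) \<notin> fib0 i K"
    proof
      assume a: "g m - k m - (g n - k n) \<in> fib0 i K"
      have "k m - k n \<in> fib0 i K"
        by (rule sg_diff[OF sK k[THEN spec, THEN conjunct1] k[THEN spec, THEN conjunct1]])
      from sg_add[OF sK a this] have "g m - g n \<in> fib0 i K" by (simp add: algebra_simps)
      then show False using g(2) nm by blast
    qed
  qed
next
  assume "\<forall>b. \<exists>g. (\<forall>m\<le>b. g m \<in> fib0 i G \<inter> Rd (hidx (t + b))) \<and> (\<forall>m\<le>b. \<forall>n<m. g m - g n \<notin> fib0 i K)"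
  then show ?thesis by (rule spec)
qed

lemma fi_reps_bounded:
  assumes G: "G \<in> PP t" and K: "K \<in> PP t" and i: "i < t" and sub: "fib0 i K \<subseteq> fib0 i G"
    and fi: "fi (fib0 i G) (fib0 i K)" and g: "g \<in> fib0 i G"
  shows "\<exists>k\<in>fib0 i K. g - k \<in> Rd (hidx t)"
  using index_alternative[OF G K i sub]
proof
  assume b: "\<forall>b. \<exists>g. (\<forall>m\<le>b. g m \<in> fib0 i G \<inter> Rd (hidx (t + b))) \<and> (\<forall>m\<le>b. \<forall>n<m. g m - g n \<notin> fib0 i K)"
  have "\<not> fi (fib0 i G) (fib0 i K)"
  proof (rule incongruent_not_fi[OF sg_fib0[OF K]])
    fix c
    from b[THEN spec, of c] obtain g where g: "\<forall>m\<le>c. g m \<in> fib0 i G \<inter> Rd (hidx (t + c))"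
      "\<forall>m\<le>c. \<forall>n<m. g m - g n \<notin> fib0 i K" by (elim exE conjE)
    have "\<forall>m\<le>c. g m \<in> fib0 i G" using g(1) by simp
    with g(2) show "\<exists>g. (\<forall>m\<le>c. g m \<in> fib0 i G) \<and> (\<forall>m\<le>c. \<forall>n<m. g m - g n \<notin> fib0 i K)" by (intro exI conjI)
  qed
  with fi show ?thesis by (rule notE[rotated])
next
  assume "\<forall>g\<in>fib0 i G. \<exists>k\<in>fib0 i K. g - k \<in> Rd (hidx t)"
  then show ?thesis using g by (rule bspec)
qed

text \<open>The Baur--Monk argument.  Conditions \<open>H\<close> of finite index are transferred from \<open>w\<close> to
  \<open>w'\<close> by counting cosets with inclusion-exclusion; the others are avoided inside a finite subgroup.\<close>

lemma back_and_forth: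
  assumes i: "i < t" and w: "\<And>j. w j \<in> RR" and x: "x \<in> RR" and eqv: "eqv (hS t) w w'"
    and w': "\<And>j. j < hS t \<Longrightarrow> w' j \<in> Rd d"
  shows "\<exists>x'\<in>Rd (hEF (t + d)). eqv t (w(i := x)) (w'(i := x'))"
proof -
  let ?t = "hI t"
  define \<A> where "\<A> = {G \<in> PP t. w(i := x) \<in> G}"
  define \<B> where "\<B> = PP t - \<A>"
  define G where "G = \<Inter>\<A>"
  define \<B>f where "\<B>f = {H \<in> \<B>. fi (fib0 i G) (fib0 i (G \<inter> H))}"
  define \<B>i where "\<B>i = \<B> - \<B>f"
  define P where "P = \<Inter>(\<A> \<union> \<B>f)"
  define K where "K = fib0 i P"
  have tt: "t \<le> ?t" by (rule CB_ge[OF CB_hI])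
  have it: "i < ?t" using i tt by simp
  have fin: "finite \<A>" "finite \<B>" "finite \<B>f" "finite \<B>i" and subs: "\<A> \<subseteq> PP t" "\<B> \<subseteq> PP t" "\<B>f \<subseteq> \<B>" "\<B>i \<subseteq> \<B>"
    using card_PP(1)[of t] by (auto simp: \<A>_def \<B>_def \<B>f_def \<B>i_def)
  have In: "\<Inter>(\<A> \<union> \<C>) \<in> PP ?t" if "\<C> \<subseteq> PP t" for \<C> using subs(1) that by (intro Inter_PP) blast
  have GH: "G \<inter> H \<in> PP ?t" if "H \<in> PP t" for H
    using In[of "{H}"] that by (simp add: G_def Int_commute)
  have G: "G \<in> PP ?t" using In[of "{}"] by (simp add: G_def)
  have P: "P \<in> PP ?t" unfolding P_def using In subs by blast
  have transfer: "fib i E w = {} \<longleftrightarrow> fib i E w' = {}" if "E \<in> PP ?t" for E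
  proof -
    have "{w. \<exists>x\<in>RR. w(i := x) \<in> E} \<in> PP (hS t)" unfolding hS_def by (rule PP_proj[OF that it])
    from eqv[unfolded eqv_def, rule_format, OF this]
    have "(\<exists>x\<in>RR. w(i := x) \<in> E) \<longleftrightarrow> (\<exists>x\<in>RR. w'(i := x) \<in> E)"
      by (simp only: mem_Collect_eq)
    moreover have "fib i E v = {} \<longleftrightarrow> \<not> (\<exists>x\<in>RR. v(i := x) \<in> E)" for v
      unfolding fib_def by blast
    ultimately show ?thesis by (simp only:)
  qed
  have xG: "x \<in> fib i G w" using x by (auto simp: fib_def G_def \<A>_def)
  have xH: "x \<notin> fib i (G \<inter> H) w" if "H \<in> \<B>" for H using that by (auto simp: fib_def \<A>_def \<B>_def)
  have PG: "P \<subseteq> G" by (auto simp: P_def G_def)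
  have PH: "P \<subseteq> G \<inter> H" if "H \<in> \<B>f" for H using that by (auto simp: P_def G_def)
  have f0mono: "fib0 i A \<subseteq> fib0 i B" if "A \<subseteq> B" for A B using that by (auto simp: fib0_def)
  have sG: "sg (fib0 i G)" and sK: "sg K" unfolding K_def by (rule sg_fib0[OF G], rule sg_fib0[OF P])
  have fiK: "fi (fib0 i G) K"
  proof -
    have "fi (fib0 i G) (fib0 i (\<Inter>(\<A> \<union> \<C>)))" if "finite \<C>" "\<C> \<subseteq> \<B>f" for \<C>
      using that
    proof (induction \<C> rule: finite_induct)
      case empty
      then show ?case using fi_refl[OF sG] by (simp only: G_def Un_empty_right)
    next
      case (insert H \<C>)
      have H: "H \<in> PP t" "fi (fib0 i G) (fib0 i (G \<inter> H))" using insert.prems subs by (auto simp: \<B>f_def)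
      have C: "\<C> \<subseteq> PP t" using insert.prems subs by blast
      have "\<Inter>(\<A> \<union> insert H \<C>) = \<Inter>(\<A> \<union> \<C>) \<inter> (G \<inter> H)" unfolding G_def by blast
      then have "fib0 i (\<Inter>(\<A> \<union> insert H \<C>)) = fib0 i (\<Inter>(\<A> \<union> \<C>)) \<inter> fib0 i (G \<inter> H)"
        unfolding fib0_def by blast
      moreover have "fi (fib0 i G) (fib0 i (\<Inter>(\<A> \<union> \<C>)) \<inter> fib0 i (G \<inter> H))"
        by (rule fi_Int[OF sg_fib0[OF In[OF C]] sg_fib0[OF GH[OF H(1)]]])
           (rule insert.IH, use insert.prems in blast, rule H(2))
      ultimately show ?case by (simp only:)
    qed
    from this[OF fin(3)] show ?thesis by (simp add: K_def P_def)
  qed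
  have KG: "K \<subseteq> fib0 i G" unfolding K_def by (rule f0mono[OF PG])
  have KH: "K \<subseteq> fib0 i (G \<inter> H)" if "H \<in> \<B>f" for H unfolding K_def by (rule f0mono[OF PH[OF that]])
  define Cc where "Cc v H = coset K ` fib i (G \<inter> H) v" for v H
  have mem: "coset K y \<in> Cc v H \<longleftrightarrow> y \<in> fib i (G \<inter> H) v" if H: "H \<in> \<B>f" for v H y
  proof
    assume "coset K y \<in> Cc v H"
    then obtain z where z: "z \<in> fib i (G \<inter> H) v" "coset K y = coset K z" unfolding Cc_def by blast
    then have "y - z \<in> K" using coset_eq[OF sK, of y z] by blast
    then have "y - z \<in> fib0 i (G \<inter> H)" using KH[OF H] by blast
    moreover have "G \<inter> H \<in> PP ?t" using H subs by (intro GH) blast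
    ultimately have "z + (y - z) \<in> fib i (G \<inter> H) v" using z(1) by (intro fib_add)
    then show "y \<in> fib i (G \<inter> H) v" by simp
  next
    assume "y \<in> fib i (G \<inter> H) v"
    then show "coset K y \<in> Cc v H" unfolding Cc_def by (rule imageI)
  qed
  have Cc_sub: "Cc v H \<subseteq> coset K ` fib i G v" for v H
    unfolding Cc_def fib_def by blast
  have cardG: "card (coset K ` fib i G v) = card (coset K ` fib0 i G)" if "fib i G v \<noteq> {}" for v
    by (rule card_coset_fib[OF G that])
  have finQ: "finite (coset K ` fib i G v)" for v
  proof (cases "fib i G v = {}")
    case False
    then obtain z where "z \<in> fib i G v" by blast
    have "coset K ` fib i G v = (\<lambda>C. (\<lambda>u. z + u) ` C) ` (coset K ` fib0 i G)"
      unfolding fib_eq_translate[OF G \<open>z \<in> fib i G v\<close>] by (simp add: image_image coset_add)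
    then show ?thesis using fiK by (simp add: fi_def)
  qed simp
  have inter: "(\<Inter>H\<in>\<I>. Cc v H) = coset K ` fib i (\<Inter>(\<A> \<union> \<I>)) v" if I: "\<I> \<subseteq> \<B>f" "\<I> \<noteq> {}" for \<I> v
  proof (intro equalityI subsetI)
    fix C assume C: "C \<in> (\<Inter>H\<in>\<I>. Cc v H)"
    obtain H0 where "H0 \<in> \<I>" using I(2) by blast
    then have "C \<in> Cc v H0" using C by blast
    then obtain y where y: "y \<in> fib i (G \<inter> H0) v" "C = coset K y" unfolding Cc_def by blast
    have yH: "y \<in> fib i (G \<inter> H) v" if H: "H \<in> \<I>" for H
    proof (rule mem[OF subsetD[OF I(1) H], THEN iffD1])
      have "C \<in> Cc v H" using C H by blast
      then show "coset K y \<in> Cc v H" by (simp only: y(2))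
    qed
    have "v(i := y) \<in> E" if "E \<in> \<A> \<union> \<I>" for E
      using that yH[of E] y(1) unfolding fib_def G_def by blast
    then have "v(i := y) \<in> \<Inter>(\<A> \<union> \<I>)" by (rule InterI)
    then have "y \<in> fib i (\<Inter>(\<A> \<union> \<I>)) v" using y(1) by (simp add: fib_def)
    then show "C \<in> coset K ` fib i (\<Inter>(\<A> \<union> \<I>)) v" using y(2) by blast
  next
    fix C assume "C \<in> coset K ` fib i (\<Inter>(\<A> \<union> \<I>)) v"
    moreover have "fib i (\<Inter>(\<A> \<union> \<I>)) v \<subseteq> fib i (G \<inter> H) v" if "H \<in> \<I>" for H
      using that unfolding fib_def G_def by blast
    ultimately show "C \<in> (\<Inter>H\<in>\<I>. Cc v H)" unfolding Cc_def by blast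
  qed
  have w'G: "fib i G w' \<noteq> {}" using transfer[OF G] xG by blast
  have "card (\<Union>H\<in>\<B>f. Cc w H) = card (\<Union>H\<in>\<B>f. Cc w' H)"
  proof (rule card_Union_eq[OF fin(3)])
    fix \<I> assume I: "\<I> \<subseteq> \<B>f" "\<I> \<noteq> {}"
    have E: "\<Inter>(\<A> \<union> \<I>) \<in> PP ?t" using I(1) subs by (intro In) blast
    show "card (\<Inter>H\<in>\<I>. Cc w H) = card (\<Inter>H\<in>\<I>. Cc w' H)"
    proof (cases "fib i (\<Inter>(\<A> \<union> \<I>)) w = {}")
      case True
      then have "fib i (\<Inter>(\<A> \<union> \<I>)) w' = {}" using transfer[OF E] by blast
      then show ?thesis by (simp only: inter[OF I] True)
    next
      case False
      then have w': "fib i (\<Inter>(\<A> \<union> \<I>)) w' \<noteq> {}" using transfer[OF E] by blast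
      show ?thesis unfolding inter[OF I] card_coset_fib[OF E False] card_coset_fib[OF E w'] ..
    qed
  qed (use finite_subset[OF Cc_sub finQ] in auto)
  moreover have "card (\<Union>H\<in>\<B>f. Cc w H) < card (coset K ` fib i G w)"
  proof (rule psubset_card_mono[OF finQ])
    have "coset K x \<notin> Cc w H" if "H \<in> \<B>f" for H
      using mem[OF that, THEN iffD1] xH[OF subsetD[OF subs(3) that]] by blast
    then have "coset K x \<notin> (\<Union>H\<in>\<B>f. Cc w H)" by blast
    moreover have "coset K x \<in> coset K ` fib i G w" using xG by blast
    ultimately show "(\<Union>H\<in>\<B>f. Cc w H) \<subset> coset K ` fib i G w" using Cc_sub by blast
  qed
  moreover have "card (coset K ` fib i G w) = card (coset K ` fib i G w')"
  proof -
    have "fib i G w \<noteq> {}" using xG by blast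
    then show ?thesis using cardG w'G by simp
  qed
  ultimately have "card (\<Union>H\<in>\<B>f. Cc w' H) < card (coset K ` fib i G w')" by simp
  then have "(\<Union>H\<in>\<B>f. Cc w' H) \<noteq> coset K ` fib i G w'" by auto
  then obtain y where y: "y \<in> fib i G w'" "\<And>H. H \<in> \<B>f \<Longrightarrow> y \<notin> fib i (G \<inter> H) w'"
  proof -
    obtain C where C: "C \<in> coset K ` fib i G w'" "C \<notin> (\<Union>H\<in>\<B>f. Cc w' H)"
      using \<open>(\<Union>H\<in>\<B>f. Cc w' H) \<noteq> coset K ` fib i G w'\<close> Cc_sub by blast
    obtain y where y: "y \<in> fib i G w'" "C = coset K y" using C(1) by blast
    have "y \<notin> fib i (G \<inter> H) w'" if "H \<in> \<B>f" for H
      using C(2) y(2) mem[OF that, THEN iffD2] that by blast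
    then show ?thesis using that y(1) by blast
  qed
  have yRR: "y \<in> RR" "w'(i := y) \<in> G" using y(1) by (auto simp: fib_def)
  have "\<And>j. j < ?t \<Longrightarrow> w' j \<in> Rd d" using w' by (simp add: hS_def)
  from fibre_bounded[OF G it yRR this] obtain x0 where x0: "x0 \<in> Rd (hbnd (?t + d))" "w'(i := x0) \<in> G" by blast
  have x0f: "x0 \<in> fib i G w'" using x0 Rd_RR by (auto simp: fib_def)
  have "y - x0 \<in> fib0 i G" by (rule fib_diff[OF G y(1) x0f])
  from fi_reps_bounded[OF G P it f0mono[OF PG] fiK[unfolded K_def] this]
  obtain k where k: "k \<in> K" "y - x0 - k \<in> Rd (hidx ?t)" unfolding K_def by blast
  define x2 where "x2 = x0 + (y - x0 - k)"
  have x2y: "x2 = y + (- k)" by (simp add: x2_def)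
  have mk: "- k \<in> K" by (rule sg_uminus[OF sK k(1)])
  have x2G: "x2 \<in> fib i G w'" unfolding x2y by (rule fib_add[OF G y(1)]) (use mk KG in blast)
  define b where "b = hcard t"
  define A where "A = K \<inter> Rd (hidx (?t + b))"
  have sA: "sg A"
    unfolding A_def by (rule sg_Int[OF sK]) (simp add: sg_def Rd_diff)
  define L where "L H = K \<inter> fib0 i H" for H
  define S where "S H = {k \<in> A. w'(i := x2 + k) \<in> H}" for H
  have PPH: "H \<in> PP t" if "H \<in> \<B>i" for H using that subs by blast
  have L_eq: "L H = fib0 i (\<Inter>(\<A> \<union> insert H \<B>f))" for H
    by (auto simp: L_def K_def P_def fib0_def)
  have LPP: "\<Inter>(\<A> \<union> insert H \<B>f) \<in> PP ?t" if "H \<in> \<B>i" for H using PPH[OF that] subs by (intro In) blast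
  have sL: "sg (L H)" if "H \<in> \<B>i" for H unfolding L_eq by (rule sg_fib0[OF LPP[OF that]])
  have nfi: "\<not> fi K (L H)" if H: "H \<in> \<B>i" for H
  proof
    assume "fi K (L H)"
    then have "fi (fib0 i G) (L H)" by (intro fi_trans[OF sG sK sL[OF H] _ KG fiK]) (auto simp: L_def)
    moreover have "L H \<subseteq> fib0 i (G \<inter> H)" using KG by (auto simp: L_def fib0_def)
    ultimately have "fi (fib0 i G) (fib0 i (G \<inter> H))"
      using fi_mono[OF sL[OF H] sg_fib0[OF GH[OF PPH[OF H]]]] by blast
    then show False using H by (auto simp: \<B>i_def \<B>f_def)
  qed
  have "\<exists>k\<in>A. \<forall>H\<in>\<B>i. k \<notin> S H"
  proof (rule avoid_cosets[OF sA _ p_pos fin(4)])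
    show "of_nat p = (0 :: 'a poly fract)" using of_nat_CHAR[where ?'a = "'a poly fract"] by (simp add: char_fract_p)
    have "card \<B>i \<le> card (PP t)" using subs by (intro card_mono card_PP(1)) blast
    then show "card \<B>i \<le> b" using card_PP(2)[of t] by (simp add: b_def)
    show "u - v \<in> L H" if H: "H \<in> \<B>i" and uv: "u \<in> S H" "v \<in> S H" for H u v
    proof -
      have "x2 + u \<in> fib i H w'" "x2 + v \<in> fib i H w'"
        using uv x2G KG fib0_RR by (auto simp: S_def A_def fib_def intro!: RR_add)
      from fib_diff[OF PPH[OF H] this] have "u - v \<in> fib0 i H" by simp
      moreover have "u - v \<in> K" using uv by (intro sg_diff[OF sK]) (auto simp: S_def A_def)
      ultimately show ?thesis by (simp add: L_def)
    qed
    show "\<exists>g::nat \<Rightarrow> _. (\<forall>m\<le>b. g m \<in> A) \<and> (\<forall>m\<le>b. \<forall>n<m. g m - g n \<notin> L H)" if H: "H \<in> \<B>i" for H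
    proof -
      have sub: "fib0 i (\<Inter>(\<A> \<union> insert H \<B>f)) \<subseteq> fib0 i P" by (rule f0mono) (auto simp: P_def)
      from fi_witness_bounded[OF P LPP[OF H] it sub, of b] nfi[OF H]
      show ?thesis unfolding L_eq A_def K_def by blast
    qed
  qed (rule sL)
  then obtain k' where k': "k' \<in> A" "\<And>H. H \<in> \<B>i \<Longrightarrow> k' \<notin> S H" by blast
  define x' where "x' = x2 + k'"
  have k'K: "k' \<in> K" using k'(1) by (simp add: A_def)
  have x'G: "x' \<in> fib i G w'" unfolding x'_def by (rule fib_add[OF G x2G]) (use k'K KG in blast)
  have x'y: "x' - y \<in> K"
    using sg_add[OF sK mk k'K] by (simp add: x'_def x2y)
  have notB: "w'(i := x') \<notin> H" if H: "H \<in> \<B>" for H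
  proof (cases "H \<in> \<B>f")
    case True
    show ?thesis
    proof
      assume "w'(i := x') \<in> H"
      then have "x' \<in> fib i (G \<inter> H) w'" using x'G by (auto simp: fib_def)
      then have "coset K x' \<in> Cc w' H" by (rule mem[OF True, THEN iffD2])
      moreover have "coset K x' = coset K y" using coset_eq[OF sK, of x' y] x'y by blast
      ultimately have "coset K y \<in> Cc w' H" by (simp only:)
      then have "y \<in> fib i (G \<inter> H) w'" by (rule mem[OF True, THEN iffD1])
      then show False using y(2)[OF True] by blast
    qed
  next
    case False
    then have "H \<in> \<B>i" using H by (simp add: \<B>i_def)
    from k'(2)[OF this] show ?thesis using k'(1) by (simp add: S_def x'_def)
  qed
  have "eqv t (w(i := x)) (w'(i := x'))"
    unfolding eqv_def
  proof
    fix H assume H: "H \<in> PP t"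
    show "w(i := x) \<in> H \<longleftrightarrow> w'(i := x') \<in> H"
    proof (cases "H \<in> \<A>")
      case True
      then have "w'(i := x') \<in> H" using x'G by (auto simp: fib_def G_def)
      moreover have "w(i := x) \<in> H" using True by (simp add: \<A>_def)
      ultimately show ?thesis by blast
    next
      case False
      then have "H \<in> \<B>" using H by (simp add: \<B>_def)
      then show ?thesis using notB False H by (auto simp: \<A>_def)
    qed
  qed
  moreover have "x' \<in> Rd (hEF (t + d))"
  proof -
    let ?n = "t + d"
    have m: "?t \<le> hI ?n" "hcard t \<le> hcard ?n" by (rule CB_mono[OF CB_hI], simp, rule CB_mono[OF CB_hcard], simp)
    have "hbnd (?t + d) \<le> hbnd (hI ?n + ?n)" using m by (intro CB_mono[OF CB_hbnd]) simp
    moreover have "hidx ?t \<le> hidx (hI ?n)" using m by (intro CB_mono[OF CB_hidx])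
    moreover have "hidx (?t + b) \<le> hidx (hI ?n + hcard ?n)" using m by (intro CB_mono[OF CB_hidx]) (simp add: b_def)
    ultimately have le: "hbnd (?t + d) \<le> hEF ?n" "hidx ?t \<le> hEF ?n" "hidx (?t + b) \<le> hEF ?n"
      by (auto simp: hEF_def)
    have "k' \<in> Rd (hidx (?t + b))" using k'(1) by (simp add: A_def)
    then show ?thesis
      unfolding x'_def x2_def by (intro Rd_add) (rule Rd_monoD[OF x0(1) le(1)], rule Rd_monoD[OF k(2) le(2)], rule Rd_monoD[OF _ le(3)])
  qed
  ultimately show ?thesis by blast
qed

end

section \<open>Truth is invariant under equivalence\<close>

lemma prod_encode_ge: "a + b \<le> prod_encode (a, b)"
proof -
  have "n \<le> triangle n" for n by (induction n) auto
  from this[of "a + b"] show ?thesis by (simp add: prod_encode_def)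
qed

lemma list_encode_ge: "x \<in> set xs \<Longrightarrow> x \<le> list_encode xs"
proof (induction xs)
  case (Cons a xs)
  have "a \<le> list_encode (a # xs)" "list_encode xs \<le> list_encode (a # xs)"
    using prod_encode_ge[of a "list_encode xs"] by simp_all
  then show ?case using Cons by auto
qed simp

lemma length_le_list_encode: "length xs \<le> list_encode xs"
proof (induction xs)
  case (Cons a xs)
  then show ?case using prod_encode_ge[of a "list_encode xs"] by simp
qed simp

lemma lp_code_LEq: "lp_term_code s \<le> lp_code (LEq s t)" "lp_term_code t \<le> lp_code (LEq s t)"
  using prod_encode_ge[of 0 "prod_encode (lp_term_code s, lp_term_code t)"]
    prod_encode_ge[of "lp_term_code s" "lp_term_code t"] by simp_all

lemma lp_code_LNeg: "Suc (lp_code \<phi>) \<le> lp_code (LNeg \<phi>)"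
  using prod_encode_ge[of 1 "lp_code \<phi>"] by simp

lemma lp_code_LAnd: "Suc (lp_code \<phi>) \<le> lp_code (LAnd \<phi> \<psi>)" "Suc (lp_code \<psi>) \<le> lp_code (LAnd \<phi> \<psi>)"
  using prod_encode_ge[of 2 "prod_encode (lp_code \<phi>, lp_code \<psi>)"]
    prod_encode_ge[of "lp_code \<phi>" "lp_code \<psi>"] by simp_all

lemma lp_code_LEx: "Suc (lp_code \<phi>) \<le> lp_code (LEx i \<phi>)" "Suc i \<le> lp_code (LEx i \<phi>)"
  using prod_encode_ge[of 3 "prod_encode (i, lp_code \<phi>)"] prod_encode_ge[of i "lp_code \<phi>"] by simp_all

lemma lpz_code_ZEq: "lpz_term_code s \<le> lpz_code (ZEq s t)" "lpz_term_code t \<le> lpz_code (ZEq s t)"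
  using prod_encode_ge[of 0 "prod_encode (lpz_term_code s, lpz_term_code t)"]
    prod_encode_ge[of "lpz_term_code s" "lpz_term_code t"] by simp_all

lemma lpz_code_ZInF: "Suc (lpz_term_code t) \<le> lpz_code (ZInF t)"
  using prod_encode_ge[of 1 "lpz_term_code t"] by simp

lemma lpz_code_ZPred:
  "Suc (n + lp_code \<sigma>) \<le> lpz_code (ZPred n \<sigma> ts)"
  "Suc (length ts + lp_code \<sigma>) \<le> lpz_code (ZPred n \<sigma> ts)"
  "t \<in> set ts \<Longrightarrow> Suc (lpz_term_code t) \<le> lpz_code (ZPred n \<sigma> ts)"
proof -
  let ?l = "list_encode (map lpz_term_code ts)"
  have 1: "Suc (n + (lp_code \<sigma> + ?l)) \<le> lpz_code (ZPred n \<sigma> ts)"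
    using prod_encode_ge[of 2 "prod_encode (n, prod_encode (lp_code \<sigma>, ?l))"]
      prod_encode_ge[of n "prod_encode (lp_code \<sigma>, ?l)"] prod_encode_ge[of "lp_code \<sigma>" ?l] by simp
  then show "Suc (n + lp_code \<sigma>) \<le> lpz_code (ZPred n \<sigma> ts)" by linarith
  show "Suc (length ts + lp_code \<sigma>) \<le> lpz_code (ZPred n \<sigma> ts)"
    using 1 length_le_list_encode[of "map lpz_term_code ts"] by simp
  assume "t \<in> set ts"
  then have "lpz_term_code t \<le> ?l" by (intro list_encode_ge) simp
  with 1 show "Suc (lpz_term_code t) \<le> lpz_code (ZPred n \<sigma> ts)" by linarith
qed

lemma lpz_code_ZNeg: "Suc (lpz_code \<phi>) \<le> lpz_code (ZNeg \<phi>)"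
  using prod_encode_ge[of 3 "lpz_code \<phi>"] by simp

lemma lpz_code_ZAnd: "Suc (lpz_code \<phi>) \<le> lpz_code (ZAnd \<phi> \<psi>)" "Suc (lpz_code \<psi>) \<le> lpz_code (ZAnd \<phi> \<psi>)"
  using prod_encode_ge[of 4 "prod_encode (lpz_code \<phi>, lpz_code \<psi>)"]
    prod_encode_ge[of "lpz_code \<phi>" "lpz_code \<psi>"] by simp_all

lemma lpz_code_ZEx: "Suc (lpz_code \<phi>) \<le> lpz_code (ZEx i \<phi>)" "Suc i \<le> lpz_code (ZEx i \<phi>)"
  using prod_encode_ge[of 5 "prod_encode (i, lpz_code \<phi>)"] prod_encode_ge[of i "lpz_code \<phi>"] by simp_all

lemma lp_term_vars_le: "i \<in> lp_term_vars t \<Longrightarrow> i \<le> lp_term_code t"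
proof (induction t)
  case (LVar k)
  then show ?case using prod_encode_ge[of 0 k] by simp
next
  case (LAdd s t)
  then show ?case
    using prod_encode_ge[of 3 "prod_encode (lp_term_code s, lp_term_code t)"]
      prod_encode_ge[of "lp_term_code s" "lp_term_code t"] by auto
next
  case (LFrob t)
  then show ?case using prod_encode_ge[of 4 "lp_term_code t"] by auto
qed simp_all

lemma lpz_term_vars_le: "i \<in> lpz_term_vars t \<Longrightarrow> i \<le> lpz_term_code t"
proof (induction t)
  case (ZVar k)
  then show ?case using prod_encode_ge[of 0 k] by simp
next
  case (ZAdd s t)
  then show ?case
    using prod_encode_ge[of 3 "prod_encode (lpz_term_code s, lpz_term_code t)"]
      prod_encode_ge[of "lpz_term_code s" "lpz_term_code t"] by auto
next
  case (ZFrob t)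
  then show ?case using prod_encode_ge[of 4 "lpz_term_code t"] by auto
next
  case (ZMulz t)
  then show ?case using prod_encode_ge[of 5 "lpz_term_code t"] by auto
qed simp_all

primrec zdepth :: "lpz_term \<Rightarrow> nat" where
  "zdepth (ZVar i) = 0"
| "zdepth ZZero = 0"
| "zdepth ZOne = 0"
| "zdepth (ZAdd s t) = max (zdepth s) (zdepth t)"
| "zdepth (ZFrob t) = Suc (zdepth t)"
| "zdepth (ZMulz t) = Suc (zdepth t)"

lemma zdepth_le: "zdepth t \<le> lpz_term_code t"
proof (induction t)
  case (ZAdd s t)
  then show ?case
    using prod_encode_ge[of 3 "prod_encode (lpz_term_code s, lpz_term_code t)"]
      prod_encode_ge[of "lpz_term_code s" "lpz_term_code t"] by auto
next
  case (ZFrob t)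
  then show ?case using prod_encode_ge[of 4 "lpz_term_code t"] by auto
next
  case (ZMulz t)
  then show ?case using prod_encode_ge[of 5 "lpz_term_code t"] by auto
qed simp_all

primrec emb :: "nat \<Rightarrow> lp_term \<Rightarrow> lpz_term" where
  "emb N (LVar i) = ZVar (N + i)"
| "emb N LZero = ZZero"
| "emb N LOne = ZOne"
| "emb N (LAdd s t) = ZAdd (emb N s) (emb N t)"
| "emb N (LFrob t) = ZFrob (emb N t)"

lemma zdepth_emb: "zdepth (emb N t) \<le> lp_term_code t"
proof (induction t)
  case (LAdd s t)
  then show ?case
    using prod_encode_ge[of 3 "prod_encode (lp_term_code s, lp_term_code t)"]
      prod_encode_ge[of "lp_term_code s" "lp_term_code t"] by auto
next
  case (LFrob t)
  then show ?case using prod_encode_ge[of 4 "lp_term_code t"] by auto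
qed simp_all

lemma vars_emb: "lpz_term_vars (emb N t) = (\<lambda>i. N + i) ` lp_term_vars t"
  by (induction t) auto

context frob_ring
begin

lemma const_fract_inj [simp]: "const_fract a = const_fract b \<longleftrightarrow> a = (b :: 'a)"
  by (simp add: const_fract_def)

lemma const_fract_add: "const_fract (a + b) = const_fract a + const_fract (b :: 'a)"
  by (simp add: const_fract_def flip: to_fract_add)

lemma const_fract_mult: "const_fract (a * b) = const_fract a * const_fract (b :: 'a)"
  by (simp add: const_fract_def flip: to_fract_mult)

lemma const_fract_power: "const_fract (a ^ n) = const_fract (a :: 'a) ^ n"
proof (induction n)
  case 0
  then show ?case by (simp add: const_fract_def one_pCons[symmetric])
next
  case (Suc n)
  then show ?case by (simp add: const_fract_mult)
qed

lemma lpz_val_emb: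
  assumes "\<And>i. i \<in> lp_term_vars t \<Longrightarrow> E (N + i) = const_fract (c i :: 'a)"
  shows "lpz_val p E (emb N t) = const_fract (lp_val p c t)"
  using assms
proof (induction t)
  case (LAdd r t)
  then show ?case by (simp add: const_fract_add)
next
  case (LFrob t)
  then show ?case by (simp add: const_fract_power)
qed (simp_all add: const_fract_def one_pCons[symmetric])

primrec zop :: "lpz_term \<Rightarrow> nat \<Rightarrow> 'a poly poly" where
  "zop (ZVar i) j = (if j = Suc i then 1 else 0)"
| "zop ZZero j = 0"
| "zop ZOne j = (if j = 0 then 1 else 0)"
| "zop (ZAdd r t) j = zop r j + zop t j"
| "zop (ZFrob t) j = oc (monom 1 1) (zop t j)"
| "zop (ZMulz t) j = oc (monom (monom 1 1) 0) (zop t j)"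

lemma osz_zop: "osz ((hoc ^^ zdepth t) 1) (zop t j)"
proof (induction t)
  case (ZAdd r t)
  have "(hoc ^^ zdepth r) 1 \<le> (hoc ^^ max (zdepth r) (zdepth t)) 1"
    "(hoc ^^ zdepth t) 1 \<le> (hoc ^^ max (zdepth r) (zdepth t)) 1"
    by (intro CB_funpow_le[OF CB_hoc]; simp)+
  from osz_mono[OF ZAdd(1) this(1)] osz_mono[OF ZAdd(2) this(2)] show ?case
    by (simp add: osz_add)
next
  case (ZFrob t)
  have "1 \<le> (hoc ^^ zdepth t) 1" using CB_funpow_le[OF CB_hoc, of 0 "zdepth t" 1 1] by simp
  then have "osz ((hoc ^^ zdepth t) 1) (monom 1 1)" by (intro osz_monom) auto
  from osz_oc[OF this ZFrob] show ?case by simp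
next
  case (ZMulz t)
  have "1 \<le> (hoc ^^ zdepth t) 1" using CB_funpow_le[OF CB_hoc, of 0 "zdepth t" 1 1] by simp
  then have "osz ((hoc ^^ zdepth t) 1) (monom (monom 1 1) 0)"
    by (intro osz_monom PF_monom) (auto simp: degree_monom_eq)
  from osz_oc[OF this ZMulz] show ?case by simp
qed simp_all

definition wenv :: "(nat \<Rightarrow> 'a poly fract) \<Rightarrow> nat \<Rightarrow> 'a poly fract" where
  "wenv E j = (case j of 0 \<Rightarrow> 1 | Suc i \<Rightarrow> E i)"

lemma wenv_upd: "wenv (E(i := x)) = (wenv E)(Suc i := x)"
  by (rule ext) (auto simp: wenv_def split: nat.split)

lemma sum_delta_ev: "k < u \<Longrightarrow> (\<Sum>j<u. ev (if j = k then 1 else 0) (x j)) = x k" for u :: nat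
proof -
  assume "k < u"
  have "(\<Sum>j<u. ev (if j = k then 1 else 0) (x j)) = (\<Sum>j<u. if j = k then x k else 0)"
    by (intro sum.cong) auto
  also have "\<dots> = x k" using \<open>k < u\<close> by simp
  finally show ?thesis .
qed

lemma lpz_val_zop:
  assumes "\<And>i. i \<in> lpz_term_vars t \<Longrightarrow> Suc i < u" "0 < u"
  shows "lpz_val p E t = (\<Sum>j<u. ev (zop t j) (wenv E j))"
  using assms(1)
proof (induction t)
  case (ZVar i)
  then show ?case using sum_delta_ev[of "Suc i" u "wenv E"] by (simp add: wenv_def)
next
  case ZOne
  then show ?case using sum_delta_ev[of 0 u "wenv E"] assms(2) by (simp add: wenv_def)
next
  case (ZAdd r t)
  then show ?case by (simp add: ev_add sum.distrib)
next
  case (ZFrob t)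
  then show ?case using frob_sum[of _ _ 1] by (simp add: ev_oc ev_monom)
next
  case (ZMulz t)
  have "z_fract = to_fract (monom (1 :: 'a) 1)" by (simp add: z_fract_def monom_Suc monom_0)
  with ZMulz show ?case by (simp add: ev_oc ev_monom sum_distrib_left)
qed simp

lemma PP_zero:
  assumes "\<And>j. osz u (B j)" "0 < u"
  shows "{w. (\<Sum>j<u. ev (B j) (w j)) = 0} \<in> PP u"
proof -
  define B' where "B' i j = (if i = 0 then B j else 0)" for i j :: nat
  define Z where "Z = (\<lambda>(i::nat) (j::nat). 0 :: 'a poly poly)"
  have Z: "ap u Z x i = 0" for x i by (simp add: Z_def)
  have B': "ap u B' w i = (if i = 0 then \<Sum>j<u. ev (B j) (w j) else 0)" for w i by (simp add: B'_def)
  have "{w. (\<Sum>j<u. ev (B j) (w j)) = 0} = PPm u B' Z Z"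
    unfolding PPm_def Z B' using assms(2) by (auto intro!: exI[of _ "\<lambda>_. 0"])
  moreover have "msz u u u B'" "msz u u u Z" using assms(1) by (auto simp: msz_def B'_def Z_def)
  ultimately show ?thesis unfolding PP_def by blast
qed

lemma PP_inF:
  assumes "\<And>j. osz u (B j)" "0 < u"
  shows "{w. (\<Sum>j<u. ev (B j) (w j)) \<in> Rd 0} \<in> PP u"
proof -
  define B' where "B' i j = (if i = 0 then B j else 0)" for i j :: nat
  define Z where "Z = (\<lambda>(i::nat) (j::nat). 0 :: 'a poly poly)"
  define N where "N i j = (if i = 0 then if j = 0 then 1 else 0 else 0 :: 'a poly poly)" for i j :: nat
  have Z: "ap u Z x i = 0" for x i by (simp add: Z_def)
  have B': "ap u B' w i = (if i = 0 then \<Sum>j<u. ev (B j) (w j) else 0)" for w i by (simp add: B'_def)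
  have N: "ap u N y i = (if i = 0 then y 0 else 0)" for y i
    using sum_delta_ev[OF assms(2), of y] by (simp add: N_def)
  have "{w. (\<Sum>j<u. ev (B j) (w j)) \<in> Rd 0} = PPm u B' Z N"
  proof (intro equalityI subsetI)
    fix w assume "w \<in> {w. (\<Sum>j<u. ev (B j) (w j)) \<in> Rd 0}"
    then have "- (\<Sum>j<u. ev (B j) (w j)) \<in> Rd 0" using Rd_uminus by blast
    then show "w \<in> PPm u B' Z N"
      unfolding PPm_def Z B' N
      by (intro CollectI exI[of _ "\<lambda>_. 0"] exI[of _ "\<lambda>_. - (\<Sum>j<u. ev (B j) (w j))"]) simp
  next
    fix w assume "w \<in> PPm u B' Z N"
    then obtain \<xi> \<eta> where "\<forall>j<u. \<eta> j \<in> Rd 0"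
      and eq: "\<forall>i<u. (if i = 0 then \<Sum>j<u. ev (B j) (w j) else 0) + 0 + (if i = 0 then \<eta> 0 else 0) = (0 :: 'a poly fract)"
      unfolding PPm_def Z B' N by (elim CollectE exE conjE)
    then have "\<eta> 0 \<in> Rd 0" "(\<Sum>j<u. ev (B j) (w j)) + \<eta> 0 = 0"
      using assms(2) eq[THEN spec, of 0] by (blast, simp)
    then have "(\<Sum>j<u. ev (B j) (w j)) = - \<eta> 0" by (simp add: eq_neg_iff_add_eq_0)
    then show "w \<in> {w. (\<Sum>j<u. ev (B j) (w j)) \<in> Rd 0}" using Rd_uminus \<open>\<eta> 0 \<in> Rd 0\<close> by simp
  qed
  moreover have "msz u u u B'" "msz u u u Z" "msz u u u N"
    using assms(1) by (auto simp: msz_def B'_def Z_def N_def)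
  ultimately show ?thesis unfolding PP_def by blast
qed

definition tok :: "nat \<Rightarrow> lpz_term \<Rightarrow> bool" where
  "tok u t \<longleftrightarrow> (\<forall>i\<in>lpz_term_vars t. Suc i < u) \<and> (hoc ^^ zdepth t) 1 \<le> u \<and> 0 < u"

lemma tok_mono: "tok u t \<Longrightarrow> u \<le> v \<Longrightarrow> tok v t"
  unfolding tok_def by (meson less_le_trans order_trans)

lemma eqv_val_eq:
  assumes "eqv u (wenv E) (wenv E')" "tok u r" "tok u t" "lpz_val p E r = lpz_val p E t"
  shows "lpz_val p E' r = lpz_val p E' t"
proof -
  let ?B = "\<lambda>j. zop r j - zop t j"
  have v: "(\<Sum>j<u. ev (?B j) (wenv E j)) = lpz_val p E r - lpz_val p E t" for E
    using assms(2,3) by (simp add: ev_diff sum_subtractf lpz_val_zop[of r u] lpz_val_zop[of t u] tok_def)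
  have "osz u (?B j)" for j
    using assms(2,3) by (intro osz_diff osz_mono[OF osz_zop]) (auto simp: tok_def)
  then have "{w. (\<Sum>j<u. ev (?B j) (w j)) = 0} \<in> PP u" using assms(2) by (intro PP_zero) (auto simp: tok_def)
  from assms(1)[unfolded eqv_def, THEN bspec, OF this] show ?thesis
    using assms(4) by (simp add: v)
qed

lemma eqv_val_inF:
  assumes "eqv u (wenv E) (wenv E')" "tok u t" "lpz_val p E t \<in> range const_fract"
  shows "lpz_val p E' t \<in> range const_fract"
proof -
  have v: "(\<Sum>j<u. ev (zop t j) (wenv E j)) = lpz_val p E t" for E
    using assms(2) by (simp add: lpz_val_zop[of t u] tok_def)
  have "osz u (zop t j)" for j
    using assms(2) by (intro osz_mono[OF osz_zop]) (auto simp: tok_def)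
  then have "{w. (\<Sum>j<u. ev (zop t j) (w j)) \<in> Rd 0} \<in> PP u" using assms(2) by (intro PP_inF) (auto simp: tok_def)
  from assms(1)[unfolded eqv_def, THEN bspec, OF this] show ?thesis
    using assms(3) by (simp add: v Rd_zero)
qed

lemma eqv_sym: "eqv u w w' \<Longrightarrow> eqv u w' w" by (simp add: eqv_def)

definition envok :: "(nat \<Rightarrow> 'a poly fract) \<Rightarrow> bool" where "envok E \<longleftrightarrow> (\<forall>i. E i \<in> RR)"

lemma wenv_RR: "envok E \<Longrightarrow> wenv E j \<in> RR"
  by (auto simp: envok_def wenv_def split: nat.split)

lemma eqv_extend:
  assumes "eqv (hS u) (wenv E) (wenv E')" "envok E" "envok E'" "x \<in> RR" "Suc i < u"
  shows "\<exists>x'\<in>RR. eqv u (wenv (E(i := x))) (wenv (E'(i := x')))"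
proof -
  obtain d where d: "\<forall>j\<in>{..<hS u}. wenv E' j \<in> Rd d"
    using RR_common[of "{..<hS u}" "wenv E'"] wenv_RR[OF assms(3)] by blast
  have "wenv E j \<in> RR" for j by (rule wenv_RR[OF assms(2)])
  moreover have "\<And>j. j < hS u \<Longrightarrow> wenv E' j \<in> Rd d" using d by blast
  ultimately show ?thesis
    using back_and_forth[OF assms(5) _ assms(4,1)] Rd_RR unfolding wenv_upd by blast
qed

lemma eqv_funpow_mono: "eqv ((hS ^^ k) u) w w' \<Longrightarrow> m \<le> k \<Longrightarrow> v \<le> u \<Longrightarrow> eqv ((hS ^^ m) v) w w'"
  by (erule eqv_mono) (rule CB_funpow_le[OF CB_hS])

lemma funpow_hS_ge: "u \<le> (hS ^^ k) u"
  using CB_funpow_le[OF CB_hS, of 0 k u u] by simp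

definition base :: "nat \<Rightarrow> nat" where "base N = (hoc ^^ N) (Suc N) + (N + N + 3)"

lemma CB_base: "base \<in> CB"
proof -
  have "(\<lambda>N. (hoc ^^ N) (Suc N) + (N + N + 3)) \<in> CB"
    by (intro CB_add CB_add_const CB_id CB_funpow[OF CB_hoc CB_id CB_Suc[OF CB_id]])
  then show ?thesis by (simp add: base_def[abs_def])
qed

lemma tok_base: "zdepth t \<le> N \<Longrightarrow> (\<And>i. i \<in> lpz_term_vars t \<Longrightarrow> i \<le> N + N) \<Longrightarrow> tok ((hS ^^ k) (base N)) t"
proof (rule tok_mono[OF _ funpow_hS_ge])
  assume a: "zdepth t \<le> N" "\<And>i. i \<in> lpz_term_vars t \<Longrightarrow> i \<le> N + N"
  have "(hoc ^^ zdepth t) 1 \<le> (hoc ^^ N) (Suc N)" by (rule CB_funpow_le[OF CB_hoc a(1)]) simp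
  moreover have "Suc i < base N" if "i \<in> lpz_term_vars t" for i using a(2)[OF that] by (simp add: base_def)
  ultimately show "tok (base N) t" unfolding tok_def by (simp add: base_def)
qed

lemma Suc_less_level: "i \<le> N + N \<Longrightarrow> Suc i < (hS ^^ k) (base N)"
proof -
  assume "i \<le> N + N"
  then have "Suc i < base N" by (simp add: base_def)
  also have "\<dots> \<le> (hS ^^ k) (base N)" by (rule funpow_hS_ge)
  finally show ?thesis .
qed

lemma lp_sat_invariant:
  assumes "lp_code \<sigma> \<le> N" "lp_code \<sigma> \<le> k" "eqv ((hS ^^ k) (base N)) (wenv E) (wenv E')" "envok E" "envok E'"
    "\<And>i. i \<le> N \<Longrightarrow> E (N + i) = const_fract (c i)" "\<And>i. i \<le> N \<Longrightarrow> E' (N + i) = const_fract (c' i)"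
  shows "lp_sat p c \<sigma> \<longleftrightarrow> lp_sat p c' \<sigma>"
  using assms
proof (induction \<sigma> arbitrary: k E E' c c')
  case (LEq r t)
  have le: "lp_term_code r \<le> N" "lp_term_code t \<le> N"
    using lp_code_LEq[of r t] LEq.prems(1) lp_code_LEq(2)[of t r] by linarith+
  have "tok ((hS ^^ k) (base N)) (emb N r)" if "lp_term_code r \<le> N" for r
  proof (rule tok_base)
    show "zdepth (emb N r) \<le> N" using zdepth_emb[of N r] that by linarith
    fix i assume "i \<in> lpz_term_vars (emb N r)"
    then obtain l where "i = N + l" "l \<in> lp_term_vars r" unfolding vars_emb by blast
    then show "i \<le> N + N" using lp_term_vars_le[of l r] that by linarith
  qed
  then have tok: "tok ((hS ^^ k) (base N)) (emb N r)" "tok ((hS ^^ k) (base N)) (emb N t)"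
    using le by blast+
  have v: "lpz_val p E (emb N r) = const_fract (lp_val p c r)" "lpz_val p E' (emb N r) = const_fract (lp_val p c' r)"
    if "lp_term_code r \<le> N" for r
    by (rule lpz_val_emb, rule LEq.prems(6), rule order_trans[OF lp_term_vars_le that], assumption)
       (rule lpz_val_emb, rule LEq.prems(7), rule order_trans[OF lp_term_vars_le that], assumption)
  have "lp_val p c r = lp_val p c t \<Longrightarrow> lp_val p c' r = lp_val p c' t"
    using eqv_val_eq[OF LEq.prems(3) tok] by (simp add: v le)
  moreover have "lp_val p c' r = lp_val p c' t \<Longrightarrow> lp_val p c r = lp_val p c t"
    using eqv_val_eq[OF eqv_sym[OF LEq.prems(3)] tok] by (simp add: v le)
  ultimately show ?case by (simp only: lp_sat.simps) blast
next
  case (LNeg \<sigma>)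
  have "lp_code \<sigma> \<le> N" "lp_code \<sigma> \<le> k" using lp_code_LNeg[of \<sigma>] LNeg.prems(1,2) by linarith+
  from LNeg.IH[OF this LNeg.prems(3-7)] show ?case by simp
next
  case (LAnd \<sigma> \<tau>)
  have "lp_code \<sigma> \<le> N" "lp_code \<sigma> \<le> k" "lp_code \<tau> \<le> N" "lp_code \<tau> \<le> k"
    using lp_code_LAnd[of \<sigma> \<tau>] lp_code_LAnd(2)[of \<tau> \<sigma>] LAnd.prems(1,2) by linarith+
  then show ?case using LAnd.IH(1)[OF _ _ LAnd.prems(3-7)] LAnd.IH(2)[OF _ _ LAnd.prems(3-7)] by simp
next
  case (LEx i \<sigma>)
  obtain k' where k': "k = Suc k'" using LEx.prems(2) lp_code_LEx(1)[of \<sigma> i] by (cases k) auto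
  have le: "lp_code \<sigma> \<le> N" "lp_code \<sigma> \<le> k'" "i \<le> N"
    using lp_code_LEx(1)[of \<sigma> i] lp_code_LEx(2)[of i \<sigma>] LEx.prems(1,2) k' by linarith+
  let ?u = "(hS ^^ k') (base N)"
  have one: "\<exists>a'. lp_sat p (c'(i := a')) \<sigma>"
    if sat: "lp_sat p (c(i := a)) \<sigma>" and q: "eqv ((hS ^^ k) (base N)) (wenv E) (wenv E')" and ok: "envok E" "envok E'"
      and c: "\<And>i. i \<le> N \<Longrightarrow> E (N + i) = const_fract (c i)" "\<And>i. i \<le> N \<Longrightarrow> E' (N + i) = const_fract (c' i)"
    for E E' c c' a
  proof -
    have aR: "const_fract a \<in> RR" using Rd_zero Rd_RR by blast
    have q': "eqv (hS ?u) (wenv E) (wenv E')" using q by (simp add: k')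
    have Ni: "Suc (N + i) < ?u" using le(3) by (intro Suc_less_level) simp
    obtain x' where x': "x' \<in> RR" "eqv ?u (wenv (E(N + i := const_fract a))) (wenv (E'(N + i := x')))"
      using eqv_extend[OF q' ok aR Ni] by blast
    have "tok ?u (ZVar (N + i))" using le(3) by (intro tok_base) auto
    from eqv_val_inF[OF x'(2) this] obtain a' where a': "x' = const_fract a'" by auto
    have "lp_sat p (c(i := a)) \<sigma> \<longleftrightarrow> lp_sat p (c'(i := a')) \<sigma>"
    proof (rule LEx.IH[OF le(1,2) x'(2)])
      show "envok (E(N + i := const_fract a))" "envok (E'(N + i := x'))"
        using ok aR x'(1) by (auto simp: envok_def)
    qed (use c a' in auto)
    then show ?thesis using sat by blast
  qed
  have "lp_sat p c (LEx i \<sigma>) \<Longrightarrow> lp_sat p c' (LEx i \<sigma>)"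
    using one[OF _ LEx.prems(3-7)] by auto
  moreover have "lp_sat p c' (LEx i \<sigma>) \<Longrightarrow> lp_sat p c (LEx i \<sigma>)"
    using one[OF _ eqv_sym[OF LEx.prems(3)] LEx.prems(5,4,7,6)] by auto
  ultimately show ?case by blast
qed

definition lupd :: "nat \<Rightarrow> 'a poly fract list \<Rightarrow> (nat \<Rightarrow> 'a poly fract) \<Rightarrow> nat \<Rightarrow> 'a poly fract" where
  "lupd N xs E j = (if N \<le> j \<and> j < N + length xs then xs ! (j - N) else E j)"

lemma lupd_snoc: "lupd N (xs @ [x]) E = (lupd N xs E)(N + length xs := x)"
  by (rule ext) (auto simp: lupd_def nth_append)

lemma envok_lupd: "envok E \<Longrightarrow> set xs \<subseteq> RR \<Longrightarrow> envok (lupd N xs E)"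
  unfolding envok_def lupd_def by (auto dest: nth_mem[of "_ - N" xs])

lemma eqv_extend_list:
  assumes "eqv ((hS ^^ (length xs + k)) (base N)) (wenv E) (wenv E')" "envok E" "envok E'"
    "set xs \<subseteq> RR" "length xs \<le> N"
  shows "\<exists>xs'. length xs' = length xs \<and> set xs' \<subseteq> RR \<and>
    eqv ((hS ^^ k) (base N)) (wenv (lupd N xs E)) (wenv (lupd N xs' E'))"
  using assms(1,4,5)
proof (induction xs arbitrary: k rule: rev_induct)
  case Nil
  have "lupd N [] F = F" for F by (rule ext) (auto simp: lupd_def)
  then show ?case using Nil by simp
next
  case (snoc x xs)
  obtain xs' where xs': "length xs' = length xs" "set xs' \<subseteq> RR"
    "eqv ((hS ^^ Suc k) (base N)) (wenv (lupd N xs E)) (wenv (lupd N xs' E'))"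
    using snoc.IH[of "Suc k"] snoc.prems by auto
  have q: "eqv (hS ((hS ^^ k) (base N))) (wenv (lupd N xs E)) (wenv (lupd N xs' E'))" using xs'(3) by simp
  have Nx: "Suc (N + length xs) < (hS ^^ k) (base N)" using snoc.prems(3) by (intro Suc_less_level) simp
  have ok: "envok (lupd N xs E)" "envok (lupd N xs' E')"
    by (rule envok_lupd[OF assms(2)], use snoc.prems(2) in simp, rule envok_lupd[OF assms(3) xs'(2)])
  have xR: "x \<in> RR" using snoc.prems(2) by simp
  obtain x' where "x' \<in> RR" "eqv ((hS ^^ k) (base N)) (wenv ((lupd N xs E)(N + length xs := x)))
      (wenv ((lupd N xs' E')(N + length xs := x')))"
    using eqv_extend[OF q ok xR Nx] by blast
  then have "length (xs' @ [x']) = length (xs @ [x]) \<and> set (xs' @ [x']) \<subseteq> RR \<and>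
    eqv ((hS ^^ k) (base N)) (wenv (lupd N (xs @ [x]) E)) (wenv (lupd N (xs' @ [x']) E'))"
    unfolding lupd_snoc xs'(1) using xs'(1,2) by (intro conjI) (simp, simp, assumption)
  then show ?case by (rule exI)
qed

lemma lpz_val_cong: "(\<And>i. i \<in> lpz_term_vars t \<Longrightarrow> E i = E' i) \<Longrightarrow> lpz_val p E t = lpz_val p E' t"
  by (induction t) auto

lemma lpz_sat_invariant:
  assumes "lpz_code \<phi> \<le> N" "lpz_code \<phi> \<le> k" "eqv ((hS ^^ k) (base N)) (wenv E) (wenv E')" "envok E" "envok E'"
    "\<And>i. N \<le> i \<Longrightarrow> E i = 0" "\<And>i. N \<le> i \<Longrightarrow> E' i = 0"
  shows "lpz_sat p RR E \<phi> \<longleftrightarrow> lpz_sat p RR E' \<phi>"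
  using assms
proof (induction \<phi> arbitrary: k E E')
  case (ZEq r t)
  have le: "lpz_term_code r \<le> N" "lpz_term_code t \<le> N"
    by (rule order_trans[OF lpz_code_ZEq(1) ZEq.prems(1)], rule order_trans[OF lpz_code_ZEq(2) ZEq.prems(1)])
  have tok: "tok ((hS ^^ k) (base N)) r" if "lpz_term_code r \<le> N" for r
  proof (rule tok_base)
    show "zdepth r \<le> N" using zdepth_le[of r] that by linarith
    show "i \<le> N + N" if "i \<in> lpz_term_vars r" for i
      using lpz_term_vars_le[OF that] \<open>lpz_term_code r \<le> N\<close> by linarith
  qed
  show ?case
    using eqv_val_eq[OF ZEq.prems(3) tok[OF le(1)] tok[OF le(2)]]
      eqv_val_eq[OF eqv_sym[OF ZEq.prems(3)] tok[OF le(1)] tok[OF le(2)]] by auto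
next
  case (ZInF t)
  have tok: "tok ((hS ^^ k) (base N)) t"
  proof (rule tok_base)
    show "zdepth t \<le> N" using zdepth_le[of t] lpz_code_ZInF[of t] ZInF.prems(1) by linarith
    show "i \<le> N + N" if "i \<in> lpz_term_vars t" for i
      using lpz_term_vars_le[OF that] lpz_code_ZInF[of t] ZInF.prems(1) by linarith
  qed
  show ?case
    using eqv_val_inF[OF ZInF.prems(3) tok] eqv_val_inF[OF eqv_sym[OF ZInF.prems(3)] tok]
    unfolding lpz_sat.simps by blast
next
  case (ZPred n \<sigma> ts)
  have one: "lpz_sat p RR E' (ZPred n \<sigma> ts)"
    if sat: "lpz_sat p RR E (ZPred n \<sigma> ts)" and q: "eqv ((hS ^^ k) (base N)) (wenv E) (wenv E')" and ok: "envok E" "envok E'"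
      and z: "\<And>i. N \<le> i \<Longrightarrow> E i = 0" "\<And>i. N \<le> i \<Longrightarrow> E' i = 0"
    for E E'
  proof -
    obtain cs where cs: "map (lpz_val p E) ts = map const_fract cs"
      "lp_sat p (\<lambda>i. if i < length cs then cs ! i else 0) \<sigma>" using sat by auto
    define xs where "xs = map const_fract cs"
    have len: "length cs = length ts" using cs(1) by (metis length_map)
    have lx: "length xs = length ts" by (simp add: xs_def len)
    have code: "length ts + lp_code \<sigma> \<le> k" "length ts + lp_code \<sigma> \<le> N"
      using lpz_code_ZPred(2)[of ts \<sigma> n] ZPred.prems(1,2) by linarith+
    have q': "eqv ((hS ^^ (length xs + lp_code \<sigma>)) (base N)) (wenv E) (wenv E')"
      by (rule eqv_funpow_mono[OF q]) (use code lx in auto)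
    have xsR: "set xs \<subseteq> RR" unfolding xs_def using Rd_zero Rd_RR by auto
    obtain xs' where xs': "length xs' = length xs" "set xs' \<subseteq> RR"
      "eqv ((hS ^^ lp_code \<sigma>) (base N)) (wenv (lupd N xs E)) (wenv (lupd N xs' E'))"
      using eqv_extend_list[OF q' ok xsR] code lx by auto
    let ?L = "(hS ^^ lp_code \<sigma>) (base N)"
    have lval: "lpz_val p (lupd N ys F) t = lpz_val p F t" if "t \<in> set ts" for ys F t
    proof (rule lpz_val_cong)
      fix i assume "i \<in> lpz_term_vars t"
      then have "i < N" using lpz_term_vars_le[of i t] lpz_code_ZPred(3)[OF that, of n \<sigma>] ZPred.prems(1) by linarith
      then show "lupd N ys F i = F i" by (simp add: lupd_def)
    qed
    have "xs' ! m = lpz_val p E' (ts ! m) \<and> xs' ! m \<in> range const_fract" if m: "m < length ts" for m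
    proof
      have tm: "ts ! m \<in> set ts" using m by simp
      have tok1: "tok ?L (ZVar (N + m))" using m code by (intro tok_base) auto
      have tok2: "tok ?L (ts ! m)"
      proof (rule tok_base)
        show "zdepth (ts ! m) \<le> N"
          using zdepth_le[of "ts ! m"] lpz_code_ZPred(3)[OF tm, of n \<sigma>] ZPred.prems(1) by linarith
        show "i \<le> N + N" if "i \<in> lpz_term_vars (ts ! m)" for i
          using lpz_term_vars_le[OF that] lpz_code_ZPred(3)[OF tm, of n \<sigma>] ZPred.prems(1) by linarith
      qed
      have xm: "xs ! m = lpz_val p E (ts ! m)" using cs(1) m unfolding xs_def by (metis nth_map)
      have "lpz_val p (lupd N xs E) (ZVar (N + m)) = lpz_val p (lupd N xs E) (ts ! m)"
        unfolding lval[OF tm] using m lx xm by (simp add: lupd_def)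
      from eqv_val_eq[OF xs'(3) tok1 tok2 this]
      show "xs' ! m = lpz_val p E' (ts ! m)" unfolding lval[OF tm] using m lx xs'(1) by (simp add: lupd_def)
      have "lpz_val p (lupd N xs E) (ZVar (N + m)) \<in> range const_fract"
        using m lx len by (simp add: lupd_def xs_def)
      from eqv_val_inF[OF xs'(3) tok1 this]
      show "xs' ! m \<in> range const_fract" using m lx xs'(1) by (simp add: lupd_def)
    qed
    note xs'm = this
    then have "\<forall>m. \<exists>a. m < length ts \<longrightarrow> xs' ! m = const_fract a" by blast
    from choice[OF this] obtain f where f: "\<forall>m. m < length ts \<longrightarrow> xs' ! m = const_fract (f m)" ..
    define cs' where "cs' = map f [0..<length ts]"
    have "map (lpz_val p E') ts = map const_fract cs'"
      using xs'm f by (intro nth_equalityI) (auto simp: cs'_def)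
    moreover have "lp_sat p (\<lambda>i. if i < length cs then cs ! i else 0) \<sigma>
        \<longleftrightarrow> lp_sat p (\<lambda>i. if i < length cs' then cs' ! i else 0) \<sigma>"
    proof (rule lp_sat_invariant[OF _ order_refl xs'(3)])
      show "lp_code \<sigma> \<le> N" using code by linarith
      show "envok (lupd N xs E)" "envok (lupd N xs' E')"
        by (rule envok_lupd[OF ok(1) xsR], rule envok_lupd[OF ok(2) xs'(2)])
      show "lupd N xs E (N + i) = const_fract (if i < length cs then cs ! i else 0)" for i
        using z(1) by (auto simp: lupd_def xs_def const_fract_def)
      show "lupd N xs' E' (N + i) = const_fract (if i < length cs' then cs' ! i else 0)" for i
        using z(2) f xs'(1) lx by (auto simp: lupd_def cs'_def) (simp add: const_fract_def)
    qed
    ultimately show ?thesis using cs(2) by auto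
  qed
  show ?case
    using one[OF _ ZPred.prems(3-7)] one[OF _ eqv_sym[OF ZPred.prems(3)] ZPred.prems(5,4,7,6)] by blast
next
  case (ZNeg \<phi>)
  have "lpz_code \<phi> \<le> N" "lpz_code \<phi> \<le> k" using lpz_code_ZNeg[of \<phi>] ZNeg.prems(1,2) by linarith+
  from ZNeg.IH[OF this ZNeg.prems(3-7)] show ?case by simp
next
  case (ZAnd \<phi> \<psi>)
  have "lpz_code \<phi> \<le> N" "lpz_code \<phi> \<le> k" "lpz_code \<psi> \<le> N" "lpz_code \<psi> \<le> k"
    using lpz_code_ZAnd(1)[of \<phi> \<psi>] lpz_code_ZAnd(2)[of \<psi> \<phi>] ZAnd.prems(1,2) by linarith+
  then show ?case using ZAnd.IH(1)[OF _ _ ZAnd.prems(3-7)] ZAnd.IH(2)[OF _ _ ZAnd.prems(3-7)] by simp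
next
  case (ZEx i \<phi>)
  obtain k' where k': "k = Suc k'" using ZEx.prems(2) lpz_code_ZEx(1)[of \<phi> i] by (cases k) auto
  have le: "lpz_code \<phi> \<le> N" "lpz_code \<phi> \<le> k'" "i < N"
    using lpz_code_ZEx(1)[of \<phi> i] lpz_code_ZEx(2)[of i \<phi>] ZEx.prems(1,2) k' by linarith+
  let ?u = "(hS ^^ k') (base N)"
  have one: "\<exists>a'\<in>RR. lpz_sat p RR (E'(i := a')) \<phi>"
    if a: "a \<in> RR" "lpz_sat p RR (E(i := a)) \<phi>" and q: "eqv ((hS ^^ k) (base N)) (wenv E) (wenv E')" and ok: "envok E" "envok E'"
      and z: "\<And>i. N \<le> i \<Longrightarrow> E i = 0" "\<And>i. N \<le> i \<Longrightarrow> E' i = 0"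
    for E E' a
  proof -
    have q': "eqv (hS ?u) (wenv E) (wenv E')" using q by (simp add: k')
    have Ni: "Suc i < ?u" using le(3) by (intro Suc_less_level) simp
    obtain x' where x': "x' \<in> RR" "eqv ?u (wenv (E(i := a))) (wenv (E'(i := x')))"
      using eqv_extend[OF q' ok a(1) Ni] by blast
    have "lpz_sat p RR (E(i := a)) \<phi> \<longleftrightarrow> lpz_sat p RR (E'(i := x')) \<phi>"
    proof (rule ZEx.IH[OF le(1,2) x'(2)])
      show "envok (E(i := a))" "envok (E'(i := x'))" using ok a(1) x'(1) by (auto simp: envok_def)
    qed (use z le(3) in auto)
    then show ?thesis using a(2) x'(1) by blast
  qed
  have "lpz_sat p RR E (ZEx i \<phi>) \<Longrightarrow> lpz_sat p RR E' (ZEx i \<phi>)"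
    using one[OF _ _ ZEx.prems(3-7)] by auto
  moreover have "lpz_sat p RR E' (ZEx i \<phi>) \<Longrightarrow> lpz_sat p RR E (ZEx i \<phi>)"
    using one[OF _ _ eqv_sym[OF ZEx.prems(3)] ZEx.prems(5,4,7,6)] by auto
  ultimately show ?case by blast
qed

definition hQ :: "nat \<Rightarrow> nat" where "hQ n = hEF ((hS ^^ n) (base n) + n)"

lemma CB_hQ: "hQ \<in> CB"
  using CB_comp[OF CB_hEF CB_add[OF CB_funpow[OF CB_hS CB_id CB_base] CB_id]]
  by (simp add: hQ_def[abs_def])

theorem bounded_quantifier:
  assumes code: "lpz_code (ZEx i \<phi>) \<le> N" and E: "\<And>j. E j \<in> Rd d" "\<And>j. N \<le> j \<Longrightarrow> E j = 0"
  shows "lpz_sat p RR E (ZEx i \<phi>) \<longleftrightarrow> (\<exists>a\<in>Rd (hQ (N + d)). lpz_sat p RR (E(i := a)) \<phi>)"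
proof
  assume "lpz_sat p RR E (ZEx i \<phi>)"
  then obtain x where x: "x \<in> RR" "lpz_sat p RR (E(i := x)) \<phi>" by auto
  let ?u = "(hS ^^ N) (base N)"
  have le: "lpz_code \<phi> \<le> N" "i < N" using lpz_code_ZEx(1)[of \<phi> i] lpz_code_ZEx(2)[of i \<phi>] code by linarith+
  have RR: "E j \<in> RR" for j using E(1) Rd_RR by blast
  have "wenv E j \<in> RR" for j by (rule wenv_RR) (simp add: envok_def RR)
  moreover have "wenv E j \<in> Rd d" for j using E(1) by (auto simp: wenv_def split: nat.split)
  moreover have "eqv (hS ?u) (wenv E) (wenv E)" by (simp add: eqv_def)
  moreover have "Suc i < ?u" using le(2) by (intro Suc_less_level) simp
  ultimately obtain x' where x': "x' \<in> Rd (hEF (?u + d))" "eqv ?u (wenv (E(i := x))) (wenv (E(i := x')))"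
    using back_and_forth[of "Suc i" ?u "wenv E" x "wenv E" d] x(1) unfolding wenv_upd by blast
  have "lpz_sat p RR (E(i := x)) \<phi> \<longleftrightarrow> lpz_sat p RR (E(i := x')) \<phi>"
  proof (rule lpz_sat_invariant[OF le(1) le(1) x'(2)])
    show "envok (E(i := x))" "envok (E(i := x'))" using RR x(1) Rd_RR[OF x'(1)] by (auto simp: envok_def)
  qed (use E(2) le(2) in auto)
  moreover have "hEF (?u + d) \<le> hQ (N + d)"
  proof -
    have "?u \<le> (hS ^^ (N + d)) (base (N + d))"
      by (rule CB_funpow_le[OF CB_hS]) (simp_all add: CB_mono[OF CB_base])
    then show ?thesis unfolding hQ_def by (intro CB_mono[OF CB_hEF]) simp
  qed
  ultimately show "\<exists>a\<in>Rd (hQ (N + d)). lpz_sat p RR (E(i := a)) \<phi>" using x(2) x'(1) Rd_monoD by blast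
next
  assume "\<exists>a\<in>Rd (hQ (N + d)). lpz_sat p RR (E(i := a)) \<phi>"
  then show "lpz_sat p RR E (ZEx i \<phi>)" using Rd_RR by auto
qed

end

section \<open>Computable functions on lists and on syntax\<close>

lemma computable_case_list [computable_intros]:
  fixes xs :: "'a::enc \<Rightarrow> 'b::enc list" and f :: "'a \<Rightarrow> 'c::enc"
  assumes "computable xs" "computable f" "computable (\<lambda>t. g (fst t) (fst (snd t)) (snd (snd t)))"
  shows "computable (\<lambda>x. case xs x of [] \<Rightarrow> f x | y # ys \<Rightarrow> g x y ys)"
proof -
  obtain g' where g: "rf 1 g'" "\<And>x y ys. g' [prod_encode (enc x, prod_encode (enc y, enc ys))] = enc (g x y ys)"
    using assms(3) by (force simp: computable_def enc_prod_def)
  have "rf 1 (\<lambda>xs. g' [xs ! 0])" using g(1) by (rule rf_cong) (auto dest!: length_1)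
  then have "computable (\<lambda>n :: nat. g' [n])" by (rule computableI) (simp add: enc_nat_def)
  then have "computable (\<lambda>x. g' [prod_encode (enc x, enc (xs x) - 1)])"
    by (rule computable_comp) (intro computable_intros assms(1))
  then have "computable (\<lambda>x. if enc (xs x) = 0 then enc (f x) else g' [prod_encode (enc x, enc (xs x) - 1)])"
    by (intro computable_intros assms(1,2))
  then obtain k where k: "rf 1 k"
    "\<And>x. k [enc x] = (if enc (xs x) = 0 then enc (f x) else g' [prod_encode (enc x, enc (xs x) - 1)])"
    by (auto simp: computable_def enc_nat_def)
  show ?thesis
  proof (rule computableI[OF k(1)])
    fix x
    show "k [enc x] = enc (case xs x of [] \<Rightarrow> f x | y # ys \<Rightarrow> g x y ys)"
      using g(2) by (cases "xs x") (simp_all add: k(2) enc_Nil enc_Cons)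
  qed
qed

lemma computable_Cons [computable_intros]:
  "computable f \<Longrightarrow> computable g \<Longrightarrow> computable (\<lambda>x. f x # g x)"
  by (rule computable_lift2[of "\<lambda>a b. Suc (prod_encode (a, b))"])
     (simp_all add: enc_Cons rf_Suc rf_prod_encode rf_proj)

lemma length_le_enc: "length (xs :: 'a::enc list) \<le> enc xs"
proof (induction xs)
  case (Cons a xs)
  then show ?case using prod_encode_ge[of "enc a" "enc xs"] by (simp add: enc_Cons)
qed simp

lemma computable_foldl [computable_intros]:
  fixes xs :: "'a::enc \<Rightarrow> 'b::enc list" and b :: "'a \<Rightarrow> 'c::enc"
  assumes "computable b" "computable xs" "computable (\<lambda>t. h (fst t) (fst (snd t)) (snd (snd t)))"
  shows "computable (\<lambda>x. foldl (h x) (b x) (xs x))"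
proof -
  let ?st = "\<lambda>x r. case snd r of [] \<Rightarrow> r | y # ys \<Rightarrow> (h x (fst r) y, ys)"
  have st: "computable (\<lambda>t. ?st (fst t) (snd t))"
  proof (intro computable_intros)
    have "computable (\<lambda>t :: ('a \<times> 'c \<times> 'b list) \<times> 'b \<times> 'b list. (fst (fst t), fst (snd (fst t)), fst (snd t)))"
      by (intro computable_intros)
    from computable_comp[OF assms(3) this]
    show "computable (\<lambda>t :: ('a \<times> 'c \<times> 'b list) \<times> 'b \<times> 'b list. h (fst (fst t)) (fst (snd (fst t))) (fst (snd t)))"
      by simp
  qed
  have "computable (\<lambda>x. fst ((?st x ^^ enc (xs x)) (b x, xs x)))"
    by (rule computable_fst, rule computable_funpow[OF _ _ st]) (intro computable_intros assms(1,2))+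
  moreover have "fst ((?st x ^^ n) (c, ys)) = foldl (h x) c ys" if "length ys \<le> n" for x n c ys
    using that
  proof (induction n arbitrary: c ys)
    case (Suc n)
    have *: "(?st x ^^ Suc n) (c, ys) = (?st x ^^ n) (?st x (c, ys))" for c ys by (simp only: funpow_Suc_right o_apply)
    have "(?st x ^^ n) (c, []) = (c, [])" for n by (induction n) simp_all
    then show ?case using Suc by (cases ys) (simp_all add: * del: funpow.simps)
  qed simp
  ultimately show ?thesis by (simp add: length_le_enc)
qed

lemma computable_rev [computable_intros]: "computable xs \<Longrightarrow> computable (\<lambda>x. rev (xs x))"
proof -
  assume "computable xs"
  then have "computable (\<lambda>x. foldl (\<lambda>r y. y # r) [] (xs x))" by (intro computable_intros)
  moreover have "foldl (\<lambda>r y. y # r) zs ys = rev ys @ zs" for ys zs :: "'b list"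
    by (induction ys arbitrary: zs) auto
  ultimately show ?thesis by simp
qed

lemma computable_foldr [computable_intros]:
  fixes xs :: "'a::enc \<Rightarrow> 'b::enc list" and b :: "'a \<Rightarrow> 'c::enc"
  assumes "computable (\<lambda>t. h (fst t) (fst (snd t)) (snd (snd t)))" "computable xs" "computable b"
  shows "computable (\<lambda>x. foldr (h x) (xs x) (b x))"
proof -
  have "computable (\<lambda>x. foldl (\<lambda>r y. h x y r) (b x) (rev (xs x)))"
  proof (intro computable_intros assms(2,3))
    have "computable (\<lambda>t :: 'a \<times> 'c \<times> 'b. (fst t, snd (snd t), fst (snd t)))"
      by (intro computable_intros)
    from computable_comp[OF assms(1) this]
    show "computable (\<lambda>t. h (fst t) (snd (snd t)) (fst (snd t)))" by simp
  qed
  then show ?thesis by (simp add: foldl_conv_foldr)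
qed

lemma computable_append [computable_intros]:
  "computable f \<Longrightarrow> computable g \<Longrightarrow> computable (\<lambda>x. f x @ g x)"
proof -
  assume "computable f" "computable g"
  then have "computable (\<lambda>x. foldr (\<lambda>y r. y # r) (f x) (g x))" by (intro computable_intros)
  moreover have "foldr (\<lambda>y r. y # r) ys zs = ys @ zs" for ys zs :: "'b list" by (induction ys) auto
  ultimately show ?thesis by simp
qed

lemma computable_map [computable_intros]:
  fixes xs :: "'a::enc \<Rightarrow> 'b::enc list" and h :: "'a \<Rightarrow> 'b \<Rightarrow> 'c::enc"
  assumes "computable (\<lambda>t. h (fst t) (snd t))" "computable xs"
  shows "computable (\<lambda>x. map (h x) (xs x))"
proof -
  have "computable (\<lambda>x. foldr (\<lambda>y r. h x y # r) (xs x) [])"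
  proof (intro computable_intros assms(2))
    have "computable (\<lambda>t :: 'a \<times> 'b \<times> 'c list. (fst t, fst (snd t)))" by (intro computable_intros)
    from computable_comp[OF assms(1) this]
    show "computable (\<lambda>t :: 'a \<times> 'b \<times> 'c list. h (fst t) (fst (snd t)))" by simp
  qed
  moreover have "foldr (\<lambda>y r. k y # r) ys [] = map k ys" for ys and k :: "'b \<Rightarrow> 'c" by (induction ys) auto
  ultimately show ?thesis by simp
qed

lemma computable_length [computable_intros]: "computable xs \<Longrightarrow> computable (\<lambda>x. length (xs x))"
proof -
  assume "computable xs"
  then have "computable (\<lambda>x. foldl (\<lambda>r y. Suc r) 0 (xs x))" by (intro computable_intros)
  moreover have "foldl (\<lambda>r y. Suc r) n ys = n + length ys" for ys :: "'b list" and n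
    by (induction ys arbitrary: n) auto
  ultimately show ?thesis by simp
qed

lemma computable_upt [computable_intros]: "computable n \<Longrightarrow> computable (\<lambda>x. [0..<n x])"
proof -
  assume "computable n"
  then have "computable (\<lambda>x. rec_nat [] (\<lambda>k r. r @ [k]) (n x))" by (intro computable_intros)
  moreover have "rec_nat [] (\<lambda>k r. r @ [k]) m = [0..<m]" for m by (induction m) auto
  ultimately show ?thesis by simp
qed

lemma computable_nth_default [computable_intros]:
  assumes "computable d" "computable xs" "computable n"
  shows "computable (\<lambda>x. nth_default (d x) (xs x) (n x))"
proof -
  let ?tl = "\<lambda>r. case r of [] \<Rightarrow> [] | y # ys \<Rightarrow> ys"
  have "computable (\<lambda>x. case (?tl ^^ n x) (xs x) of [] \<Rightarrow> d x | y # ys \<Rightarrow> y)"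
    by (intro computable_intros assms computable_comp[OF assms(1)])
  moreover have "(case (?tl ^^ m) ys of [] \<Rightarrow> c | y # ys \<Rightarrow> y) = nth_default c ys m" for m c and ys :: "'b list"
  proof (induction m arbitrary: ys)
    case 0
    show ?case by (cases ys) simp_all
  next
    case (Suc m)
    have "(?tl ^^ Suc m) ys = (?tl ^^ m) (?tl ys)" by (simp add: funpow_swap1)
    then show ?case using Suc by (cases ys) (simp_all add: nth_default_def)
  qed
  ultimately show ?thesis by simp
qed

lemma computable_list_all [computable_intros]:
  assumes "computable (\<lambda>t. P (fst t) (snd t))" "computable xs"
  shows "computable (\<lambda>x. \<forall>y\<in>set (xs x). P x y)"
proof -
  have "computable (\<lambda>x. foldr (\<lambda>y r. y \<and> r) (map (P x) (xs x)) True)"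
    by (intro computable_intros assms)
  moreover have "foldr (\<lambda>y r. y \<and> r) ys True \<longleftrightarrow> (\<forall>y\<in>set ys. y)" for ys by (induction ys) auto
  ultimately show ?thesis by simp
qed

lemma computable_list_decode [computable_intros]: "computable f \<Longrightarrow> computable (\<lambda>x. list_decode (f x))"
  by (rule computable_lift[of "\<lambda>a. a"]) (simp_all add: rf_proj enc_list_def enc_nat_def[abs_def])

definition tag :: "nat \<Rightarrow> nat" where "tag n = fst (prod_decode n)"
definition arg :: "nat \<Rightarrow> nat" where "arg n = snd (prod_decode n)"

lemma tag_arg [simp]: "tag (prod_encode (a, b)) = a" "arg (prod_encode (a, b)) = b"
  by (simp_all add: tag_def arg_def)

lemma tag_le: "tag n \<le> n" and arg_le: "arg n \<le> n" and arg_less: "tag n \<noteq> 0 \<Longrightarrow> arg n < n"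
  using prod_encode_ge[of "tag n" "arg n"] by (simp_all add: tag_def arg_def)

lemma tag_arg_less: "tag n \<noteq> 0 \<Longrightarrow> tag (arg n) < n" "tag n \<noteq> 0 \<Longrightarrow> arg (arg n) < n"
  using arg_less[of n] tag_le[of "arg n"] arg_le[of "arg n"] by linarith+

lemma computable_tag [computable_intros]: "computable f \<Longrightarrow> computable (\<lambda>x. tag (f x))"
  unfolding tag_def
  by (rule computable_lift[of "\<lambda>a. fst (prod_decode a)"]) (simp_all add: enc_nat_def rf_fst rf_proj)

lemma computable_arg [computable_intros]: "computable f \<Longrightarrow> computable (\<lambda>x. arg (f x))"
  unfolding arg_def
  by (rule computable_lift[of "\<lambda>a. snd (prod_decode a)"]) (simp_all add: enc_nat_def rf_snd rf_proj)

text \<open>Course-of-values recursion: the list of all earlier values is computed by primitive recursion.\<close>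

lemma computable_tree_recursion:
  fixes F :: "'a::enc \<Rightarrow> nat \<Rightarrow> 'b::enc"
  assumes g: "computable (\<lambda>t. g (fst t) (fst (snd t)) (fst (snd (snd t))) (fst (snd (snd (snd t)))) (snd (snd (snd (snd t)))))"
    and F: "\<And>a n. F a n = g a n (if arg n < n then F a (arg n) else d)
      (if tag (arg n) < n then F a (tag (arg n)) else d) (if arg (arg n) < n then F a (arg (arg n)) else d)"
  shows "computable (\<lambda>t. F (fst t) (snd t))"
proof -
  let ?G = "\<lambda>a n r. g a n (if arg n < n then nth_default d r (n - 1 - arg n) else d)
    (if tag (arg n) < n then nth_default d r (n - 1 - tag (arg n)) else d)
    (if arg (arg n) < n then nth_default d r (n - 1 - arg (arg n)) else d)"
  have G: "computable (\<lambda>t. ?G (fst t) (fst (snd t)) (snd (snd t)))"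
  proof -
    have "computable (\<lambda>t :: 'a \<times> nat \<times> 'b list. (fst t, fst (snd t),
        (if arg (fst (snd t)) < fst (snd t) then nth_default d (snd (snd t)) (fst (snd t) - 1 - arg (fst (snd t))) else d),
        (if tag (arg (fst (snd t))) < fst (snd t) then nth_default d (snd (snd t)) (fst (snd t) - 1 - tag (arg (fst (snd t)))) else d),
        (if arg (arg (fst (snd t))) < fst (snd t) then nth_default d (snd (snd t)) (fst (snd t) - 1 - arg (arg (fst (snd t)))) else d)))"
      by (intro computable_intros)
    from computable_comp[OF g this] show ?thesis by (simp only: fst_conv snd_conv)
  qed
  have nth: "nth_default d (rev (map (F a) [0..<n])) (n - Suc k) = F a k" if "k < n" for a n k
    using that by (simp add: nth_default_def rev_nth)
  have hist: "rec_nat [] (\<lambda>k r. ?G a k r # r) n = rev (map (F a) [0..<n])" for a n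
  proof (induction n)
    case (Suc n)
    have "?G a n (rev (map (F a) [0..<n])) = F a n"
      unfolding F[of a n] by (simp add: nth cong: if_cong)
    then show ?case using Suc by simp
  qed simp
  have "computable (\<lambda>t. rec_nat [] (\<lambda>k r. ?G (fst t) k r # r) (Suc (snd t)))"
  proof (rule computable_rec_nat)
    have "computable (\<lambda>t :: ('a \<times> nat) \<times> nat \<times> 'b list. (fst (fst t), fst (snd t), snd (snd t)))"
      by (intro computable_intros)
    from computable_comp[OF G this]
    show "computable (\<lambda>t :: ('a \<times> nat) \<times> nat \<times> 'b list. ?G (fst (fst t)) (fst (snd t)) (snd (snd t)) # snd (snd t))"
      by (intro computable_Cons) (simp only: fst_conv snd_conv, intro computable_intros)
  qed (intro computable_intros)+
  then have "computable (\<lambda>t. rev (map (F (fst t)) [0..<Suc (snd t)]))" by (simp only: hist)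
  then have "computable (\<lambda>t. nth_default d (rev (map (F (fst t)) [0..<Suc (snd t)])) (Suc (snd t) - Suc (snd t)))"
    by (rule computable_nth_default[OF computable_const]) (intro computable_intros)
  then show ?thesis by (subst (asm) nth) simp_all
qed

lemma computable_on_type:
  assumes "computable (\<lambda>t. H (fst t) (dec (snd t)))" "\<And>y :: 'b::enc. dec (enc y) = y" "computable f" "computable g"
  shows "computable (\<lambda>x. H (f x) (g x :: 'b))"
proof -
  have "computable (\<lambda>x. (f x, enc (g x)))" by (intro computable_intros assms(3,4))
  from computable_comp[OF assms(1) this] show ?thesis by (simp add: assms(2))
qed

function lp_term_dec :: "nat \<Rightarrow> lp_term" where
  "lp_term_dec n = (if tag n = 0 then LVar (arg n) else if tag n = 1 then LZero
    else if tag n = 2 then LOne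
    else if tag n = 3 then LAdd (lp_term_dec (tag (arg n))) (lp_term_dec (arg (arg n)))
    else LFrob (lp_term_dec (arg n)))"
  by auto
termination by (relation "measure id") (auto simp: arg_less tag_arg_less)

function lp_form_dec :: "nat \<Rightarrow> lp_form" where
  "lp_form_dec n = (if tag n = 0 then LEq (lp_term_dec (tag (arg n))) (lp_term_dec (arg (arg n)))
    else if tag n = 1 then LNeg (lp_form_dec (arg n))
    else if tag n = 2 then LAnd (lp_form_dec (tag (arg n))) (lp_form_dec (arg (arg n)))
    else LEx (tag (arg n)) (lp_form_dec (arg (arg n))))"
  by auto
termination by (relation "measure id") (auto simp: arg_less tag_arg_less)

function lpz_term_dec :: "nat \<Rightarrow> lpz_term" where
  "lpz_term_dec n = (if tag n = 0 then ZVar (arg n) else if tag n = 1 then ZZero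
    else if tag n = 2 then ZOne
    else if tag n = 3 then ZAdd (lpz_term_dec (tag (arg n))) (lpz_term_dec (arg (arg n)))
    else if tag n = 4 then ZFrob (lpz_term_dec (arg n))
    else ZMulz (lpz_term_dec (arg n)))"
  by auto
termination by (relation "measure id") (auto simp: arg_less tag_arg_less)

function lpz_form_dec :: "nat \<Rightarrow> lpz_form" where
  "lpz_form_dec n = (if tag n = 0 then ZEq (lpz_term_dec (tag (arg n))) (lpz_term_dec (arg (arg n)))
    else if tag n = 1 then ZInF (lpz_term_dec (arg n))
    else if tag n = 2 then ZPred (tag (arg n)) (lp_form_dec (tag (arg (arg n))))
      (map lpz_term_dec (list_decode (arg (arg (arg n)))))
    else if tag n = 3 then ZNeg (lpz_form_dec (arg n))
    else if tag n = 4 then ZAnd (lpz_form_dec (tag (arg n))) (lpz_form_dec (arg (arg n)))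
    else ZEx (tag (arg n)) (lpz_form_dec (arg (arg n))))"
  by auto
termination by (relation "measure id") (auto simp: arg_less tag_arg_less)

declare lp_term_dec.simps [simp del] lp_form_dec.simps [simp del]
  lpz_term_dec.simps [simp del] lpz_form_dec.simps [simp del]

lemma lp_term_dec_enc [simp]: "lp_term_dec (lp_term_code t) = t"
  by (induction t) (subst lp_term_dec.simps, simp)+

lemma lp_form_dec_enc [simp]: "lp_form_dec (lp_code \<phi>) = \<phi>"
  by (induction \<phi>) (subst lp_form_dec.simps, simp)+

lemma lpz_term_dec_enc [simp]: "lpz_term_dec (lpz_term_code t) = t"
  by (induction t) (subst lpz_term_dec.simps, simp)+

lemma lpz_form_dec_enc [simp]: "lpz_form_dec (lpz_code \<phi>) = \<phi>"
  by (induction \<phi>) (subst lpz_form_dec.simps, simp add: comp_def)+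

lemmas enc_syntax = enc_lp_term_def enc_lp_form_def enc_lpz_term_def enc_lpz_form_def

lemma computable_constructors [computable_intros]:
  "computable i \<Longrightarrow> computable (\<lambda>x. LVar (i x))"
  "computable t \<Longrightarrow> computable t' \<Longrightarrow> computable (\<lambda>x. LAdd (t x) (t' x))"
  "computable t \<Longrightarrow> computable (\<lambda>x. LFrob (t x))"
  "computable t \<Longrightarrow> computable t' \<Longrightarrow> computable (\<lambda>x. LEq (t x) (t' x))"
  "computable \<phi> \<Longrightarrow> computable (\<lambda>x. LNeg (\<phi> x))"
  "computable \<phi> \<Longrightarrow> computable \<psi> \<Longrightarrow> computable (\<lambda>x. LAnd (\<phi> x) (\<psi> x))"
  "computable i \<Longrightarrow> computable \<phi> \<Longrightarrow> computable (\<lambda>x. LEx (i x) (\<phi> x))"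
  "computable i \<Longrightarrow> computable (\<lambda>x. ZVar (i x))"
  "computable u \<Longrightarrow> computable u' \<Longrightarrow> computable (\<lambda>x. ZAdd (u x) (u' x))"
  "computable u \<Longrightarrow> computable (\<lambda>x. ZFrob (u x))"
  "computable u \<Longrightarrow> computable (\<lambda>x. ZMulz (u x))"
  "computable u \<Longrightarrow> computable u' \<Longrightarrow> computable (\<lambda>x. ZEq (u x) (u' x))"
  "computable u \<Longrightarrow> computable (\<lambda>x. ZInF (u x))"
  "computable \<alpha> \<Longrightarrow> computable (\<lambda>x. ZNeg (\<alpha> x))"
  "computable \<alpha> \<Longrightarrow> computable \<beta> \<Longrightarrow> computable (\<lambda>x. ZAnd (\<alpha> x) (\<beta> x))"
  "computable i \<Longrightarrow> computable \<alpha> \<Longrightarrow> computable (\<lambda>x. ZEx (i x) (\<alpha> x))"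
  by (rule computable_lift[of "\<lambda>a. prod_encode (0, a)"]
        computable_lift[of "\<lambda>a. prod_encode (1, a)"]
        computable_lift[of "\<lambda>a. prod_encode (3, a)"]
        computable_lift[of "\<lambda>a. prod_encode (4, a)"]
        computable_lift[of "\<lambda>a. prod_encode (5, a)"]
        computable_lift2[of "\<lambda>a b. prod_encode (0, prod_encode (a, b))"]
        computable_lift2[of "\<lambda>a b. prod_encode (2, prod_encode (a, b))"]
        computable_lift2[of "\<lambda>a b. prod_encode (3, prod_encode (a, b))"]
        computable_lift2[of "\<lambda>a b. prod_encode (4, prod_encode (a, b))"]
        computable_lift2[of "\<lambda>a b. prod_encode (5, prod_encode (a, b))"],
      simp add: rf_prod_encode rf_proj rf_const, assumption, (assumption)?, simp add: enc_syntax; fail)+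

lemma computable_ZPred [computable_intros]:
  assumes "computable n" "computable \<sigma>" "computable ts"
  shows "computable (\<lambda>x. ZPred (n x) (\<sigma> x) (ts x))"
  by (rule computable_lift2[where h = "\<lambda>a b. prod_encode (2, prod_encode (a, b))" and f = n
        and g = "\<lambda>x. (\<sigma> x, ts x)" and k = "\<lambda>n y. ZPred n (fst y) (snd y)", simplified])
     (simp_all add: rf_prod_encode rf_proj rf_const assms computable_Pair enc_syntax enc_Pair
        enc_list_def[abs_def] comp_def flip: enc_lpz_term_def[abs_def])

lemma computable_lp_term_dec: "computable lp_term_dec"
proof -
  have "computable (\<lambda>t. (\<lambda>(a :: nat) n. lp_term_dec n) (fst t) (snd t))"
    by (rule computable_tree_recursion[where d = LZero and g = "\<lambda>a n x y z. if tag n = 0 then LVar (arg n)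
      else if tag n = 1 then LZero else if tag n = 2 then LOne else if tag n = 3 then LAdd y z else LFrob x"])
      (intro computable_intros, subst lp_term_dec.simps, simp add: arg_less tag_arg_less)
  from computable_comp[OF this, of "\<lambda>n. (0, n)"] show ?thesis by (simp add: computable_intros)
qed

lemma computable_lp_form_dec: "computable lp_form_dec"
proof -
  note [computable_intros] = computable_comp[OF computable_lp_term_dec]
  have "computable (\<lambda>t. (\<lambda>(a :: nat) n. lp_form_dec n) (fst t) (snd t))"
    by (rule computable_tree_recursion[where d = "LEq LZero LZero" and g = "\<lambda>a n x y z.
      if tag n = 0 then LEq (lp_term_dec (tag (arg n))) (lp_term_dec (arg (arg n)))
      else if tag n = 1 then LNeg x else if tag n = 2 then LAnd y z else LEx (tag (arg n)) z"])
      (intro computable_intros, subst lp_form_dec.simps, simp add: arg_less tag_arg_less)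
  from computable_comp[OF this, of "\<lambda>n. (0, n)"] show ?thesis by (simp add: computable_intros)
qed

lemma computable_lpz_term_dec: "computable lpz_term_dec"
proof -
  have "computable (\<lambda>t. (\<lambda>(a :: nat) n. lpz_term_dec n) (fst t) (snd t))"
    by (rule computable_tree_recursion[where d = ZZero and g = "\<lambda>a n x y z. if tag n = 0 then ZVar (arg n)
      else if tag n = 1 then ZZero else if tag n = 2 then ZOne else if tag n = 3 then ZAdd y z
      else if tag n = 4 then ZFrob x else ZMulz x"])
      (intro computable_intros, subst lpz_term_dec.simps, simp add: arg_less tag_arg_less)
  from computable_comp[OF this, of "\<lambda>n. (0, n)"] show ?thesis by (simp add: computable_intros)
qed

lemma computable_lpz_form_dec: "computable lpz_form_dec"
proof -
  note [computable_intros] = computable_comp[OF computable_lp_form_dec] computable_comp[OF computable_lpz_term_dec]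
  have "computable (\<lambda>t. (\<lambda>(a :: nat) n. lpz_form_dec n) (fst t) (snd t))"
    by (rule computable_tree_recursion[where d = "ZInF ZZero" and g = "\<lambda>a n x y z.
      if tag n = 0 then ZEq (lpz_term_dec (tag (arg n))) (lpz_term_dec (arg (arg n)))
      else if tag n = 1 then ZInF (lpz_term_dec (arg n))
      else if tag n = 2 then ZPred (tag (arg n)) (lp_form_dec (tag (arg (arg n))))
        (map lpz_term_dec (list_decode (arg (arg (arg n)))))
      else if tag n = 3 then ZNeg x else if tag n = 4 then ZAnd y z else ZEx (tag (arg n)) z"])
      (intro computable_intros, subst lpz_form_dec.simps, simp add: arg_less tag_arg_less)
  from computable_comp[OF this, of "\<lambda>n. (0, n)"] show ?thesis by (simp add: computable_intros)
qed

lemma computable_lp_term_vars [computable_intros]: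
  assumes "computable i" "computable t"
  shows "computable (\<lambda>x. i x \<in> lp_term_vars (t x))"
proof (rule computable_on_type[where dec = lp_term_dec, OF _ _ assms])
  show "computable (\<lambda>t. fst t \<in> lp_term_vars (lp_term_dec (snd t)))"
    by (rule computable_tree_recursion[where d = False and g = "\<lambda>a n x y z. if tag n = 0 then a = arg n
      else if tag n = 1 then False else if tag n = 2 then False else if tag n = 3 then y \<or> z else x"])
      (intro computable_intros, subst lp_term_dec.simps, simp add: arg_less tag_arg_less)
qed (simp add: enc_syntax)

lemma computable_lp_free [computable_intros]:
  assumes "computable i" "computable \<phi>"
  shows "computable (\<lambda>x. i x \<in> lp_free (\<phi> x))"
proof (rule computable_on_type[where dec = lp_form_dec, OF _ _ assms])
  note [computable_intros] = computable_comp[OF computable_lp_term_dec]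
  show "computable (\<lambda>t. fst t \<in> lp_free (lp_form_dec (snd t)))"
    by (rule computable_tree_recursion[where d = False and g = "\<lambda>a n x y z.
      if tag n = 0 then a \<in> lp_term_vars (lp_term_dec (tag (arg n))) \<or> a \<in> lp_term_vars (lp_term_dec (arg (arg n)))
      else if tag n = 1 then x else if tag n = 2 then y \<or> z else \<not> a = tag (arg n) \<and> z"])
      (intro computable_intros, subst lp_form_dec.simps, auto simp: arg_less tag_arg_less)
qed (simp add: enc_syntax)

lemma computable_lpz_term_vars [computable_intros]:
  assumes "computable i" "computable t"
  shows "computable (\<lambda>x. i x \<in> lpz_term_vars (t x))"
proof (rule computable_on_type[where dec = lpz_term_dec, OF _ _ assms])
  show "computable (\<lambda>t. fst t \<in> lpz_term_vars (lpz_term_dec (snd t)))"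
    by (rule computable_tree_recursion[where d = False and g = "\<lambda>a n x y z. if tag n = 0 then a = arg n
      else if tag n = 1 then False else if tag n = 2 then False else if tag n = 3 then y \<or> z else x"])
      (intro computable_intros, subst lpz_term_dec.simps, simp add: arg_less tag_arg_less)
qed (simp add: enc_syntax)

lemma computable_lpz_free [computable_intros]:
  assumes "computable i" "computable \<phi>"
  shows "computable (\<lambda>x. i x \<in> lpz_free (\<phi> x))"
proof (rule computable_on_type[where dec = lpz_form_dec, OF _ _ assms])
  note [computable_intros] = computable_comp[OF computable_lpz_term_dec]
  show "computable (\<lambda>t. fst t \<in> lpz_free (lpz_form_dec (snd t)))"
    by (rule computable_tree_recursion[where d = False and g = "\<lambda>a n x y z.
      if tag n = 0 then a \<in> lpz_term_vars (lpz_term_dec (tag (arg n))) \<or> a \<in> lpz_term_vars (lpz_term_dec (arg (arg n)))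
      else if tag n = 1 then a \<in> lpz_term_vars (lpz_term_dec (arg n))
      else if tag n = 2 then \<not> (\<forall>u\<in>set (list_decode (arg (arg (arg n)))). \<not> a \<in> lpz_term_vars (lpz_term_dec u))
      else if tag n = 3 then x else if tag n = 4 then y \<or> z else \<not> a = tag (arg n) \<and> z"])
      (intro computable_intros, subst lpz_form_dec.simps, auto simp: arg_less tag_arg_less)
qed (simp add: enc_syntax)

lemma lp_free_le: "i \<in> lp_free \<phi> \<Longrightarrow> i \<le> lp_code \<phi>"
proof (induction \<phi>)
  case (LEq s t)
  then show ?case using lp_term_vars_le[of i s] lp_term_vars_le[of i t] lp_code_LEq[of s t] lp_code_LEq[of t s] by auto
next
  case (LNeg \<phi>)
  then show ?case using lp_code_LNeg[of \<phi>] by auto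
next
  case (LAnd \<phi> \<psi>)
  then show ?case using lp_code_LAnd(1)[of \<phi> \<psi>] lp_code_LAnd(2)[of \<psi> \<phi>] by auto
next
  case (LEx k \<phi>)
  then show ?case using lp_code_LEx(1)[of \<phi> k] by auto
qed

lemma lpz_free_le: "i \<in> lpz_free \<phi> \<Longrightarrow> i \<le> lpz_code \<phi>"
proof (induction \<phi>)
  case (ZEq s t)
  then show ?case using lpz_term_vars_le[of i s] lpz_term_vars_le[of i t] lpz_code_ZEq[of s t] lpz_code_ZEq[of t s] by auto
next
  case (ZInF t)
  then show ?case using lpz_term_vars_le[of i t] lpz_code_ZInF[of t] by auto
next
  case (ZPred n \<sigma> ts)
  then obtain t where t: "t \<in> set ts" "i \<in> lpz_term_vars t" by auto
  show ?case using lpz_term_vars_le[OF t(2)] lpz_code_ZPred(3)[OF t(1), of n \<sigma>] by linarith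
next
  case (ZNeg \<phi>)
  then show ?case using lpz_code_ZNeg[of \<phi>] by auto
next
  case (ZAnd \<phi> \<psi>)
  then show ?case using lpz_code_ZAnd(1)[of \<phi> \<psi>] lpz_code_ZAnd(2)[of \<psi> \<phi>] by auto
next
  case (ZEx k \<phi>)
  then show ?case using lpz_code_ZEx(1)[of \<phi> k] by auto
qed

lemma computable_lp_free_subset [computable_intros]:
  assumes "computable n" "computable \<phi>"
  shows "computable (\<lambda>x. lp_free (\<phi> x) \<subseteq> {..<n x})"
proof -
  have "computable (\<lambda>x. \<forall>i\<in>set [0..<Suc (enc (\<phi> x))]. \<not> i \<in> lp_free (\<phi> x) \<or> i < n x)"
    by (intro computable_intros computable_comp[OF assms(1)] computable_comp[OF assms(2)] assms)
  moreover have "(\<forall>i\<in>set [0..<Suc (enc \<psi>)]. \<not> i \<in> lp_free \<psi> \<or> i < m) \<longleftrightarrow> lp_free \<psi> \<subseteq> {..<m}" for \<psi> m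
    using lp_free_le[of _ \<psi>] by (fastforce simp: enc_syntax less_Suc_eq_le simp del: upt_Suc)
  ultimately show ?thesis by (simp only:)
qed

lemma computable_lpz_closed [computable_intros]:
  assumes "computable \<phi>"
  shows "computable (\<lambda>x. lpz_free (\<phi> x) = {})"
proof -
  have "computable (\<lambda>x. \<forall>i\<in>set [0..<Suc (enc (\<phi> x))]. \<not> i \<in> lpz_free (\<phi> x))"
    by (intro computable_intros computable_comp[OF assms] assms)
  moreover have "(\<forall>i\<in>set [0..<Suc (enc \<psi>)]. \<not> i \<in> lpz_free \<psi>) \<longleftrightarrow> lpz_free \<psi> = {}" for \<psi>
    using lpz_free_le[of _ \<psi>] by (fastforce simp: enc_syntax less_Suc_eq_le simp del: upt_Suc)
  ultimately show ?thesis by (simp only:)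
qed

lemma computable_lpz_wf [computable_intros]:
  assumes "computable \<phi>"
  shows "computable (\<lambda>x. lpz_wf (\<phi> x))"
proof (rule computable_on_type[where dec = lpz_form_dec and H = "\<lambda>a :: nat. lpz_wf", OF _ _ computable_const assms])
  note [computable_intros] = computable_comp[OF computable_lp_form_dec]
  show "computable (\<lambda>t :: nat \<times> nat. lpz_wf (lpz_form_dec (snd t)))"
    by (rule computable_tree_recursion[where d = True and F = "\<lambda>a n. lpz_wf (lpz_form_dec n)" and g = "\<lambda>a n x y z.
      if tag n = 0 then True else if tag n = 1 then True
      else if tag n = 2 then lp_free (lp_form_dec (tag (arg (arg n)))) \<subseteq> {..<tag (arg n)} \<and>
        length (list_decode (arg (arg (arg n)))) = tag (arg n)
      else if tag n = 3 then x else if tag n = 4 then y \<and> z else z"])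
      (intro computable_intros, subst lpz_form_dec.simps, auto simp: arg_less tag_arg_less)
qed (simp add: enc_syntax)

section \<open>Translation into the language of the field\<close>

definition padd :: "lp_term list \<Rightarrow> lp_term list \<Rightarrow> lp_term list" where
  "padd xs ys = map (\<lambda>k. LAdd (nth_default LZero xs k) (nth_default LZero ys k)) [0..<length xs + length ys]"

definition smul :: "nat \<Rightarrow> lp_term \<Rightarrow> lp_term" where
  "smul c t = (LAdd t ^^ c) LZero"

primrec mulc :: "nat list \<Rightarrow> lp_term list \<Rightarrow> lp_term list" where
  "mulc [] xs = []"
| "mulc (c # cs) xs = padd (map (smul c) xs) (LZero # mulc cs xs)"

definition frobl :: "nat \<Rightarrow> lp_term list \<Rightarrow> lp_term list" where
  "frobl p xs = foldr (\<lambda>t r. LFrob t # replicate (p - 1) LZero @ r) xs []"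

definition peq :: "lp_term list \<Rightarrow> lp_term list \<Rightarrow> lp_form" where
  "peq xs ys = foldr (\<lambda>k r. LAnd (LEq (nth_default LZero xs k) (nth_default LZero ys k)) r)
    [0..<length xs + length ys] (LEq LZero LZero)"

definition exv :: "nat list \<Rightarrow> lp_form \<Rightarrow> lp_form" where
  "exv vs \<psi> = foldr LEx vs \<psi>"

lemma computable_padd [computable_intros]:
  "computable f \<Longrightarrow> computable g \<Longrightarrow> computable (\<lambda>x. padd (f x) (g x))"
  unfolding padd_def
  by (intro computable_intros) (erule computable_comp, intro computable_intros | assumption)+

lemma computable_smul [computable_intros]:
  "computable f \<Longrightarrow> computable g \<Longrightarrow> computable (\<lambda>x. smul (f x) (g x))"
  unfolding smul_def
  by (intro computable_intros) (erule computable_comp, intro computable_intros | assumption)+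

lemma computable_mulc [computable_intros]: "computable f \<Longrightarrow> computable (\<lambda>x. mulc cs (f x))"
proof (induction cs)
  case (Cons c cs)
  have "computable (\<lambda>x. padd (map (smul c) (f x)) (LZero # mulc cs (f x)))"
    by (rule computable_padd[OF computable_map[OF computable_smul] computable_Cons])
      (rule computable_const computable_snd computable_id Cons.IH Cons.prems)+
  then show ?case by simp
qed (simp add: computable_const)

lemma computable_frobl [computable_intros]: "computable f \<Longrightarrow> computable (\<lambda>x. frobl p (f x))"
  unfolding frobl_def by (intro computable_intros)

lemma computable_peq [computable_intros]:
  "computable f \<Longrightarrow> computable g \<Longrightarrow> computable (\<lambda>x. peq (f x) (g x))"
  unfolding peq_def
  by (intro computable_intros) (erule computable_comp, intro computable_intros | assumption)+

lemma computable_exv [computable_intros]: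
  "computable f \<Longrightarrow> computable g \<Longrightarrow> computable (\<lambda>x. exv (f x) (g x))"
  unfolding exv_def by (intro computable_intros)

definition pv :: "nat \<Rightarrow> (nat \<Rightarrow> 'a::field) \<Rightarrow> lp_term list \<Rightarrow> 'a poly" where
  "pv p f ts = Poly (map (lp_val p f) ts)"

lemma coeff_pv: "coeff (pv p f ts) k = lp_val p f (nth_default LZero ts k)"
  by (simp add: pv_def coeff_Poly_eq nth_default_map_eq[where dflt' = LZero])

lemma pv_Nil [simp]: "pv p f [] = 0" and pv_Cons [simp]: "pv p f (t # ts) = pCons (lp_val p f t) (pv p f ts)"
  by (simp_all add: pv_def)

lemma pv_replicate: "pv p f (replicate n LZero @ ts) = monom 1 n * pv p f ts"
  by (induction n) (simp_all add: monom_0 monom_Suc)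

lemma pv_padd: "pv p f (padd xs ys) = pv p f xs + pv p f ys"
proof (rule poly_eqI)
  fix k
  show "coeff (pv p f (padd xs ys)) k = coeff (pv p f xs + pv p f ys) k"
    by (simp add: coeff_pv padd_def nth_default_def)
qed

lemma lp_val_smul: "lp_val p f (smul c t) = of_nat c * lp_val p f t"
  by (induction c) (simp_all add: smul_def algebra_simps)

lemma pv_mulc: "pv p f (mulc cs xs) = Poly (map of_nat cs) * pv p f xs"
proof (induction cs)
  case (Cons c cs)
  have "pv p f (map (smul c) xs) = smult (of_nat c) (pv p f xs)"
    by (rule poly_eqI) (simp add: coeff_pv nth_default_def lp_val_smul)
  with Cons show ?case by (simp add: pv_padd)
qed simp

lemma pv_mulc_power: "pv p f ((mulc cs ^^ n) xs) = Poly (map of_nat cs) ^ n * pv p f xs"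
  by (induction n) (simp_all add: pv_mulc)

lemma lp_sat_peq: "lp_sat p f (peq xs ys) \<longleftrightarrow> pv p f xs = pv p f ys"
proof -
  have "lp_sat p f (foldr (\<lambda>k r. LAnd (LEq (nth_default LZero xs k) (nth_default LZero ys k)) r) ks (LEq LZero LZero))
    \<longleftrightarrow> (\<forall>k\<in>set ks. coeff (pv p f xs) k = coeff (pv p f ys) k)" for ks
    by (induction ks) (simp_all add: coeff_pv)
  moreover have "coeff (pv p f xs) k = coeff (pv p f ys) k" if "\<not> k < length xs + length ys" for k
    using that by (simp add: coeff_pv nth_default_def)
  ultimately show ?thesis unfolding peq_def poly_eq_iff by auto
qed

lemma lp_sat_exv: "lp_sat p f (exv vs \<psi>) \<longleftrightarrow> (\<exists>g. lp_sat p (\<lambda>i. if i \<in> set vs then g i else f i) \<psi>)"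
proof (induction vs arbitrary: f)
  case (Cons v vs)
  have "(\<exists>a. lp_sat p (f(v := a)) (exv vs \<psi>)) \<longleftrightarrow> (\<exists>g. lp_sat p (\<lambda>i. if i \<in> set (v # vs) then g i else f i) \<psi>)"
  proof
    assume "\<exists>a. lp_sat p (f(v := a)) (exv vs \<psi>)"
    then obtain a g where "lp_sat p (\<lambda>i. if i \<in> set vs then g i else (f(v := a)) i) \<psi>" using Cons by blast
    moreover have "(\<lambda>i. if i \<in> set vs then g i else (f(v := a)) i)
      = (\<lambda>i. if i \<in> set (v # vs) then (if i \<in> set vs then g i else a) else f i)" by auto
    ultimately have "lp_sat p (\<lambda>i. if i \<in> set (v # vs) then (if i \<in> set vs then g i else a) else f i) \<psi>"
      by (simp only:)
    then show "\<exists>g. lp_sat p (\<lambda>i. if i \<in> set (v # vs) then g i else f i) \<psi>"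
      by (intro exI[of _ "\<lambda>i. if i \<in> set vs then g i else a"])
  next
    assume "\<exists>g. lp_sat p (\<lambda>i. if i \<in> set (v # vs) then g i else f i) \<psi>"
    then obtain g where "lp_sat p (\<lambda>i. if i \<in> set (v # vs) then g i else f i) \<psi>" ..
    moreover have "(\<lambda>i. if i \<in> set (v # vs) then g i else f i)
      = (\<lambda>i. if i \<in> set vs then g i else (f(v := g v)) i)" by auto
    ultimately have "lp_sat p (\<lambda>i. if i \<in> set vs then g i else (f(v := g v)) i) \<psi>" by (simp only:)
    then have "lp_sat p (f(v := g v)) (exv vs \<psi>)" unfolding Cons by (rule exI[where x = g])
    then show "\<exists>a. lp_sat p (f(v := a)) (exv vs \<psi>)" by (rule exI)
  qed
  then show ?case by (simp add: exv_def)
qed (simp add: exv_def)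

lemma lp_val_cong: "(\<And>i. i \<in> lp_term_vars t \<Longrightarrow> f i = g i) \<Longrightarrow> lp_val p f t = lp_val p g t"
  by (induction t) auto

lemma lp_sat_cong: "(\<And>i. i \<in> lp_free \<phi> \<Longrightarrow> f i = g i) \<Longrightarrow> lp_sat p f \<phi> \<longleftrightarrow> lp_sat p g \<phi>"
proof (induction \<phi> arbitrary: f g)
  case (LEq t u)
  have "lp_val p f t = lp_val p g t" "lp_val p f u = lp_val p g u"
    by (rule lp_val_cong, use LEq in simp)+
  then show ?case by simp
next
  case (LNeg \<phi>)
  have "lp_sat p f \<phi> = lp_sat p g \<phi>" by (rule LNeg.IH) (use LNeg.prems in simp)
  then show ?case by simp
next
  case (LAnd \<phi> \<psi>)
  have "lp_sat p f \<phi> = lp_sat p g \<phi>" "lp_sat p f \<psi> = lp_sat p g \<psi>"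
    by (rule LAnd.IH, use LAnd.prems in simp)+
  then show ?case by simp
next
  case (LEx i \<phi>)
  have "lp_sat p (f(i := a)) \<phi> = lp_sat p (g(i := a)) \<phi>" for a
    by (rule LEx.IH) (use LEx.prems in auto)
  then show ?case by simp
qed

definition close0 :: "lp_form \<Rightarrow> lp_form" where
  "close0 \<psi> = exv [0..<Suc (enc \<psi>)] (foldr (\<lambda>k r. LAnd (LEq (LVar k) LZero) r) [0..<Suc (enc \<psi>)] \<psi>)"

lemma computable_close0 [computable_intros]: "computable f \<Longrightarrow> computable (\<lambda>x. close0 (f x))"
  unfolding close0_def by (intro computable_intros)

lemma lp_free_exv: "lp_free (exv vs \<psi>) = lp_free \<psi> - set vs"
  by (induction vs) (auto simp: exv_def)

lemma lp_free_close0: "lp_free (close0 \<psi>) = {}"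
proof -
  have "lp_free (foldr (\<lambda>k r. LAnd (LEq (LVar k) LZero) r) ks \<psi>) = set ks \<union> lp_free \<psi>" for ks
    by (induction ks) auto
  then show ?thesis
    using lp_free_le[of _ \<psi>] by (auto simp: close0_def lp_free_exv enc_syntax less_Suc_eq_le simp del: upt_Suc)
qed

lemma lp_sat_close0: "lp_sat p (f :: nat \<Rightarrow> 'a) (close0 \<psi>) \<longleftrightarrow> lp_sat p (\<lambda>_. 0 :: 'a::field) \<psi>"
proof -
  have and0: "lp_sat p h (foldr (\<lambda>k r. LAnd (LEq (LVar k) LZero) r) ks \<psi>)
    \<longleftrightarrow> (\<forall>k\<in>set ks. h k = 0) \<and> lp_sat p h \<psi>" for h :: "nat \<Rightarrow> 'a" and ks
    by (induction ks) auto
  have zero: "lp_sat p h \<psi> \<longleftrightarrow> lp_sat p (\<lambda>_. 0 :: 'a) \<psi>" if "\<forall>k<Suc (enc \<psi>). h k = 0" for h :: "nat \<Rightarrow> 'a"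
    by (rule lp_sat_cong) (use that lp_free_le[of _ \<psi>] in \<open>auto simp: enc_syntax less_Suc_eq_le\<close>)
  show ?thesis unfolding close0_def lp_sat_exv and0
  proof (safe, goal_cases)
    case (1 g)
    then show ?case using zero[of "\<lambda>i. if i \<in> set [0..<Suc (enc \<psi>)] then g i else f i"] by (simp del: upt_Suc)
  next
    case 2
    have "lp_sat p (\<lambda>i. if i \<in> set [0..<Suc (enc \<psi>)] then 0 else f i) \<psi>"
      using zero[of "\<lambda>i. if i \<in> set [0..<Suc (enc \<psi>)] then 0 else f i"] 2 by (simp del: upt_Suc)
    then show ?case by (intro exI[of _ "\<lambda>_. 0"]) (simp del: upt_Suc)
  qed
qed

lemma lp_theory_close0: "close0 \<psi> \<in> lp_theory TYPE('a::field) p \<longleftrightarrow> lp_sat p (\<lambda>_. 0 :: 'a) \<psi>"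
  by (simp add: lp_theory_def lp_free_close0 lp_sat_close0)

locale sentence_translation = frob_ring p s for p :: nat and s :: "'a::field poly" +
  fixes cs :: "nat list"
  assumes s_cs: "s = Poly (map of_nat cs)"
begin

definition cvars :: "nat \<Rightarrow> nat \<Rightarrow> nat \<Rightarrow> nat list" where
  "cvars N d i = map (\<lambda>j. N + prod_encode (i, j)) [0..<Suc (D * d)]"

lemma set_cvars: "v \<in> set (cvars N d i) \<longleftrightarrow> (\<exists>j\<le>D * d. v = N + prod_encode (i, j))"
  by (auto simp: cvars_def simp del: upt_Suc)

lemma computable_cvars [computable_intros]:
  "computable n \<Longrightarrow> computable d \<Longrightarrow> computable i \<Longrightarrow> computable (\<lambda>x. cvars (n x) (d x) (i x))"
  unfolding cvars_def
  by (intro computable_intros) (erule computable_comp, intro computable_intros | assumption)+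

text \<open>A term is translated to a pair \<open>(e, xs)\<close>: its value is the polynomial with coefficient list
  \<open>xs\<close>, divided by \<open>s\<^sup>e\<close>.  The variable \<open>i\<close> ranges over fractions with denominator \<open>s\<^sup>E\<close>, and its
  coefficients are the variables \<open>N + prod_encode (i, j)\<close>, where \<open>N\<close> exceeds all variables of the
  given sentence.\<close>

primrec tm :: "nat \<Rightarrow> nat \<Rightarrow> lpz_term \<Rightarrow> nat \<times> lp_term list" where
  "tm N E (ZVar i) = (E, map LVar (cvars N E i))"
| "tm N E ZZero = (0, [])"
| "tm N E ZOne = (0, [LOne])"
| "tm N E (ZAdd t u) = (fst (tm N E t) + fst (tm N E u),
    padd ((mulc cs ^^ fst (tm N E u)) (snd (tm N E t))) ((mulc cs ^^ fst (tm N E t)) (snd (tm N E u))))"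
| "tm N E (ZFrob t) = (p * fst (tm N E t), frobl p (snd (tm N E t)))"
| "tm N E (ZMulz t) = (fst (tm N E t), LZero # snd (tm N E t))"

lemma computable_tm [computable_intros]:
  assumes "computable n" "computable d" "computable t"
  shows "computable (\<lambda>x. tm (n x) (d x) (t x))"
proof (rule computable_on_type[where dec = lpz_term_dec and H = "\<lambda>a. tm (fst a) (snd a)" and f = "\<lambda>x. (n x, d x)", simplified fst_conv snd_conv])
  show "computable (\<lambda>t :: (nat \<times> nat) \<times> nat. tm (fst (fst t)) (snd (fst t)) (lpz_term_dec (snd t)))"
    by (rule computable_tree_recursion[where F = "\<lambda>a n. tm (fst a) (snd a) (lpz_term_dec n)" and d = "(0, [])"
        and g = "\<lambda>a n x y z.
      if tag n = 0 then (snd a, map LVar (cvars (fst a) (snd a) (arg n)))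
      else if tag n = 1 then (0, []) else if tag n = 2 then (0, [LOne])
      else if tag n = 3 then (fst y + fst z, padd ((mulc cs ^^ fst z) (snd y)) ((mulc cs ^^ fst y) (snd z)))
      else if tag n = 4 then (p * fst x, frobl p (snd x)) else (fst x, LZero # snd x)"])
      (intro computable_intros, subst lpz_term_dec.simps, simp add: arg_less tag_arg_less)
qed (simp_all add: enc_syntax assms computable_Pair)

definition Bd :: "nat \<Rightarrow> nat \<Rightarrow> nat" where
  "Bd N k = ((\<lambda>d. hQ (N + d)) ^^ k) 0"

lemma Bd_Suc: "Bd N (Suc k) = hQ (N + Bd N k)" by (simp add: Bd_def)

lemma Bd_mono: "k \<le> l \<Longrightarrow> Bd N k \<le> Bd N l"
proof (induction l)
  case (Suc l)
  have "Bd N l \<le> Bd N (Suc l)" using CB_ge[OF CB_hQ, of "N + Bd N l"] by (simp add: Bd_Suc)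
  with Suc show ?case by (cases "k = Suc l") auto
qed simp

lemma computable_Bd [computable_intros]:
  "computable n \<Longrightarrow> computable k \<Longrightarrow> computable (\<lambda>x. Bd (n x) (k x))"
proof -
  have "computable hQ" using CB_hQ by (simp add: CB_def)
  note [computable_intros] = computable_comp[OF this]
  assume "computable n" "computable k"
  then show ?thesis unfolding Bd_def
    by (intro computable_intros) (erule computable_comp, intro computable_intros | assumption)+
qed

text \<open>In the clause for \<open>ZEx\<close>, the block \<open>cvars N d N\<close> is a numerator over the smaller denominator
  \<open>s\<^sup>d\<close>, which bounds the quantifier; the block \<open>cvars N E i\<close> is the same element over \<open>s\<^sup>E\<close>.\<close>

primrec tr :: "nat \<Rightarrow> nat \<Rightarrow> lpz_form \<Rightarrow> lp_form" where
  "tr N E (ZEq t u) = peq ((mulc cs ^^ fst (tm N E u)) (snd (tm N E t))) ((mulc cs ^^ fst (tm N E t)) (snd (tm N E u)))"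
| "tr N E (ZInF t) = LEx 0 (peq (snd (tm N E t)) ((mulc cs ^^ fst (tm N E t)) [LVar 0]))"
| "tr N E (ZPred n \<sigma> ts) = exv [0..<n] (foldr (\<lambda>k r. LAnd (peq (snd (tm N E (nth_default ZZero ts k)))
      ((mulc cs ^^ fst (tm N E (nth_default ZZero ts k))) [LVar k])) r) [0..<n] \<sigma>)"
| "tr N E (ZNeg \<phi>) = LNeg (tr N E \<phi>)"
| "tr N E (ZAnd \<phi> \<psi>) = LAnd (tr N E \<phi>) (tr N E \<psi>)"
| "tr N E (ZEx i \<phi>) = (let d = Bd N (Suc N - enc (ZEx i \<phi>)) in
    exv (cvars N E i) (exv (cvars N d N)
      (LAnd (peq (map LVar (cvars N E i)) ((mulc cs ^^ (E - d)) (map LVar (cvars N d N)))) (tr N E \<phi>))))"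

lemma computable_tr:
  assumes "computable n" "computable d" "computable \<phi>"
  shows "computable (\<lambda>x. tr (n x) (d x) (\<phi> x))"
proof (rule computable_on_type[where dec = lpz_form_dec and H = "\<lambda>a. tr (fst a) (snd a)" and f = "\<lambda>x. (n x, d x)", simplified fst_conv snd_conv])
  note [computable_intros] = computable_comp[OF computable_lp_form_dec] computable_comp[OF computable_lpz_term_dec]
    computable_comp[OF computable_lpz_form_dec]
  show "computable (\<lambda>t :: (nat \<times> nat) \<times> nat. tr (fst (fst t)) (snd (fst t)) (lpz_form_dec (snd t)))"
    apply (rule computable_tree_recursion[where F = "\<lambda>a n. tr (fst a) (snd a) (lpz_form_dec n)" and d = "LEq LZero LZero"
        and g = "\<lambda>a n x y z.
      if tag n = 0 then peq ((mulc cs ^^ fst (tm (fst a) (snd a) (lpz_term_dec (arg (arg n))))) (snd (tm (fst a) (snd a) (lpz_term_dec (tag (arg n))))))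
        ((mulc cs ^^ fst (tm (fst a) (snd a) (lpz_term_dec (tag (arg n))))) (snd (tm (fst a) (snd a) (lpz_term_dec (arg (arg n))))))
      else if tag n = 1 then LEx 0 (peq (snd (tm (fst a) (snd a) (lpz_term_dec (arg n))))
        ((mulc cs ^^ fst (tm (fst a) (snd a) (lpz_term_dec (arg n)))) [LVar 0]))
      else if tag n = 2 then exv [0..<tag (arg n)] (foldr (\<lambda>k r. LAnd (peq
          (snd (tm (fst a) (snd a) (nth_default ZZero (map lpz_term_dec (list_decode (arg (arg (arg n))))) k)))
          ((mulc cs ^^ fst (tm (fst a) (snd a) (nth_default ZZero (map lpz_term_dec (list_decode (arg (arg (arg n))))) k))) [LVar k])) r)
        [0..<tag (arg n)] (lp_form_dec (tag (arg (arg n)))))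
      else if tag n = 3 then LNeg x else if tag n = 4 then LAnd y z
      else exv (cvars (fst a) (snd a) (tag (arg n))) (exv (cvars (fst a) (Bd (fst a) (Suc (fst a) - enc (lpz_form_dec n))) (fst a))
        (LAnd (peq (map LVar (cvars (fst a) (snd a) (tag (arg n))))
          ((mulc cs ^^ (snd a - Bd (fst a) (Suc (fst a) - enc (lpz_form_dec n))))
            (map LVar (cvars (fst a) (Bd (fst a) (Suc (fst a) - enc (lpz_form_dec n))) (fst a))))) z))"])
    subgoal by (intro computable_intros)
    subgoal for a n by (simp add: lpz_form_dec.simps[of n] arg_less tag_arg_less Let_def)
    done
qed (simp_all add: enc_syntax assms computable_Pair)

lemma tf_s_nz: "to_fract s \<noteq> 0" using s_nz by simp

lemma pv_frobl: "pv p (f :: nat \<Rightarrow> 'a) (frobl p ts) = pv p f ts ^ p"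
proof (induction ts)
  case Nil
  then show ?case using p_pos by (simp add: frobl_def zero_power)
next
  case (Cons t ts)
  obtain q where q: "p = Suc q" using p_pos by (cases p) auto
  have "pv p f (frobl p (t # ts)) = [:lp_val p f t ^ p:] + monom 1 1 * (monom 1 (p - 1) * pv p f (frobl p ts))"
    by (simp add: frobl_def pv_replicate monom_Suc monom_0)
  also have "\<dots> = [:lp_val p f t:] ^ p + (monom 1 1 * pv p f ts) ^ p"
  proof -
    have m: "monom 1 1 * monom 1 (p - 1) = (monom 1 1 ^ p :: 'a poly)"
      by (simp add: mult_monom monom_power q)
    have "monom 1 1 * (monom 1 (p - 1) * pv p f ts ^ p) = monom 1 1 ^ p * pv p f ts ^ p"
      unfolding m[symmetric] by (simp only: mult.assoc)
    then show ?thesis unfolding Cons.IH by (simp only: power_mult_distrib poly_const_pow)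
  qed
  also have "\<dots> = ([:lp_val p f t:] + monom 1 1 * pv p f ts) ^ p"
    using frob_add_poly[of "[:lp_val p f t:]" "monom 1 1 * pv p f ts" 1] by simp
  also have "[:lp_val p f t:] + monom 1 1 * pv p f ts = pv p f (t # ts)" by (simp add: monom_Suc monom_0)
  finally show ?case .
qed

definition env_rel :: "nat \<Rightarrow> nat \<Rightarrow> (nat \<Rightarrow> 'a) \<Rightarrow> (nat \<Rightarrow> 'a poly fract) \<Rightarrow> bool" where
  "env_rel N E f e \<longleftrightarrow> (\<forall>i<N. to_fract (pv p f (map LVar (cvars N E i))) = e i * to_fract s ^ E)"

lemma pv_mulc_s: "pv p f ((mulc cs ^^ n) xs) = s ^ n * pv p f xs"
  by (simp add: pv_mulc_power flip: s_cs)

lemma tm_correct: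
  assumes "env_rel N E f e" "lpz_term_vars t \<subseteq> {..<N}"
  shows "to_fract (pv p f (snd (tm N E t))) = lpz_val p e t * to_fract s ^ fst (tm N E t)"
  using assms(2)
proof (induction t)
  case (ZVar i)
  then show ?case using assms(1) by (simp add: env_rel_def)
next
  case ZOne
  then show ?case by (simp flip: one_pCons)
next
  case (ZAdd t u)
  then show ?case
    by (simp add: pv_padd pv_mulc_s to_fract_add[symmetric] to_fract_mult[symmetric] tf_power[symmetric] del: to_fract_add to_fract_mult)
       (simp add: tf_power power_add algebra_simps)
next
  case (ZFrob t)
  then show ?case by (simp add: pv_frobl tf_power power_mult_distrib power_mult mult.commute[of p])
next
  case (ZMulz t)
  have "pCons 0 (pv p f (snd (tm N E t))) = [:0, 1:] * pv p f (snd (tm N E t))" by simp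
  then have "to_fract (pCons 0 (pv p f (snd (tm N E t)))) = z_fract * to_fract (pv p f (snd (tm N E t)))"
    by (simp only: to_fract_mult z_fract_def)
  with ZMulz show ?case by simp
qed simp

lemma env_rel_cong: "env_rel N E f e \<Longrightarrow> (\<And>v. N \<le> v \<Longrightarrow> g v = f v) \<Longrightarrow> env_rel N E g e"
proof -
  assume r: "env_rel N E f e" and fg: "\<And>v. N \<le> v \<Longrightarrow> g v = f v"
  have "pv p g (map LVar (cvars N E i)) = pv p f (map LVar (cvars N E i))" for i
    unfolding pv_def by (rule arg_cong[of _ _ Poly]) (auto simp: fg cvars_def)
  with r show ?thesis by (simp add: env_rel_def)
qed

lemma val_eq_const:
  assumes "env_rel N E f e" "lpz_term_vars t \<subseteq> {..<N}" "i < N"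
  shows "lp_sat p f (peq (snd (tm N E t)) ((mulc cs ^^ fst (tm N E t)) [LVar i])) \<longleftrightarrow> lpz_val p e t = const_fract (f i)"
proof -
  have "lp_sat p f (peq (snd (tm N E t)) ((mulc cs ^^ fst (tm N E t)) [LVar i]))
    \<longleftrightarrow> to_fract (pv p f (snd (tm N E t))) = to_fract (s ^ fst (tm N E t) * [:f i:])"
    by (simp add: lp_sat_peq pv_mulc_s)
  also have "\<dots> \<longleftrightarrow> lpz_val p e t * to_fract s ^ fst (tm N E t) = const_fract (f i) * to_fract s ^ fst (tm N E t)"
    unfolding tm_correct[OF assms(1,2)] by (simp only: to_fract_mult tf_power const_fract_def mult.commute)
  also have "\<dots> \<longleftrightarrow> lpz_val p e t = const_fract (f i)" using tf_s_nz by simp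
  finally show ?thesis .
qed

lemma pv_cvars: "pv p f (map LVar (cvars N d i)) = Poly (map (\<lambda>j. f (N + prod_encode (i, j))) [0..<Suc (D * d)])"
  by (simp add: pv_def cvars_def comp_def del: upt_Suc)

lemma degree_pv_cvars: "degree (pv p f (map LVar (cvars N d i))) \<le> D * d"
  unfolding pv_cvars by (rule degree_le) (simp add: coeff_Poly_eq nth_default_def del: upt_Suc)

lemma pv_cvars_coeff:
  assumes "degree q \<le> D * d" "\<And>j. j \<le> D * d \<Longrightarrow> f (N + prod_encode (i, j)) = coeff q j"
  shows "pv p f (map LVar (cvars N d i)) = q"
proof (rule poly_eqI)
  fix k
  show "coeff (pv p f (map LVar (cvars N d i))) k = coeff q k"
    unfolding pv_cvars using assms coeff_eq_0[of q k]
    by (cases "k \<le> D * d") (simp_all add: coeff_Poly_eq nth_default_def less_Suc_eq_le del: upt_Suc)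
qed

lemma tr_correct:
  assumes "lpz_wf \<phi>" "lpz_code \<phi> < N" "\<And>j. e j \<in> Rd (Bd N (N - lpz_code \<phi>))" "\<And>j. N \<le> j \<Longrightarrow> e j = 0"
    "env_rel N E f e" "E = Bd N (Suc N)"
  shows "lp_sat p f (tr N E \<phi>) \<longleftrightarrow> lpz_sat p RR e \<phi>"
  using assms
proof (induction \<phi> arbitrary: e f)
  case (ZEq t u)
  have vars: "lpz_term_vars t \<subseteq> {..<N}" "lpz_term_vars u \<subseteq> {..<N}"
  proof -
    have "i < N" if "i \<in> lpz_free (ZEq t u)" for i
      using lpz_free_le[OF that] ZEq.prems(2) by linarith
    then show "lpz_term_vars t \<subseteq> {..<N}" "lpz_term_vars u \<subseteq> {..<N}" by auto
  qed
  let ?a = "fst (tm N E t)" and ?b = "fst (tm N E u)"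
  have "lp_sat p f (tr N E (ZEq t u))
    \<longleftrightarrow> to_fract (s ^ ?b * pv p f (snd (tm N E t))) = to_fract (s ^ ?a * pv p f (snd (tm N E u)))"
    by (simp add: lp_sat_peq pv_mulc_s del: to_fract_mult)
  also have "\<dots> \<longleftrightarrow> (to_fract s ^ ?b * to_fract s ^ ?a) * lpz_val p e t = (to_fract s ^ ?b * to_fract s ^ ?a) * lpz_val p e u"
    by (simp only: to_fract_mult tf_power tm_correct[OF ZEq.prems(5) vars(1)] tm_correct[OF ZEq.prems(5) vars(2)] ac_simps)
  also have "\<dots> \<longleftrightarrow> lpz_sat p RR e (ZEq t u)" using tf_s_nz by simp
  finally show ?case .
next
  case (ZInF t)
  have vars: "lpz_term_vars t \<subseteq> {..<N}"
  proof
    fix i assume "i \<in> lpz_term_vars t"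
    then show "i \<in> {..<N}" using lpz_term_vars_le[of i t] lpz_code_ZInF[of t] ZInF.prems(2) by simp
  qed
  have N: "0 < N" using lpz_code_ZInF[of t] ZInF.prems(2) by linarith
  have "lp_sat p (f(0 := a)) (peq (snd (tm N E t)) ((mulc cs ^^ fst (tm N E t)) [LVar 0]))
    \<longleftrightarrow> lpz_val p e t = const_fract a" for a
    using val_eq_const[OF env_rel_cong[OF ZInF.prems(5)] vars N, of "f(0 := a)"] N by simp
  then show ?case by auto
next
  case (ZPred n \<sigma> ts)
  have wf: "lp_free \<sigma> \<subseteq> {..<n}" "length ts = n" using ZPred.prems(1) by auto
  have nN: "n < N" using lpz_code_ZPred(1)[of n \<sigma> ts] ZPred.prems(2) by linarith
  have vars: "lpz_term_vars (ts ! k) \<subseteq> {..<N}" if "k < n" for k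
  proof
    fix i assume "i \<in> lpz_term_vars (ts ! k)"
    moreover have "ts ! k \<in> set ts" using that wf by simp
    ultimately show "i \<in> {..<N}"
      using lpz_term_vars_le[of i "ts ! k"] lpz_code_ZPred(3)[of "ts ! k" ts n \<sigma>] ZPred.prems(2) by simp
  qed
  have and1: "lp_sat p h (foldr (\<lambda>k r. LAnd (P k) r) ks \<sigma>) \<longleftrightarrow> (\<forall>k\<in>set ks. lp_sat p h (P k)) \<and> lp_sat p h \<sigma>"
    for h :: "nat \<Rightarrow> 'a" and P ks by (induction ks) auto
  have nd: "nth_default ZZero ts k = ts ! k" if "k < n" for k using that wf by (simp add: nth_default_def)
  have body: "lp_sat p h (peq (snd (tm N E (nth_default ZZero ts k)))
      ((mulc cs ^^ fst (tm N E (nth_default ZZero ts k))) [LVar k])) \<longleftrightarrow> lpz_val p e (ts ! k) = const_fract (h k)"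
    if "k < n" "\<And>v. N \<le> v \<Longrightarrow> h v = f v" for h k
    unfolding nd[OF that(1)]
    by (rule val_eq_const[OF env_rel_cong[OF ZPred.prems(5)] vars[OF that(1)]]) (use that nN in auto)
  have L: "lp_sat p f (tr N E (ZPred n \<sigma> ts)) \<longleftrightarrow>
    (\<exists>g. (\<forall>k<n. lpz_val p e (ts ! k) = const_fract (g k)) \<and> lp_sat p (\<lambda>i. if i < n then g i else f i) \<sigma>)"
    unfolding tr.simps lp_sat_exv and1
    by (intro arg_cong[of _ _ Ex] ext) (use body[of _ "\<lambda>i. if i < n then _ i else f i"] nN in auto)
  show ?case
  proof
    assume "lp_sat p f (tr N E (ZPred n \<sigma> ts))"
    then obtain g where g: "\<forall>k<n. lpz_val p e (ts ! k) = const_fract (g k)"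
      "lp_sat p (\<lambda>i. if i < n then g i else f i) \<sigma>" using L by blast
    let ?cs = "map g [0..<n]"
    have "map (lpz_val p e) ts = map const_fract ?cs" using g(1) wf by (intro nth_equalityI) auto
    moreover have "lp_sat p (\<lambda>i. if i < length ?cs then ?cs ! i else 0) \<sigma>"
      using g(2) by (subst lp_sat_cong[where g = "\<lambda>i. if i < n then g i else f i"]) (use wf in auto)
    ultimately show "lpz_sat p RR e (ZPred n \<sigma> ts)" unfolding lpz_sat.simps by blast
  next
    assume "lpz_sat p RR e (ZPred n \<sigma> ts)"
    then obtain bs where bs: "map (lpz_val p e) ts = map const_fract bs"
      "lp_sat p (\<lambda>i. if i < length bs then bs ! i else 0) \<sigma>" by auto
    have len: "length bs = n" using arg_cong[OF bs(1), of length] wf by simp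
    have "lpz_val p e (ts ! k) = const_fract (bs ! k)" if "k < n" for k
      using arg_cong[OF bs(1), of "\<lambda>l. l ! k"] that len wf by simp
    moreover have "lp_sat p (\<lambda>i. if i < n then bs ! i else f i) \<sigma>"
      using bs(2) by (subst lp_sat_cong[where g = "\<lambda>i. if i < length bs then bs ! i else 0"]) (use wf len in auto)
    ultimately show "lp_sat p f (tr N E (ZPred n \<sigma> ts))" unfolding L by (intro exI[of _ "\<lambda>i. bs ! i"]) auto
  qed
next
  case (ZNeg \<phi>)
  have le: "lpz_code \<phi> < N" "Bd N (N - lpz_code (ZNeg \<phi>)) \<le> Bd N (N - lpz_code \<phi>)"
    using lpz_code_ZNeg[of \<phi>] ZNeg.prems(2) by (linarith, intro Bd_mono, linarith)
  have "lp_sat p f (tr N E \<phi>) \<longleftrightarrow> lpz_sat p RR e \<phi>"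
    by (rule ZNeg.IH[OF _ le(1) Rd_monoD[OF ZNeg.prems(3) le(2)] ZNeg.prems(4,5,6)]) (use ZNeg.prems(1) in auto)
  then show ?case by simp
next
  case (ZAnd \<phi> \<psi>)
  have le: "lpz_code \<phi> < N" "Bd N (N - lpz_code (ZAnd \<phi> \<psi>)) \<le> Bd N (N - lpz_code \<phi>)"
    "lpz_code \<psi> < N" "Bd N (N - lpz_code (ZAnd \<phi> \<psi>)) \<le> Bd N (N - lpz_code \<psi>)"
    using lpz_code_ZAnd(1)[of \<phi> \<psi>] lpz_code_ZAnd(2)[of \<psi> \<phi>] ZAnd.prems(2)
    by (linarith, intro Bd_mono, linarith, linarith, intro Bd_mono, linarith)
  have "lp_sat p f (tr N E \<phi>) \<longleftrightarrow> lpz_sat p RR e \<phi>"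
    by (rule ZAnd.IH(1)[OF _ le(1) Rd_monoD[OF ZAnd.prems(3) le(2)] ZAnd.prems(4,5,6)]) (use ZAnd.prems(1) in auto)
  moreover have "lp_sat p f (tr N E \<psi>) \<longleftrightarrow> lpz_sat p RR e \<psi>"
    by (rule ZAnd.IH(2)[OF _ le(3) Rd_monoD[OF ZAnd.prems(3) le(4)] ZAnd.prems(4,5,6)]) (use ZAnd.prems(1) in auto)
  ultimately show ?case by simp
next
  case (ZEx i \<phi>)
  let ?c = "lpz_code (ZEx i \<phi>)"
  define d where "d = Bd N (Suc N - ?c)"
  have c: "?c \<le> N" "lpz_code \<phi> < ?c" "i < N"
    using lpz_code_ZEx(1)[of \<phi> i] lpz_code_ZEx(2)[of i \<phi>] ZEx.prems(2) by linarith+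
  have d: "d = hQ (N + Bd N (N - ?c))" using c(1) by (simp add: d_def Suc_diff_le Bd_Suc del: lpz_code.simps)
  have dE: "d \<le> E" unfolding d_def ZEx.prems(6) by (rule Bd_mono) simp
  have d': "d \<le> Bd N (N - lpz_code \<phi>)" unfolding d_def by (rule Bd_mono) (use c in linarith)
  have d0: "Bd N (N - ?c) \<le> d" unfolding d_def by (rule Bd_mono) (use c in linarith)
  define ok where "ok f' \<longleftrightarrow> pv p f' (map LVar (cvars N E i)) = s ^ (E - d) * pv p f' (map LVar (cvars N d N))"
    for f' :: "nat \<Rightarrow> 'a"
  define mix where "mix g h = (\<lambda>v. if v \<in> set (cvars N d N) then h v else if v \<in> set (cvars N E i) then g v else f v)"
    for g h :: "nat \<Rightarrow> 'a"
  have L: "lp_sat p f (tr N E (ZEx i \<phi>)) \<longleftrightarrow> (\<exists>g h. ok (mix g h) \<and> lp_sat p (mix g h) (tr N E \<phi>))"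
    unfolding tr.simps Let_def enc_syntax d_def[symmetric] lp_sat_exv lp_sat.simps lp_sat_peq pv_mulc_s ok_def mix_def ..
  have IH: "lp_sat p f' (tr N E \<phi>) \<longleftrightarrow> lpz_sat p RR (e(i := a)) \<phi>"
    if a: "a \<in> Rd d" and ea: "to_fract (pv p f' (map LVar (cvars N E i))) = a * to_fract s ^ E"
      and f': "f' = mix g h" for f' a g h
  proof (rule ZEx.IH)
    show "lpz_wf \<phi>" using ZEx.prems(1) by simp
    show "lpz_code \<phi> < N" using c by linarith
    show "(e(i := a)) j \<in> Rd (Bd N (N - lpz_code \<phi>))" for j
      using Rd_monoD[OF a d'] Rd_monoD[OF ZEx.prems(3) order_trans[OF d0 d']] by simp
    show "(e(i := a)) j = 0" if "N \<le> j" for j using ZEx.prems(4)[OF that] that c(3) by auto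
    show "E = Bd N (Suc N)" by (rule ZEx.prems(6))
    show "env_rel N E f' (e(i := a))" unfolding env_rel_def
    proof (intro allI impI)
      fix k assume k: "k < N"
      show "to_fract (pv p f' (map LVar (cvars N E k))) = (e(i := a)) k * to_fract s ^ E"
      proof (cases "k = i")
        case False
        have "pv p f' (map LVar (cvars N E k)) = pv p f (map LVar (cvars N E k))"
          unfolding pv_def by (rule arg_cong[of _ _ Poly]) (use False k in \<open>auto simp: set_cvars f' mix_def\<close>)
        then show ?thesis using ZEx.prems(5) False k by (simp add: env_rel_def)
      qed (simp add: ea)
    qed
  qed
  have bq: "lpz_sat p RR e (ZEx i \<phi>) \<longleftrightarrow> (\<exists>a\<in>Rd d. lpz_sat p RR (e(i := a)) \<phi>)"
    unfolding d by (rule bounded_quantifier[OF c(1) ZEx.prems(3,4)])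
  have sE: "to_fract s ^ E = to_fract s ^ (E - d) * to_fract s ^ d"
    using dE by (simp flip: power_add)
  show ?case
  proof
    assume "lp_sat p f (tr N E (ZEx i \<phi>))"
    then obtain g h where gh: "ok (mix g h)" "lp_sat p (mix g h) (tr N E \<phi>)" using L by blast
    define a where "a = to_fract (pv p (mix g h) (map LVar (cvars N d N))) / to_fract s ^ d"
    have a: "a \<in> Rd d" by (rule RdI[OF degree_pv_cvars a_def])
    have "to_fract (pv p (mix g h) (map LVar (cvars N E i))) = a * to_fract s ^ E"
      using gh(1) tf_s_nz unfolding ok_def sE a_def by (simp add: tf_power)
    from IH[OF a this refl] gh(2) show "lpz_sat p RR e (ZEx i \<phi>)" unfolding bq using a by blast
  next
    assume "lpz_sat p RR e (ZEx i \<phi>)"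
    then obtain a where a: "a \<in> Rd d" "lpz_sat p RR (e(i := a)) \<phi>" unfolding bq by blast
    from a(1) obtain q where q: "degree q \<le> D * d" "a = to_fract q / to_fract s ^ d" by (rule RdE)
    let ?P = "s ^ (E - d) * q"
    have P: "degree ?P \<le> D * E"
    proof -
      have "degree ?P \<le> degree s * (E - d) + D * d"
        using degree_mult_le[of "s ^ (E - d)" q] degree_power_le[of s "E - d"] q(1) by linarith
      also have "\<dots> \<le> D * (E - d) + D * d" by (intro add_mono mult_le_mono) auto
      also have "\<dots> = D * E" using dE by (simp flip: add_mult_distrib2)
      finally show ?thesis .
    qed
    define g where "g v = coeff ?P (snd (prod_decode (v - N)))" for v
    define h where "h v = coeff q (snd (prod_decode (v - N)))" for v
    have Q: "pv p (mix g h) (map LVar (cvars N d N)) = q"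
      by (rule pv_cvars_coeff[OF q(1)]) (auto simp: mix_def set_cvars h_def)
    have PP: "pv p (mix g h) (map LVar (cvars N E i)) = ?P"
      by (rule pv_cvars_coeff[OF P]) (use c(3) in \<open>auto simp: mix_def set_cvars g_def\<close>)
    have "to_fract (pv p (mix g h) (map LVar (cvars N E i))) = a * to_fract s ^ E"
      unfolding PP sE q(2) using tf_s_nz by (simp add: tf_power)
    from IH[OF a(1) this refl] a(2) have "lp_sat p (mix g h) (tr N E \<phi>)" by blast
    moreover have "ok (mix g h)" unfolding ok_def PP Q ..
    ultimately show "lp_sat p f (tr N E (ZEx i \<phi>))" unfolding L by blast
  qed
qed

end

section \<open>Decidability\<close>

lemma decidable_iff_computable: "decidable A \<longleftrightarrow> computable (\<lambda>x :: nat. x \<in> A)"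
proof
  assume "decidable A"
  then obtain f where f: "recursive_fn 1 f" "\<And>x. f [x] = (if x \<in> A then 1 else 0)"
    unfolding decidable_def by blast
  then have "rf 1 f" unfolding rf_def by blast
  then show "computable (\<lambda>x. x \<in> A)" by (rule computableI) (simp add: f(2))
next
  assume "computable (\<lambda>x. x \<in> A)"
  then obtain g where g: "rf 1 g" "\<And>x. g [x] = (if x \<in> A then 1 else 0)" by (auto simp: computable_def)
  from g(1) obtain f where "recursive_fn 1 f" "\<forall>xs. length xs = 1 \<longrightarrow> f xs = g xs" unfolding rf_def by blast
  with g(2) show "decidable A" unfolding decidable_def by (intro exI[of _ f]) simp
qed

context sentence_translation
begin

lemma lpz_sat_cong: "(\<And>i. i \<in> lpz_free \<phi> \<Longrightarrow> e i = e' i) \<Longrightarrow> lpz_sat p RR e \<phi> \<longleftrightarrow> lpz_sat p RR e' \<phi>"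
proof (induction \<phi> arbitrary: e e')
  case (ZEq t u)
  have "lpz_val p e t = lpz_val p e' t" "lpz_val p e u = lpz_val p e' u"
    by (rule lpz_val_cong, use ZEq in simp)+
  then show ?case by simp
next
  case (ZInF t)
  have "lpz_val p e t = lpz_val p e' t" by (rule lpz_val_cong) (use ZInF in simp)
  then show ?case by simp
next
  case (ZPred n \<sigma> ts)
  have "map (lpz_val p e) ts = map (lpz_val p e') ts"
  proof (rule map_cong[OF refl])
    fix t assume "t \<in> set ts"
    then show "lpz_val p e t = lpz_val p e' t" by (intro lpz_val_cong) (use ZPred in auto)
  qed
  then show ?case by (simp only: lpz_sat.simps)
next
  case (ZNeg \<phi>)
  have "lpz_sat p RR e \<phi> = lpz_sat p RR e' \<phi>" by (rule ZNeg.IH) (use ZNeg.prems in simp)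
  then show ?case by simp
next
  case (ZAnd \<phi> \<psi>)
  have "lpz_sat p RR e \<phi> = lpz_sat p RR e' \<phi>" "lpz_sat p RR e \<psi> = lpz_sat p RR e' \<psi>"
    by (rule ZAnd.IH, use ZAnd.prems in simp)+
  then show ?case by simp
next
  case (ZEx i \<phi>)
  have "lpz_sat p RR (e(i := a)) \<phi> = lpz_sat p RR (e'(i := a)) \<phi>" for a
    by (rule ZEx.IH) (use ZEx.prems in auto)
  then show ?case by simp
qed

definition transl :: "lpz_form \<Rightarrow> lp_form" where
  "transl \<phi> = close0 (tr (Suc (enc \<phi>)) (Bd (Suc (enc \<phi>)) (Suc (Suc (enc \<phi>)))) \<phi>)"

lemma computable_transl: "computable transl"
  unfolding transl_def[abs_def] by (intro computable_intros computable_tr)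

lemma transl_correct:
  assumes "lpz_wf \<phi>" "lpz_free \<phi> = {}"
  shows "transl \<phi> \<in> lp_theory TYPE('a) p \<longleftrightarrow> \<phi> \<in> lpz_theory p RR"
proof -
  let ?N = "Suc (enc \<phi>)"
  let ?E = "Bd ?N (Suc ?N)"
  have "pv p (\<lambda>_. 0 :: 'a) (map LVar (cvars ?N ?E i)) = 0" for i
    by (rule pv_cvars_coeff) simp_all
  then have rel: "env_rel ?N ?E (\<lambda>_. 0) (\<lambda>_. 0)" by (simp add: env_rel_def)
  have "transl \<phi> \<in> lp_theory TYPE('a) p \<longleftrightarrow> lp_sat p (\<lambda>_. 0 :: 'a) (tr ?N ?E \<phi>)"
    unfolding transl_def by (rule lp_theory_close0)
  also have "\<dots> \<longleftrightarrow> lpz_sat p RR (\<lambda>_. 0) \<phi>"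
    by (rule tr_correct[OF assms(1) _ _ _ rel refl]) (simp_all add: enc_syntax)
  also have "\<dots> \<longleftrightarrow> (\<forall>e. (\<forall>i. e i \<in> RR) \<longrightarrow> lpz_sat p RR e \<phi>)"
  proof -
    have eq: "lpz_sat p RR e \<phi> \<longleftrightarrow> lpz_sat p RR e' \<phi>" for e e'
      by (rule lpz_sat_cong) (simp add: assms(2))
    show ?thesis
    proof (intro iffI allI impI)
      fix e assume "lpz_sat p RR (\<lambda>_. 0) \<phi>"
      then show "lpz_sat p RR e \<phi>" by (rule eq[THEN iffD1])
    next
      assume "\<forall>e. (\<forall>i. e i \<in> RR) \<longrightarrow> lpz_sat p RR e \<phi>"
      then show "lpz_sat p RR (\<lambda>_. 0) \<phi>" using Rd_RR[OF Rd_0] by (elim allE[of _ "\<lambda>_. 0"] mp) simp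
    qed
  qed
  also have "\<dots> \<longleftrightarrow> \<phi> \<in> lpz_theory p RR" by (simp add: lpz_theory_def assms)
  finally show ?thesis .
qed

theorem decidable_lpz_theory:
  assumes "decidable (lp_code ` lp_theory TYPE('a) p)"
  shows "decidable (lpz_code ` lpz_theory p RR)"
proof -
  let ?T = "lp_code ` lp_theory TYPE('a) p"
  have T: "computable (\<lambda>x. x \<in> ?T)" using assms by (simp only: decidable_iff_computable)
  have "computable (\<lambda>x. enc (lpz_form_dec x) = x \<and> lpz_wf (lpz_form_dec x) \<and> lpz_free (lpz_form_dec x) = {} \<and>
      enc (transl (lpz_form_dec x)) \<in> ?T)"
    by (intro computable_intros computable_comp[OF T] computable_comp[OF computable_transl] computable_lpz_form_dec)
  moreover have "(enc (lpz_form_dec x) = x \<and> lpz_wf (lpz_form_dec x) \<and> lpz_free (lpz_form_dec x) = {} \<and>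
      enc (transl (lpz_form_dec x)) \<in> ?T) \<longleftrightarrow> x \<in> lpz_code ` lpz_theory p RR" (is "?L x \<longleftrightarrow> _") for x
  proof
    assume L: "?L x"
    then obtain \<psi> where \<psi>: "\<psi> \<in> lp_theory TYPE('a) p" "enc (transl (lpz_form_dec x)) = lp_code \<psi>" by blast
    from \<psi>(2) have "transl (lpz_form_dec x) = \<psi>" by (simp add: enc_syntax lp_code_inject)
    with \<psi>(1) have "transl (lpz_form_dec x) \<in> lp_theory TYPE('a) p" by (simp only:)
    then have "lpz_form_dec x \<in> lpz_theory p RR"
      by (subst (asm) transl_correct) (use L in \<open>simp_all only:\<close>)
    moreover have "x = lpz_code (lpz_form_dec x)" using L by (simp add: enc_syntax)
    ultimately show "x \<in> lpz_code ` lpz_theory p RR" by (rule rev_image_eqI)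
  next
    assume "x \<in> lpz_code ` lpz_theory p RR"
    then obtain \<phi> where \<phi>: "\<phi> \<in> lpz_theory p RR" "x = lpz_code \<phi>" by blast
    then have wf: "lpz_wf \<phi>" "lpz_free \<phi> = {}" by (auto simp: lpz_theory_def)
    have "transl \<phi> \<in> lp_theory TYPE('a) p" using transl_correct[OF wf] \<phi>(1) by blast
    then have "enc (transl \<phi>) \<in> ?T" unfolding enc_syntax by (rule imageI)
    then show "?L x" unfolding \<phi>(2) lpz_form_dec_enc using wf by (simp only: enc_syntax simp_thms)
  qed
  ultimately show ?thesis by (simp only: decidable_iff_computable)
qed

end

context char_p_field
begin

lemma Ints_of_nat: "x \<in> \<int> \<Longrightarrow> \<exists>n. of_nat n = (x :: 'a)"
proof -
  assume "x \<in> \<int>"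
  then obtain k where k: "x = of_int k" by (auto elim: Ints_cases)
  have "k + int p * \<bar>k\<bar> \<ge> 0"
  proof -
    have "1 * \<bar>k\<bar> \<le> int p * \<bar>k\<bar>" using p_pos by (intro mult_right_mono) (auto simp: Suc_le_eq)
    then show ?thesis by linarith
  qed
  then have "of_nat (nat (k + int p * \<bar>k\<bar>)) = (of_int (k + int p * \<bar>k\<bar>) :: 'a)" by simp
  also have "\<dots> = x" using of_nat_CHAR[where ?'a = 'a] by (simp add: k char_p)
  finally show ?thesis by blast
qed

lemma prime_field_poly_lift: "f \<in> PF \<Longrightarrow> \<exists>cs. f = Poly (map of_nat cs)"
proof -
  assume f: "f \<in> PF"
  then have "\<forall>i. \<exists>n. of_nat n = coeff f i" using Ints_of_nat by (simp add: prime_field_polys_def)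
  from choice[OF this] obtain c where c: "\<And>i. of_nat (c i) = coeff f i" by blast
  have "f = Poly (map of_nat (map c [0..<Suc (degree f)]))"
    by (rule poly_eqI) (auto simp: coeff_Poly_eq nth_default_def c coeff_eq_0 simp del: upt_Suc)
  then show ?thesis by (rule exI)
qed

text \<open>The powers \<open>x ^ (p ^ k)\<close> are roots of the same polynomial, so two of them agree.\<close>

lemma perfect_if_algebraic:
  assumes "algebraic_over_prime_field TYPE('a)"
  shows "\<exists>y::'a. y ^ p = x"
proof -
  obtain f where f: "f \<in> PF" "f \<noteq> 0" "poly f x = 0"
    using assms unfolding algebraic_over_prime_field_def by blast
  have "poly f (x ^ p ^ k) = poly f x ^ p ^ k" for k
  proof -
    have "poly f x ^ p ^ k = (\<Sum>i\<le>degree f. (coeff f i * x ^ i) ^ p ^ k)"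
      using freshmans_dream_sum'[where ?'a = 'a and n = k, OF _ refl] prime_p
      by (simp add: poly_altdef char_p)
    also have "\<dots> = poly f (x ^ p ^ k)"
      unfolding poly_altdef
    proof (rule sum.cong[OF refl])
      fix i
      show "(coeff f i * x ^ i) ^ p ^ k = coeff f i * (x ^ p ^ k) ^ i"
        unfolding power_mult_distrib Ints_frob[OF PF_coeff[OF f(1)]]
        by (simp only: power_mult[symmetric] mult.commute[of i])
    qed
    finally show ?thesis ..
  qed
  then have "range (\<lambda>k. x ^ p ^ k) \<subseteq> {y. poly f y = 0}" using f(3) by (auto simp: zero_power)
  then have "finite (range (\<lambda>k. x ^ p ^ k))" using poly_roots_finite[OF f(2)] finite_subset by blast
  then have "\<not> inj (\<lambda>k. x ^ p ^ k)" using finite_imageD[of "\<lambda>k. x ^ p ^ k" UNIV] by auto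
  then obtain k l where kl: "x ^ p ^ k = x ^ p ^ l" "k < l"
    unfolding inj_def by (metis linorder_neqE_nat)
  obtain m where m: "l = Suc (k + m)" using less_imp_Suc_add[OF kl(2)] by blast
  have "((x ^ p ^ m) ^ p) ^ p ^ k = x ^ p ^ l"
    unfolding m power_mult[symmetric] by (simp add: power_add ac_simps)
  with kl(1) have "((x ^ p ^ m) ^ p) ^ p ^ k = x ^ p ^ k" by simp
  then have "(x ^ p ^ m) ^ p = x" unfolding frob_inj .
  then show ?thesis by blast
qed

end

context frob_ring
begin

lemma adjoin_ring_eq_RR:
  assumes "finite S" "s = \<Prod>S"
  shows "adjoin_ring S = RR"
proof (intro equalityI subsetI)
  fix x assume "x \<in> adjoin_ring S"
  then show "x \<in> RR"
  proof induction
    case (const c)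
    then show ?case using Rd_zero Rd_RR by blast
  next
    case z
    have "degree (s * [:0, 1:]) \<le> D * 1" using degree_mult_le[of s "[:0, 1:]"] by simp
    moreover have "z_fract = to_fract (s * [:0, 1:]) / to_fract s ^ 1"
      using s_nz unfolding z_fract_def to_fract_mult by simp
    ultimately have "z_fract \<in> Rd 1" by (rule RdI)
    then show ?case by (rule Rd_RR)
  next
    case (inv t)
    then have "t dvd s ^ 1" using dvd_prodI[OF assms(1), of t "\<lambda>x. x"] assms(2) by simp
    then show ?case by (rule RR_inverse_dvd)
  next
    case (add x y)
    then show ?case by (intro RR_add)
  next
    case (mult x y)
    then show ?case by (intro RR_mult)
  qed
next
  fix x assume "x \<in> RR"
  then obtain d where "x \<in> Rd d" by (auto simp: RR_def)
  then obtain f where f: "x = to_fract f / to_fract s ^ d" by (rule RdE)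
  have one: "1 \<in> adjoin_ring S" using adjoin_ring.const[of 1 S] by (simp add: const_fract_def flip: one_pCons)
  have "to_fract f \<in> adjoin_ring S"
  proof (induction f)
    case 0
    then show ?case using adjoin_ring.const[of 0 S] by (simp add: const_fract_def)
  next
    case (pCons a f)
    have "pCons a f = [:a:] + [:0, 1:] * f" by simp
    then have "to_fract (pCons a f) = const_fract a + z_fract * to_fract f"
      unfolding const_fract_def z_fract_def by (simp only: to_fract_add to_fract_mult)
    then show ?case using pCons by (simp only: adjoin_ring.intros)
  qed
  moreover have "inverse (to_fract (\<Prod>A)) \<in> adjoin_ring S" if "A \<subseteq> S" for A
  proof -
    have "finite A" using that assms(1) finite_subset by blast
    then show ?thesis using that
    proof (induction A)
      case (insert t A)
      have "inverse (to_fract (\<Prod>(insert t A))) = inverse (to_fract t) * inverse (to_fract (\<Prod>A))"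
        using insert by simp
      then show ?case using insert by (simp only: adjoin_ring.intros insert_subset)
    qed (simp add: one)
  qed
  then have "inverse (to_fract s) \<in> adjoin_ring S" using assms(2) by blast
  then have "inverse (to_fract s) ^ d \<in> adjoin_ring S"
    by (induction d) (simp_all add: one adjoin_ring.mult)
  ultimately have "to_fract f * inverse (to_fract s) ^ d \<in> adjoin_ring S" by (rule adjoin_ring.mult)
  then show "x \<in> adjoin_ring S" by (simp add: f divide_inverse power_inverse)
qed

end

theorem corollary1p2:
  fixes p :: nat and S :: "'a::field poly set"
  assumes "prime p"
    and "CHAR('a) = p"
    and "algebraic_over_prime_field TYPE('a)"
    and "finite S"
    and "\<forall>s\<in>S. irreducible_in prime_field_polys s \<and> irreducible s"
    and "decidable (lp_code ` lp_theory TYPE('a) p)"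
  shows "decidable (lpz_code ` lpz_theory p (adjoin_ring S))"
proof -
  have "0 \<notin> S" using assms(5) by (auto simp: irreducible_in_def)
  then interpret char_p_field p "\<Prod>S"
    by unfold_locales (use assms(1,2,4) in \<open>auto simp: prod_zero_iff\<close>)
  interpret frob_ring p "\<Prod>S"
    by unfold_locales (rule perfect_if_algebraic[OF assms(3)])
  have "A \<subseteq> S \<Longrightarrow> \<Prod>A \<in> PF" for A
    by (induction A rule: infinite_finite_induct) (use assms(5) in \<open>auto simp: irreducible_in_def intro: PF_mult\<close>)
  then obtain cs where "\<Prod>S = Poly (map of_nat cs)" using prime_field_poly_lift[of "\<Prod>S"] by blast
  then interpret sentence_translation p "\<Prod>S" cs by unfold_locales
  show ?thesis
    unfolding adjoin_ring_eq_RR[OF assms(4) refl] by (rule decidable_lpz_theory[OF assms(6)])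
qed

end
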